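(* Suppose the differential equation $\dot x=f(t,x)$ on $S^1=\mathbb R/\mathbb Z$ is gradient-like and almost periodic in $t$, i.e. the map $\mathbb R\to V^r(S^1)$, $t\mapsto f(t,\cdot)$, $r\ge1$, is almost periodic. Then: (1) every solution that is unstable on $\mathbb R_+$ (has exponential dichotomy of the unstable type on $\mathbb R_+$) is almost periodic (as a map $\mathbb R\to S^1$) and has exponential dichotomy of the unstable type on $\mathbb R$; every solution that is stable on $\mathbb R_-$ (has exponential dichotomy of the stable type on $\mathbb R_-$) is almost periodic and has exponential dichotomy of the stable type on $\mathbb R$; (2) these almost periodic solutions can be united into finitely many, $n\in\mathbb N$, pairs -- one stable and one unstable -- serving as the boundary solutions of a closed strip; the union of these strips is $\mathbb R\times S^1$; (3) within such a strip, solutions distinct from the boundary ones tend to the boundary stable almost periodic solution as $t\to\infty$ and to the boundary unstable almost periodic solution as $t\to-\infty$; (4) the ODE is uniformly equivalent to an autonomous scalar differential equation $\dot x=g(x)$ with a smooth function $g$ having $2n$ simple zeroes on $S^1$.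
   Context: Setting. $S^1=\mathbb R/\mathbb Z$; $V^r(S^1)$ ($r\ge 1$) is the Banach space of $C^r$ 1-periodic functions of $x$ with the $C^r$-norm. A nonautonomous vector field (NVF) on $S^1$ is a bounded uniformly continuous map $\mathbb R\to V^r(S^1)$, $t\mapsto f(t,\cdot)$; it defines the ODE $\dot x=f(t,x)$, $x\in S^1$, all of whose solutions exist for all $t\in\mathbb R$. An integral curve (IC) is the graph in $\mathbb R\times S^1$ of a solution; the ICs form a foliation of $\mathbb R\times S^1$. $\mathbb R\times S^1$ carries the product uniform structure (product of the standard metrics). $\mathbb R_+=\{t\ge0\}$, $\mathbb R_-=\{t\le0\}$. A zero $x_*$ of $g$ is simple if $g'(x_* )\neq0$. Almost periodicity. A continuous map $g:\mathbb R\to X$ into a metric space $(X,d)$ (in particular a Banach space, or $S^1$ with its standard metric $d(x,y)=\min\{|x-y|,1-|x-y|\}$, $0\le x,y\le1$) is almost periodic if for every $\varepsilon>0$ there is a relatively dense set $L(\varepsilon)\subset\mathbb R$ such that $d(g(t+l),g(t))\le\varepsilon$ for all $t\in\mathbb R$, $l\in L(\varepsilon)$; a set $L\subset\mathbb R$ is relatively dense if for some $T>0$ every interval $(a,a+T)$ contains a point of $L$. Uniform equivalence. An equimorphism is a homeomorphism $h$ such that $h$ and $h^{-1}$ are uniformly continuous. Two NVFs (ODEs) are uniformly equivalent if there is an equimorphism $h:\mathbb R\times S^1\to\mathbb R\times S^1$ sending every IC of the first to an IC of the second, preserving the orientation of ICs by increasing $t$. Exponential dichotomy. For a solution $x(t)$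 put $a(t)=f_x(t,x(t))$. Let $J$ be $\mathbb R_+$, $\mathbb R_-$ or $\mathbb R$. The solution (or its IC) has exponential dichotomy of the stable type on $J$ if there are $C,\lambda>0$ with $\exp[\int_\tau^t a(s)ds]\le Ce^{-\lambda(t-\tau)}$ for all $t\ge\tau$ in $J$; of the unstable type on $J$ if there are $C,\lambda>0$ with $\exp[\int_\tau^t a(s)ds]\le Ce^{\lambda(t-\tau)}$ for all $t\le\tau$ in $J$. Bunches. A stable bunch is a maximal set of ICs having exponential dichotomy of the stable type on $\mathbb R_+$, any two solutions of which satisfy $|x_1(t)-x_2(t)|\to0 \pmod 1$ as $t\to\infty$. An unstable bunch is a maximal set of ICs having exponential dichotomy of the unstable type on $\mathbb R_-$, any two solutions of which satisfy $|x_1(t)-x_2(t)|\to0\pmod 1$ as $t\to-\infty$. Gradient-like. The ODE $\dot x=f(t,x)$ is gradient-like if: (A1) every solution has exponential dichotomy (of the stable or of the unstable type) on $\mathbb R_+$ and also on $\mathbb R_-$; (A2) there are finitely many stable bunches and finitely many unstable bunches (hence finitely many ICs of the unstable type on $\mathbb R_+$ and finitely many of the stable type on $\mathbb R_-$); (A3) no solution has simultaneously exponential dichotomy of the unstable type on $\mathbb R_+$ and of the stable type on $\mathbb R_-$; (A4) consider all ICs of the unstable type on $\mathbb R_+$, and select one IC from every stable bunch. For every $\varepsilon>0$ there are pairwise disjoint thin (of width less than $\varepsilon$) uniform neighborhoods on $\mathbb R_+$, $\mathcal U_1,\dots,\mathcal U_s$ of the former and $\mathcal V_1,\dots,\mathcal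 V_r$ of the latter, with boundary curves uniformly transversal to ICs (ICs leave $\mathcal U_i$ and enter $\mathcal V_j$ through them as $t$ increases), such that the passage time of ICs from one boundary curve to another one, i.e. through the semi-strips ($t\ge0$) lying between a boundary curve of some $\mathcal U_i$ and the neighboring boundary curve of some $\mathcal V_j$, is bounded from above uniformly over all such ICs.
   Formalization: In (2), n disjoint stable/unstable pairs bound only n strips, which cannot cover R×S^1; here n is the number of stable (and of unstable) almost periodic solutions, alternating around the circle, and the covering strips in (2),(3) are all 2n strips between neighbouring ones. *)

theory Defs
  imports "HOL-Analysis.Analysis"
begin

section \<open>The circle\<close>

quotient_type circle = real / "\<lambda>x y. x - y \<in> \<int>"
proof (rule equivpI)
  show "reflp (\<lambda>x y::real. x - y \<in> \<int>)" by (simp add: reflp_def)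
  show "symp (\<lambda>x y::real. x - y \<in> \<int>)"
    by (rule sympI) (metis Ints_minus minus_diff_eq)
  show "transp (\<lambda>x y::real. x - y \<in> \<int>)"
  proof (rule transpI)
    fix x y z :: real
    assume "x - y \<in> \<int>" "y - z \<in> \<int>"
    then have "(x - y) + (y - z) \<in> \<int>" by (rule Ints_add)
    then show "x - z \<in> \<int>" by simp
  qed
qed

lift_definition to_circle :: "real \<Rightarrow> circle" is "\<lambda>x. x" .

text \<open>The representative in \<open>[0,1)\<close>.\<close>

lift_definition circle_rep :: "circle \<Rightarrow> real" is frac
proof -
  fix x y :: real
  assume "x - y \<in> \<int>"
  then obtain n where "x - y = of_int n" by (auto elim: Ints_cases)
  then have "x = y + of_int n" by simp
  then show "frac x = frac y" by (simp add: frac_def)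
qed

lemma to_circle_eq_iff: "to_circle x = to_circle y \<longleftrightarrow> x - y \<in> \<int>"
  by transfer simp

lemma circle_rep_bounds: "0 \<le> circle_rep p" "circle_rep p < 1"
  by (transfer, simp add: frac_lt_1)+

lemma to_circle_rep [simp]: "to_circle (circle_rep p) = p"
  by transfer (simp add: frac_def)

lemma circle_rep_to_circle: "circle_rep (to_circle x) = frac x"
  by transfer simp

lemma circle_rep_inject: "circle_rep p = circle_rep q \<longleftrightarrow> p = q"
  by (metis to_circle_rep)

instantiation circle :: metric_space
begin

definition dist_circle :: "circle \<Rightarrow> circle \<Rightarrow> real" where
  "dist_circle p q = min \<bar>circle_rep p - circle_rep q\<bar> (1 - \<bar>circle_rep p - circle_rep q\<bar>)"

definition uniformity_circle :: "(circle \<times> circle) filter" where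
  "uniformity_circle = (INF e\<in>{0 <..}. principal {(x, y). dist x y < e})"

definition open_circle :: "circle set \<Rightarrow> bool" where
  "open_circle U \<longleftrightarrow> (\<forall>x\<in>U. \<forall>\<^sub>F (x', y) in uniformity. x' = x \<longrightarrow> y \<in> U)"

instance
proof
  fix p q r :: circle
  show "dist p q = 0 \<longleftrightarrow> p = q"
    using circle_rep_bounds[of p] circle_rep_bounds[of q] circle_rep_inject[of p q]
    unfolding dist_circle_def by (auto simp: min_def)
  show "dist p q \<le> dist p r + dist q r"
    using circle_rep_bounds[of p] circle_rep_bounds[of q] circle_rep_bounds[of r]
    unfolding dist_circle_def min_def abs_if by (simp split: if_split)
qed (simp_all add: uniformity_circle_def open_circle_def)

end


section \<open>The space of periodic functions of class \<open>C\<^sup>r\<close>\<close>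

definition Cr_periodic :: "nat \<Rightarrow> (real \<Rightarrow> real) set" where
  "Cr_periodic r = {g. (\<forall>x. g (x + 1) = g x) \<and>
     (\<forall>k<r. \<forall>x. (deriv ^^ k) g differentiable (at x)) \<and> continuous_on UNIV ((deriv ^^ r) g)}"

definition Cr_norm :: "nat \<Rightarrow> (real \<Rightarrow> real) \<Rightarrow> real" where
  "Cr_norm r g = (\<Sum>k\<le>r. SUP x. \<bar>(deriv ^^ k) g x\<bar>)"

text \<open>Outside the carrier the distance is set to \<open>0\<close>, since \<open>Metric_space\<close> requires
  nonnegativity and symmetry for all arguments.\<close>

definition Cr_dist :: "nat \<Rightarrow> (real \<Rightarrow> real) \<Rightarrow> (real \<Rightarrow> real) \<Rightarrow> real" where
  "Cr_dist r g h =
     (if g \<in> Cr_periodic r \<and> h \<in> Cr_periodic r then Cr_norm r (\<lambda>x. g x - h x) else 0)"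

definition Cr_metric :: "nat \<Rightarrow> (real \<Rightarrow> real) metric" where
  "Cr_metric r = metric (Cr_periodic r, Cr_dist r)"

lemma deriv_iter_periodic:
  assumes "\<And>x. g (x + 1) = (g x :: real)"
  shows "(deriv ^^ k) g (x + 1) = (deriv ^^ k) g (x::real)"
proof (induction k arbitrary: x)
  case 0
  show ?case using assms by simp
next
  case (Suc k)
  let ?g = "(deriv ^^ k) g"
  have "(\<lambda>x. ?g (x + 1)) = ?g" using Suc by auto
  then have "(?g has_real_derivative D) (at (x + 1)) \<longleftrightarrow> (?g has_real_derivative D) (at x)" for D
    by (metis DERIV_shift)
  then have "deriv ?g (x + 1) = deriv ?g x" by (simp add: deriv_def)
  then show ?case by simp
qed

lemma Cr_periodic_continuous:
  assumes "g \<in> Cr_periodic r" "k \<le> r"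
  shows "continuous_on UNIV ((deriv ^^ k) g)"
proof (cases "k = r")
  case False
  then have "k < r" using assms by simp
  then show ?thesis using assms
    by (auto simp: Cr_periodic_def intro!: continuous_at_imp_continuous_on differentiable_imp_continuous_within)
qed (use assms in \<open>simp add: Cr_periodic_def\<close>)

lemma periodic_shift_int:
  fixes g :: "real \<Rightarrow> real"
  assumes "\<And>x. g (x + 1) = g x"
  shows "g (x + of_int n) = g x"
proof -
  have nat: "g (x + of_nat m) = g x" for x m
  proof (induction m)
    case (Suc m)
    have "x + of_nat (Suc m) = (x + of_nat m) + 1" by simp
    then show ?case using assms[of "x + of_nat m"] Suc by metis
  qed simp
  show ?thesis
  proof (cases n)
    case (nonneg m)
    then show ?thesis using nat by simp
  next
    case (neg m)
    then show ?thesis using nat[of "x + of_int n" "Suc m"] by simp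
  qed
qed

lemma Cr_periodic_bdd:
  assumes "g \<in> Cr_periodic r" "k \<le> r"
  shows "bdd_above (range (\<lambda>x. \<bar>(deriv ^^ k) g x\<bar>))"
proof -
  let ?g = "(deriv ^^ k) g"
  have per: "?g (x + 1) = ?g x" for x
    using assms by (intro deriv_iter_periodic) (simp add: Cr_periodic_def)
  have "continuous_on {0..1} (\<lambda>x. \<bar>?g x\<bar>)"
    by (intro continuous_intros continuous_on_subset[OF Cr_periodic_continuous[OF assms]]) auto
  then have "bdd_above ((\<lambda>x. \<bar>?g x\<bar>) ` {0..1})"
    by (intro bounded_imp_bdd_above compact_imp_bounded compact_continuous_image) auto
  then obtain B where B: "\<And>x. x \<in> {0..1} \<Longrightarrow> \<bar>?g x\<bar> \<le> B" unfolding bdd_above_def by blast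
  have "\<bar>?g x\<bar> \<le> B" for x
  proof -
    have "?g x = ?g (frac x + of_int \<lfloor>x\<rfloor>)" by (simp add: frac_def)
    also have "\<dots> = ?g (frac x)" by (rule periodic_shift_int, rule per)
    finally show ?thesis using B[of "frac x"] by (simp add: frac_lt_1 less_imp_le)
  qed
  then show ?thesis by (auto simp: bdd_above_def)
qed

lemma Cr_periodic_deriv_diff:
  assumes "g \<in> Cr_periodic r" "h \<in> Cr_periodic r" "k \<le> r"
  shows "(deriv ^^ k) (\<lambda>x. g x - h x) = (\<lambda>x. (deriv ^^ k) g x - (deriv ^^ k) h x)"
  using assms(3)
proof (induction k)
  case (Suc k)
  have "deriv (\<lambda>x. (deriv ^^ k) g x - (deriv ^^ k) h x) x
      = deriv ((deriv ^^ k) g) x - deriv ((deriv ^^ k) h) x" for x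
    using assms Suc.prems
    by (intro deriv_diff) (auto simp: Cr_periodic_def field_differentiable_def real_differentiable_def)
  then show ?case using Suc by auto
qed simp

lemma Metric_space_Cr: "Metric_space (Cr_periodic r) (Cr_dist r)"
proof -
  define D where "D k g h = (SUP x. \<bar>(deriv ^^ k) g x - (deriv ^^ k) h x\<bar>)"
    for k and g h :: "real \<Rightarrow> real"
  have eq: "Cr_dist r g h = (\<Sum>k\<le>r. D k g h)"
    if "g \<in> Cr_periodic r" "h \<in> Cr_periodic r" for g h
    unfolding Cr_norm_def Cr_dist_def D_def
    by (simp add: that) (intro sum.cong, simp_all add: Cr_periodic_deriv_diff[OF that])
  have bdd: "bdd_above (range (\<lambda>x. \<bar>(deriv ^^ k) g x - (deriv ^^ k) h x\<bar>))"
    if gh: "g \<in> Cr_periodic r" "h \<in> Cr_periodic r" and k: "k \<le> r" for g h k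
  proof -
    obtain A B where "\<And>x. \<bar>(deriv ^^ k) g x\<bar> \<le> A" "\<And>x. \<bar>(deriv ^^ k) h x\<bar> \<le> B"
      using Cr_periodic_bdd[OF gh(1) k] Cr_periodic_bdd[OF gh(2) k] by (auto simp: bdd_above_def)
    then have "\<bar>(deriv ^^ k) g x - (deriv ^^ k) h x\<bar> \<le> A + B" for x
      by (meson abs_triangle_ineq4 add_mono order_trans)
    then show ?thesis by (auto simp: bdd_above_def)
  qed
  have le: "\<bar>(deriv ^^ k) g x - (deriv ^^ k) h x\<bar> \<le> D k g h"
    if "g \<in> Cr_periodic r" "h \<in> Cr_periodic r" "k \<le> r" for g h k x
    unfolding D_def by (rule cSUP_upper[OF _ bdd[OF that]]) simp
  have nn: "0 \<le> D k g h" if "g \<in> Cr_periodic r" "h \<in> Cr_periodic r" "k \<le> r" for g h k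
    using le[OF that, of 0] by linarith
  have sym: "D k g h = D k h g" for k g h
    unfolding D_def by (subst abs_minus_commute) (rule refl)
  show ?thesis
  proof
    show "0 \<le> Cr_dist r g h" for g h
    proof (cases "g \<in> Cr_periodic r \<and> h \<in> Cr_periodic r")
      case True
      then show ?thesis by (auto simp: eq nn intro: sum_nonneg)
    qed (auto simp: Cr_dist_def)
    show "Cr_dist r g h = Cr_dist r h g" for g h
    proof (cases "g \<in> Cr_periodic r \<and> h \<in> Cr_periodic r")
      case True
      then show ?thesis using eq[of g h] eq[of h g] sym[of _ g h] by simp
    qed (auto simp: Cr_dist_def)
  next
    fix g h assume gh: "g \<in> Cr_periodic r" "h \<in> Cr_periodic r"
    show "Cr_dist r g h = 0 \<longleftrightarrow> g = h"
    proof
      assume "Cr_dist r g h = 0"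
      then have "D 0 g h = 0"
        using nn[OF gh] using sum_nonneg_eq_0_iff[of "{..r}" "\<lambda>k. D k g h"] by (simp add: eq[OF gh])
      then show "g = h" using le[OF gh, of 0] by (intro ext) simp
    next
      assume "g = h"
      then show "Cr_dist r g h = 0" using gh by (simp add: eq D_def)
    qed
  next
    fix g h l assume g: "g \<in> Cr_periodic r" and h: "h \<in> Cr_periodic r" and l: "l \<in> Cr_periodic r"
    have "D k g l \<le> D k g h + D k h l" if "k \<le> r" for k
      unfolding D_def[of k g l]
    proof (rule cSUP_least)
      fix x
      have "\<bar>(deriv ^^ k) g x - (deriv ^^ k) l x\<bar>
          \<le> \<bar>(deriv ^^ k) g x - (deriv ^^ k) h x\<bar> + \<bar>(deriv ^^ k) h x - (deriv ^^ k) l x\<bar>"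
        by linarith
      also have "\<dots> \<le> D k g h + D k h l" by (intro add_mono le g h l that)
      finally show "\<bar>(deriv ^^ k) g x - (deriv ^^ k) l x\<bar> \<le> D k g h + D k h l" .
    qed simp
    then show "Cr_dist r g l \<le> Cr_dist r g h + Cr_dist r h l"
      unfolding eq[OF g h] eq[OF h l] eq[OF g l] sum.distrib[symmetric] by (intro sum_mono) simp
  qed
qed

lemma mspace_Cr_metric [simp]: "mspace (Cr_metric r) = Cr_periodic r"
  and mdist_Cr_metric [simp]: "mdist (Cr_metric r) = Cr_dist r"
  unfolding Cr_metric_def
  by (simp_all add: Metric_space.mspace_metric Metric_space.mdist_metric Metric_space_Cr)


section \<open>Nonautonomous vector fields and almost periodicity\<close>

definition nonautonomous_vf :: "nat \<Rightarrow> (real \<Rightarrow> real \<Rightarrow> real) \<Rightarrow> bool" where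
  "nonautonomous_vf r f \<longleftrightarrow> uniformly_continuous_map euclidean_metric (Cr_metric r) f \<and>
     (\<exists>B. \<forall>t. Cr_norm r (f t) \<le> B)"

definition relatively_dense :: "real set \<Rightarrow> bool" where
  "relatively_dense L \<longleftrightarrow> (\<exists>T>0. \<forall>a. L \<inter> {a<..<a + T} \<noteq> {})"

definition almost_periodic :: "'a metric \<Rightarrow> (real \<Rightarrow> 'a) \<Rightarrow> bool" where
  "almost_periodic m g \<longleftrightarrow> continuous_map euclideanreal (mtopology_of m) g \<and>
     (\<forall>\<epsilon>>0. \<exists>L. relatively_dense L \<and> (\<forall>l\<in>L. \<forall>t. mdist m (g (t + l)) (g t) \<le> \<epsilon>))"


section \<open>Solutions and uniform equivalence\<close>

definition lifted_solution :: "(real \<Rightarrow> real \<Rightarrow> real) \<Rightarrow> (real \<Rightarrow> real) \<Rightarrow> bool" where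
  "lifted_solution f u \<longleftrightarrow> (\<forall>t. (u has_real_derivative f t (u t)) (at t))"

text \<open>A solution on the circle is the projection of a solution of the periodic equation on the
  line. Solutions and integral curves (their graphs) determine each other, so sets of integral
  curves are represented as sets of solutions.\<close>

definition solution :: "(real \<Rightarrow> real \<Rightarrow> real) \<Rightarrow> (real \<Rightarrow> circle) \<Rightarrow> bool" where
  "solution f x \<longleftrightarrow> (\<exists>u. lifted_solution f u \<and> x = to_circle \<circ> u)"

definition integral_curve :: "(real \<Rightarrow> circle) \<Rightarrow> (real \<times> circle) set" where
  "integral_curve x = range (\<lambda>t. (t, x t))"

definition equimorphism :: "(real \<times> circle \<Rightarrow> real \<times> circle) \<Rightarrow> bool" where
  "equimorphism h \<longleftrightarrow> (\<exists>h'. homeomorphism UNIV UNIV h h' \<and>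
     uniformly_continuous_on UNIV h \<and> uniformly_continuous_on UNIV h')"

definition uniformly_equivalent ::
    "(real \<Rightarrow> real \<Rightarrow> real) \<Rightarrow> (real \<Rightarrow> real \<Rightarrow> real) \<Rightarrow> bool" where
  "uniformly_equivalent f g \<longleftrightarrow> (\<exists>h. equimorphism h \<and>
     (\<forall>x. solution f x \<longrightarrow>
        (\<exists>y. solution g y \<and> h ` integral_curve x = integral_curve y) \<and>
        strict_mono (\<lambda>t. fst (h (t, x t)))))"


section \<open>Exponential dichotomy and bunches\<close>

text \<open>The coefficient \<open>f\<^sub>x(t, x(t))\<close>; by periodicity of \<open>f t\<close> the choice of representative of
  \<open>x t\<close> is immaterial.\<close>

definition linearization :: "(real \<Rightarrow> real \<Rightarrow> real) \<Rightarrow> (real \<Rightarrow> circle) \<Rightarrow> real \<Rightarrow> real" where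
  "linearization f x t = deriv (f t) (circle_rep (x t))"

definition stable_dichotomy ::
    "(real \<Rightarrow> real \<Rightarrow> real) \<Rightarrow> real set \<Rightarrow> (real \<Rightarrow> circle) \<Rightarrow> bool" where
  "stable_dichotomy f J x \<longleftrightarrow> (\<exists>C>0. \<exists>\<mu>>0. \<forall>\<tau>\<in>J. \<forall>t\<in>J. \<tau> \<le> t \<longrightarrow>
     exp (LBINT s=\<tau>..t. linearization f x s) \<le> C * exp (- \<mu> * (t - \<tau>)))"

text \<open>In the unstable case the integration is backwards in time, \<open>t \<le> \<tau>\<close>; the interval integral
  is oriented.\<close>

definition unstable_dichotomy ::
    "(real \<Rightarrow> real \<Rightarrow> real) \<Rightarrow> real set \<Rightarrow> (real \<Rightarrow> circle) \<Rightarrow> bool" where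
  "unstable_dichotomy f J x \<longleftrightarrow> (\<exists>C>0. \<exists>\<mu>>0. \<forall>\<tau>\<in>J. \<forall>t\<in>J. t \<le> \<tau> \<longrightarrow>
     exp (LBINT s=\<tau>..t. linearization f x s) \<le> C * exp (\<mu> * (t - \<tau>)))"

abbreviation forward_stable :: "(real \<Rightarrow> real \<Rightarrow> real) \<Rightarrow> (real \<Rightarrow> circle) set" where
  "forward_stable f \<equiv> {x. solution f x \<and> stable_dichotomy f {0..} x}"

abbreviation forward_unstable :: "(real \<Rightarrow> real \<Rightarrow> real) \<Rightarrow> (real \<Rightarrow> circle) set" where
  "forward_unstable f \<equiv> {x. solution f x \<and> unstable_dichotomy f {0..} x}"

abbreviation backward_stable :: "(real \<Rightarrow> real \<Rightarrow> real) \<Rightarrow> (real \<Rightarrow> circle) set" where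
  "backward_stable f \<equiv> {x. solution f x \<and> stable_dichotomy f {..0} x}"

abbreviation backward_unstable :: "(real \<Rightarrow> real \<Rightarrow> real) \<Rightarrow> (real \<Rightarrow> circle) set" where
  "backward_unstable f \<equiv> {x. solution f x \<and> unstable_dichotomy f {..0} x}"

definition asymptotic :: "real filter \<Rightarrow> (real \<Rightarrow> circle) \<Rightarrow> (real \<Rightarrow> circle) \<Rightarrow> bool" where
  "asymptotic F x y \<longleftrightarrow> ((\<lambda>t. dist (x t) (y t)) \<longlongrightarrow> 0) F"

text \<open>A maximal pairwise asymptotic subset of \<open>A\<close>. Nonemptiness only matters for \<open>A = {}\<close>.\<close>

definition bunch_in :: "real filter \<Rightarrow> (real \<Rightarrow> circle) set \<Rightarrow> (real \<Rightarrow> circle) set \<Rightarrow> bool" where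
  "bunch_in F A B \<longleftrightarrow> B \<noteq> {} \<and> B \<subseteq> A \<and> (\<forall>x\<in>B. \<forall>y\<in>B. asymptotic F x y) \<and>
     (\<forall>B'. B \<subseteq> B' \<and> B' \<subseteq> A \<and> (\<forall>x\<in>B'. \<forall>y\<in>B'. asymptotic F x y) \<longrightarrow> B' = B)"

definition stable_bunch :: "(real \<Rightarrow> real \<Rightarrow> real) \<Rightarrow> (real \<Rightarrow> circle) set \<Rightarrow> bool" where
  "stable_bunch f = bunch_in at_top (forward_stable f)"

definition unstable_bunch :: "(real \<Rightarrow> real \<Rightarrow> real) \<Rightarrow> (real \<Rightarrow> circle) set \<Rightarrow> bool" where
  "unstable_bunch f = bunch_in at_bot (backward_unstable f)"


section \<open>Gradient-like equations\<close>

text \<open>The closed strip over \<open>J\<close> between the projections of the curves \<open>u \<le> v\<close>, given on the line.\<close>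

definition strip :: "real set \<Rightarrow> (real \<Rightarrow> real) \<Rightarrow> (real \<Rightarrow> real) \<Rightarrow> (real \<times> circle) set" where
  "strip J u v = {(t, to_circle s) | t s. t \<in> J \<and> u t \<le> s \<and> s \<le> v t}"

text \<open>The strip between \<open>lo\<close> and \<open>hi\<close> is a uniform neighborhood of \<open>x\<close> on \<open>t \<ge> 0\<close> of width less
  than \<open>\<epsilon>\<close>: it contains the \<open>\<delta>\<close>-tube around \<open>x\<close> for some \<open>\<delta> > 0\<close>.\<close>

definition thin_neighborhood ::
    "real \<Rightarrow> (real \<Rightarrow> circle) \<Rightarrow> (real \<Rightarrow> real) \<Rightarrow> (real \<Rightarrow> real) \<Rightarrow> bool" where
  "thin_neighborhood \<epsilon> x lo hi \<longleftrightarrow>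
     (\<exists>u. continuous_on {0..} u \<and> (\<forall>t\<ge>0. x t = to_circle (u t)) \<and>
        (\<exists>\<delta>>0. \<forall>t\<ge>0. lo t \<le> u t - \<delta> \<and> u t + \<delta> \<le> hi t)) \<and>
     (\<forall>t\<ge>0. hi t - lo t < \<epsilon>)"

text \<open>Uniform transversality of the boundary curves, with integral curves leaving, respectively
  entering, the strip as \<open>t\<close> increases. Since \<open>f\<close> is bounded, a lower bound on the difference of
  the slopes is equivalent to a lower bound on the angle. Only the values for \<open>t \<ge> 0\<close> are constrained;
  a \<open>C\<^sup>1\<close> curve on \<open>t \<ge> 0\<close> extends beyond \<open>0\<close>, so the two-sided derivative at \<open>0\<close> is no restriction.\<close>

definition leaves_strip :: "(real \<Rightarrow> real \<Rightarrow> real) \<Rightarrow> (real \<Rightarrow> real) \<Rightarrow> (real \<Rightarrow> real) \<Rightarrow> bool" where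
  "leaves_strip f lo hi \<longleftrightarrow> lo C1_differentiable_on {0..} \<and> hi C1_differentiable_on {0..} \<and>
     (\<exists>c>0. \<forall>t\<ge>0. f t (lo t) \<le> deriv lo t - c \<and> deriv hi t + c \<le> f t (hi t))"

definition enters_strip :: "(real \<Rightarrow> real \<Rightarrow> real) \<Rightarrow> (real \<Rightarrow> real) \<Rightarrow> (real \<Rightarrow> real) \<Rightarrow> bool" where
  "enters_strip f lo hi \<longleftrightarrow> lo C1_differentiable_on {0..} \<and> hi C1_differentiable_on {0..} \<and>
     (\<exists>c>0. \<forall>t\<ge>0. deriv lo t + c \<le> f t (lo t) \<and> f t (hi t) \<le> deriv hi t - c)"

text \<open>In the following condition \<open>S\<close> consists of one solution from every stable bunch, and the
  neighborhood of \<open>x\<close> is the strip between \<open>lo x\<close> and \<open>hi x\<close>. The last clause bounds the passage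
  times: an integral curve starting on a boundary curve of a neighborhood of an unstable solution
  runs outside all the neighborhoods and reaches a boundary curve of a neighborhood of a stable one
  within time \<open>T\<close>.\<close>

definition bounded_passage :: "(real \<Rightarrow> real \<Rightarrow> real) \<Rightarrow> bool" where
  "bounded_passage f \<longleftrightarrow> (\<exists>S.
     S \<subseteq> \<Union>{B. stable_bunch f B} \<and> (\<forall>B. stable_bunch f B \<longrightarrow> (\<exists>!x. x \<in> S \<inter> B)) \<and>
     (\<forall>\<epsilon>>0. \<exists>lo hi. let U = forward_unstable f; N = (\<lambda>x. strip {0..} (lo x) (hi x)) in
        (\<forall>x\<in>U \<union> S. thin_neighborhood \<epsilon> x (lo x) (hi x)) \<and>
        (\<forall>x\<in>U. leaves_strip f (lo x) (hi x)) \<and>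
        (\<forall>x\<in>S. enters_strip f (lo x) (hi x)) \<and>
        (\<forall>x\<in>U \<union> S. \<forall>y\<in>U \<union> S. x \<noteq> y \<longrightarrow> N x \<inter> N y = {}) \<and>
        (\<exists>T. \<forall>x\<in>U. \<forall>z. solution f z \<longrightarrow>
           (\<forall>t0\<ge>0. z t0 \<in> {to_circle (lo x t0), to_circle (hi x t0)} \<longrightarrow>
              (\<exists>t1\<in>{t0..t0 + T}. (\<exists>y\<in>S. z t1 \<in> {to_circle (lo y t1), to_circle (hi y t1)}) \<and>
                 (\<forall>t\<in>{t0<..<t1}. \<forall>y\<in>U \<union> S. (t, z t) \<notin> N y))))))"

definition gradient_like :: "(real \<Rightarrow> real \<Rightarrow> real) \<Rightarrow> bool" where
  "gradient_like f \<longleftrightarrow>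
     (\<forall>x. solution f x \<longrightarrow>
        (stable_dichotomy f {0..} x \<or> unstable_dichotomy f {0..} x) \<and>
        (stable_dichotomy f {..0} x \<or> unstable_dichotomy f {..0} x)) \<and>
     finite {B. stable_bunch f B} \<and> finite {B. unstable_bunch f B} \<and>
     forward_unstable f \<inter> backward_stable f = {} \<and>
     bounded_passage f"

end

theory Submission
  imports Defs
begin

text \<open>
  All arguments take place on the universal cover. Conditions (A1) and (A3) show that a solution that is
  unstable on \<open>t \<ge> 0\<close>, respectively stable on \<open>t \<le> 0\<close>, has the same dichotomy on all of \<open>\<real>\<close>; call
  these the repelling and the attracting solutions. For an exponentially stable solution \<open>u\<close> there is a
  bounded weight \<open>Q\<close> such that \<open>Q (y - u)\<close> decreases at every instant for \<open>y\<close> near \<open>u\<close>, even if \<open>y\<close> solves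
  the equation only approximately. Hence the translate of an attracting solution by a sufficiently
  good almost period of the equation is shadowed by an attracting solution, and by time reversal the same
  holds for the repelling ones. The separation of the repelling solutions on \<open>t \<ge> 0\<close> given by (A4),
  together with the openness of exponential stability, makes them finite in number modulo \<open>1\<close>. Shadowing then carries the separation over to all of \<open>\<real>\<close>, and finiteness together with shadowing gives
  almost periodicity. Limits of translates along almost periods tending to \<open>\<infinity>\<close> and \<open>- \<infinity>\<close> show
  that attracting and repelling solutions alternate, and that every solution comes close to one of them
  within a uniformly bounded time. In a strip between neighbouring ones, the time elapsed since the
  crossing of the curve \<open>s + \<rho> / Q\<close> is a coordinate that increases at unit speed; matching it with the
  corresponding coordinate of \<open>x' = - sin (2 \<pi> n x) / (2 \<pi> n)\<close> gives the uniform equivalence.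
\<close>

section \<open>Real analysis\<close>

text \<open>The hypotheses are not symmetric in time: the separation of the unstable solutions comes
  from (A4) and concerns t \<ge> 0. Finiteness of the repelling solutions is therefore proved
  directly, while the attracting ones inherit it from the alternation of the two kinds and not from
  a time-reversed argument. A dichotomy is an average statement whose constants depend on the
  solution, whereas compactness arguments need common constants. These come from finiteness modulo
  1, which is why finiteness of the repelling solutions precedes the existence of attracting ones
  between them. No family of limit equations appears. Translation by an almost period with vanishing
  error yields approximate solutions of the same equation, so limits of translates solve the
  original one. What is gained is time: a dichotomy on a half line becomes one on the whole line
  when the translations tend to infinity. The conjugacy is found through its inverse, a monotone
  family of curves indexed by the points of the model; a solution is a curve with moving
  index.\<close>

lemma abs_diff_le_of_deriv_le:
  fixes p g :: "real \<Rightarrow> real"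
  assumes "a \<le> b"
    and "\<And>s. a \<le> s \<Longrightarrow> s \<le> b \<Longrightarrow> (p has_real_derivative p' s) (at s)"
    and "\<And>s. a \<le> s \<Longrightarrow> s \<le> b \<Longrightarrow> (g has_real_derivative g' s) (at s)"
    and "\<And>s. a \<le> s \<Longrightarrow> s \<le> b \<Longrightarrow> \<bar>p' s\<bar> \<le> g' s"
  shows "\<bar>p b - p a\<bar> \<le> g b - g a"
proof -
  have "(\<lambda>s. g s - p s) a \<le> (\<lambda>s. g s - p s) b"
  proof (rule DERIV_nonneg_imp_nondecreasing[OF assms(1)])
    fix x assume x: "a \<le> x" "x \<le> b"
    show "\<exists>y. ((\<lambda>s. g s - p s) has_real_derivative y) (at x) \<and> 0 \<le> y"
      using DERIV_diff[OF assms(3)[OF x] assms(2)[OF x]] assms(4)[OF x] by (intro exI) auto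
  qed
  moreover have "(\<lambda>s. g s + p s) a \<le> (\<lambda>s. g s + p s) b"
  proof (rule DERIV_nonneg_imp_nondecreasing[OF assms(1)])
    fix x assume x: "a \<le> x" "x \<le> b"
    show "\<exists>y. ((\<lambda>s. g s + p s) has_real_derivative y) (at x) \<and> 0 \<le> y"
      using DERIV_add[OF assms(3)[OF x] assms(2)[OF x]] assms(4)[OF x] by (intro exI) auto
  qed
  ultimately show ?thesis by simp
qed

lemma abs_diff_le_of_deriv_bound:
  fixes p :: "real \<Rightarrow> real"
  assumes "\<And>s. (p has_real_derivative p' s) (at s)" and "\<And>s. \<bar>p' s\<bar> \<le> B"
  shows "\<bar>p b - p a\<bar> \<le> B * \<bar>b - a\<bar>"
proof -
  have *: "\<bar>p b - p a\<bar> \<le> B * b - B * a" if "a \<le> b" for a b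
    by (rule abs_diff_le_of_deriv_le[where p' = p' and g = "\<lambda>s. B * s" and g' = "\<lambda>_. B", OF that])
      (use assms in \<open>auto intro!: derivative_eq_intros\<close>)
  show ?thesis
    using *[of a b] *[of b a] by (cases "a \<le> b") (auto simp: algebra_simps abs_minus_commute)
qed

text \<open>Gronwall in both time directions: \<open>p t * exp (- K * t)\<close> is nonincreasing
  and \<open>p t * exp (K * t)\<close> is nondecreasing.\<close>

lemma growth_bound:
  fixes p :: "real \<Rightarrow> real"
  assumes p: "\<And>s. (p has_real_derivative p' s) (at s)" and le: "\<And>s. \<bar>p' s\<bar> \<le> K * p s"
  shows "p t \<le> p s * exp (K * \<bar>t - s\<bar>)"
proof (cases "s \<le> t")
  case True
  have "p t * exp (- K * t) \<le> p s * exp (- K * s)"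
  proof (rule DERIV_nonpos_imp_nonincreasing[OF True, of "\<lambda>t. p t * exp (- K * t)"])
    fix x
    have "((\<lambda>t. p t * exp (- K * t)) has_real_derivative
        (p' x - K * p x) * exp (- K * x)) (at x)"
      by (rule derivative_eq_intros p refl | simp add: algebra_simps)+
    moreover have "(p' x - K * p x) * exp (- K * x) \<le> 0"
      using le[of x] by (intro mult_nonpos_nonneg) auto
    ultimately show "\<exists>y. ((\<lambda>t. p t * exp (- K * t)) has_real_derivative y) (at x) \<and> y \<le> 0"
      by blast
  qed
  then have "p t * exp (- K * t) * exp (K * t) \<le> p s * exp (- K * s) * exp (K * t)"
    by (rule mult_right_mono) simp
  moreover have "K * \<bar>t - s\<bar> = - K * s + K * t" using True by (simp add: algebra_simps)
  ultimately show ?thesis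
    by (simp only: mult.assoc flip: exp_add) simp
next
  case False
  then have ts: "t \<le> s" by simp
  have "p t * exp (K * t) \<le> p s * exp (K * s)"
  proof (rule DERIV_nonneg_imp_nondecreasing[OF ts, of "\<lambda>t. p t * exp (K * t)"])
    fix x
    have "((\<lambda>t. p t * exp (K * t)) has_real_derivative
        (p' x + K * p x) * exp (K * x)) (at x)"
      by (rule derivative_eq_intros p refl | simp add: algebra_simps)+
    moreover have "0 \<le> (p' x + K * p x) * exp (K * x)"
      using le[of x] by (intro mult_nonneg_nonneg) auto
    ultimately show "\<exists>y. ((\<lambda>t. p t * exp (K * t)) has_real_derivative y) (at x) \<and> 0 \<le> y"
      by blast
  qed
  then have "p t * exp (K * t) * exp (- K * t) \<le> p s * exp (K * s) * exp (- K * t)"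
    by (rule mult_right_mono) simp
  moreover have "K * \<bar>t - s\<bar> = K * s + - K * t" using ts by (simp add: algebra_simps)
  ultimately show ?thesis
    by (simp only: mult.assoc flip: exp_add) simp
qed

text \<open>The square is differentiated because \<open>\<bar>v\<bar>\<close> need not be
  differentiable at a zero of \<open>v\<close>; the hypothesis on \<open>v' x * v x\<close> is what
  the derivative of \<open>(v t)\<^sup>2 * exp (2 * k * t)\<close> asks for.\<close>

lemma decay_bound:
  fixes v :: "real \<Rightarrow> real"
  assumes "s \<le> t" and v: "\<And>x. s \<le> x \<Longrightarrow> x \<le> t \<Longrightarrow> (v has_real_derivative v' x) (at x)"
    and le: "\<And>x. s \<le> x \<Longrightarrow> x \<le> t \<Longrightarrow> v' x * v x \<le> - k * (v x)\<^sup>2"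
  shows "\<bar>v t\<bar> \<le> \<bar>v s\<bar> * exp (- k * (t - s))"
proof -
  have "(v t)\<^sup>2 * exp (2 * k * t) \<le> (v s)\<^sup>2 * exp (2 * k * s)"
  proof (rule DERIV_nonpos_imp_nonincreasing[OF assms(1), of "\<lambda>t. (v t)\<^sup>2 * exp (2 * k * t)"])
    fix x assume x: "s \<le> x" "x \<le> t"
    have "((\<lambda>t. (v t)\<^sup>2 * exp (2 * k * t)) has_real_derivative
        2 * (v' x * v x + k * (v x)\<^sup>2) * exp (2 * k * x)) (at x)"
      by (rule derivative_eq_intros v x refl | simp add: algebra_simps power2_eq_square)+
    moreover have "2 * (v' x * v x + k * (v x)\<^sup>2) * exp (2 * k * x) \<le> 0"
      using le[OF x] by (intro mult_nonpos_nonneg[OF _ exp_ge_zero]) (simp add: algebra_simps)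
    ultimately show "\<exists>y. ((\<lambda>t. (v t)\<^sup>2 * exp (2 * k * t)) has_real_derivative y) (at x) \<and> y \<le> 0"
      by blast
  qed
  then have "(v t)\<^sup>2 * exp (2 * k * t) * exp (- (2 * k * t)) \<le> (v s)\<^sup>2 * exp (2 * k * s) * exp (- (2 * k * t))"
    by (rule mult_right_mono) simp
  then have "(v t)\<^sup>2 \<le> (v s)\<^sup>2 * exp (2 * k * s + - (2 * k * t))"
    by (simp only: mult.assoc flip: exp_add) simp
  also have "2 * k * s + - (2 * k * t) = (- k * (t - s)) + (- k * (t - s))" by (simp add: algebra_simps)
  also have "(v s)\<^sup>2 * exp (- k * (t - s) + - k * (t - s)) = (\<bar>v s\<bar> * exp (- k * (t - s)))\<^sup>2"
    by (simp only: exp_add power2_eq_square) (simp add: algebra_simps flip: abs_mult)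
  finally show ?thesis by (simp flip: abs_le_square_iff add: abs_mult)
qed

text \<open>The sign of the derivative is known on the level \<open>\<rho>\<close> only. At the last
  time \<open>c\<close> with \<open>v c \<le> \<rho>\<close> the value is \<open>\<rho>\<close>
  itself, and the negative derivative there pushes \<open>v\<close> below the level just after
  \<open>c\<close>.\<close>

lemma barrier:
  fixes v :: "real \<Rightarrow> real"
  assumes "a \<le> b" "v a \<le> \<rho>"
    and v: "\<And>x. a \<le> x \<Longrightarrow> x \<le> b \<Longrightarrow> (v has_real_derivative v' x) (at x)"
    and neg: "\<And>x. a \<le> x \<Longrightarrow> x \<le> b \<Longrightarrow> v x = \<rho> \<Longrightarrow> v' x < 0"
  shows "v b \<le> \<rho>"
proof (rule ccontr)
  assume "\<not> v b \<le> \<rho>"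
  have cont: "continuous_on {a..b} v"
    by (intro continuous_at_imp_continuous_on ballI DERIV_isCont[OF v]) auto
  define S where "S = {x \<in> {a..b}. v x \<le> \<rho>}"
  have S: "a \<in> S" "S \<subseteq> {a..b}" using assms by (auto simp: S_def)
  have "closed S"
    unfolding S_def using continuous_on_closed_Collect_le[OF cont continuous_on_const, of \<rho>] by simp
  define c where "c = Sup S"
  have bdd: "bdd_above S" using S(2) by (intro bdd_above_mono[OF bdd_above_Icc])
  have "c \<in> S" unfolding c_def
    using closed_contains_Sup[OF _ bdd \<open>closed S\<close>] S(1) by blast
  then have c: "a \<le> c" "c \<le> b" "v c \<le> \<rho>" by (auto simp: S_def)
  have above: "\<rho> < v x" if "c < x" "x \<le> b" for x
    using that c cSup_upper[OF _ bdd, of x] by (force simp: S_def c_def)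
  have "c < b" using c \<open>\<not> v b \<le> \<rho>\<close> by (cases "c = b") auto
  have "v c = \<rho>"
  proof (rule ccontr)
    assume "v c \<noteq> \<rho>"
    then have "v c < \<rho>" using c by simp
    then have "\<exists>x. c \<le> x \<and> x \<le> b \<and> v x = \<rho>"
      using \<open>\<not> v b \<le> \<rho>\<close> c
      by (intro IVT') (auto intro: continuous_on_subset[OF cont])
    then obtain x where "c \<le> x" "x \<le> b" "v x = \<rho>" by blast
    with above[of x] \<open>v c < \<rho>\<close> show False by (cases "x = c") auto
  qed
  from DERIV_neg_dec_right[OF v neg[OF _ _ this]] c
  obtain d where d: "d > 0" "\<And>h. h > 0 \<Longrightarrow> h < d \<Longrightarrow> v (c + h) < v c" by blast
  define h where "h = min (d / 2) (b - c)"
  have "0 < h" "h < d" "c + h \<le> b" using d(1) \<open>c < b\<close> by (auto simp: h_def)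
  with above[of "c + h"] d(2)[of h] \<open>v c = \<rho>\<close> show False by simp
qed

lemma antiderivative_exists:
  fixes a :: "real \<Rightarrow> real"
  assumes "continuous_on UNIV a"
  shows "\<exists>A. \<forall>t. (A has_real_derivative a t) (at t)"
proof -
  have "\<exists>F. \<forall>x :: real. -\<infinity> < ereal x \<longrightarrow> ereal x < \<infinity> \<longrightarrow> (F has_vector_derivative a x) (at x)"
    using assms by (intro einterval_antiderivative) (auto simp: continuous_on_eq_continuous_at)
  then show ?thesis by (auto simp: has_real_derivative_iff_has_vector_derivative)
qed

lemma integral_eq_antiderivative:
  fixes a :: "real \<Rightarrow> real"
  assumes "\<And>t. (A has_real_derivative a t) (at t)" "s \<le> t"
  shows "integral {s..t} a = A t - A s"
  using assms
  by (intro integral_unique fundamental_theorem_of_calculus)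
    (auto simp: has_real_derivative_iff_has_vector_derivative intro: has_vector_derivative_at_within)


section \<open>Exponentially contracting and expanding coefficients\<close>

text \<open>The logarithm of the stable dichotomy estimate: the multiplicative constant there is
  \<open>exp C\<close> here. Additive constants combine well when intervals are joined or the
  coefficient is perturbed.\<close>

definition contracting :: "real set \<Rightarrow> real \<Rightarrow> real \<Rightarrow> (real \<Rightarrow> real) \<Rightarrow> bool" where
  "contracting J C m a \<longleftrightarrow> (\<forall>s\<in>J. \<forall>t\<in>J. s \<le> t \<longrightarrow> integral {s..t} a \<le> C - m * (t - s))"

definition expanding :: "real set \<Rightarrow> real \<Rightarrow> real \<Rightarrow> (real \<Rightarrow> real) \<Rightarrow> bool" where
  "expanding J C m a \<longleftrightarrow> (\<forall>s\<in>J. \<forall>t\<in>J. s \<le> t \<longrightarrow> m * (t - s) - C \<le> integral {s..t} a)"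

text \<open>Time reversal; it reduces statements on expanding coefficients to statements on
  contracting ones. The additional sign is that of the reversed field
  \<open>- f (- t) x\<close>.\<close>

lemma expanding_iff_reversed: "expanding J C m a \<longleftrightarrow> contracting (uminus ` J) C m (\<lambda>t. - a (- t))"
proof -
  have *: "integral {s..t} (\<lambda>t. - a (- t)) = - integral {- t..- s} a" for s t
    using Henstock_Kurzweil_Integration.integral_reflect_real[of "- s" "- t" a] by (simp add: integral_neg)
  show ?thesis unfolding expanding_def contracting_def *
  proof safe
    fix s t assume "\<forall>s\<in>J. \<forall>t\<in>J. s \<le> t \<longrightarrow> m * (t - s) - C \<le> integral {s..t} a" "s \<in> J" "t \<in> J" "- s \<le> - t"
    then show "- integral {- (- t)..- (- s)} a \<le> C - m * (- t - - s)" by (force simp: algebra_simps)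
  next
    fix s t assume "\<forall>s\<in>uminus ` J. \<forall>t\<in>uminus ` J. s \<le> t \<longrightarrow> - integral {- t..- s} a \<le> C - m * (t - s)"
      "s \<in> J" "t \<in> J" "s \<le> t"
    from this(1)[rule_format, of "- t" "- s"] this(2-) show "m * (t - s) - C \<le> integral {s..t} a"
      by (simp add: algebra_simps)
  qed
qed

lemma contracting_mono:
  assumes "contracting J C m a" "C \<le> C'" "m' \<le> m" "J' \<subseteq> J"
  shows "contracting J' C' m' a"
  unfolding contracting_def
proof safe
  fix s t assume "s \<in> J'" "t \<in> J'" "s \<le> t"
  then have "integral {s..t} a \<le> C - m * (t - s)" using assms by (auto simp: contracting_def)
  also have "\<dots> \<le> C' - m' * (t - s)"
    using assms \<open>s \<le> t\<close> by (intro diff_mono mult_right_mono) auto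
  finally show "integral {s..t} a \<le> C' - m' * (t - s)" .
qed

lemma expanding_mono:
  assumes "expanding J C m a" "C \<le> C'" "m' \<le> m" "J' \<subseteq> J"
  shows "expanding J' C' m' a"
  using assms contracting_mono[of "uminus ` J" C m _ C' m' "uminus ` J'"]
  by (auto simp: expanding_iff_reversed)

text \<open>A perturbation of size \<open>e\<close> costs \<open>e\<close> in the rate and nothing
  in \<open>C\<close>. With \<open>e\<close> equal to half the rate it transfers the dichotomy to
  nearby solutions.\<close>

lemma contracting_near:
  fixes a b :: "real \<Rightarrow> real"
  assumes "contracting J C m a" and cont: "continuous_on UNIV a" "continuous_on UNIV b"
    and J: "\<And>s t. s \<in> J \<Longrightarrow> t \<in> J \<Longrightarrow> {s..t} \<subseteq> J" and near: "\<And>t. t \<in> J \<Longrightarrow> \<bar>b t - a t\<bar> \<le> e"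
  shows "contracting J C (m - e) b"
  unfolding contracting_def
proof safe
  fix s t assume st: "s \<in> J" "t \<in> J" "s \<le> t"
  have int: "a integrable_on {s..t}" "b integrable_on {s..t}"
    using cont by (auto intro!: integrable_continuous_real intro: continuous_on_subset)
  have "integral {s..t} b \<le> integral {s..t} (\<lambda>x. a x + e)"
    using J[of s t] st near int
    by (intro integral_le integrable_add) (force intro!: integrable_continuous_real continuous_intros simp: abs_le_iff)+
  also have "\<dots> = integral {s..t} a + e * (t - s)"
    using int st by (subst integral_add) auto
  also have "\<dots> \<le> C - m * (t - s) + e * (t - s)"
    using assms(1) st by (auto simp: contracting_def)
  finally show "integral {s..t} b \<le> C - (m - e) * (t - s)" by (simp add: algebra_simps)
qed

lemma not_contracting_expanding:
  assumes "contracting J C m a" "expanding J C' m' a" "0 < m" "0 < m'"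
    and unb: "\<And>d. \<exists>s\<in>J. \<exists>t\<in>J. s + d \<le> t"
  shows False
proof -
  \<comment> \<open>Beyond the length \<open>(C + C') / (m + m')\<close> the lower linear bound
    exceeds the upper one; the summand 1 makes this strict, and the maximum with 1 ensures
    \<open>s \<le> t\<close>.\<close>
  obtain s t where st: "s \<in> J" "t \<in> J" "s + max 1 ((C + C') / (m + m') + 1) \<le> t" using unb by blast
  then have "s \<le> t" and le: "(C + C') / (m + m') + 1 \<le> t - s" by linarith+
  then have "m' * (t - s) - C' \<le> C - m * (t - s)"
    using assms st unfolding contracting_def expanding_def by force
  then have "(m + m') * (t - s) \<le> C + C'" by (simp add: algebra_simps)
  also have "\<dots> < (m + m') * ((C + C') / (m + m') + 1)"
    using assms by (simp add: distrib_left[of _ _ 1])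
  also have "\<dots> \<le> (m + m') * (t - s)" using le assms by (intro mult_left_mono) auto
  finally show False by simp
qed

lemma contracting_join:
  fixes a :: "real \<Rightarrow> real"
  assumes "contracting {..0} C m a" "contracting {0..} C' m' a" "continuous_on UNIV a" "0 < m" "0 < m'"
  shows "contracting UNIV (max 0 C + max 0 C') (min m m') a"
  unfolding contracting_def
proof safe
  \<comment> \<open>With nonnegative constants the sum dominates each of them, so intervals on one
    side of 0 obey the same bound.\<close>
  let ?C = "max 0 C + max 0 C'" let ?m = "min m m'"
  fix s t :: real assume st: "s \<le> t"
  have neg: "integral {s..t} a \<le> max 0 C - ?m * (t - s)" if "s \<le> t" "t \<le> 0" for s t
    using contracting_mono[OF assms(1), of "max 0 C" ?m "{..0}"] that by (auto simp: contracting_def)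
  have pos: "integral {s..t} a \<le> max 0 C' - ?m * (t - s)" if "s \<le> t" "0 \<le> s" for s t
    using contracting_mono[OF assms(2), of "max 0 C'" ?m "{0..}"] that by (auto simp: contracting_def)
  consider "t \<le> 0" | "0 \<le> s" | "s \<le> 0" "0 \<le> t" by linarith
  then show "integral {s..t} a \<le> ?C - ?m * (t - s)"
  proof cases
    case 3
    have "integral {s..t} a = integral {s..0} a + integral {0..t} a"
      using 3 assms(3) by (intro Henstock_Kurzweil_Integration.integral_combine[symmetric])
        (auto intro!: integrable_continuous_real intro: continuous_on_subset)
    then show ?thesis using neg[of s 0] pos[of 0 t] 3 by (simp add: algebra_simps)
  qed (use neg[of s t] pos[of s t] st in auto)
qed

lemma expanding_join:
  fixes a :: "real \<Rightarrow> real"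
  assumes "expanding {..0} C m a" "expanding {0..} C' m' a" "continuous_on UNIV a" "0 < m" "0 < m'"
  shows "expanding UNIV (max 0 C + max 0 C') (min m m') a"
proof -
  have "continuous_on UNIV (\<lambda>t. - a (- t))"
    by (intro continuous_intros continuous_on_compose2[OF assms(3)]) auto
  then show ?thesis
    using contracting_join[of C' m' "\<lambda>t. - a (- t)" C m] assms
    by (simp add: expanding_iff_reversed min.commute add.commute)
qed

text \<open>In the coordinate \<open>Q (y - u)\<close> the contraction of the linearized equation is visible at every
  instant, not only on average. The weight is \<open>Q t = \<integral>\<^sub>t\<^sup>\<infinity> exp (\<integral>\<^sub>t\<^sup>s a) ds\<close>.\<close>

lemma lyapunov_weight:
  fixes a :: "real \<Rightarrow> real"
  assumes "contracting J C m a" "0 < m" and a: "continuous_on UNIV a" "\<And>t. \<bar>a t\<bar> \<le> L" "0 < L"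
    and J: "J \<noteq> {}" "\<forall>s\<in>J. {s..} \<subseteq> J"
  obtains Q where "\<And>t. (Q has_real_derivative - 1 - a t * Q t) (at t)"
    "\<And>t. t \<in> J \<Longrightarrow> exp (- 1) / L \<le> Q t" "\<And>t. t \<in> J \<Longrightarrow> Q t \<le> exp C / m"
proof -
  obtain A where A: "\<And>t. (A has_real_derivative a t) (at t)"
    using antiderivative_exists[OF a(1)] by blast
  have "continuous_on UNIV (\<lambda>t. exp (A t))"
    by (intro continuous_intros continuous_at_imp_continuous_on ballI DERIV_isCont[OF A])
  then obtain G where G: "\<And>t. (G has_real_derivative exp (A t)) (at t)"
    using antiderivative_exists by blast
  have mono: "G s \<le> G t" if "s \<le> t" for s t
    using that by (rule DERIV_nonneg_imp_nondecreasing) (use G exp_ge_zero in blast)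
  \<comment> \<open>The tail of the integral of \<open>exp A\<close> is compared with that of
    \<open>exp (A s + C - m * (t - s))\<close>, whose total mass is
    \<open>exp (A s + C) / m\<close>.\<close>
  have up: "G t \<le> G s + exp (A s + C) / m" if "s \<in> J" "s \<le> t" for s t
  proof -
    let ?\<phi> = "\<lambda>t. G t + exp (A s + C - m * (t - s)) / m"
    have "?\<phi> t \<le> ?\<phi> s"
    proof (rule DERIV_nonpos_imp_nonincreasing[OF that(2)])
      fix x assume x: "s \<le> x" "x \<le> t"
      have "(?\<phi> has_real_derivative exp (A x) - exp (A s + C - m * (x - s))) (at x)"
        by (rule derivative_eq_intros G refl | use \<open>0 < m\<close> in simp)+
      moreover have "A x - A s \<le> C - m * (x - s)"
        using assms(1) J(2) that x integral_eq_antiderivative[of A a, OF A x(1)]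
        by (force simp: contracting_def)
      then have "exp (A x) - exp (A s + C - m * (x - s)) \<le> 0" by simp
      ultimately show "\<exists>y. (?\<phi> has_real_derivative y) (at x) \<and> y \<le> 0" by blast
    qed
    moreover have "0 \<le> exp (A s + C - m * (t - s)) / m" using \<open>0 < m\<close> by simp
    ultimately have "G t \<le> ?\<phi> s" by linarith
    then show ?thesis by simp
  qed
  define I where "I = (SUP t. G t)"
  obtain s0 where s0: "s0 \<in> J" using J by blast
  have bdd: "bdd_above (range G)"
  proof (rule bdd_aboveI2)
    fix t show "G t \<le> G s0 + exp (A s0 + C) / m"
      using up[OF s0, of t] mono[of t s0] \<open>0 < m\<close> by (cases "s0 \<le> t") (auto intro: order_trans)
  qed
  \<comment> \<open>\<open>I\<close> is the limit of the increasing function \<open>G\<close>, so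
    \<open>I - G t\<close> is the tail integral of \<open>exp A\<close> from \<open>t\<close>
    on.\<close>
  define Q where "Q t = exp (- A t) * (I - G t)" for t
  show thesis
  proof
    show "(Q has_real_derivative - 1 - a t * Q t) (at t)" for t
      unfolding Q_def by (rule derivative_eq_intros A G refl | simp add: algebra_simps flip: exp_add)+
    show "Q t \<le> exp C / m" if "t \<in> J" for t
    proof -
      have "I \<le> G t + exp (A t + C) / m" unfolding I_def
      proof (rule cSUP_least)
        fix x show "G x \<le> G t + exp (A t + C) / m"
          using up[OF that, of x] mono[of x t] \<open>0 < m\<close> by (cases "t \<le> x") (auto intro: order_trans)
      qed simp
      then have "exp (- A t) * (I - G t) \<le> exp (- A t) * (exp (A t + C) / m)"
        by (intro mult_left_mono) auto
      then show ?thesis by (simp add: Q_def flip: exp_add)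
    qed
    show "exp (- 1) / L \<le> Q t" if "t \<in> J" for t
    proof -
      \<comment> \<open>During the time \<open>1 / L\<close> the exponent \<open>A\<close> falls by
        at most 1, so this piece of the tail alone contributes
        \<open>exp (A t - 1) / L\<close>.\<close>
      have t: "t < t + 1 / L" using \<open>0 < L\<close> by simp
      obtain z where z: "t < z" "z < t + 1 / L" "G (t + 1 / L) - G t = (t + 1 / L - t) * exp (A z)"
        using MVT2[OF t, of G "\<lambda>x. exp (A x)"] G by blast
      have "\<bar>A z - A t\<bar> \<le> L * \<bar>z - t\<bar>" using abs_diff_le_of_deriv_bound[of A a L] A a by blast
      also have "\<dots> \<le> L * (1 / L)" using z \<open>0 < L\<close> by (intro mult_left_mono) auto
      finally have "A t - 1 \<le> A z" using \<open>0 < L\<close> by simp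
      then have "exp (A t - 1) / L \<le> G (t + 1 / L) - G t" unfolding z(3) using \<open>0 < L\<close>
        by (simp add: divide_right_mono)
      also have "\<dots> \<le> I - G t" unfolding I_def using cSUP_upper[OF _ bdd, of "t + 1 / L"] by simp
      finally have "exp (- A t) * (exp (A t - 1) / L) \<le> exp (- A t) * (I - G t)"
        by (intro mult_left_mono) auto
      then show ?thesis by (simp add: Q_def flip: exp_add)
    qed
  qed
qed

section \<open>Periodic scalar equations\<close>

text \<open>The equation lifted to the line. \<open>L\<close> is at once a speed limit and a
  Lipschitz constant; the uniform continuity of \<open>fx\<close> over the whole plane makes the
  radii and errors below independent of the solution and of time.\<close>

locale periodic_field =
  fixes f fx :: "real \<Rightarrow> real \<Rightarrow> real" and L :: real
  assumes periodic: "f t (x + 1) = f t x"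
    and deriv: "(f t has_real_derivative fx t x) (at x)"
    and continuous: "continuous_on UNIV (\<lambda>p. f (fst p) (snd p))"
    and bound: "\<bar>f t x\<bar> \<le> L"
    and fx_bound: "\<bar>fx t x\<bar> \<le> L"
    and L_pos: "0 < L"
    and fx_uniform: "0 < e \<Longrightarrow> \<exists>d>0. \<forall>s t x y. \<bar>s - t\<bar> < d \<longrightarrow> \<bar>x - y\<bar> < d \<longrightarrow> \<bar>fx s x - fx t y\<bar> < e"

text \<open>The defect may vary with time in any way and only its size counts. Translates of
  solutions by almost periods are the intended examples.\<close>

definition approx_solution :: "(real \<Rightarrow> real \<Rightarrow> real) \<Rightarrow> real \<Rightarrow> (real \<Rightarrow> real) \<Rightarrow> bool" where
  "approx_solution f \<epsilon> y \<longleftrightarrow> (\<forall>t. \<exists>e. \<bar>e\<bar> \<le> \<epsilon> \<and> (y has_real_derivative f t (y t) + e) (at t))"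

lemma approx_solution_of_solution: "lifted_solution f y \<Longrightarrow> 0 \<le> \<epsilon> \<Longrightarrow> approx_solution f \<epsilon> y"
  unfolding approx_solution_def lifted_solution_def by (auto intro!: exI[of _ 0])

lemma reversed_solution_iff:
  "lifted_solution (\<lambda>t x. - f (- t) x) (\<lambda>t. u (- t)) \<longleftrightarrow> lifted_solution f u"
proof -
  have *: "lifted_solution (\<lambda>t x. - f (- t) x) (\<lambda>t. u (- t))" if "lifted_solution f u" for f u
    unfolding lifted_solution_def
  proof
    fix t :: real
    have "(u has_real_derivative f (- t) (u (- t))) (at (- t))"
      using that by (simp add: lifted_solution_def)
    moreover have "(uminus has_real_derivative - 1) (at t)" by (auto intro!: derivative_eq_intros)
    ultimately have "((\<lambda>t. u (- t)) has_real_derivative f (- t) (u (- t)) * - 1) (at t)"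
      by (intro DERIV_chain')
    then show "((\<lambda>t. u (- t)) has_real_derivative - f (- t) (u (- t))) (at t)" by simp
  qed
  show ?thesis using *[of f u] *[of "\<lambda>t x. - f (- t) x" "\<lambda>t. u (- t)"] by auto
qed

lemma mirrored_solution_iff:
  "lifted_solution (\<lambda>t x. - f t (- x)) (\<lambda>t. - u t) \<longleftrightarrow> lifted_solution f u"
  unfolding lifted_solution_def
  using DERIV_minus[of u] DERIV_minus[of "\<lambda>t. - u t"] by (metis (no_types, lifting) minus_minus ext)

context periodic_field
begin

lemma lipschitz: "\<bar>f t x - f t y\<bar> \<le> L * \<bar>x - y\<bar>"
  using abs_diff_le_of_deriv_bound[of "f t" "fx t" L] deriv fx_bound by blast

lemma periodic_int: "f t (x + of_int n) = f t x"
  using periodic_shift_int[of "f t"] periodic by blast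

lemma fx_periodic_int: "fx t (x + of_int n) = fx t x"
proof -
  have "(f t has_real_derivative fx t (x + of_int n)) (at (x + of_int n))" by (rule deriv)
  then have "((\<lambda>x. f t (x + of_int n)) has_real_derivative fx t (x + of_int n)) (at x)"
    by (simp add: DERIV_shift)
  then have "(f t has_real_derivative fx t (x + of_int n)) (at x)" by (simp only: periodic_int)
  with deriv show ?thesis by (metis DERIV_unique)
qed

lemma continuous_along:
  assumes "continuous_on UNIV u"
  shows "continuous_on UNIV (\<lambda>t. f t (u t))"
proof -
  have "continuous_on UNIV (\<lambda>t. (t, u t))" by (intro continuous_intros assms)
  from continuous_on_compose2[OF continuous this] show ?thesis by simp
qed

lemma fx_continuous_along:
  assumes "continuous_on UNIV u"
  shows "continuous_on UNIV (\<lambda>t. fx t (u t))"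
  unfolding continuous_on_iff
proof safe
  fix t e :: real assume "0 < e"
  with fx_uniform obtain d where d: "d > 0"
    "\<And>s t x y. \<bar>s - t\<bar> < d \<Longrightarrow> \<bar>x - y\<bar> < d \<Longrightarrow> \<bar>fx s x - fx t y\<bar> < e" by metis
  obtain d' where d': "d' > 0" "\<And>s. dist s t < d' \<Longrightarrow> dist (u s) (u t) < d"
    using assms d(1) unfolding continuous_on_iff by blast
  have "dist (fx s (u s)) (fx t (u t)) < e" if "dist s t < min d d'" for s
    using d(2)[of s t "u s" "u t"] d'(2)[of s] that by (auto simp: dist_real_def)
  then show "\<exists>d>0. \<forall>s\<in>UNIV. dist s t < d \<longrightarrow> dist (fx s (u s)) (fx t (u t)) < e"
    using d(1) d'(1) by (intro exI[of _ "min d d'"]) auto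
qed

text \<open>Time reversal changes the type of a dichotomy, so results on stable solutions become
  results on unstable ones.\<close>

lemma reversed: "periodic_field (\<lambda>t x. - f (- t) x) (\<lambda>t x. - fx (- t) x) L"
proof
  show "continuous_on UNIV (\<lambda>p. - f (- fst p) (snd p))"
  proof -
    have "continuous_on UNIV (\<lambda>p :: real \<times> real. (- fst p, snd p))" by (intro continuous_intros)
    from continuous_on_minus[OF continuous_on_compose2[OF continuous this]] show ?thesis by simp
  qed
  show "\<exists>d>0. \<forall>s t x y. \<bar>s - t\<bar> < d \<longrightarrow> \<bar>x - y\<bar> < d \<longrightarrow> \<bar>- fx (- s) x - - fx (- t) y\<bar> < e"
    if e: "0 < e" for e
  proof -
    obtain d where d: "d > 0"
      "\<And>s t x y. \<bar>s - t\<bar> < d \<Longrightarrow> \<bar>x - y\<bar> < d \<Longrightarrow> \<bar>fx s x - fx t y\<bar> < e" using fx_uniform[OF e] by blast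
    have "\<bar>- fx (- s) x - - fx (- t) y\<bar> < e" if "\<bar>s - t\<bar> < d" "\<bar>x - y\<bar> < d" for s t x y
      using d(2)[of "- s" "- t" x y] that by linarith
    with d(1) show ?thesis by blast
  qed
  show "((\<lambda>x. - f (- t) x) has_real_derivative - fx (- t) x) (at x)" for t x
    by (intro DERIV_minus deriv)
qed (use bound fx_bound L_pos periodic in auto)

text \<open>Reflection keeps the dichotomy type and the direction of time; it exchanges the strips
  whose attracting boundary is the lower one with those where it is the upper one.\<close>

lemma mirrored: "periodic_field (\<lambda>t x. - f t (- x)) (\<lambda>t x. fx t (- x)) L"
proof
  show "- f t (- (x + 1)) = - f t (- x)" for t x using periodic[of t "- x - 1"] by simp
  show "continuous_on UNIV (\<lambda>p. - f (fst p) (- snd p))"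
  proof -
    have "continuous_on UNIV (\<lambda>p :: real \<times> real. (fst p, - snd p))" by (intro continuous_intros)
    from continuous_on_minus[OF continuous_on_compose2[OF continuous this]] show ?thesis by simp
  qed
  show "\<exists>d>0. \<forall>s t x y. \<bar>s - t\<bar> < d \<longrightarrow> \<bar>x - y\<bar> < d \<longrightarrow> \<bar>fx s (- x) - fx t (- y)\<bar> < e"
    if e: "0 < e" for e
  proof -
    obtain d where d: "d > 0"
      "\<And>s t x y. \<bar>s - t\<bar> < d \<Longrightarrow> \<bar>x - y\<bar> < d \<Longrightarrow> \<bar>fx s x - fx t y\<bar> < e" using fx_uniform[OF e] by blast
    have "\<bar>fx s (- x) - fx t (- y)\<bar> < e" if "\<bar>s - t\<bar> < d" "\<bar>x - y\<bar> < d" for s t x y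
      using d(2)[of s t "- x" "- y"] that by linarith
    with d(1) show ?thesis by blast
  qed
  show "((\<lambda>x. - f t (- x)) has_real_derivative fx t (- x)) (at x)" for t x
    using DERIV_minus[OF DERIV_chain'[OF DERIV_minus[OF DERIV_ident] deriv[of t "- x"]]] by simp
qed (use bound fx_bound L_pos in auto)

text \<open>Picard iteration, contracting on all of \<open>\<real>\<close> at once in the norm \<open>sup\<^sub>t \<bar>\<phi> t\<bar> exp (- 2 L \<bar>t - t0\<bar>)\<close>.\<close>

lemma solution_exists: "\<exists>u. lifted_solution f u \<and> u t0 = v"
proof -
  \<comment> \<open>Candidates have the form \<open>v + E t * \<phi> t\<close> with
    \<open>\<phi>\<close> bounded; the factor \<open>E\<close> absorbs their growth.\<close>
  define E where "E t = exp (2 * L * \<bar>t - t0\<bar>)" for t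
  have E: "0 < E t" "continuous_on UNIV E" for t
    unfolding E_def by (auto intro!: continuous_intros)
  have "\<exists>p. (\<forall>t. (p has_real_derivative f t (v + E t * apply_bcontfun \<phi> t)) (at t)) \<and> p t0 = 0"
    for \<phi> :: "real \<Rightarrow>\<^sub>C real"
  proof -
    have "continuous_on UNIV (\<lambda>t. f t (v + E t * apply_bcontfun \<phi> t))"
      by (intro continuous_along continuous_intros E) auto
    then obtain p where p: "\<And>t. (p has_real_derivative f t (v + E t * apply_bcontfun \<phi> t)) (at t)"
      using antiderivative_exists by blast
    then have "((\<lambda>t. p t - p t0) has_real_derivative f t (v + E t * apply_bcontfun \<phi> t)) (at t)" for t
      by (auto intro!: derivative_eq_intros)
    then show ?thesis by (intro exI[of _ "\<lambda>t. p t - p t0"]) auto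
  qed
  then obtain p where p: "\<And>\<phi> t. (p \<phi> has_real_derivative f t (v + E t * apply_bcontfun \<phi> t)) (at t)"
    and p0: "\<And>\<phi>. p \<phi> t0 = 0" by metis
  define \<Phi> where "\<Phi> \<phi> = Bcontfun (\<lambda>t. p \<phi> t / E t)" for \<phi>
  have \<Phi>: "apply_bcontfun (\<Phi> \<phi>) = (\<lambda>t. p \<phi> t / E t)" for \<phi>
    unfolding \<Phi>_def
  proof (rule Bcontfun_inverse, rule bcontfun_normI)
    show "continuous_on UNIV (\<lambda>t. p \<phi> t / E t)"
      using E by (intro continuous_intros continuous_at_imp_continuous_on ballI DERIV_isCont[OF p])
        (auto simp: continuous_on_eq_continuous_at less_imp_neq[symmetric])
    fix t
    have "\<bar>p \<phi> t - p \<phi> t0\<bar> \<le> L * \<bar>t - t0\<bar>"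
      by (rule abs_diff_le_of_deriv_bound[OF p bound])
    also have "\<dots> \<le> 2 * L * \<bar>t - t0\<bar>" using L_pos by simp
    also have "\<dots> \<le> E t" unfolding E_def
      using exp_ge_add_one_self[of "2 * L * \<bar>t - t0\<bar>"] by linarith
    finally show "norm (p \<phi> t / E t) \<le> 1" using E(1)[of t] p0 by (simp add: abs_divide)
  qed
  \<comment> \<open>The Lipschitz constant \<open>L\<close> against the growth rate
    \<open>2 * L\<close> of \<open>E\<close> leaves the factor 1/2.\<close>
  have contr: "dist (\<Phi> \<phi>) (\<Phi> \<psi>) \<le> 1 / 2 * dist \<phi> \<psi>" for \<phi> \<psi>
  proof (rule dist_bound)
    fix t
    let ?D = "dist \<phi> \<psi>"
    let ?q' = "\<lambda>s. f s (v + E s * apply_bcontfun \<phi> s) - f s (v + E s * apply_bcontfun \<psi> s)"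
    have der: "((\<lambda>s. p \<phi> s - p \<psi> s) has_real_derivative ?q' s) (at s)" for s
      by (intro DERIV_diff p)
    have le: "\<bar>?q' s\<bar> \<le> L * ?D * E s" for s
    proof -
      have "\<bar>?q' s\<bar> \<le> L * \<bar>E s * (apply_bcontfun \<phi> s - apply_bcontfun \<psi> s)\<bar>"
        using lipschitz[of s "v + E s * apply_bcontfun \<phi> s" "v + E s * apply_bcontfun \<psi> s"]
        by (simp add: right_diff_distrib)
      also have "\<dots> = L * (E s * dist (apply_bcontfun \<phi> s) (apply_bcontfun \<psi> s))"
        using E(1)[of s] by (simp add: abs_mult dist_real_def)
      also have "\<dots> \<le> L * (E s * ?D)"
        using E(1)[of s] L_pos dist_bounded[of \<phi> s \<psi>] by (intro mult_left_mono) auto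
      finally show ?thesis by (simp add: algebra_simps)
    qed
    have "\<bar>p \<phi> t - p \<psi> t\<bar> \<le> ?D / 2 * E t"
    proof (cases "t0 \<le> t")
      case True
      let ?g = "\<lambda>s. ?D / 2 * exp (2 * L * (s - t0))"
      have "\<bar>(p \<phi> t - p \<psi> t) - (p \<phi> t0 - p \<psi> t0)\<bar> \<le> ?g t - ?g t0"
      proof (rule abs_diff_le_of_deriv_le[OF True der])
        fix s assume s: "t0 \<le> s" "s \<le> t"
        show "(?g has_real_derivative L * ?D * E s) (at s)"
          by (rule derivative_eq_intros refl | use s in \<open>simp add: E_def algebra_simps\<close>)+
      qed (rule le)
      moreover have "?g t - ?g t0 = ?D / 2 * E t - ?D / 2" using True by (simp add: E_def)
      ultimately show ?thesis using p0[of \<phi>] p0[of \<psi>] zero_le_dist[of \<phi> \<psi>] by linarith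
    next
      case False
      let ?g = "\<lambda>s. - (?D / 2 * exp (2 * L * (t0 - s)))"
      have "t \<le> t0" using False by simp
      then have "\<bar>(p \<phi> t0 - p \<psi> t0) - (p \<phi> t - p \<psi> t)\<bar> \<le> ?g t0 - ?g t"
      proof (rule abs_diff_le_of_deriv_le[OF _ der])
        fix s assume s: "t \<le> s" "s \<le> t0"
        show "(?g has_real_derivative L * ?D * E s) (at s)"
          by (rule derivative_eq_intros refl | use s in \<open>simp add: E_def algebra_simps\<close>)+
      qed (rule le)
      moreover have "?g t0 - ?g t = ?D / 2 * E t - ?D / 2" using False by (simp add: E_def)
      ultimately show ?thesis using p0[of \<phi>] p0[of \<psi>] zero_le_dist[of \<phi> \<psi>] by linarith
    qed
    then show "dist (apply_bcontfun (\<Phi> \<phi>) t) (apply_bcontfun (\<Phi> \<psi>) t) \<le> 1 / 2 * ?D"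
      using E(1)[of t] by (simp add: \<Phi> dist_real_def field_simps flip: diff_divide_distrib)
  qed
  obtain \<phi> where fixp: "\<Phi> \<phi> = \<phi>"
    using banach_fix_type[of "1/2" \<Phi>] contr by auto
  have "E t * apply_bcontfun \<phi> t = p \<phi> t" for t
    using \<Phi>[of \<phi>] E(1)[of t] by (simp add: fixp)
  then have "((\<lambda>t. v + p \<phi> t) has_real_derivative f t (v + p \<phi> t)) (at t)" for t
    using p[of \<phi> t] by (auto intro!: derivative_eq_intros)
  then show ?thesis
    by (intro exI[of _ "\<lambda>t. v + p \<phi> t"]) (simp add: lifted_solution_def p0)
qed

text \<open>The quantity \<open>(y t - u t)\<^sup>2 + \<epsilon>\<^sup>2\<close> is differentiable
  and satisfies the hypothesis of \<open>growth_bound\<close>: in the rate \<open>2 * L + 1\<close>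
  the summand 1 absorbs the mixed term
  \<open>2 * \<bar>y t - u t\<bar> * \<epsilon>\<close>.\<close>

lemma approx_gap:
  assumes "approx_solution f \<epsilon> y" "lifted_solution f u"
  shows "(y t - u t)\<^sup>2 \<le> ((y s - u s)\<^sup>2 + \<epsilon>\<^sup>2) * exp ((2 * L + 1) * \<bar>t - s\<bar>)"
proof -
  obtain e where e: "\<And>t. \<bar>e t\<bar> \<le> \<epsilon>" and y: "\<And>t. (y has_real_derivative f t (y t) + e t) (at t)"
    using assms(1) unfolding approx_solution_def by metis
  have u: "\<And>t. (u has_real_derivative f t (u t)) (at t)"
    using assms(2) by (simp add: lifted_solution_def)
  let ?p = "\<lambda>t. (y t - u t)\<^sup>2 + \<epsilon>\<^sup>2"
  let ?p' = "\<lambda>t. 2 * (y t - u t) * (f t (y t) - f t (u t) + e t)"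
  have "?p t \<le> ?p s * exp ((2 * L + 1) * \<bar>t - s\<bar>)"
  proof (rule growth_bound)
    fix t
    show "(?p has_real_derivative ?p' t) (at t)"
      by (rule derivative_eq_intros y u refl | simp add: algebra_simps)+
    have "\<bar>f t (y t) - f t (u t) + e t\<bar> \<le> L * \<bar>y t - u t\<bar> + \<epsilon>"
      using lipschitz[of t "y t" "u t"] e[of t] by linarith
    then have "2 * \<bar>y t - u t\<bar> * \<bar>f t (y t) - f t (u t) + e t\<bar> \<le> 2 * \<bar>y t - u t\<bar> * (L * \<bar>y t - u t\<bar> + \<epsilon>)"
      by (intro mult_left_mono) auto
    then have "\<bar>?p' t\<bar> \<le> 2 * \<bar>y t - u t\<bar> * (L * \<bar>y t - u t\<bar> + \<epsilon>)"
      by (simp only: abs_mult abs_numeral)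
    also have "\<dots> = 2 * L * (y t - u t)\<^sup>2 + 2 * \<bar>y t - u t\<bar> * \<epsilon>"
      by (simp add: algebra_simps power2_eq_square flip: abs_mult)
    also have "2 * \<bar>y t - u t\<bar> * \<epsilon> \<le> (y t - u t)\<^sup>2 + \<epsilon>\<^sup>2"
      using sum_squares_bound[of "\<bar>y t - u t\<bar>" \<epsilon>] by simp
    also have "2 * L * (y t - u t)\<^sup>2 + \<dots> \<le> (2 * L + 1) * ?p t"
      using L_pos by (simp add: algebra_simps)
    finally show "\<bar>?p' t\<bar> \<le> (2 * L + 1) * ?p t" by simp
  qed
  then show ?thesis by (smt (verit) zero_le_power2)
qed

lemma solution_gap:
  assumes "lifted_solution f u" "lifted_solution f v"
  shows "\<bar>u t - v t\<bar> \<le> \<bar>u s - v s\<bar> * exp ((2 * L + 1) * \<bar>t - s\<bar>)"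
proof -
  define E where "E = exp ((2 * L + 1) * \<bar>t - s\<bar>)"
  have E: "1 \<le> E" using L_pos by (simp add: E_def)
  have "(u t - v t)\<^sup>2 \<le> (u s - v s)\<^sup>2 * E"
    using approx_gap[OF approx_solution_of_solution[OF assms(1)] assms(2), of 0 t s] by (simp add: E_def)
  \<comment> \<open>Replacing \<open>E\<close> by \<open>E * E\<close> doubles the exponent but
    makes the right side a perfect square.\<close>
  also have "\<dots> \<le> (u s - v s)\<^sup>2 * (E * E)"
    using E by (intro mult_left_mono) auto
  also have "\<dots> = (\<bar>u s - v s\<bar> * E)\<^sup>2" by (simp add: power_mult_distrib power2_eq_square)
  finally show ?thesis using E by (simp flip: abs_le_square_iff E_def add: abs_mult)
qed

lemma solution_unique:
  assumes "lifted_solution f u" "lifted_solution f v" "u s = v s"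
  shows "u = v"
  using solution_gap[OF assms(1,2), of _ s] assms(3) by (intro ext) simp

lemma solution_shift_int:
  assumes "lifted_solution f u"
  shows "lifted_solution f (\<lambda>t. u t + of_int n)"
  using assms unfolding lifted_solution_def periodic_int by (auto intro!: derivative_eq_intros)

lemma solution_lipschitz:
  assumes "lifted_solution f u"
  shows "\<bar>u t - u s\<bar> \<le> L * \<bar>t - s\<bar>"
  using assms abs_diff_le_of_deriv_bound[of u "\<lambda>t. f t (u t)" L] bound by (simp add: lifted_solution_def)

lemma solution_continuous:
  assumes "lifted_solution f u"
  shows "continuous_on UNIV u"
  using assms unfolding lifted_solution_def
  by (auto intro!: continuous_at_imp_continuous_on intro: DERIV_isCont)

lemmas coefficient_continuous = fx_continuous_along[OF solution_continuous]

lemma solution_less: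
  assumes "lifted_solution f u" "lifted_solution f v" "u s < v s"
  shows "u t < v t"
proof (rule ccontr)
  have cont: "continuous_on A (\<lambda>x. u x - v x)" for A
    using assms by (intro continuous_on_diff continuous_on_subset[OF solution_continuous subset_UNIV])
  assume "\<not> u t < v t"
  then have "\<exists>x. u x - v x = 0"
  proof (cases "s \<le> t")
    case True
    then have "\<exists>x\<ge>s. x \<le> t \<and> u x - v x = 0"
      using assms \<open>\<not> u t < v t\<close>
      by (intro IVT' cont) auto
    then show ?thesis by blast
  next
    case False
    then have "\<exists>x\<ge>t. x \<le> s \<and> u x - v x = 0"
      using assms \<open>\<not> u t < v t\<close>
      by (intro IVT2' cont) auto
    then show ?thesis by blast
  qed
  then obtain x where "u x = v x" by auto
  from solution_unique[OF assms(1,2) this] assms(3) show False by simp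
qed


section \<open>Stable solutions\<close>

text \<open>\<open>D\<close> is the derivative of \<open>Q (y - u)\<close> and should be close to
  \<open>- (y - u)\<close>. Within the radius \<open>r\<close> the nonlinear remainder spoils at
  most half of this decay; the defect \<open>e\<close> enters through \<open>q2\<close>. The
  derivative itself exists at any distance, which later gives the continuity needed for
  crossings.\<close>

definition adapted_weight :: "real set \<Rightarrow> (real \<Rightarrow> real) \<Rightarrow> real \<Rightarrow> real \<Rightarrow> real \<Rightarrow> (real \<Rightarrow> real) \<Rightarrow> bool" where
  "adapted_weight J u q1 q2 r Q \<longleftrightarrow> (\<forall>t\<in>J. q1 \<le> Q t \<and> Q t \<le> q2) \<and>
     (\<forall>t\<in>J. \<forall>y e. (y has_real_derivative f t (y t) + e) (at t) \<longrightarrow>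
        (\<exists>D. ((\<lambda>t. Q t * (y t - u t)) has_real_derivative D) (at t) \<and>
           (\<bar>y t - u t\<bar> \<le> r \<longrightarrow> \<bar>D + (y t - u t)\<bar> \<le> \<bar>y t - u t\<bar> / 2 + q2 * \<bar>e\<bar>)))"

text \<open>For a given field the constants depend on \<open>C\<close> and \<open>m\<close> only,
  not on \<open>u\<close> or \<open>J\<close>. \<open>q1\<close> and \<open>q2\<close> are the
  bounds of \<open>lyapunov_weight\<close>; within \<open>r\<close> the slope \<open>fx\<close>
  varies by less than \<open>1 / (2 * q2)\<close>, so that \<open>Q\<close> times the remainder is
  at most half the distance.\<close>

lemma stable_weight:
  assumes "0 < m"
  obtains q1 q2 r where "0 < q1" "0 < q2" "0 < r"
    "\<And>J u. lifted_solution f u \<Longrightarrow> contracting J C m (\<lambda>t. fx t (u t)) \<Longrightarrow> J \<noteq> {} \<Longrightarrow>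
       \<forall>s\<in>J. {s..} \<subseteq> J \<Longrightarrow> \<exists>Q. adapted_weight J u q1 q2 r Q"
proof -
  define q1 where "q1 = exp (- 1) / L"
  define q2 where "q2 = exp C / m"
  have q: "0 < q1" "0 < q2" using L_pos assms by (auto simp: q1_def q2_def)
  obtain d where d: "d > 0"
    "\<And>s t x y. \<bar>s - t\<bar> < d \<Longrightarrow> \<bar>x - y\<bar> < d \<Longrightarrow> \<bar>fx s x - fx t y\<bar> < 1 / (2 * q2)"
    using fx_uniform[of "1 / (2 * q2)"] q by (metis divide_pos_pos mult_pos_pos zero_less_numeral zero_less_one)
  define r where "r = d / 2"
  show thesis
  proof
    fix J u
    assume u: "lifted_solution f u" and J: "J \<noteq> {}" "\<forall>s\<in>J. {s..} \<subseteq> J"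
      and c: "contracting J C m (\<lambda>t. fx t (u t))"
    obtain Q where Q: "\<And>t. (Q has_real_derivative - 1 - fx t (u t) * Q t) (at t)"
      "\<And>t. t \<in> J \<Longrightarrow> q1 \<le> Q t" "\<And>t. t \<in> J \<Longrightarrow> Q t \<le> q2"
      using lyapunov_weight[OF c assms coefficient_continuous[OF u] fx_bound L_pos J]
      unfolding q1_def q2_def by blast
    have "\<exists>D. ((\<lambda>t. Q t * (y t - u t)) has_real_derivative D) (at t) \<and>
           (\<bar>y t - u t\<bar> \<le> r \<longrightarrow> \<bar>D + (y t - u t)\<bar> \<le> \<bar>y t - u t\<bar> / 2 + q2 * \<bar>e\<bar>)"
      if t: "t \<in> J" and y: "(y has_real_derivative f t (y t) + e) (at t)" for t y e
    proof (intro exI conjI impI)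
      let ?N = "f t (y t) - f t (u t) - fx t (u t) * (y t - u t)"
      have u': "(u has_real_derivative f t (u t)) (at t)" using u by (simp add: lifted_solution_def)
      show "((\<lambda>t. Q t * (y t - u t)) has_real_derivative - (y t - u t) + Q t * ?N + Q t * e) (at t)"
        by (rule derivative_eq_intros Q y u' refl | simp add: algebra_simps)+
      assume r: "\<bar>y t - u t\<bar> \<le> r"
      have "\<bar>?N\<bar> \<le> 1 / (2 * q2) * \<bar>y t - u t\<bar>"
      proof -
        obtain z where z: "\<bar>z - u t\<bar> \<le> \<bar>y t - u t\<bar>" "f t (y t) - f t (u t) = (y t - u t) * fx t z"
        proof -
          consider "y t < u t" | "u t < y t" | "y t = u t" by linarith
          then show thesis
          proof cases
            case 1
            then obtain z where "y t < z" "z < u t" "f t (u t) - f t (y t) = (u t - y t) * fx t z"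
              using MVT2[of "y t" "u t" "f t" "fx t"] deriv by blast
            then show thesis by (intro that[of z]) (auto simp: algebra_simps)
          next
            case 2
            then obtain z where "u t < z" "z < y t" "f t (y t) - f t (u t) = (y t - u t) * fx t z"
              using MVT2[of "u t" "y t" "f t" "fx t"] deriv by blast
            then show thesis by (intro that[of z]) (auto simp: algebra_simps)
          qed (use that[of "u t"] in auto)
        qed
        have "\<bar>fx t z - fx t (u t)\<bar> \<le> 1 / (2 * q2)"
          using d(2)[of t t z "u t"] d(1) z(1) r by (simp add: r_def)
        moreover have "\<bar>?N\<bar> = \<bar>fx t z - fx t (u t)\<bar> * \<bar>y t - u t\<bar>"
          unfolding z(2) by (simp add: algebra_simps flip: abs_mult)
        ultimately show ?thesis by (metis abs_ge_zero mult_right_mono)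
      qed
      then have "Q t * \<bar>?N\<bar> \<le> q2 * (1 / (2 * q2) * \<bar>y t - u t\<bar>)"
        using Q(2,3)[OF t] q by (intro mult_mono) auto
      then have "\<bar>Q t * ?N\<bar> \<le> \<bar>y t - u t\<bar> / 2" using Q(2)[OF t] q by (simp add: abs_mult)
      moreover have "\<bar>Q t * e\<bar> \<le> q2 * \<bar>e\<bar>"
        using Q(2,3)[OF t] q by (simp add: abs_mult mult_right_mono)
      ultimately show "\<bar>- (y t - u t) + Q t * ?N + Q t * e + (y t - u t)\<bar>
          \<le> \<bar>y t - u t\<bar> / 2 + q2 * \<bar>e\<bar>" by linarith
    qed
    then show "\<exists>Q. adapted_weight J u q1 q2 r Q"
      using Q unfolding adapted_weight_def by (intro exI[of _ Q]) auto
  qed (use q d in \<open>auto simp: r_def\<close>)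
qed

text \<open>The two edges of the tube \<open>Q t * \<bar>y t - u t\<bar> \<le> \<rho>\<close> are
  barriers. On them \<open>\<rho> \<le> q1 * r\<close> keeps \<open>y\<close> within the radius
  \<open>r\<close> of \<open>u\<close>, and \<open>2 * q2\<^sup>2 * \<epsilon> < \<rho>\<close>
  makes the defect weaker than the surviving half of the decay.\<close>

lemma weight_invariant:
  assumes Q: "adapted_weight J u q1 q2 r Q" "0 < q1" "0 < q2"
    and J: "s \<in> J" "\<forall>s\<in>J. {s..} \<subseteq> J"
    and y: "approx_solution f \<epsilon> y" and \<rho>: "\<rho> \<le> q1 * r" "2 * q2\<^sup>2 * \<epsilon> < \<rho>"
    and s: "Q s * \<bar>y s - u s\<bar> \<le> \<rho>" and t: "s \<le> t"
  shows "Q t * \<bar>y t - u t\<bar> \<le> \<rho>"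
proof -
  let ?v = "\<lambda>t. Q t * (y t - u t)"
  have "\<exists>D. (?v has_real_derivative D) (at x) \<and>
      (\<bar>y x - u x\<bar> \<le> r \<longrightarrow> \<bar>D + (y x - u x)\<bar> \<le> \<bar>y x - u x\<bar> / 2 + q2 * \<epsilon>)" if x: "x \<in> J" for x
  proof -
    obtain e where e: "\<bar>e\<bar> \<le> \<epsilon>" "(y has_real_derivative f x (y x) + e) (at x)"
      using y unfolding approx_solution_def by blast
    moreover have "q2 * \<bar>e\<bar> \<le> q2 * \<epsilon>" using e Q by simp
    ultimately show ?thesis using Q(1) x unfolding adapted_weight_def by (meson add_left_mono order_trans)
  qed
  then have "\<forall>x\<in>J. \<exists>D. (?v has_real_derivative D) (at x) \<and>
      (\<bar>y x - u x\<bar> \<le> r \<longrightarrow> \<bar>D + (y x - u x)\<bar> \<le> \<bar>y x - u x\<bar> / 2 + q2 * \<epsilon>)" by (rule ballI)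
  from bchoice[OF this] obtain D where "\<forall>x\<in>J. (?v has_real_derivative D x) (at x) \<and>
      (\<bar>y x - u x\<bar> \<le> r \<longrightarrow> \<bar>D x + (y x - u x)\<bar> \<le> \<bar>y x - u x\<bar> / 2 + q2 * \<epsilon>)" ..
  then have D: "\<And>x. x \<in> J \<Longrightarrow> (?v has_real_derivative D x) (at x)"
    and le: "\<And>x. x \<in> J \<Longrightarrow> \<bar>y x - u x\<bar> \<le> r \<Longrightarrow> \<bar>D x + (y x - u x)\<bar> \<le> \<bar>y x - u x\<bar> / 2 + q2 * \<epsilon>"
    by simp_all
  have q: "q1 \<le> Q x" "Q x \<le> q2" "0 < Q x" if "x \<in> J" for x
    using Q that unfolding adapted_weight_def by force+
  have \<epsilon>: "0 \<le> \<epsilon>" using y unfolding approx_solution_def by (metis abs_ge_zero order_trans)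
  have \<rho>_pos: "0 < \<rho>" using \<rho>(2) \<epsilon> by (smt (verit) mult_nonneg_nonneg zero_le_power2)
  have neg: "\<bar>D x + (y x - u x)\<bar> < \<bar>y x - u x\<bar>" if "x \<in> J" "\<bar>?v x\<bar> = \<rho>" for x
  proof -
    have eq: "Q x * \<bar>y x - u x\<bar> = \<rho>" using that q[of x] by (simp add: abs_mult)
    have "q1 * \<bar>y x - u x\<bar> \<le> \<rho>" using q[OF that(1)] eq by (metis abs_ge_zero mult_right_mono)
    then have "q1 * \<bar>y x - u x\<bar> \<le> q1 * r" using \<rho>(1) by linarith
    then have "\<bar>y x - u x\<bar> \<le> r" using Q by simp
    note le[OF that(1) this]
    moreover have "q2 * (2 * q2 * \<epsilon>) < q2 * \<bar>y x - u x\<bar>"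
      using mult_right_mono[OF q(2)[OF that(1)], of "\<bar>y x - u x\<bar>"] eq \<rho>(2) by (simp add: power2_eq_square)
    then have "2 * (q2 * \<epsilon>) < \<bar>y x - u x\<bar>" using Q by (simp add: mult.assoc)
    moreover have "A < B" if "A \<le> B / 2 + c" "2 * c < B" for A B c :: real using that by simp
    ultimately show ?thesis by blast
  qed
  have sgn: "0 < ?v x \<longleftrightarrow> 0 < y x - u x" if "x \<in> J" for x
    using q(3)[OF that] by (simp add: zero_less_mult_iff)
  have "?v t \<le> \<rho>"
  proof (rule barrier[OF t])
    show "?v s \<le> \<rho>"
      using s q[OF J(1)] mult_left_mono[OF abs_ge_self, of "Q s" "y s - u s"] by linarith
    fix x assume x: "s \<le> x" "x \<le> t"
    then have "x \<in> J" using J by blast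
    show "(?v has_real_derivative D x) (at x)" using D \<open>x \<in> J\<close> by blast
    show "D x < 0" if "?v x = \<rho>"
      using neg[OF \<open>x \<in> J\<close>] sgn[OF \<open>x \<in> J\<close>] that \<rho>_pos by simp
  qed
  moreover have "- ?v t \<le> \<rho>"
  proof (rule barrier[OF t])
    show "- ?v s \<le> \<rho>"
      using s q[OF J(1)] mult_left_mono[OF abs_ge_minus_self, of "Q s" "y s - u s"]
      unfolding mult_minus_right by linarith
    fix x assume x: "s \<le> x" "x \<le> t"
    then have "x \<in> J" using J by blast
    show "((\<lambda>t. - ?v t) has_real_derivative - D x) (at x)" using D \<open>x \<in> J\<close> by (intro DERIV_minus) blast
    show "- D x < 0" if "- ?v x = \<rho>"
    proof -
      have "\<bar>?v x\<bar> = \<rho>" "?v x < 0" using that \<rho>_pos by auto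
      then have "y x - u x < 0" using q(3)[OF \<open>x \<in> J\<close>] by (simp add: mult_less_0_iff)
      with neg[OF \<open>x \<in> J\<close> \<open>\<bar>?v x\<bar> = \<rho>\<close>] show ?thesis by simp
    qed
  qed
  moreover have "0 < Q t" using q(3) J t by auto
  then have "Q t * \<bar>y t - u t\<bar> = \<bar>?v t\<bar>" by (simp add: abs_mult)
  ultimately show ?thesis by linarith
qed

text \<open>Half of the decay of \<open>Q (y - u)\<close> survives the remainder, and expressing
  \<open>y - u\<close> through \<open>Q (y - u)\<close> costs the factor \<open>q2\<close>; hence
  the rate \<open>1 / (2 * q2)\<close>.\<close>

lemma weight_decay:
  assumes Q: "adapted_weight J u q1 q2 r Q" "0 < q1" "0 < q2"
    and J: "s \<in> J" "\<forall>s\<in>J. {s..} \<subseteq> J"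
    and y: "lifted_solution f y" and near: "\<And>x. s \<le> x \<Longrightarrow> x \<le> t \<Longrightarrow> \<bar>y x - u x\<bar> \<le> r" and t: "s \<le> t"
  shows "Q t * \<bar>y t - u t\<bar> \<le> Q s * \<bar>y s - u s\<bar> * exp (- (1 / (2 * q2)) * (t - s))"
proof -
  let ?v = "\<lambda>t. Q t * (y t - u t)"
  have "\<exists>D. (?v has_real_derivative D) (at x) \<and>
      (\<bar>y x - u x\<bar> \<le> r \<longrightarrow> \<bar>D + (y x - u x)\<bar> \<le> \<bar>y x - u x\<bar> / 2)" if x: "x \<in> J" for x
  proof -
    have "(y has_real_derivative f x (y x) + 0) (at x)" using y by (simp add: lifted_solution_def)
    then show ?thesis using Q(1) x unfolding adapted_weight_def by fastforce
  qed
  then have "\<forall>x\<in>J. \<exists>D. (?v has_real_derivative D) (at x) \<and>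
      (\<bar>y x - u x\<bar> \<le> r \<longrightarrow> \<bar>D + (y x - u x)\<bar> \<le> \<bar>y x - u x\<bar> / 2)" by (rule ballI)
  from bchoice[OF this] obtain D where "\<forall>x\<in>J. (?v has_real_derivative D x) (at x) \<and>
      (\<bar>y x - u x\<bar> \<le> r \<longrightarrow> \<bar>D x + (y x - u x)\<bar> \<le> \<bar>y x - u x\<bar> / 2)" ..
  then have D: "\<And>x. x \<in> J \<Longrightarrow> (?v has_real_derivative D x) (at x)"
    and le: "\<And>x. x \<in> J \<Longrightarrow> \<bar>y x - u x\<bar> \<le> r \<Longrightarrow> \<bar>D x + (y x - u x)\<bar> \<le> \<bar>y x - u x\<bar> / 2"
    by simp_all
  have q: "q1 \<le> Q x" "Q x \<le> q2" "0 < Q x" if "x \<in> J" for x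
    using Q that unfolding adapted_weight_def by force+
  have "\<bar>?v t\<bar> \<le> \<bar>?v s\<bar> * exp (- (1 / (2 * q2)) * (t - s))"
  proof (rule decay_bound[OF t])
    fix x assume x: "s \<le> x" "x \<le> t"
    then have xJ: "x \<in> J" using J by blast
    show "(?v has_real_derivative D x) (at x)" using D xJ by blast
    let ?d = "y x - u x"
    have "D x * ?d \<le> - (?d\<^sup>2 / 2)"
    proof -
      have "(D x + ?d) * ?d \<le> \<bar>D x + ?d\<bar> * \<bar>?d\<bar>" by (metis abs_ge_self abs_mult)
      also have "\<dots> \<le> \<bar>?d\<bar> / 2 * \<bar>?d\<bar>" using le[OF xJ near[OF x]] by (intro mult_right_mono) auto
      also have "\<bar>?d\<bar> / 2 * \<bar>?d\<bar> = ?d\<^sup>2 / 2" by (simp add: power2_eq_square flip: abs_mult)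
      finally show ?thesis by (simp only: distrib_right power2_eq_square)
    qed
    then have "Q x * (D x * ?d) \<le> Q x * - (?d\<^sup>2 / 2)" using q(3)[OF xJ] by (intro mult_left_mono) auto
    also have "\<dots> \<le> - (1 / (2 * q2)) * (?v x)\<^sup>2"
    proof -
      have "Q x * Q x * ?d\<^sup>2 \<le> q2 * Q x * ?d\<^sup>2"
        using q[OF xJ] by (intro mult_right_mono) auto
      then show ?thesis using Q(3) by (simp add: field_simps power2_eq_square)
    qed
    finally show "D x * ?v x \<le> - (1 / (2 * q2)) * (?v x)\<^sup>2" by (simp add: algebra_simps)
  qed
  moreover have "0 < Q s" "0 < Q t" using q(3) J t by auto
  ultimately show ?thesis by (simp only: abs_mult abs_of_pos)
qed

text \<open>One pair of constants serves all upward closed \<open>J\<close>, so the lemma applies to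
  half lines and to the whole line, with any starting time in them.\<close>

lemma stable_nearby:
  assumes "0 < m" "0 < \<eta>"
  shows "\<exists>d>0. \<exists>\<epsilon>>0. \<forall>J u y s t. lifted_solution f u \<longrightarrow> contracting J C m (\<lambda>t. fx t (u t)) \<longrightarrow>
    s \<in> J \<longrightarrow> (\<forall>s\<in>J. {s..} \<subseteq> J) \<longrightarrow> approx_solution f \<epsilon> y \<longrightarrow> \<bar>y s - u s\<bar> \<le> d \<longrightarrow> s \<le> t \<longrightarrow>
    \<bar>y t - u t\<bar> \<le> \<eta>"
proof -
  obtain q1 q2 r where q: "0 < q1" "0 < q2" "0 < r" and
    Q: "\<And>J u. lifted_solution f u \<Longrightarrow> contracting J C m (\<lambda>t. fx t (u t)) \<Longrightarrow> J \<noteq> {} \<Longrightarrow>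
       \<forall>s\<in>J. {s..} \<subseteq> J \<Longrightarrow> \<exists>Q. adapted_weight J u q1 q2 r Q"
    using stable_weight[OF assms(1), of C] by blast
  define \<rho> where "\<rho> = q1 * min r \<eta>"
  have \<rho>: "0 < \<rho>" "\<rho> \<le> q1 * r" "\<rho> \<le> q1 * \<eta>" using q assms by (auto simp: \<rho>_def)
  \<comment> \<open>The factor 4 gives \<open>2 * q2\<^sup>2 * \<epsilon> = \<rho> / 2\<close>,
    strictly below \<open>\<rho>\<close>.\<close>
  define \<epsilon> where "\<epsilon> = \<rho> / (4 * q2\<^sup>2)"
  have \<epsilon>: "0 < \<epsilon>" "2 * q2\<^sup>2 * \<epsilon> < \<rho>" using \<rho> q by (auto simp: \<epsilon>_def)
  have "\<bar>y t - u t\<bar> \<le> \<eta>"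
    if h: "lifted_solution f u" "contracting J C m (\<lambda>t. fx t (u t))" "s \<in> J" "\<forall>s\<in>J. {s..} \<subseteq> J"
      "approx_solution f \<epsilon> y" "\<bar>y s - u s\<bar> \<le> \<rho> / q2" "s \<le> t" for J u y s t
  proof -
    obtain W where W: "adapted_weight J u q1 q2 r W" using Q[of u J] h by fastforce
    then have WJ: "q1 \<le> W x" "W x \<le> q2" if "x \<in> J" for x using that by (auto simp: adapted_weight_def)
    have "W s * \<bar>y s - u s\<bar> \<le> q2 * (\<rho> / q2)" using WJ[OF h(3)] h(6) q by (intro mult_mono) auto
    then have "W s * \<bar>y s - u s\<bar> \<le> \<rho>" using q by simp
    then have "W t * \<bar>y t - u t\<bar> \<le> \<rho>"
      using weight_invariant[OF W q(1,2) h(3) h(4,5) \<rho>(2) \<epsilon>(2)] h(7) by blast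
    moreover have "q1 * \<bar>y t - u t\<bar> \<le> W t * \<bar>y t - u t\<bar>"
      using WJ[of t] h(3,4,7) by (intro mult_right_mono) auto
    ultimately have "q1 * \<bar>y t - u t\<bar> \<le> q1 * \<eta>" using \<rho>(3) by linarith
    then show ?thesis using q by simp
  qed
  moreover have "0 < \<rho> / q2" using \<rho> q by simp
  ultimately show ?thesis using \<epsilon>(1) by blast
qed

text \<open>The initial distance is absorbed into \<open>K\<close> through its bound
  \<open>d\<close>. This form is enough for convergence in the future and for isolation in the
  past.\<close>

lemma stable_decay:
  assumes "0 < m"
  shows "\<exists>d>0. \<exists>K>0. \<exists>k>0. \<forall>J u y s t. lifted_solution f u \<longrightarrow> contracting J C m (\<lambda>t. fx t (u t)) \<longrightarrow>
    s \<in> J \<longrightarrow> (\<forall>s\<in>J. {s..} \<subseteq> J) \<longrightarrow> lifted_solution f y \<longrightarrow> \<bar>y s - u s\<bar> \<le> d \<longrightarrow> s \<le> t \<longrightarrow>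
    \<bar>y t - u t\<bar> \<le> K * exp (- k * (t - s))"
proof -
  obtain q1 q2 r where q: "0 < q1" "0 < q2" "0 < r" and
    Q: "\<And>J u. lifted_solution f u \<Longrightarrow> contracting J C m (\<lambda>t. fx t (u t)) \<Longrightarrow> J \<noteq> {} \<Longrightarrow>
       \<forall>s\<in>J. {s..} \<subseteq> J \<Longrightarrow> \<exists>Q. adapted_weight J u q1 q2 r Q"
    using stable_weight[OF assms(1), of C] by blast
  obtain d where d: "0 < d" "\<And>J u y s t. lifted_solution f u \<Longrightarrow> contracting J C m (\<lambda>t. fx t (u t)) \<Longrightarrow>
    s \<in> J \<Longrightarrow> (\<forall>s\<in>J. {s..} \<subseteq> J) \<Longrightarrow> lifted_solution f y \<Longrightarrow> \<bar>y s - u s\<bar> \<le> d \<Longrightarrow> s \<le> t \<Longrightarrow>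
    \<bar>y t - u t\<bar> \<le> r"
  proof -
    obtain d \<epsilon> where d: "0 < d" "0 < \<epsilon>" and *: "\<forall>J u y s t. lifted_solution f u \<longrightarrow>
      contracting J C m (\<lambda>t. fx t (u t)) \<longrightarrow> s \<in> J \<longrightarrow> (\<forall>s\<in>J. {s..} \<subseteq> J) \<longrightarrow>
      approx_solution f \<epsilon> y \<longrightarrow> \<bar>y s - u s\<bar> \<le> d \<longrightarrow> s \<le> t \<longrightarrow> \<bar>y t - u t\<bar> \<le> r"
      using stable_nearby[OF assms q(3), of C] by blast
    show thesis
      by (rule that[OF d(1)]) (use * approx_solution_of_solution[of f _ \<epsilon>] d(2) in \<open>simp add: less_imp_le\<close>)
  qed
  have "\<bar>y t - u t\<bar> \<le> q2 * d / q1 * exp (- (1 / (2 * q2)) * (t - s))"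
    if h: "lifted_solution f u" "contracting J C m (\<lambda>t. fx t (u t))" "s \<in> J" "\<forall>s\<in>J. {s..} \<subseteq> J"
      "lifted_solution f y" "\<bar>y s - u s\<bar> \<le> d" "s \<le> t" for J u y s t
  proof -
    obtain W where W: "adapted_weight J u q1 q2 r W" using Q[of u J] h by fastforce
    then have WJ: "q1 \<le> W x" "W x \<le> q2" if "x \<in> J" for x using that by (auto simp: adapted_weight_def)
    have "q1 * \<bar>y t - u t\<bar> \<le> W t * \<bar>y t - u t\<bar>"
      using WJ[of t] h(3,4,7) by (intro mult_right_mono) auto
    also have "\<dots> \<le> W s * \<bar>y s - u s\<bar> * exp (- (1 / (2 * q2)) * (t - s))"
      by (rule weight_decay[OF W q(1,2) h(3) h(4,5) d(2)[OF h(1-6)] h(7)]) auto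
    also have "\<dots> \<le> q2 * d * exp (- (1 / (2 * q2)) * (t - s))"
      using WJ[OF h(3)] h(6) q d(1) by (intro mult_mono mult_right_mono) auto
    finally show ?thesis using q by (simp add: field_simps)
  qed
  note bound = this
  have k: "0 < q2 * d / q1" "0 < 1 / (2 * q2)" using q d by auto
  show ?thesis
    by (rule exI[of _ d], rule conjI, rule d(1), rule exI[of _ "q2 * d / q1"], rule conjI, rule k(1),
      rule exI[of _ "1 / (2 * q2)"], rule conjI, rule k(2), intro allI impI, rule bound)
qed


text \<open>Decay read backwards: closeness at an early time \<open>s\<close> bounds the distance at
  0 by \<open>K * exp (k * s)\<close>, so a different solution has to leave the neighborhood in the
  far past.\<close>

lemma stable_isolated:
  assumes "0 < m"
  shows "\<exists>d>0. \<forall>u y. lifted_solution f u \<longrightarrow> contracting UNIV C m (\<lambda>t. fx t (u t)) \<longrightarrow>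
    lifted_solution f y \<longrightarrow> (\<forall>T. \<exists>t\<le>T. \<bar>y t - u t\<bar> \<le> d) \<longrightarrow> y = u"
proof -
  obtain d K k where d: "0 < d" "0 < K" "0 < k" and decay: "\<forall>J u y s t. lifted_solution f u \<longrightarrow>
    contracting J C m (\<lambda>t. fx t (u t)) \<longrightarrow> s \<in> J \<longrightarrow> (\<forall>s\<in>J. {s..} \<subseteq> J) \<longrightarrow> lifted_solution f y \<longrightarrow>
    \<bar>y s - u s\<bar> \<le> d \<longrightarrow> s \<le> t \<longrightarrow> \<bar>y t - u t\<bar> \<le> K * exp (- k * (t - s))"
    using stable_decay[OF assms, of C] by blast
  have "y = u" if h: "lifted_solution f u" "contracting UNIV C m (\<lambda>t. fx t (u t))"
    "lifted_solution f y" and near: "\<forall>T. \<exists>t\<le>T. \<bar>y t - u t\<bar> \<le> d" for u y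
  proof (rule ccontr)
    assume "y \<noteq> u"
    then have pos: "0 < \<bar>y 0 - u 0\<bar>" using solution_unique[OF h(3,1), of 0] by auto
    \<comment> \<open>Chosen so that \<open>K / (k * - T)\<close> is the distance at 0;
      \<open>x < exp x\<close> then yields the strict inequality.\<close>
    define T where "T = - (K / (k * \<bar>y 0 - u 0\<bar>))"
    have "T < 0" using pos d by (simp add: T_def)
    obtain s where s: "s \<le> T" "\<bar>y s - u s\<bar> \<le> d" using near by blast
    have "\<bar>y 0 - u 0\<bar> \<le> K * exp (- k * (0 - s))"
      by (rule decay[rule_format, OF h(1,2) UNIV_I _ h(3) s(2)]) (use s \<open>T < 0\<close> in auto)
    also have "\<dots> \<le> K * exp (- (k * - T))"
      using s d by (auto intro!: mult_left_mono)
    also have "\<dots> = K / exp (k * - T)" by (simp only: exp_minus divide_inverse)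
    also have "\<dots> < K / (k * - T)"
    proof (rule divide_strict_left_mono)
      show "k * - T < exp (k * - T)" using exp_ge_add_one_self[of "k * - T"] by linarith
      show "0 < exp (k * - T) * (k * - T)"
        using d \<open>T < 0\<close> by (simp add: mult_pos_neg)
    qed (rule d)
    also have "\<dots> = \<bar>y 0 - u 0\<bar>" using d pos by (simp add: T_def)
    finally show False by simp
  qed
  with d(1) show ?thesis by blast
qed

lemma stable_attracts:
  assumes "0 < m"
  shows "\<exists>d>0. \<forall>J u y s. lifted_solution f u \<longrightarrow> contracting J C m (\<lambda>t. fx t (u t)) \<longrightarrow>
    s \<in> J \<longrightarrow> (\<forall>s\<in>J. {s..} \<subseteq> J) \<longrightarrow> lifted_solution f y \<longrightarrow> \<bar>y s - u s\<bar> \<le> d \<longrightarrow>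
    ((\<lambda>t. y t - u t) \<longlongrightarrow> 0) at_top"
proof -
  obtain d K k where d: "0 < d" "0 < K" "0 < k" and decay: "\<forall>J u y s t. lifted_solution f u \<longrightarrow>
    contracting J C m (\<lambda>t. fx t (u t)) \<longrightarrow> s \<in> J \<longrightarrow> (\<forall>s\<in>J. {s..} \<subseteq> J) \<longrightarrow> lifted_solution f y \<longrightarrow>
    \<bar>y s - u s\<bar> \<le> d \<longrightarrow> s \<le> t \<longrightarrow> \<bar>y t - u t\<bar> \<le> K * exp (- k * (t - s))"
    using stable_decay[OF assms, of C] by blast
  have "((\<lambda>t. y t - u t) \<longlongrightarrow> 0) at_top"
    if h: "lifted_solution f u" "contracting J C m (\<lambda>t. fx t (u t))" "s \<in> J" "\<forall>s\<in>J. {s..} \<subseteq> J"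
      "lifted_solution f y" "\<bar>y s - u s\<bar> \<le> d" for J u y s
  proof (rule Lim_null_comparison)
    show "\<forall>\<^sub>F t in at_top. norm (y t - u t) \<le> K * exp (- k * (t - s))"
      using decay h by (intro eventually_at_top_linorderI[of s]) (auto simp del: mult_minus_left)
    have "filterlim (\<lambda>t. - s + t) at_top at_top"
      by (rule filterlim_tendsto_add_at_top[OF tendsto_const filterlim_ident])
    then have "filterlim (\<lambda>t. - k * (- s + t)) at_bot at_top"
      using d by (intro filterlim_tendsto_neg_mult_at_bot[OF tendsto_const]) auto
    then have "((\<lambda>t. exp (- k * (- s + t))) \<longlongrightarrow> 0) at_top"
      by (rule filterlim_compose[OF exp_at_bot])
    then show "((\<lambda>t. K * exp (- k * (t - s))) \<longlongrightarrow> 0) at_top"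
      using tendsto_mult_right_zero[of _ _ K] by (simp add: add.commute)
  qed
  with d(1) show ?thesis by blast
qed

end

lemma expanding_reversed_coefficient:
  "expanding J C m (\<lambda>t. fx t (w t)) \<longleftrightarrow> contracting (uminus ` J) C m (\<lambda>t. - fx (- t) (w (- t)))"
  by (rule expanding_iff_reversed)

context periodic_field
begin

lemma unstable_isolated:
  assumes "0 < m"
  shows "\<exists>d>0. \<forall>w y. lifted_solution f w \<longrightarrow> expanding UNIV C m (\<lambda>t. fx t (w t)) \<longrightarrow>
    lifted_solution f y \<longrightarrow> (\<forall>T. \<exists>t\<ge>T. \<bar>y t - w t\<bar> \<le> d) \<longrightarrow> y = w"
proof -
  interpret rev: periodic_field "\<lambda>t x. - f (- t) x" "\<lambda>t x. - fx (- t) x" L by (rule reversed)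
  obtain d where d: "0 < d" and *: "\<forall>u y. lifted_solution (\<lambda>t x. - f (- t) x) u \<longrightarrow>
    contracting UNIV C m (\<lambda>t. - fx (- t) (u t)) \<longrightarrow> lifted_solution (\<lambda>t x. - f (- t) x) y \<longrightarrow>
    (\<forall>T. \<exists>t\<le>T. \<bar>y t - u t\<bar> \<le> d) \<longrightarrow> y = u" using rev.stable_isolated[OF assms, of C] by blast
  have "y = w" if h: "lifted_solution f w" "expanding UNIV C m (\<lambda>t. fx t (w t))"
    "lifted_solution f y" and near: "\<forall>T. \<exists>t\<ge>T. \<bar>y t - w t\<bar> \<le> d" for w y
  proof -
    have "\<exists>t\<le>T. \<bar>y (- t) - w (- t)\<bar> \<le> d" for T
    proof -
      obtain t where "t \<ge> - T" "\<bar>y t - w t\<bar> \<le> d" using near by blast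
      then show ?thesis by (intro exI[of _ "- t"]) auto
    qed
    then have "(\<lambda>t. y (- t)) = (\<lambda>t. w (- t))"
      using h by (intro *[rule_format]) (auto simp: reversed_solution_iff expanding_reversed_coefficient)
    then show ?thesis by (metis ext minus_minus)
  qed
  with d show ?thesis by blast
qed

text \<open>Under time reversal upward closed sets become downward closed: near an unstable solution
  it is the past that stays close.\<close>

lemma unstable_nearby:
  assumes "0 < m" "0 < \<eta>"
  shows "\<exists>d>0. \<forall>J w y s t. lifted_solution f w \<longrightarrow> expanding J C m (\<lambda>t. fx t (w t)) \<longrightarrow>
    s \<in> J \<longrightarrow> (\<forall>s\<in>J. {..s} \<subseteq> J) \<longrightarrow> lifted_solution f y \<longrightarrow> \<bar>y s - w s\<bar> \<le> d \<longrightarrow> t \<le> s \<longrightarrow>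
    \<bar>y t - w t\<bar> \<le> \<eta>"
proof -
  interpret rev: periodic_field "\<lambda>t x. - f (- t) x" "\<lambda>t x. - fx (- t) x" L by (rule reversed)
  obtain d \<epsilon> where d: "0 < d" "0 < \<epsilon>" and *: "\<forall>J u y s t. lifted_solution (\<lambda>t x. - f (- t) x) u \<longrightarrow>
    contracting J C m (\<lambda>t. - fx (- t) (u t)) \<longrightarrow> s \<in> J \<longrightarrow> (\<forall>s\<in>J. {s..} \<subseteq> J) \<longrightarrow>
    approx_solution (\<lambda>t x. - f (- t) x) \<epsilon> y \<longrightarrow> \<bar>y s - u s\<bar> \<le> d \<longrightarrow> s \<le> t \<longrightarrow> \<bar>y t - u t\<bar> \<le> \<eta>"
    using rev.stable_nearby[OF assms, of C] by blast
  have "\<bar>y t - w t\<bar> \<le> \<eta>" if h: "lifted_solution f w" "expanding J C m (\<lambda>t. fx t (w t))" "s \<in> J"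
    "\<forall>s\<in>J. {..s} \<subseteq> J" "lifted_solution f y" "\<bar>y s - w s\<bar> \<le> d" "t \<le> s" for J w y s t
  proof -
    have up: "\<forall>s\<in>uminus ` J. {s..} \<subseteq> uminus ` J"
    proof safe
      fix s t assume "s \<in> J" "- s \<le> t"
      moreover from this have "{..s} \<subseteq> J" using h(4) by blast
      ultimately have "- t \<in> J" by auto
      then show "t \<in> uminus ` J" by (metis image_eqI minus_minus)
    qed
    have "approx_solution (\<lambda>t x. - f (- t) x) \<epsilon> (\<lambda>t. y (- t))"
      using h(5) d by (intro approx_solution_of_solution) (auto simp: reversed_solution_iff)
    then have "\<bar>y (- (- t)) - w (- (- t))\<bar> \<le> \<eta>"
      using h up by (intro *[rule_format, of "\<lambda>t. w (- t)" "uminus ` J" "- s"])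
        (auto simp: reversed_solution_iff expanding_reversed_coefficient)
    then show ?thesis by simp
  qed
  with d(1) show ?thesis by blast
qed

text \<open>If a solution contracting on all of \<open>\<real>\<close> came close to an expanding one, it would have stayed close
  to it in the whole past, where both dichotomies would hold at once.\<close>

lemma stable_unstable_separated:
  assumes "0 < m" "0 < m'"
  shows "\<exists>d>0. \<forall>s w t. lifted_solution f s \<longrightarrow> contracting UNIV C m (\<lambda>t. fx t (s t)) \<longrightarrow>
    lifted_solution f w \<longrightarrow> expanding UNIV C' m' (\<lambda>t. fx t (w t)) \<longrightarrow> d < \<bar>s t - w t\<bar>"
proof -
  obtain \<delta> where \<delta>: "\<delta> > 0"
    "\<And>s t x y. \<bar>s - t\<bar> < \<delta> \<Longrightarrow> \<bar>x - y\<bar> < \<delta> \<Longrightarrow> \<bar>fx s x - fx t y\<bar> < m / 2"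
    using fx_uniform[of "m / 2"] assms by auto
  have "0 < \<delta> / 2" using \<delta> by simp
  obtain d where d: "0 < d" and near: "\<forall>J w y s t. lifted_solution f w \<longrightarrow>
    expanding J C' m' (\<lambda>t. fx t (w t)) \<longrightarrow> s \<in> J \<longrightarrow> (\<forall>s\<in>J. {..s} \<subseteq> J) \<longrightarrow> lifted_solution f y \<longrightarrow>
    \<bar>y s - w s\<bar> \<le> d \<longrightarrow> t \<le> s \<longrightarrow> \<bar>y t - w t\<bar> \<le> \<delta> / 2"
    using unstable_nearby[OF assms(2) \<open>0 < \<delta> / 2\<close>, of C'] by blast
  have "d < \<bar>s t - w t\<bar>" if h: "lifted_solution f s" "contracting UNIV C m (\<lambda>t. fx t (s t))"
    "lifted_solution f w" "expanding UNIV C' m' (\<lambda>t. fx t (w t))" for s w t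
  proof (rule ccontr)
    assume "\<not> d < \<bar>s t - w t\<bar>"
    then have "\<bar>s x - w x\<bar> < \<delta>" if "x \<le> t" for x
      using near[rule_format, OF h(3,4), of t s x] h that \<delta>(1) by simp
    then have close: "\<bar>fx x (w x) - fx x (s x)\<bar> \<le> m / 2" if "x \<in> {..t}" for x
      using \<delta>(2)[of x x "w x" "s x"] \<delta>(1) that by (auto simp: abs_minus_commute less_imp_le)
    have "contracting {..t} C (m - m / 2) (\<lambda>t. fx t (w t))"
      by (rule contracting_near[OF contracting_mono[OF h(2) order_refl order_refl subset_UNIV]
          coefficient_continuous[OF h(1)] coefficient_continuous[OF h(3)] _ close]) auto
    moreover have "expanding {..t} C' m' (\<lambda>t. fx t (w t))"
      by (rule expanding_mono[OF h(4) order_refl order_refl subset_UNIV])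
    moreover have "\<exists>a\<in>{..t}. \<exists>b\<in>{..t}. a + d \<le> b" for d
      by (rule bexI[of _ "t - max d 0"], rule bexI[of _ t]) auto
    ultimately show False
      using not_contracting_expanding[of "{..t}" C "m - m / 2" "\<lambda>t. fx t (w t)" C' m'] assms by simp
  qed
  with d show ?thesis by blast
qed


section \<open>Almost periods, limits of translates and shadowing\<close>

text \<open>Closeness of the field together with its slope: the bound on \<open>f\<close> makes a
  translate an approximate solution, the bound on \<open>fx\<close> carries its dichotomy
  over.\<close>

definition almost_period :: "real \<Rightarrow> real \<Rightarrow> bool" where
  "almost_period \<epsilon> l \<longleftrightarrow> (\<forall>t x. \<bar>f (t + l) x - f t x\<bar> \<le> \<epsilon> \<and> \<bar>fx (t + l) x - fx t x\<bar> \<le> \<epsilon>)"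

lemma almost_period_minus:
  assumes "almost_period \<epsilon> l"
  shows "almost_period \<epsilon> (- l)"
  unfolding almost_period_def
proof (intro allI)
  fix t x
  show "\<bar>f (t + - l) x - f t x\<bar> \<le> \<epsilon> \<and> \<bar>fx (t + - l) x - fx t x\<bar> \<le> \<epsilon>"
    using assms[unfolded almost_period_def, rule_format, of "t - l" x]
    by (simp add: abs_minus_commute)
qed

lemma almost_period_mono: "almost_period \<epsilon> l \<Longrightarrow> \<epsilon> \<le> \<epsilon>' \<Longrightarrow> almost_period \<epsilon>' l"
  unfolding almost_period_def by (meson order_trans)

lemma almost_period_0: "0 \<le> \<epsilon> \<Longrightarrow> almost_period \<epsilon> 0"
  by (simp add: almost_period_def)

lemma translate_approx_solution:
  assumes "lifted_solution f u" "almost_period \<epsilon> l"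
  shows "approx_solution f \<epsilon> (\<lambda>t. u (t + l))"
  unfolding approx_solution_def
proof
  fix t
  have "(u has_real_derivative f (t + l) (u (t + l))) (at (t + l))"
    using assms(1) by (simp add: lifted_solution_def)
  then have "((\<lambda>t. u (t + l)) has_real_derivative f (t + l) (u (t + l))) (at t)"
    by (simp add: DERIV_shift)
  then show "\<exists>e. \<bar>e\<bar> \<le> \<epsilon> \<and> ((\<lambda>t. u (t + l)) has_real_derivative f t (u (t + l)) + e) (at t)"
    using assms(2) by (intro exI[of _ "f (t + l) (u (t + l)) - f t (u (t + l))"])
      (auto simp: almost_period_def)
qed

text \<open>\<open>approx_gap\<close> controls the distance for \<open>\<bar>t\<bar> \<le> R\<close>
  by its value at 0 and by the defect, and both tend to 0. For this reason the limit solves the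
  given equation itself.\<close>

lemma translates_converge:
  assumes u: "\<And>k. lifted_solution f (u k)" and l: "\<And>k. almost_period (\<epsilon> k) (l k)"
    and \<epsilon>: "\<epsilon> \<longlonglongrightarrow> 0" and y: "lifted_solution f y" and lim: "(\<lambda>k. u k (l k)) \<longlonglongrightarrow> y 0"
    and "0 < \<eta>"
  shows "\<forall>\<^sub>F k in sequentially. \<forall>t. \<bar>t\<bar> \<le> R \<longrightarrow> \<bar>u k (t + l k) - y t\<bar> < \<eta>"
proof -
  let ?E = "exp ((2 * L + 1) * R)"
  have "(\<lambda>k. ((u k (l k) - y 0)\<^sup>2 + (\<epsilon> k)\<^sup>2) * ?E) \<longlonglongrightarrow> ((y 0 - y 0)\<^sup>2 + 0\<^sup>2) * ?E"
    by (intro tendsto_intros lim \<epsilon>)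
  from order_tendstoD(2)[OF this, of "\<eta>\<^sup>2"] \<open>0 < \<eta>\<close>
  have "\<forall>\<^sub>F k in sequentially. ((u k (l k) - y 0)\<^sup>2 + (\<epsilon> k)\<^sup>2) * ?E < \<eta>\<^sup>2" by simp
  then show ?thesis
  proof eventually_elim
    case (elim k)
    show ?case
    proof (intro allI impI)
      fix t assume t: "\<bar>t\<bar> \<le> R"
      have "(u k (t + l k) - y t)\<^sup>2
          \<le> ((u k (0 + l k) - y 0)\<^sup>2 + (\<epsilon> k)\<^sup>2) * exp ((2 * L + 1) * \<bar>t - 0\<bar>)"
        by (rule approx_gap[OF translate_approx_solution[OF u l] y])
      also have "\<dots> \<le> ((u k (l k) - y 0)\<^sup>2 + (\<epsilon> k)\<^sup>2) * ?E"
        using t L_pos by (auto intro!: mult_left_mono)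
      also have "\<dots> < \<eta>\<^sup>2" by (rule elim)
      finally show "\<bar>u k (t + l k) - y t\<bar> < \<eta>"
        using \<open>0 < \<eta>\<close> by (metis abs_of_pos abs_less_iff real_sqrt_abs real_sqrt_less_mono)
    qed
  qed
qed

lemma translates_tendsto:
  assumes u: "\<And>k. lifted_solution f (u k)" and l: "\<And>k. almost_period (\<epsilon> k) (l k)"
    and \<epsilon>: "\<epsilon> \<longlonglongrightarrow> 0" and y: "lifted_solution f y" and lim: "(\<lambda>k. u k (l k)) \<longlonglongrightarrow> y 0"
  shows "(\<lambda>k. u k (t + l k)) \<longlonglongrightarrow> y t"
proof (rule tendstoI)
  fix e :: real assume "0 < e"
  from translates_converge[OF u l \<epsilon> y lim this, of "\<bar>t\<bar>"]
  show "\<forall>\<^sub>F k in sequentially. dist (u k (t + l k)) (y t) < e"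
    by eventually_elim (auto simp: dist_real_def)
qed

text \<open>It suffices to extract a limit of the values at the translation times; convergence at
  all other times follows by continuous dependence.\<close>

lemma translates_cluster:
  assumes u: "\<And>k. lifted_solution f (u k)" and l: "\<And>k. almost_period (\<epsilon> k) (l k)"
    and \<epsilon>: "\<epsilon> \<longlonglongrightarrow> 0" and bdd: "bounded (range (\<lambda>k. u k (l k)))"
  obtains r y where "strict_mono (r :: nat \<Rightarrow> nat)" "lifted_solution f y" "(\<lambda>k. u (r k) (l (r k))) \<longlonglongrightarrow> y 0"
    "\<And>t. (\<lambda>k. u (r k) (t + l (r k))) \<longlonglongrightarrow> y t"
proof -
  obtain v r where r: "strict_mono (r :: nat \<Rightarrow> nat)" "((\<lambda>k. u k (l k)) \<circ> r) \<longlonglongrightarrow> v"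
    using bounded_imp_convergent_subsequence[OF bdd] by blast
  obtain y where y: "lifted_solution f y" "y 0 = v" using solution_exists by blast
  have lim: "(\<lambda>k. u (r k) (l (r k))) \<longlonglongrightarrow> y 0" using r(2) by (simp add: y(2) o_def)
  have "(\<lambda>k. \<epsilon> (r k)) \<longlonglongrightarrow> 0" using LIMSEQ_subseq_LIMSEQ[OF \<epsilon> r(1)] by (simp add: o_def)
  from translates_tendsto[OF u l this y(1) lim] show thesis by (intro that[OF r(1) y(1) lim])
qed

text \<open>The estimate is required only eventually for each pair \<open>s \<le> t\<close>. Thus
  solutions contracting on \<open>{0..}\<close> with common constants have a limit contracting on
  all of \<real> once \<open>l k\<close> tends to infinity.\<close>

lemma contracting_limit:
  assumes u: "\<And>k. lifted_solution f (u k)" and l: "\<And>k. almost_period (\<epsilon> k) (l k)"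
    and \<epsilon>: "\<epsilon> \<longlonglongrightarrow> 0" and y: "lifted_solution f y" and lim: "(\<lambda>k. u k (l k)) \<longlonglongrightarrow> y 0"
    and contr: "\<And>s t. s \<le> t \<Longrightarrow> \<forall>\<^sub>F k in sequentially.
      integral {s + l k..t + l k} (\<lambda>t. fx t (u k t)) \<le> C - m * (t - s)"
  shows "contracting UNIV C m (\<lambda>t. fx t (y t))"
  unfolding contracting_def
proof safe
  fix s t :: real assume st: "s \<le> t"
  show "integral {s..t} (\<lambda>t. fx t (y t)) \<le> C - m * (t - s)"
  proof (rule field_le_epsilon)
    fix e' :: real assume "0 < e'"
    \<comment> \<open>The error accumulated over the interval is at most \<open>e * (t - s)\<close>;
      the summand 1 covers \<open>s = t\<close>.\<close>
    define e where "e = e' / (t - s + 1)"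
    have e: "0 < e" "e * (t - s) \<le> e'" using \<open>0 < e'\<close> st by (auto simp: e_def field_simps)
    obtain \<delta> where \<delta>: "\<delta> > 0"
      "\<And>s t x y. \<bar>s - t\<bar> < \<delta> \<Longrightarrow> \<bar>x - y\<bar> < \<delta> \<Longrightarrow> \<bar>fx s x - fx t y\<bar> < e / 2"
      using fx_uniform[of "e / 2"] e by auto
    have "\<forall>\<^sub>F k in sequentially. \<epsilon> k < e / 2" using \<epsilon> e by (intro order_tendstoD) auto
    then have "\<forall>\<^sub>F k in sequentially. integral {s + l k..t + l k} (\<lambda>t. fx t (u k t)) \<le> C - m * (t - s) \<and>
        (\<forall>x. \<bar>x\<bar> \<le> \<bar>s\<bar> + \<bar>t\<bar> \<longrightarrow> \<bar>u k (x + l k) - y x\<bar> < \<delta>) \<and> \<epsilon> k < e / 2"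
      using contr[OF st] translates_converge[OF u l \<epsilon> y lim \<delta>(1), of "\<bar>s\<bar> + \<bar>t\<bar>"]
      by (intro eventually_conj)
    then obtain k where k: "integral {s + l k..t + l k} (\<lambda>t. fx t (u k t)) \<le> C - m * (t - s)"
        "\<And>x. \<bar>x\<bar> \<le> \<bar>s\<bar> + \<bar>t\<bar> \<Longrightarrow> \<bar>u k (x + l k) - y x\<bar> < \<delta>" "\<epsilon> k < e / 2"
      using eventually_happens'[OF sequentially_bot] by blast
    let ?a = "\<lambda>x. fx (x + l k) (u k (x + l k))"
    have "\<bar>fx x (y x) - ?a x\<bar> \<le> e" if "s \<le> x" "x \<le> t" for x
    proof -
      have "\<bar>u k (x + l k) - y x\<bar> < \<delta>" using k(2)[of x] that by linarith
      then have "\<bar>fx x (u k (x + l k)) - fx x (y x)\<bar> < e / 2" using \<delta> by simp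
      moreover have "\<bar>?a x - fx x (u k (x + l k))\<bar> \<le> \<epsilon> k" using l by (simp add: almost_period_def)
      ultimately show ?thesis using k(3) by linarith
    qed
    then have le: "fx x (y x) \<le> ?a x + e" if "s \<le> x" "x \<le> t" for x using that by (force simp: abs_le_iff)
    have cont: "continuous_on A ?a" "continuous_on A (\<lambda>t. fx t (y t))" for A
    proof -
      have "continuous_on A (\<lambda>x. x + l k)" by (intro continuous_intros)
      from continuous_on_compose2[OF coefficient_continuous[OF u] this] show "continuous_on A ?a" by simp
      show "continuous_on A (\<lambda>t. fx t (y t))"
        by (rule continuous_on_subset[OF coefficient_continuous[OF y] subset_UNIV])
    qed
    have "integral {s..t} (\<lambda>t. fx t (y t)) \<le> integral {s..t} (\<lambda>x. ?a x + e)"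
      by (intro integral_le integrable_continuous_real continuous_intros cont le) auto
    also have "\<dots> = integral {s..t} ?a + e * (t - s)"
      using st by (subst integral_add) (auto intro!: integrable_continuous_real cont)
    also have "integral {s..t} ?a = integral {s + l k..t + l k} (\<lambda>t. fx t (u k t))"
      using integral_shift_real_ivl[of "s + l k" "l k" "t + l k" "\<lambda>x. fx x (u k x)"] by simp
    finally show "integral {s..t} (\<lambda>t. fx t (y t)) \<le> C - m * (t - s) + e'"
      using k(1) e(2) by linarith
  qed
qed

text \<open>The shadow is the limit of the exact solutions \<open>z k\<close> that start on the
  translate at time \<open>- k\<close> and stay near it afterwards. A quarter of \<open>m\<close> is
  lost through the distance to the translate and a quarter through the almost period.\<close>

lemma stable_shadow:
  assumes "0 < m" "0 < \<eta>"
  shows "\<exists>\<epsilon>>0. \<forall>u l. lifted_solution f u \<longrightarrow> contracting UNIV C m (\<lambda>t. fx t (u t)) \<longrightarrow>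
    almost_period \<epsilon> l \<longrightarrow> (\<exists>y. lifted_solution f y \<and> contracting UNIV C (m / 2) (\<lambda>t. fx t (y t)) \<and>
      (\<forall>t. \<bar>y t - u (t + l)\<bar> \<le> \<eta>))"
proof -
  obtain \<delta> where \<delta>: "\<delta> > 0"
    "\<And>s t x y. \<bar>s - t\<bar> < \<delta> \<Longrightarrow> \<bar>x - y\<bar> < \<delta> \<Longrightarrow> \<bar>fx s x - fx t y\<bar> < m / 4"
    using fx_uniform[of "m / 4"] assms by auto
  define \<eta>' where "\<eta>' = min \<eta> (\<delta> / 2)"
  have \<eta>': "0 < \<eta>'" "\<eta>' \<le> \<eta>" "\<eta>' < \<delta>" using assms \<delta> by (auto simp: \<eta>'_def)
  obtain d \<epsilon>1 where d: "0 < d" "0 < \<epsilon>1" and near: "\<forall>J u y s t. lifted_solution f u \<longrightarrow>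
      contracting J C m (\<lambda>t. fx t (u t)) \<longrightarrow> s \<in> J \<longrightarrow> (\<forall>s\<in>J. {s..} \<subseteq> J) \<longrightarrow>
      approx_solution f \<epsilon>1 y \<longrightarrow> \<bar>y s - u s\<bar> \<le> d \<longrightarrow> s \<le> t \<longrightarrow> \<bar>y t - u t\<bar> \<le> \<eta>'"
    using stable_nearby[OF assms(1) \<eta>'(1), of C] by blast
  define \<epsilon> where "\<epsilon> = min \<epsilon>1 (m / 4)"
  have \<epsilon>: "0 < \<epsilon>" "\<epsilon> \<le> \<epsilon>1" "\<epsilon> \<le> m / 4" using d assms by (auto simp: \<epsilon>_def)
  have "\<exists>y. lifted_solution f y \<and> contracting UNIV C (m / 2) (\<lambda>t. fx t (y t)) \<and>
      (\<forall>t. \<bar>y t - u (t + l)\<bar> \<le> \<eta>)"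
    if u: "lifted_solution f u" and c: "contracting UNIV C m (\<lambda>t. fx t (u t))" and l: "almost_period \<epsilon> l" for u l
  proof -
    have "\<exists>z. lifted_solution f z \<and> z (- real k) = u (- real k + l)" for k
      by (rule solution_exists)
    then obtain z where z: "\<And>k. lifted_solution f (z k)" "\<And>k. z k (- real k) = u (- real k + l)"
      by metis
    have zu: "\<bar>z k t - u (t + l)\<bar> \<le> \<eta>'" if "- real k \<le> t" for k t
    proof -
      \<comment> \<open>Stability is known for \<open>u\<close>, not for its translate. So
        \<open>z k\<close> is moved back by \<open>l\<close>, where it becomes an approximate
        solution close to the exact solution \<open>u\<close>.\<close>
      have "approx_solution f \<epsilon>1 (\<lambda>t. z k (t + - l))"
        by (intro translate_approx_solution z almost_period_minus almost_period_mono[OF l \<epsilon>(2)])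
      from near[rule_format, OF u c _ _ this, of "- real k + l" "t + l"] that z(2)[of k] d(1)
      show ?thesis by simp
    qed
    have bdd: "bounded (range (\<lambda>k. z k 0))"
      unfolding bounded_iff
    proof (intro exI[of _ "\<bar>u l\<bar> + \<eta>'"] ballI)
      fix x assume "x \<in> range (\<lambda>k. z k 0)"
      then obtain k where "x = z k 0" by auto
      with zu[of k 0] show "norm x \<le> \<bar>u l\<bar> + \<eta>'" by simp
    qed
    obtain r y where r: "strict_mono (r :: nat \<Rightarrow> nat)" and y: "lifted_solution f y"
      and "(\<lambda>k. z (r k) 0) \<longlonglongrightarrow> y 0" and lim: "\<And>t. (\<lambda>k. z (r k) (t + 0)) \<longlonglongrightarrow> y t"
      by (rule translates_cluster[OF z(1) almost_period_0[OF order_refl] tendsto_const bdd]) (rule that)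
    have yu: "\<bar>y t - u (t + l)\<bar> \<le> \<eta>'" for t
    proof (rule tendsto_upperbound)
      show "((\<lambda>k. \<bar>z (r k) t - u (t + l)\<bar>) \<longlongrightarrow> \<bar>y t - u (t + l)\<bar>) sequentially"
        using lim[of t] by (intro tendsto_intros) simp
      show "\<forall>\<^sub>F k in sequentially. \<bar>z (r k) t - u (t + l)\<bar> \<le> \<eta>'"
      proof (rule eventually_sequentiallyI)
        fix k assume "nat \<lceil>- t\<rceil> \<le> k"
        then have "- real (r k) \<le> t" using seq_suble[OF r, of k] by linarith
        then show "\<bar>z (r k) t - u (t + l)\<bar> \<le> \<eta>'" by (rule zu)
      qed
    qed simp
    have close: "\<bar>fx t (y t) - fx (t + l) (u (t + l))\<bar> \<le> m / 2" for t
    proof -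
      have "\<bar>fx t (y t) - fx t (u (t + l))\<bar> < m / 4" using \<delta>(2)[of t t "y t"] \<delta>(1) \<eta>'(3) yu[of t] by auto
      moreover have "\<bar>fx (t + l) (u (t + l)) - fx t (u (t + l))\<bar> \<le> m / 4"
        using almost_period_mono[OF l \<epsilon>(3)] by (simp add: almost_period_def)
      ultimately show ?thesis by linarith
    qed
    have "contracting UNIV C m (\<lambda>t. fx (t + l) (u (t + l)))"
      unfolding contracting_def
    proof safe
      fix s t :: real assume "s \<le> t"
      then have "integral {s + l..t + l} (\<lambda>t. fx t (u t)) \<le> C - m * (t + l - (s + l))"
        using c unfolding contracting_def by (meson UNIV_I add_right_mono)
      then show "integral {s..t} (\<lambda>t. fx (t + l) (u (t + l))) \<le> C - m * (t - s)"
        using integral_shift_real_ivl[of "s + l" l "t + l" "\<lambda>t. fx t (u t)"] by simp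
    qed
    then have "contracting UNIV C (m - m / 2) (\<lambda>t. fx t (y t))"
    proof (rule contracting_near[OF _ _ coefficient_continuous[OF y] _ close])
      show "continuous_on UNIV (\<lambda>t. fx (t + l) (u (t + l)))"
      proof -
        have "continuous_on UNIV (\<lambda>x. x + l)" by (intro continuous_intros)
        from continuous_on_compose2[OF coefficient_continuous[OF u] this] show ?thesis by simp
      qed
    qed auto
    moreover have "\<bar>y t - u (t + l)\<bar> \<le> \<eta>" for t using yu[of t] \<eta>'(2) by linarith
    ultimately show ?thesis using y by (intro exI[of _ y]) simp
  qed
  with \<epsilon>(1) show ?thesis by blast
qed


lemma unstable_shadow:
  assumes "0 < m" "0 < \<eta>"
  shows "\<exists>\<epsilon>>0. \<forall>w l. lifted_solution f w \<longrightarrow> expanding UNIV C m (\<lambda>t. fx t (w t)) \<longrightarrow>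
    almost_period \<epsilon> l \<longrightarrow> (\<exists>y. lifted_solution f y \<and> expanding UNIV C (m / 2) (\<lambda>t. fx t (y t)) \<and>
      (\<forall>t. \<bar>y t - w (t + l)\<bar> \<le> \<eta>))"
proof -
  interpret rev: periodic_field "\<lambda>t x. - f (- t) x" "\<lambda>t x. - fx (- t) x" L by (rule reversed)
  have period: "rev.almost_period \<epsilon> (- l)" if "almost_period \<epsilon> l" for \<epsilon> l
    unfolding rev.almost_period_def
  proof (intro allI)
    fix t x
    show "\<bar>- f (- (t + - l)) x - - f (- t) x\<bar> \<le> \<epsilon> \<and> \<bar>- fx (- (t + - l)) x - - fx (- t) x\<bar> \<le> \<epsilon>"
      using that[unfolded almost_period_def, rule_format, of "- t" x]
      by (simp add: abs_minus_commute algebra_simps)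
  qed
  obtain \<epsilon> where \<epsilon>: "0 < \<epsilon>" and *: "\<forall>u l. lifted_solution (\<lambda>t x. - f (- t) x) u \<longrightarrow>
    contracting UNIV C m (\<lambda>t. - fx (- t) (u t)) \<longrightarrow> rev.almost_period \<epsilon> l \<longrightarrow>
    (\<exists>y. lifted_solution (\<lambda>t x. - f (- t) x) y \<and> contracting UNIV C (m / 2) (\<lambda>t. - fx (- t) (y t)) \<and>
      (\<forall>t. \<bar>y t - u (t + l)\<bar> \<le> \<eta>))"
    using rev.stable_shadow[OF assms, of C] by blast
  have "\<exists>y. lifted_solution f y \<and> expanding UNIV C (m / 2) (\<lambda>t. fx t (y t)) \<and>
      (\<forall>t. \<bar>y t - w (t + l)\<bar> \<le> \<eta>)"
    if h: "lifted_solution f w" "expanding UNIV C m (\<lambda>t. fx t (w t))" "almost_period \<epsilon> l" for w l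
  proof -
    obtain y where y: "lifted_solution (\<lambda>t x. - f (- t) x) y"
      "contracting UNIV C (m / 2) (\<lambda>t. - fx (- t) (y t))" "\<And>t. \<bar>y t - w (- (t + - l))\<bar> \<le> \<eta>"
      using *[rule_format, of "\<lambda>t. w (- t)" "- l"] h period
      by (auto simp: reversed_solution_iff expanding_reversed_coefficient)
    have "lifted_solution f (\<lambda>t. y (- t))"
      using y(1) reversed_solution_iff[of f "\<lambda>t. y (- t)"] by simp
    moreover have "expanding UNIV C (m / 2) (\<lambda>t. fx t (y (- t)))"
      using y(2) expanding_reversed_coefficient[of UNIV C "m / 2" fx "\<lambda>t. y (- t)"] by simp
    moreover have "\<bar>y (- t) - w (t + l)\<bar> \<le> \<eta>" for t using y(3)[of "- t"] by (simp add: add.commute)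
    ultimately show ?thesis by (intro exI[of _ "\<lambda>t. y (- t)"]) simp
  qed
  with \<epsilon> show ?thesis by blast
qed

end

section \<open>Gradient-like almost periodic equations on the line\<close>

text \<open>A scale of constants with a single index, which every dichotomy satisfies from some
  index on; finitely many dichotomies then share an index.\<close>

lemma contracting_eventually:
  assumes "0 < m" "contracting J C m a"
  shows "\<forall>\<^sub>F n in sequentially. contracting J (real n) (1 / (real n + 1)) a"
proof (rule eventually_sequentiallyI)
  fix n assume n: "nat \<lceil>max C (1 / m)\<rceil> \<le> n"
  then have "C \<le> real n" "1 / m \<le> real n" by linarith+
  moreover from this have "1 / (real n + 1) \<le> m" using assms(1) by (simp add: field_simps)
  ultimately show "contracting J (real n) (1 / (real n + 1)) a"
    using contracting_mono[OF assms(2)] by blast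
qed

lemma expanding_eventually:
  assumes "0 < m" "expanding J C m a"
  shows "\<forall>\<^sub>F n in sequentially. expanding J (real n) (1 / (real n + 1)) a"
  using assms contracting_eventually by (auto simp: expanding_iff_reversed)

text \<open>\<open>isolated\<close> is the form in which the disjoint neighborhoods of (A4) enter on
  the line; the integer translates of \<open>w\<close> are among the \<open>w'\<close>.\<close>

locale gradient_field = periodic_field +
  assumes recurrent: "0 < \<epsilon> \<Longrightarrow> \<exists>T>0. \<forall>a. \<exists>l. a < l \<and> l < a + T \<and> almost_period \<epsilon> l"
    and forward_dichotomy: "lifted_solution f u \<Longrightarrow>
      (\<exists>C m. 0 < m \<and> contracting {0..} C m (\<lambda>t. fx t (u t))) \<or>
      (\<exists>C m. 0 < m \<and> expanding {0..} C m (\<lambda>t. fx t (u t)))"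
    and backward_dichotomy: "lifted_solution f u \<Longrightarrow>
      (\<exists>C m. 0 < m \<and> contracting {..0} C m (\<lambda>t. fx t (u t))) \<or>
      (\<exists>C m. 0 < m \<and> expanding {..0} C m (\<lambda>t. fx t (u t)))"
    and no_saddle: "lifted_solution f u \<Longrightarrow> 0 < m \<Longrightarrow> expanding {0..} C m (\<lambda>t. fx t (u t)) \<Longrightarrow>
      0 < m' \<Longrightarrow> contracting {..0} C' m' (\<lambda>t. fx t (u t)) \<Longrightarrow> False"
    and isolated: "lifted_solution f w \<Longrightarrow> 0 < m \<Longrightarrow> expanding {0..} C m (\<lambda>t. fx t (w t)) \<Longrightarrow>
      \<exists>d>0. \<forall>w'. lifted_solution f w' \<longrightarrow> (\<exists>C m. 0 < m \<and> expanding {0..} C m (\<lambda>t. fx t (w' t))) \<longrightarrow>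
        w' \<noteq> w \<longrightarrow> (\<forall>t\<ge>0. d < \<bar>w' t - w t\<bar>)"
begin

section \<open>Repelling and attracting solutions\<close>

definition repelling :: "(real \<Rightarrow> real) \<Rightarrow> bool" where
  "repelling w \<longleftrightarrow> lifted_solution f w \<and> (\<exists>C m. 0 < m \<and> expanding {0..} C m (\<lambda>t. fx t (w t)))"

definition attracting :: "(real \<Rightarrow> real) \<Rightarrow> bool" where
  "attracting s \<longleftrightarrow> lifted_solution f s \<and> (\<exists>C m. 0 < m \<and> contracting {..0} C m (\<lambda>t. fx t (s t)))"

lemma repelling_solution: "repelling w \<Longrightarrow> lifted_solution f w"
  and attracting_solution: "attracting s \<Longrightarrow> lifted_solution f s"
  by (simp_all add: repelling_def attracting_def)

lemma forward_exclusive: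
  assumes "0 < m" "contracting {0..} C m a" "0 < m'" "expanding {0..} C' m' a"
  shows False
proof -
  have "\<exists>s\<in>{0..}. \<exists>t\<in>{0..}. s + d \<le> t" for d :: real
    by (rule bexI[of _ 0], rule bexI[of _ "max d 0"]) auto
  with not_contracting_expanding assms show False by blast
qed

lemma not_repelling_contracting:
  assumes "lifted_solution f u" "\<not> repelling u"
  shows "\<exists>C m. 0 < m \<and> contracting {0..} C m (\<lambda>t. fx t (u t))"
  using assms forward_dichotomy unfolding repelling_def by blast

lemma contracting_not_repelling:
  assumes "0 < m" "contracting {0..} C m (\<lambda>t. fx t (u t))"
  shows "\<not> repelling u"
  using assms forward_exclusive unfolding repelling_def by blast

lemma repelling_iff:
  "repelling w \<longleftrightarrow> lifted_solution f w \<and> (\<exists>C m. 0 < m \<and> expanding UNIV C m (\<lambda>t. fx t (w t)))"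
proof
  assume w: "repelling w"
  then obtain C m where C: "lifted_solution f w" "0 < m" "expanding {0..} C m (\<lambda>t. fx t (w t))"
    unfolding repelling_def by blast
  with no_saddle backward_dichotomy obtain C' m' where C': "0 < m'" "expanding {..0} C' m' (\<lambda>t. fx t (w t))"
    by blast
  from expanding_join[OF C'(2) C(3) coefficient_continuous[OF C(1)] C'(1) C(2)] C C'
  show "lifted_solution f w \<and> (\<exists>C m. 0 < m \<and> expanding UNIV C m (\<lambda>t. fx t (w t)))"
    by (metis min_less_iff_conj)
next
  assume "lifted_solution f w \<and> (\<exists>C m. 0 < m \<and> expanding UNIV C m (\<lambda>t. fx t (w t)))"
  then show "repelling w"
    unfolding repelling_def using expanding_mono[OF _ order_refl order_refl subset_UNIV] by blast
qed

lemma attracting_iff: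
  "attracting s \<longleftrightarrow> lifted_solution f s \<and> (\<exists>C m. 0 < m \<and> contracting UNIV C m (\<lambda>t. fx t (s t)))"
proof
  assume s: "attracting s"
  then obtain C m where C: "lifted_solution f s" "0 < m" "contracting {..0} C m (\<lambda>t. fx t (s t))"
    unfolding attracting_def by blast
  with no_saddle forward_dichotomy obtain C' m' where C': "0 < m'" "contracting {0..} C' m' (\<lambda>t. fx t (s t))"
    by blast
  from contracting_join[OF C(3) C'(2) coefficient_continuous[OF C(1)] C(2) C'(1)] C C'
  show "lifted_solution f s \<and> (\<exists>C m. 0 < m \<and> contracting UNIV C m (\<lambda>t. fx t (s t)))"
    by (metis min_less_iff_conj)
next
  assume "lifted_solution f s \<and> (\<exists>C m. 0 < m \<and> contracting UNIV C m (\<lambda>t. fx t (s t)))"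
  then show "attracting s"
    unfolding attracting_def using contracting_mono[OF _ order_refl order_refl subset_UNIV] by blast
qed

lemma attracting_not_repelling: "attracting s \<Longrightarrow> \<not> repelling s"
  unfolding attracting_def repelling_def using no_saddle by blast

section \<open>Invariance, openness, finiteness and uniform separation\<close>

lemma repelling_shift: "repelling w \<Longrightarrow> repelling (\<lambda>t. w t + of_int n)"
  unfolding repelling_def fx_periodic_int using solution_shift_int by blast

lemma attracting_shift: "attracting s \<Longrightarrow> attracting (\<lambda>t. s t + of_int n)"
  unfolding attracting_def fx_periodic_int using solution_shift_int by blast

text \<open>A solution starting nearby stays so close that its coefficient differs by at most half
  the rate; it contracts as well and cannot be repelling.\<close>

lemma contracting_open:
  assumes u: "lifted_solution f u" and c: "0 < m" "contracting {0..} C m (\<lambda>t. fx t (u t))"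
  shows "\<exists>d>0. \<forall>y. lifted_solution f y \<longrightarrow> \<bar>y 0 - u 0\<bar> < d \<longrightarrow>
    \<not> repelling y \<and> ((\<lambda>t. y t - u t) \<longlongrightarrow> 0) at_top"
proof -
  obtain \<delta> where \<delta>: "\<delta> > 0"
    "\<And>s t x y. \<bar>s - t\<bar> < \<delta> \<Longrightarrow> \<bar>x - y\<bar> < \<delta> \<Longrightarrow> \<bar>fx s x - fx t y\<bar> < m / 2"
    using fx_uniform[of "m / 2"] c by auto
  have "0 < \<delta> / 2" using \<delta> by simp
  from stable_nearby[OF c(1) this, of C]
  obtain d1 \<epsilon> where d1: "0 < d1" "0 < \<epsilon>" and near: "\<forall>J u y s t. lifted_solution f u \<longrightarrow>
      contracting J C m (\<lambda>t. fx t (u t)) \<longrightarrow> s \<in> J \<longrightarrow> (\<forall>s\<in>J. {s..} \<subseteq> J) \<longrightarrow>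
      approx_solution f \<epsilon> y \<longrightarrow> \<bar>y s - u s\<bar> \<le> d1 \<longrightarrow> s \<le> t \<longrightarrow> \<bar>y t - u t\<bar> \<le> \<delta> / 2" by blast
  from stable_attracts[OF c(1), of C]
  obtain d2 where d2: "0 < d2" and attr: "\<forall>J u y s. lifted_solution f u \<longrightarrow>
      contracting J C m (\<lambda>t. fx t (u t)) \<longrightarrow> s \<in> J \<longrightarrow> (\<forall>s\<in>J. {s..} \<subseteq> J) \<longrightarrow> lifted_solution f y \<longrightarrow>
      \<bar>y s - u s\<bar> \<le> d2 \<longrightarrow> ((\<lambda>t. y t - u t) \<longlongrightarrow> 0) at_top" by blast
  have "\<not> repelling y \<and> ((\<lambda>t. y t - u t) \<longlongrightarrow> 0) at_top"
    if y: "lifted_solution f y" and d: "\<bar>y 0 - u 0\<bar> < min d1 d2" for y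
  proof
    show "((\<lambda>t. y t - u t) \<longlongrightarrow> 0) at_top"
      by (rule attr[rule_format, OF u c(2) _ _ y, of 0]) (use d in auto)
    have le: "\<bar>y t - u t\<bar> \<le> \<delta> / 2" if "0 \<le> t" for t
      by (rule near[rule_format, OF u c(2) _ _ approx_solution_of_solution[OF y], of 0])
        (use d d1 that in auto)
    have "\<bar>fx t (y t) - fx t (u t)\<bar> \<le> m / 2" if "t \<in> {0..}" for t
      using \<delta>(2)[of t t "y t" "u t"] \<delta>(1) le[of t] that by (auto intro: less_imp_le)
    then have "contracting {0..} C (m - m / 2) (\<lambda>t. fx t (y t))"
      by (intro contracting_near[OF c(2) coefficient_continuous[OF u] coefficient_continuous[OF y]]) auto
    then show "\<not> repelling y" by (intro contracting_not_repelling[of "m - m / 2"]) (use c in auto)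
  qed
  then show ?thesis using d1 d2 by (intro exI[of _ "min d1 d2"]) auto
qed

text \<open>Infinitely many initial values would accumulate at some \<open>x\<close>. If the
  solution through \<open>x\<close> is repelling, this contradicts \<open>isolated\<close>;
  otherwise it contracts in the future, and no solution starting nearby is repelling.\<close>

lemma repelling_finite: "finite {w. repelling w \<and> a \<le> w 0 \<and> w 0 \<le> b}"
proof (rule ccontr)
  let ?F = "{w. repelling w \<and> a \<le> w 0 \<and> w 0 \<le> b}"
  assume "infinite ?F"
  moreover have "inj_on (\<lambda>w. w 0) ?F"
    by (auto intro!: inj_onI solution_unique[of _ _ 0] simp: repelling_solution)
  ultimately have "infinite ((\<lambda>w. w 0) ` ?F)" by (simp add: finite_image_iff)
  then obtain x where "x islimpt ((\<lambda>w. w 0) ` ?F)"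
    using Heine_Borel_imp_Bolzano_Weierstrass[of "{a..b}" "(\<lambda>w. w 0) ` ?F"] by (auto simp: image_subset_iff)
  then have lim: "\<exists>w. repelling w \<and> w 0 \<noteq> x \<and> \<bar>w 0 - x\<bar> < e" if "0 < e" for e
    using that unfolding islimpt_approachable dist_real_def by blast
  obtain u where u: "lifted_solution f u" "u 0 = x" using solution_exists by blast
  show False
  proof (cases "repelling u")
    case True
    then obtain C m where "0 < m" "expanding {0..} C m (\<lambda>t. fx t (u t))" unfolding repelling_def by blast
    from isolated[OF u(1) this] obtain d where d: "d > 0"
      "\<And>w. repelling w \<Longrightarrow> w \<noteq> u \<Longrightarrow> \<forall>t\<ge>0. d < \<bar>w t - u t\<bar>" unfolding repelling_def by blast
    obtain w where "repelling w" "w 0 \<noteq> x" "\<bar>w 0 - x\<bar> < d" using lim[OF d(1)] by blast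
    with d(2)[of w] u(2) show False by force
  next
    case False
    then obtain C m where "0 < m" "contracting {0..} C m (\<lambda>t. fx t (u t))"
      using not_repelling_contracting[OF u(1)] by blast
    from contracting_open[OF u(1) this] obtain d where d: "d > 0"
      "\<And>y. lifted_solution f y \<Longrightarrow> \<bar>y 0 - u 0\<bar> < d \<Longrightarrow> \<not> repelling y" by blast
    obtain w where "repelling w" "w 0 \<noteq> x" "\<bar>w 0 - x\<bar> < d" using lim[OF d(1)] by blast
    with d(2)[of w] u(2) repelling_solution show False by blast
  qed
qed

lemma shift_to_unit:
  fixes x a :: real
  shows "\<exists>n::int. a \<le> x + of_int n \<and> x + of_int n < a + 1"
proof
  show "a \<le> x + of_int (- \<lfloor>x - a\<rfloor>) \<and> x + of_int (- \<lfloor>x - a\<rfloor>) < a + 1" by linarith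
qed

text \<open>There are finitely many representatives in one period, so conditions that hold for each
  of them from some index on hold at a common index; invariance under integer shifts extends this to
  all solutions.\<close>

lemma uniform_over_period:
  assumes fin: "finite {w. K w \<and> 0 \<le> w 0 \<and> w 0 \<le> (1::real)}"
    and shift: "\<And>w (n::int). K w \<Longrightarrow> K (\<lambda>t. w t + of_int n)"
    and ev: "\<And>w. K w \<Longrightarrow> \<forall>\<^sub>F k in sequentially. P w k"
    and P: "\<And>w n k. P w k \<Longrightarrow> P (\<lambda>t. w t + of_int n) k"
  shows "\<exists>k::nat. \<forall>w. K w \<longrightarrow> P w k"
proof -
  have "\<forall>\<^sub>F k in sequentially. \<forall>w\<in>{w. K w \<and> 0 \<le> w 0 \<and> w 0 \<le> 1}. P w k"
    using ev by (intro eventually_ball_finite[OF fin]) auto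
  then obtain k where k: "\<And>w. K w \<Longrightarrow> 0 \<le> w 0 \<Longrightarrow> w 0 \<le> 1 \<Longrightarrow> P w k"
    using eventually_happens'[OF sequentially_bot] by fastforce
  have "P w k" if "K w" for w
  proof -
    obtain n :: int where n: "0 \<le> w 0 + of_int n" "w 0 + of_int n < 0 + 1" using shift_to_unit by blast
    with k[OF shift[OF that, of n]] have "P (\<lambda>t. w t + of_int n) k" by simp
    from P[OF this, of "- n"] show ?thesis by simp
  qed
  then show ?thesis by blast
qed

lemma repelling_uniform:
  obtains C m where "0 < m" "\<And>w. repelling w \<Longrightarrow> expanding UNIV C m (\<lambda>t. fx t (w t))"
proof -
  have "\<exists>k. \<forall>w. repelling w \<longrightarrow> expanding UNIV (real k) (1 / (real k + 1)) (\<lambda>t. fx t (w t))"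
  proof (rule uniform_over_period[OF repelling_finite repelling_shift])
    fix w assume "repelling w"
    then show "\<forall>\<^sub>F k in sequentially. expanding UNIV (real k) (1 / (real k + 1)) (\<lambda>t. fx t (w t))"
      using expanding_eventually unfolding repelling_iff by blast
  qed (simp_all add: fx_periodic_int)
  then obtain k where "\<And>w. repelling w \<Longrightarrow> expanding UNIV (real k) (1 / (real k + 1)) (\<lambda>t. fx t (w t))"
    by blast
  then show thesis by (intro that[of "1 / (real k + 1)" "real k"]) auto
qed

lemma repelling_separated_forward:
  obtains d where "0 < d" "\<And>w w' t. repelling w \<Longrightarrow> repelling w' \<Longrightarrow> w' \<noteq> w \<Longrightarrow> 0 \<le> t \<Longrightarrow> d < \<bar>w' t - w t\<bar>"
proof -
  let ?P = "\<lambda>w k. \<forall>w'. repelling w' \<longrightarrow> w' \<noteq> w \<longrightarrow> (\<forall>t\<ge>0. 1 / (real k + 1) < \<bar>w' t - w t\<bar>)"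
  have "\<exists>k. \<forall>w. repelling w \<longrightarrow> ?P w k"
  proof (rule uniform_over_period[OF repelling_finite repelling_shift])
    fix w assume "repelling w"
    then obtain C m where "lifted_solution f w" "0 < m" "expanding {0..} C m (\<lambda>t. fx t (w t))"
      unfolding repelling_def by blast
    from isolated[OF this] obtain d where d: "d > 0"
      "\<And>w' t. repelling w' \<Longrightarrow> w' \<noteq> w \<Longrightarrow> 0 \<le> t \<Longrightarrow> d < \<bar>w' t - w t\<bar>" unfolding repelling_def by blast
    show "\<forall>\<^sub>F k in sequentially. ?P w k"
    proof (rule eventually_sequentiallyI)
      fix k assume "nat \<lceil>1 / d\<rceil> \<le> k"
      then have "1 / d \<le> real k" by linarith
      then have "1 / (real k + 1) \<le> d" using d(1) by (simp add: field_simps)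
      with d(2) show "?P w k" by fastforce
    qed
  next
    fix w n k assume P: "?P w k"
    show "?P (\<lambda>t. w t + of_int n) k"
    proof (intro allI impI)
      fix w' and t :: real assume w': "repelling w'" "w' \<noteq> (\<lambda>t. w t + of_int n)" "0 \<le> t"
      have "(\<lambda>t. w' t + of_int (- n)) \<noteq> w" using w'(2) by (metis add.right_neutral add.commute add.left_commute of_int_minus add.right_inverse)
      with P repelling_shift[OF w'(1), of "- n"] w'(3)
      have "1 / (real k + 1) < \<bar>w' t + of_int (- n) - w t\<bar>" by blast
      then show "1 / (real k + 1) < \<bar>w' t - (w t + of_int n)\<bar>" by (simp add: algebra_simps)
    qed
  qed
  then obtain k where "\<And>w. repelling w \<Longrightarrow> ?P w k" by blast
  then show thesis by (intro that[of "1 / (real k + 1)"]) auto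
qed

text \<open>The common constants make one \<open>\<epsilon>\<close> serve all repelling solutions;
  the shadow expands on all of \<real> and is therefore repelling again.\<close>

lemma repelling_shadow:
  assumes "0 < \<eta>"
  shows "\<exists>\<epsilon>>0. \<forall>w l. repelling w \<longrightarrow> almost_period \<epsilon> l \<longrightarrow> (\<exists>y. repelling y \<and> (\<forall>t. \<bar>y t - w (t + l)\<bar> \<le> \<eta>))"
proof -
  obtain C m where m: "0 < m" and C: "\<And>w. repelling w \<Longrightarrow> expanding UNIV C m (\<lambda>t. fx t (w t))"
    using repelling_uniform by blast
  obtain \<epsilon> where \<epsilon>: "0 < \<epsilon>" and *: "\<forall>w l. lifted_solution f w \<longrightarrow> expanding UNIV C m (\<lambda>t. fx t (w t)) \<longrightarrow>
    almost_period \<epsilon> l \<longrightarrow> (\<exists>y. lifted_solution f y \<and> expanding UNIV C (m / 2) (\<lambda>t. fx t (y t)) \<and>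
      (\<forall>t. \<bar>y t - w (t + l)\<bar> \<le> \<eta>))"
    using unstable_shadow[OF m assms, of C] by blast
  have "\<exists>y. repelling y \<and> (\<forall>t. \<bar>y t - w (t + l)\<bar> \<le> \<eta>)" if w: "repelling w" "almost_period \<epsilon> l" for w l
  proof -
    obtain y where "lifted_solution f y" "expanding UNIV C (m / 2) (\<lambda>t. fx t (y t))"
      "\<forall>t. \<bar>y t - w (t + l)\<bar> \<le> \<eta>"
      using *[rule_format, OF repelling_solution[OF w(1)] C[OF w(1)] w(2)] by blast
    moreover have "0 < m / 2" using m by simp
    ultimately show ?thesis unfolding repelling_iff by blast
  qed
  with \<epsilon> show ?thesis by blast
qed

lemma almost_period_beyond:
  assumes "0 < \<epsilon>"
  shows "\<exists>l\<ge>a. almost_period \<epsilon> l"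
  using recurrent[OF assms] less_imp_le by blast

text \<open>An almost period \<open>l\<close> moves the time \<open>t\<close> into the half line
  where separation is known. The shadows of the two translates are distinct, and of \<open>d\<close>
  there remains \<open>d - 2 * (d / 4)\<close>.\<close>

lemma repelling_separated:
  obtains d where "0 < d" "\<And>w w' t. repelling w \<Longrightarrow> repelling w' \<Longrightarrow> w' \<noteq> w \<Longrightarrow> d \<le> \<bar>w' t - w t\<bar>"
proof -
  obtain d where d: "0 < d"
    "\<And>w w' t. repelling w \<Longrightarrow> repelling w' \<Longrightarrow> w' \<noteq> w \<Longrightarrow> 0 \<le> t \<Longrightarrow> d < \<bar>w' t - w t\<bar>"
    by (rule repelling_separated_forward) blast
  have "0 < d / 4" using d by simp
  from repelling_shadow[OF this] obtain \<epsilon> where \<epsilon>: "0 < \<epsilon>" and shadow: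
    "\<And>w l. repelling w \<Longrightarrow> almost_period \<epsilon> l \<Longrightarrow> \<exists>y. repelling y \<and> (\<forall>t. \<bar>y t - w (t + l)\<bar> \<le> d / 4)" by blast
  have "d / 2 \<le> \<bar>w' t - w t\<bar>" if w: "repelling w" "repelling w'" "w' \<noteq> w" for w w' t
  proof -
    obtain l where l: "max 0 (- t) \<le> l" "almost_period \<epsilon> l" using almost_period_beyond[OF \<epsilon>] by blast
    note ap = almost_period_minus[OF l(2)]
    obtain y where y: "repelling y" "\<And>t. \<bar>y t - w (t + - l)\<bar> \<le> d / 4" using shadow[OF w(1) ap] by blast
    obtain y' where y': "repelling y'" "\<And>t. \<bar>y' t - w' (t + - l)\<bar> \<le> d / 4" using shadow[OF w(2) ap] by blast
    have close: "\<bar>y (x + l) - w x\<bar> \<le> d / 4" "\<bar>y' (x + l) - w' x\<bar> \<le> d / 4" for x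
      using y(2)[of "x + l"] y'(2)[of "x + l"] by simp_all
    \<comment> \<open>A common shadow would at time \<open>l\<close> be within \<open>d / 4\<close>
      of both \<open>w 0\<close> and \<open>w' 0\<close>.\<close>
    have "y' \<noteq> y"
    proof
      assume "y' = y"
      then have "\<bar>y l - w 0\<bar> \<le> d / 4" "\<bar>y l - w' 0\<bar> \<le> d / 4" using close[of 0] by simp_all
      then have "\<bar>w' 0 - w 0\<bar> \<le> d / 2" by linarith
      with d(2)[OF w, of 0] d(1) show False by simp
    qed
    with d(2)[OF y(1) y'(1), of "t + l"] l(1) have "d < \<bar>y' (t + l) - y (t + l)\<bar>" by simp
    with close[of t] show ?thesis by linarith
  qed
  with d(1) show thesis by (intro that[of "d / 2"]) auto
qed

text \<open>Being asymptotic is an equivalence relation on initial values. Without repelling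
  solutions in the interval every solution starting there contracts in the future, so the classes
  are open; and the interval is connected.\<close>

lemma no_repelling_between_asymptotic:
  assumes y: "lifted_solution f y" "lifted_solution f y'" "y 0 \<le> y' 0"
    and none: "\<And>w. repelling w \<Longrightarrow> \<not> (y 0 \<le> w 0 \<and> w 0 \<le> y' 0)"
  shows "((\<lambda>t. y t - y' t) \<longlongrightarrow> 0) at_top"
proof -
  define R where "R a b \<longleftrightarrow> (\<exists>u v. lifted_solution f u \<and> lifted_solution f v \<and> u 0 = a \<and> v 0 = b \<and>
    ((\<lambda>t. u t - v t) \<longlongrightarrow> 0) at_top)" for a b
  have "R (y 0) (y' 0)"
  proof (rule connected_equivalence_relation[of "{y 0..y' 0}"])
    show "R b a" if "R a b" for a b
      using that tendsto_minus unfolding R_def by fastforce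
    show "R a c" if R: "R a b" "R b c" for a b c
    proof -
      obtain u v v' z where h: "lifted_solution f u" "lifted_solution f v" "u 0 = a" "v 0 = b"
        "((\<lambda>t. u t - v t) \<longlongrightarrow> 0) at_top" "lifted_solution f v'" "lifted_solution f z" "v' 0 = b" "z 0 = c"
        "((\<lambda>t. v' t - z t) \<longlongrightarrow> 0) at_top" using R unfolding R_def by blast
      then have "v' = v" using solution_unique by metis
      with tendsto_add[OF h(5,10)] h show ?thesis unfolding R_def by auto
    qed
    fix a assume a: "a \<in> {y 0..y' 0}"
    obtain u where u: "lifted_solution f u" "u 0 = a" using solution_exists by blast
    have "\<not> repelling u" using none[of u] a u by auto
    then obtain C m where "0 < m" "contracting {0..} C m (\<lambda>t. fx t (u t))"
      using not_repelling_contracting[OF u(1)] by blast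
    from contracting_open[OF u(1) this] obtain d where d: "d > 0"
      "\<And>y. lifted_solution f y \<Longrightarrow> \<bar>y 0 - u 0\<bar> < d \<Longrightarrow> ((\<lambda>t. y t - u t) \<longlongrightarrow> 0) at_top" by blast
    have "R a x" if x: "\<bar>x - a\<bar> < d" for x
    proof -
      obtain v where v: "lifted_solution f v" "v 0 = x" using solution_exists by blast
      with d(2)[OF v(1)] u(2) x have "((\<lambda>t. - (v t - u t)) \<longlongrightarrow> - 0) at_top" by (intro tendsto_minus) simp
      with u v show ?thesis unfolding R_def by auto
    qed
    then show "\<exists>T. openin (top_of_set {y 0..y' 0}) T \<and> a \<in> T \<and> (\<forall>x\<in>T. R a x)"
      using d(1) a by (intro exI[of _ "{y 0..y' 0} \<inter> ball a d"])
        (auto simp: openin_open_Int dist_real_def abs_minus_commute)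
  qed (use y in auto)
  then obtain u v where "lifted_solution f u" "lifted_solution f v" "u 0 = y 0" "v 0 = y' 0"
    "((\<lambda>t. u t - v t) \<longlongrightarrow> 0) at_top" unfolding R_def by blast
  then show ?thesis using solution_unique y by metis
qed

text \<open>Otherwise a solution and its translate by 1 would be asymptotic, although their distance
  is constant.\<close>

lemma repelling_exists: "\<exists>w. repelling w \<and> a \<le> w t \<and> w t < a + 1"
proof -
  have "\<exists>w. repelling w"
  proof (rule ccontr)
    assume none: "\<nexists>w. repelling w"
    obtain y where y: "lifted_solution f y" "y 0 = 0" using solution_exists by blast
    have "((\<lambda>t. y t - (y t + of_int 1)) \<longlongrightarrow> 0) at_top"
      by (rule no_repelling_between_asymptotic[OF y(1) solution_shift_int[OF y(1)]]) (use none in auto)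
    then show False by (simp add: tendsto_const_iff)
  qed
  then obtain w where "repelling w" by blast
  moreover obtain n :: int where "a \<le> w t + of_int n" "w t + of_int n < a + 1"
    using shift_to_unit by blast
  ultimately show ?thesis using repelling_shift[of w n] by blast
qed

end

section \<open>Alternation of attracting and repelling solutions\<close>

lemma inverse_Suc_tendsto: "(\<lambda>k. 1 / (real k + 1)) \<longlonglongrightarrow> 0"
  using LIMSEQ_inverse_real_of_nat by (simp add: inverse_eq_divide add.commute)

context gradient_field
begin

text \<open>Solutions are started between \<open>w\<close> and \<open>w'\<close> ever further in the
  past, by way of shadows of their translates; they contract from then on with constants common to
  all choices. Moved forward by the almost periods \<open>l k\<close>, they accumulate at a solution
  contracting on all of \<real>.\<close>

lemma attracting_between:
  assumes w: "repelling w" "repelling w'" "w 0 < w' 0"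
  obtains s where "attracting s" "w 0 < s 0" "s 0 < w' 0"
proof -
  obtain d where d: "0 < d" "\<And>w w' t. repelling w \<Longrightarrow> repelling w' \<Longrightarrow> w' \<noteq> w \<Longrightarrow> d \<le> \<bar>w' t - w t\<bar>"
    using repelling_separated by blast
  \<comment> \<open>A solution starting \<open>d / 2\<close> above a repelling one is too close to
    it to be repelling, hence contracts in the future.\<close>
  let ?P = "\<lambda>w k. \<exists>z. lifted_solution f z \<and> z 0 = w 0 + d / 2 \<and>
    contracting {0..} (real k) (1 / (real k + 1)) (\<lambda>t. fx t (z t))"
  have "\<exists>k. \<forall>w. repelling w \<longrightarrow> ?P w k"
  proof (rule uniform_over_period[OF repelling_finite repelling_shift])
    fix w assume w: "repelling w"
    obtain z where z: "lifted_solution f z" "z 0 = w 0 + d / 2" using solution_exists by blast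
    have "\<not> repelling z" using d(2)[OF w, of z 0] z d(1) by force
    then obtain C m where "0 < m" "contracting {0..} C m (\<lambda>t. fx t (z t))"
      using not_repelling_contracting z by blast
    from contracting_eventually[OF this]
    show "\<forall>\<^sub>F k in sequentially. ?P w k" by eventually_elim (use z in blast)
  next
    fix w k and n :: int assume "?P w k"
    then obtain z where "lifted_solution f z" "z 0 = w 0 + d / 2"
      "contracting {0..} (real k) (1 / (real k + 1)) (\<lambda>t. fx t (z t))" by blast
    then show "?P (\<lambda>t. w t + of_int n) k"
      by (intro exI[of _ "\<lambda>t. z t + of_int n"]) (simp add: fx_periodic_int solution_shift_int)
  qed
  then obtain k0 where k0: "\<And>w. repelling w \<Longrightarrow> ?P w k0" by blast
  define C where "C = real k0"
  define m where "m = 1 / (real k0 + 1)"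
  have m: "0 < m" by (simp add: m_def)
  define P where "P k l u \<longleftrightarrow> real k \<le> l \<and> almost_period (1 / (real k + 1)) l \<and> lifted_solution f u \<and>
      contracting {0..} C m (\<lambda>t. fx t (u t)) \<and> w 0 - 1 / (real k + 1) \<le> u l \<and> u l \<le> w' 0 + 1 / (real k + 1)"
    for k :: nat and l u
  have "\<exists>l u. P k l u" for k
  proof -
    \<comment> \<open>The first bound confines the limit to the interval from \<open>w 0\<close> to
      \<open>w' 0\<close>, the second keeps the shadows \<open>v\<close> and \<open>v'\<close> in
      order.\<close>
    define \<eta> where "\<eta> = min (1 / (real k + 1)) ((w' 0 - w 0) / 4)"
    have \<eta>: "\<eta> \<le> 1 / (real k + 1)" "\<eta> \<le> (w' 0 - w 0) / 4" "0 < \<eta>"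
      unfolding \<eta>_def by (rule min.cobounded1, rule min.cobounded2) (use w(3) in simp)
    obtain \<epsilon> where \<epsilon>: "0 < \<epsilon>" and shadow: "\<And>w l. repelling w \<Longrightarrow> almost_period \<epsilon> l \<Longrightarrow>
        \<exists>y. repelling y \<and> (\<forall>t. \<bar>y t - w (t + l)\<bar> \<le> \<eta>)" using repelling_shadow[OF \<eta>(3)] by blast
    have "0 < min \<epsilon> (1 / (real k + 1))" using \<epsilon> by simp
    then obtain l where l: "real k \<le> l" "almost_period (min \<epsilon> (1 / (real k + 1))) l"
      using almost_period_beyond by blast
    have l1: "almost_period \<epsilon> (- l)" and l2: "almost_period (1 / (real k + 1)) l"
      using l(2) almost_period_mono almost_period_minus by auto
    obtain v where v: "repelling v" "\<And>t. \<bar>v t - w (t + - l)\<bar> \<le> \<eta>" using shadow[OF w(1) l1] by blast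
    obtain v' where v': "repelling v'" "\<And>t. \<bar>v' t - w' (t + - l)\<bar> \<le> \<eta>" using shadow[OF w(2) l1] by blast
    have vl: "\<bar>v l - w 0\<bar> \<le> \<eta>" "\<bar>v' l - w' 0\<bar> \<le> \<eta>" using v(2)[of l] v'(2)[of l] by simp_all
    moreover have "4 * \<eta> \<le> w' 0 - w 0" using \<eta>(2) by simp
    ultimately have "v l < v' l" using w(3) by linarith
    then have "v 0 < v' 0" using solution_less v(1) v'(1) repelling_solution by blast
    then have "d \<le> v' 0 - v 0" using d(2)[OF v(1) v'(1), of 0] by auto
    moreover obtain u where u: "lifted_solution f u" "u 0 = v 0 + d / 2" "contracting {0..} C m (\<lambda>t. fx t (u t))"
      using k0[OF v(1)] by (auto simp: C_def m_def)
    ultimately have "v 0 < u 0" "u 0 < v' 0" using d(1) by auto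
    then have "v l < u l" "u l < v' l" using solution_less u(1) v(1) v'(1) repelling_solution by blast+
    then have "w 0 - 1 / (real k + 1) \<le> u l" "u l \<le> w' 0 + 1 / (real k + 1)" using vl \<eta>(1) by linarith+
    then show ?thesis using l(1) l2 u unfolding P_def by blast
  qed
  then obtain l u where "\<And>k. P k (l k) (u k)" by metis
  then have l: "\<And>k. real k \<le> l k" "\<And>k. almost_period (1 / (real k + 1)) (l k)"
    and u: "\<And>k. lifted_solution f (u k)" "\<And>k. contracting {0..} C m (\<lambda>t. fx t (u k t))"
    and ul: "\<And>k. w 0 - 1 / (real k + 1) \<le> u k (l k)" "\<And>k. u k (l k) \<le> w' 0 + 1 / (real k + 1)"
    unfolding P_def by auto
  have "bounded (range (\<lambda>k. u k (l k)))"
    unfolding bounded_iff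
  proof (intro exI[of _ "\<bar>w 0\<bar> + \<bar>w' 0\<bar> + 1"] ballI)
    fix x assume "x \<in> range (\<lambda>k. u k (l k))"
    then obtain k where "x = u k (l k)" by auto
    moreover have "1 / (real k + 1) \<le> 1" by simp
    ultimately show "norm x \<le> \<bar>w 0\<bar> + \<bar>w' 0\<bar> + 1" using ul[of k] unfolding real_norm_def by linarith
  qed
  then obtain r s where r: "strict_mono (r :: nat \<Rightarrow> nat)" and s: "lifted_solution f s"
    and lim: "(\<lambda>k. u (r k) (l (r k))) \<longlonglongrightarrow> s 0"
    using translates_cluster[where u = u and l = l, OF u(1) l(2) inverse_Suc_tendsto] by blast
  have lim_r: "(\<lambda>k. 1 / (real (r k) + 1)) \<longlonglongrightarrow> 0"
    using LIMSEQ_subseq_LIMSEQ[OF inverse_Suc_tendsto r] by (simp add: o_def)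
  have contr: "contracting UNIV C m (\<lambda>t. fx t (s t))"
  proof (rule contracting_limit[OF u(1) l(2) lim_r s lim])
    fix x t :: real assume "x \<le> t"
    show "\<forall>\<^sub>F k in sequentially. integral {x + l (r k)..t + l (r k)} (\<lambda>t. fx t (u (r k) t)) \<le> C - m * (t - x)"
    proof (rule eventually_sequentiallyI)
      fix k assume "nat \<lceil>- x\<rceil> \<le> k"
      then have "- x \<le> l (r k)" using seq_suble[OF r, of k] l(1)[of "r k"] by linarith
      then show "integral {x + l (r k)..t + l (r k)} (\<lambda>t. fx t (u (r k) t)) \<le> C - m * (t - x)"
        using u(2)[of "r k", unfolded contracting_def, rule_format, of "x + l (r k)" "t + l (r k)"] \<open>x \<le> t\<close>
        by simp
    qed
  qed
  then have "attracting s" using m s unfolding attracting_iff by blast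
  have "w 0 - 0 \<le> s 0"
    by (rule LIMSEQ_le[OF tendsto_diff[OF tendsto_const lim_r] lim]) (use ul in blast)
  moreover have "s 0 \<le> w' 0 + 0"
    by (rule LIMSEQ_le[OF lim tendsto_add[OF tendsto_const lim_r]]) (use ul in blast)
  moreover have "s 0 \<noteq> w 0" "s 0 \<noteq> w' 0"
    using solution_unique[OF s] repelling_solution w attracting_not_repelling[OF \<open>attracting s\<close>] by metis+
  ultimately show thesis using \<open>attracting s\<close> by (intro that[of s]) auto
qed

text \<open>Suppose the strip from \<open>s\<close> to \<open>s'\<close> is free of repelling
  solutions. In the far past its width stays above some \<open>d\<close>, by isolation of attracting
  solutions. Limits of translates into the past are two attracting solutions with gap at least
  \<open>d\<close> at all times and no repelling solution between them, hence asymptotic in the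
  future: a contradiction.\<close>

lemma repelling_between:
  assumes s: "attracting s" "attracting s'" "s 0 < s' 0"
  obtains w where "repelling w" "s 0 < w 0" "w 0 < s' 0"
proof (rule ccontr)
  note result = that
  assume "\<not> thesis"
  then have none: "\<not> (s 0 < w 0 \<and> w 0 < s' 0)" if w: "repelling w" for w
    using result[OF w] \<open>\<not> thesis\<close> by blast
  have none_t: "\<not> (s t < w t \<and> w t < s' t)" if "repelling w" for w t
    using none[OF that] solution_less s that repelling_solution attracting_solution by metis
  note sol = attracting_solution[OF s(1)] attracting_solution[OF s(2)]
  \<comment> \<open>Every interval of length 1 contains a repelling solution at each time, so the
    free strip is narrower; this bounds the translates of \<open>s'\<close> along with those of
    \<open>s\<close>.\<close>
  have close: "s' t - s t < 1" for t
  proof (rule ccontr)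
    assume "\<not> s' t - s t < 1"
    moreover obtain w where w: "repelling w" "s t \<le> w t" "w t < s t + 1" using repelling_exists by blast
    moreover have "w t \<noteq> s t" using solution_unique sol w repelling_solution attracting_not_repelling s by metis
    ultimately show False using none_t[OF w(1), of t] by linarith
  qed
  have less: "s t < s' t" for t using solution_less[OF sol s(3)] .
  obtain C m where m: "0 < m" "contracting UNIV C m (\<lambda>t. fx t (s t))" using s(1) unfolding attracting_iff by blast
  obtain C' m' where m': "0 < m'" "contracting UNIV C' m' (\<lambda>t. fx t (s' t))" using s(2) unfolding attracting_iff by blast
  obtain d where d: "0 < d" "\<forall>u y. lifted_solution f u \<longrightarrow> contracting UNIV C m (\<lambda>t. fx t (u t)) \<longrightarrow>
    lifted_solution f y \<longrightarrow> (\<forall>T. \<exists>t\<le>T. \<bar>y t - u t\<bar> \<le> d) \<longrightarrow> y = u" using stable_isolated[OF m(1), of C] by blast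
  have "\<not> (\<forall>T. \<exists>t\<le>T. \<bar>s' t - s t\<bar> \<le> d)"
  proof
    assume "\<forall>T. \<exists>t\<le>T. \<bar>s' t - s t\<bar> \<le> d"
    then have "s' = s" by (intro d(2)[rule_format, OF sol(1) m(2) sol(2)]) blast
    with s(3) show False by simp
  qed
  then obtain T where T0: "\<And>t. t \<le> T \<Longrightarrow> \<not> \<bar>s' t - s t\<bar> \<le> d" by blast
  have T: "d < s' t - s t" if "t \<le> T" for t using T0[OF that] less[of t] by simp
  \<comment> \<open>The integer \<open>n\<close> brings the value at the translation time into
    \<open>[0, 1)\<close>, so that a subsequence converges.\<close>
  have "\<exists>l n. l \<le> - real k \<and> almost_period (1 / (real k + 1)) l \<and> 0 \<le> s l + of_int n \<and> s l + of_int n < 1" for k :: nat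
  proof -
    obtain l where "real k \<le> l" "almost_period (1 / (real k + 1)) l"
      using almost_period_beyond[of "1 / (real k + 1)" "real k"] by auto
    then have "- l \<le> - real k" "almost_period (1 / (real k + 1)) (- l)" using almost_period_minus by auto
    moreover obtain n :: int where "0 \<le> s (- l) + of_int n" "s (- l) + of_int n < 0 + 1" using shift_to_unit by blast
    ultimately show ?thesis by (intro exI[of _ "- l"] exI[of _ n]) simp
  qed
  then obtain l n where l: "\<And>k. l k \<le> - real k" "\<And>k. almost_period (1 / (real k + 1)) (l k)"
    and n: "\<And>k. 0 \<le> s (l k) + of_int (n k)" "\<And>k. s (l k) + of_int (n k) < 1" by metis
  define u where "u k t = s t + of_int (n k)" for k t
  define u' where "u' k t = s' t + of_int (n k)" for k t
  have u: "lifted_solution f (u k)" "lifted_solution f (u' k)" for k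
    unfolding u_def u'_def by (intro solution_shift_int sol)+
  have "bounded (range (\<lambda>k. u k (l k)))"
    unfolding bounded_iff using n by (intro exI[of _ 1]) (auto simp: u_def abs_le_iff less_imp_le intro: order_trans[of _ 0])
  then obtain r y where r: "strict_mono (r :: nat \<Rightarrow> nat)" and y: "lifted_solution f y"
    and lim: "(\<lambda>k. u (r k) (l (r k))) \<longlonglongrightarrow> y 0"
    using translates_cluster[where u = u and l = l, OF u(1) l(2) inverse_Suc_tendsto] by blast
  have lim_r: "(\<lambda>k. 1 / (real (r k) + 1)) \<longlonglongrightarrow> 0"
    using LIMSEQ_subseq_LIMSEQ[OF inverse_Suc_tendsto r] by (simp add: o_def)
  have "bounded (range (\<lambda>k. u' (r k) (l (r k))))"
    unfolding bounded_iff
  proof (intro exI[of _ 2] ballI)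
    fix x assume "x \<in> range (\<lambda>k. u' (r k) (l (r k)))"
    then obtain k where "x = u' (r k) (l (r k))" by auto
    then show "norm x \<le> 2" using n[of "r k"] close[of "l (r k)"] less[of "l (r k)"]
      unfolding u'_def real_norm_def by linarith
  qed
  then obtain r' y' where r': "strict_mono (r' :: nat \<Rightarrow> nat)" and y': "lifted_solution f y'"
    and lim': "(\<lambda>k. u' (r (r' k)) (l (r (r' k)))) \<longlonglongrightarrow> y' 0"
    using translates_cluster[where u = "\<lambda>k. u' (r k)" and l = "\<lambda>k. l (r k)", OF u(2) l(2) lim_r] by blast
  define q where "q k = r (r' k)" for k
  have q: "k \<le> q k" for k using seq_suble[OF r, of "r' k"] seq_suble[OF r', of k] by (simp add: q_def)
  have lim_q: "(\<lambda>k. 1 / (real (q k) + 1)) \<longlonglongrightarrow> 0"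
    using LIMSEQ_subseq_LIMSEQ[OF lim_r r'] by (simp add: o_def q_def)
  have lim_y: "(\<lambda>k. u (q k) (l (q k))) \<longlonglongrightarrow> y 0"
    using LIMSEQ_subseq_LIMSEQ[OF lim r'] by (simp add: o_def q_def)
  have lim_y': "(\<lambda>k. u' (q k) (l (q k))) \<longlonglongrightarrow> y' 0" using lim' by (simp add: q_def)
  have shifted: "integral {x + l k..t + l k} (\<lambda>t. fx t (v t + of_int (n k))) \<le> C - m * (t - x)"
    if "contracting UNIV C m (\<lambda>t. fx t (v t))" "x \<le> t" for v C m x t k
    using that(1)[unfolded contracting_def, rule_format, of "x + l k" "t + l k"] that(2)
    by (simp add: fx_periodic_int)
  have "contracting UNIV C m (\<lambda>t. fx t (y t))"
    by (rule contracting_limit[OF u(1) l(2) lim_q y lim_y])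
      (simp add: u_def shifted[OF m(2)])
  then have "attracting y" using m(1) y unfolding attracting_iff by blast
  have "contracting UNIV C' m' (\<lambda>t. fx t (y' t))"
    by (rule contracting_limit[OF u(2) l(2) lim_q y' lim_y'])
      (simp add: u'_def shifted[OF m'(2)])
  then have "attracting y'" using m'(1) y' unfolding attracting_iff by blast
  have gap: "d \<le> y' t - y t" for t
  proof (rule tendsto_lowerbound)
    show "((\<lambda>k. u' (q k) (t + l (q k)) - u (q k) (t + l (q k))) \<longlongrightarrow> y' t - y t) sequentially"
      by (intro tendsto_diff translates_tendsto[OF u(1) l(2) lim_q y lim_y]
          translates_tendsto[OF u(2) l(2) lim_q y' lim_y'])
    show "\<forall>\<^sub>F k in sequentially. d \<le> u' (q k) (t + l (q k)) - u (q k) (t + l (q k))"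
    proof (rule eventually_sequentiallyI)
      fix k assume "nat \<lceil>t - T\<rceil> \<le> k"
      then have "t + l (q k) \<le> T" using q[of k] l(1)[of "q k"] by linarith
      from T[OF this] show "d \<le> u' (q k) (t + l (q k)) - u (q k) (t + l (q k))"
        by (simp add: u_def u'_def)
    qed
  qed simp
  \<comment> \<open>A repelling solution between the limits, translated back by
    \<open>- l (q k)\<close> and shadowed, would give one between \<open>s\<close> and
    \<open>s'\<close>.\<close>
  have no_rep: "\<not> (y 0 \<le> w 0 \<and> w 0 \<le> y' 0)" if w: "repelling w" for w
  proof
    assume "y 0 \<le> w 0 \<and> w 0 \<le> y' 0"
    moreover have "w 0 \<noteq> y 0" "w 0 \<noteq> y' 0"
      using solution_unique y y' repelling_solution[OF w] attracting_not_repelling \<open>attracting y\<close>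
        \<open>attracting y'\<close> w by metis+
    ultimately have less: "y 0 < w 0" "w 0 < y' 0" by auto
    define \<eta> where "\<eta> = min (w 0 - y 0) (y' 0 - w 0) / 2"
    have \<eta>: "0 < \<eta>" "y 0 + \<eta> < w 0" "w 0 + \<eta> < y' 0" using less by (auto simp: \<eta>_def min_def field_simps)
    obtain \<epsilon> where \<epsilon>: "0 < \<epsilon>" and shadow: "\<And>w l. repelling w \<Longrightarrow> almost_period \<epsilon> l \<Longrightarrow>
        \<exists>y. repelling y \<and> (\<forall>t. \<bar>y t - w (t + l)\<bar> \<le> \<eta>)" using repelling_shadow[OF \<eta>(1)] by blast
    have "\<forall>\<^sub>F k in sequentially. u (q k) (l (q k)) < w 0 - \<eta>"
      by (rule order_tendstoD(2)[OF lim_y]) (use \<eta> in simp)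
    moreover have "\<forall>\<^sub>F k in sequentially. w 0 + \<eta> < u' (q k) (l (q k))"
      by (rule order_tendstoD(1)[OF lim_y']) (use \<eta> in simp)
    moreover have "\<forall>\<^sub>F k in sequentially. 1 / (real (q k) + 1) < \<epsilon>"
      by (rule order_tendstoD(2)[OF lim_q \<epsilon>])
    ultimately have "\<forall>\<^sub>F k in sequentially. u (q k) (l (q k)) < w 0 - \<eta> \<and> w 0 + \<eta> < u' (q k) (l (q k)) \<and>
      1 / (real (q k) + 1) < \<epsilon>" by (intro eventually_conj)
    then obtain k where k: "u (q k) (l (q k)) < w 0 - \<eta>" "w 0 + \<eta> < u' (q k) (l (q k))"
      "1 / (real (q k) + 1) < \<epsilon>" using eventually_happens'[OF sequentially_bot] by blast
    have "almost_period \<epsilon> (- l (q k))"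
      using almost_period_mono[OF l(2)] k(3) by (intro almost_period_minus) auto
    then obtain v where v: "repelling v" "\<And>t. \<bar>v t - w (t + - l (q k))\<bar> \<le> \<eta>" using shadow[OF w] by blast
    have "\<bar>v (l (q k)) - w 0\<bar> \<le> \<eta>" using v(2)[of "l (q k)"] by simp
    then have "u (q k) (l (q k)) < v (l (q k))" "v (l (q k)) < u' (q k) (l (q k))" using k by linarith+
    then have "s (l (q k)) < v (l (q k)) + of_int (- n (q k))" "v (l (q k)) + of_int (- n (q k)) < s' (l (q k))"
      by (simp_all add: u_def u'_def)
    with none_t[OF repelling_shift[OF v(1), of "- n (q k)"]] show False by blast
  qed
  have "((\<lambda>t. y t - y' t) \<longlongrightarrow> 0) at_top"
  proof (rule no_repelling_between_asymptotic[OF y y'])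
    show "y 0 \<le> y' 0" using gap[of 0] d(1) by simp
  qed (rule no_rep)
  then have "\<forall>\<^sub>F t in at_top. dist (y t - y' t) 0 < d" using d(1) by (rule tendstoD)
  then obtain t where "dist (y t - y' t) 0 < d" using eventually_happens'[OF trivial_limit_at_top_linorder] by blast
  with gap[of t] show False by (simp add: dist_real_def)
qed

text \<open>Each attracting solution is sent to the first repelling one above it, which is less than
  1 away and therefore starts in \<open>[0, 2]\<close>. By \<open>repelling_between\<close> this map
  is injective.\<close>

lemma attracting_finite: "finite {s. attracting s \<and> 0 \<le> s 0 \<and> s 0 \<le> 1}"
proof -
  let ?A = "{s. attracting s \<and> 0 \<le> s 0 \<and> s 0 \<le> 1}"
  let ?W = "{w. repelling w \<and> 0 \<le> w 0 \<and> w 0 \<le> 2}"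
  have ex: "\<exists>w. w \<in> ?W \<and> s 0 < w 0 \<and> (\<forall>v. repelling v \<longrightarrow> s 0 < v 0 \<longrightarrow> w 0 \<le> v 0)" if "s \<in> ?A" for s
  proof -
    let ?V = "{w\<in>?W. s 0 < w 0}"
    obtain w where w: "repelling w" "s 0 \<le> w 0" "w 0 < s 0 + 1" using repelling_exists by blast
    moreover have "w 0 \<noteq> s 0" using solution_unique w that repelling_solution attracting_solution
      attracting_not_repelling by (metis (no_types, lifting) mem_Collect_eq)
    ultimately have "w \<in> ?V" using that by auto
    moreover have "finite ?V" by (rule finite_subset[OF _ repelling_finite[of 0 2]]) auto
    ultimately obtain v where v: "is_arg_min (\<lambda>w. w 0) (\<lambda>w. w \<in> ?V) v"
      using ex_is_arg_min_if_finite[of ?V "\<lambda>w. w 0"] by blast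
    have "v 0 \<le> z 0" if "repelling z" "s 0 < z 0" for z
    proof (cases "z 0 \<le> 2")
      case True
      then show ?thesis using v that \<open>s \<in> ?A\<close> unfolding is_arg_min_def by (force simp: not_less)
    next
      case False
      then show ?thesis using v unfolding is_arg_min_def by auto
    qed
    with v show ?thesis unfolding is_arg_min_def by blast
  qed
  then have "\<forall>s\<in>?A. \<exists>w. w \<in> ?W \<and> s 0 < w 0 \<and> (\<forall>v. repelling v \<longrightarrow> s 0 < v 0 \<longrightarrow> w 0 \<le> v 0)"
    by (rule ballI)
  from bchoice[OF this] obtain g
    where g': "\<forall>s\<in>?A. g s \<in> ?W \<and> s 0 < g s 0 \<and> (\<forall>v. repelling v \<longrightarrow> s 0 < v 0 \<longrightarrow> g s 0 \<le> v 0)" ..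
  have g: "g s \<in> ?W" "s 0 < g s 0" "repelling v \<Longrightarrow> s 0 < v 0 \<Longrightarrow> g s 0 \<le> v 0" if "s \<in> ?A" for s v
    using bspec[OF g' that] by blast+
  have less: "g s 0 < g s' 0" if h: "s \<in> ?A" "s' \<in> ?A" "s 0 < s' 0" for s s'
  proof -
    obtain w where "repelling w" "s 0 < w 0" "w 0 < s' 0" using repelling_between[of s s'] h by blast
    with g(3)[OF h(1), of w] g(2)[OF h(2)] show ?thesis by linarith
  qed
  have "inj_on g ?A"
  proof (rule inj_onI)
    fix s s' assume h: "s \<in> ?A" "s' \<in> ?A" "g s = g s'"
    then have "s 0 = s' 0" using less[of s s'] less[of s' s] by (metis less_irrefl linorder_neqE_linordered_idom)
    then show "s = s'" using h solution_unique attracting_solution by blast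
  qed
  moreover have "g ` ?A \<subseteq> ?W" by (rule image_subsetI) (rule g(1))
  then have "finite (g ` ?A)" by (rule finite_subset) (rule repelling_finite)
  ultimately show ?thesis by (rule finite_imageD[rotated])
qed

lemma attracting_uniform:
  obtains C m where "0 < m" "\<And>s. attracting s \<Longrightarrow> contracting UNIV C m (\<lambda>t. fx t (s t))"
proof -
  have "\<exists>k. \<forall>s. attracting s \<longrightarrow> contracting UNIV (real k) (1 / (real k + 1)) (\<lambda>t. fx t (s t))"
  proof (rule uniform_over_period[OF attracting_finite attracting_shift])
    fix s assume "attracting s"
    then show "\<forall>\<^sub>F k in sequentially. contracting UNIV (real k) (1 / (real k + 1)) (\<lambda>t. fx t (s t))"
      using contracting_eventually unfolding attracting_iff by blast
  qed (simp_all add: fx_periodic_int)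
  then obtain k where "\<And>s. attracting s \<Longrightarrow> contracting UNIV (real k) (1 / (real k + 1)) (\<lambda>t. fx t (s t))"
    by blast
  then show thesis by (intro that[of "1 / (real k + 1)" "real k"]) auto
qed

lemma attracting_shadow:
  assumes "0 < \<eta>"
  shows "\<exists>\<epsilon>>0. \<forall>s l. attracting s \<longrightarrow> almost_period \<epsilon> l \<longrightarrow> (\<exists>y. attracting y \<and> (\<forall>t. \<bar>y t - s (t + l)\<bar> \<le> \<eta>))"
proof -
  obtain C m where m: "0 < m" and C: "\<And>s. attracting s \<Longrightarrow> contracting UNIV C m (\<lambda>t. fx t (s t))"
    using attracting_uniform by blast
  obtain \<epsilon> where \<epsilon>: "0 < \<epsilon>" and *: "\<forall>s l. lifted_solution f s \<longrightarrow> contracting UNIV C m (\<lambda>t. fx t (s t)) \<longrightarrow>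
    almost_period \<epsilon> l \<longrightarrow> (\<exists>y. lifted_solution f y \<and> contracting UNIV C (m / 2) (\<lambda>t. fx t (y t)) \<and>
      (\<forall>t. \<bar>y t - s (t + l)\<bar> \<le> \<eta>))"
    using stable_shadow[OF m assms, of C] by blast
  have "\<exists>y. attracting y \<and> (\<forall>t. \<bar>y t - s (t + l)\<bar> \<le> \<eta>)" if s: "attracting s" "almost_period \<epsilon> l" for s l
  proof -
    obtain y where "lifted_solution f y" "contracting UNIV C (m / 2) (\<lambda>t. fx t (y t))"
      "\<forall>t. \<bar>y t - s (t + l)\<bar> \<le> \<eta>"
      using *[rule_format, OF attracting_solution[OF s(1)] C[OF s(1)] s(2)] by blast
    moreover have "0 < m / 2" using m by simp
    ultimately show ?thesis unfolding attracting_iff by blast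
  qed
  with \<epsilon> show ?thesis by blast
qed

text \<open>A solution staying away from all attracting and repelling ones for arbitrarily long times would, by
  translation through almost periods, give one staying away from them forever; but that one is
  stable in the future, so its translates accumulate at an attracting solution.\<close>

lemma passage_time:
  assumes \<eta>: "0 < \<eta>"
  shows "\<exists>T>0. \<forall>z t. lifted_solution f z \<longrightarrow>
    (\<exists>x p. t \<le> x \<and> x \<le> t + T \<and> (attracting p \<or> repelling p) \<and> \<bar>z x - p x\<bar> < \<eta>)"
proof (rule ccontr)
  assume "\<not> ?thesis"
  then have neg: "\<exists>z t. lifted_solution f z \<and>
      (\<forall>x p. t \<le> x \<longrightarrow> x \<le> t + T \<longrightarrow> attracting p \<or> repelling p \<longrightarrow> \<eta> \<le> \<bar>z x - p x\<bar>)" if "0 < T" for T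
    using that by (meson not_less)
  obtain \<epsilon> where \<epsilon>: "0 < \<epsilon>" and shadow: "\<And>p l. attracting p \<or> repelling p \<Longrightarrow> almost_period \<epsilon> l \<Longrightarrow>
      \<exists>p'. (attracting p' \<or> repelling p') \<and> (\<forall>t. \<bar>p' t - p (t + l)\<bar> \<le> \<eta> / 4)"
  proof -
    have \<eta>4: "0 < \<eta> / 4" using \<eta> by simp
    from repelling_shadow[OF \<eta>4] obtain \<epsilon>1 where 1: "0 < \<epsilon>1" "\<And>p l. repelling p \<Longrightarrow> almost_period \<epsilon>1 l \<Longrightarrow>
      \<exists>p'. repelling p' \<and> (\<forall>t. \<bar>p' t - p (t + l)\<bar> \<le> \<eta> / 4)" by blast
    from attracting_shadow[OF \<eta>4] obtain \<epsilon>2 where 2: "0 < \<epsilon>2" "\<And>p l. attracting p \<Longrightarrow> almost_period \<epsilon>2 l \<Longrightarrow>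
      \<exists>p'. attracting p' \<and> (\<forall>t. \<bar>p' t - p (t + l)\<bar> \<le> \<eta> / 4)" by blast
    show thesis
    proof (rule that[of "min \<epsilon>1 \<epsilon>2"])
      fix p l assume p: "attracting p \<or> repelling p" and l: "almost_period (min \<epsilon>1 \<epsilon>2) l"
      have "almost_period \<epsilon>1 l" "almost_period \<epsilon>2 l" using almost_period_mono[OF l] by auto
      with p 1(2) 2(2) show "\<exists>p'. (attracting p' \<or> repelling p') \<and> (\<forall>t. \<bar>p' t - p (t + l)\<bar> \<le> \<eta> / 4)" by meson
    qed (use 1 2 in auto)
  qed
  \<comment> \<open>An interval of length \<open>G + 2 * real j\<close> without close encounters
    contains an almost period \<open>l\<close> together with its
    \<open>j\<close>-neighborhood.\<close>
  have "\<exists>l u. almost_period (1 / (real j + 1)) l \<and> lifted_solution f u \<and> 0 \<le> u l \<and> u l < 1 \<and>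
      (\<forall>x p. \<bar>x\<bar> \<le> real j \<longrightarrow> attracting p \<or> repelling p \<longrightarrow> \<eta> \<le> \<bar>u (x + l) - p (x + l)\<bar>)" for j :: nat
  proof -
    obtain G where G: "0 < G" "\<And>a. \<exists>l. a < l \<and> l < a + G \<and> almost_period (1 / (real j + 1)) l"
      using recurrent[of "1 / (real j + 1)"] by auto
    have "0 < G + 2 * real j" using G by simp
    from neg[OF this] obtain z t where z: "lifted_solution f z" and
      far: "\<And>x p. t \<le> x \<Longrightarrow> x \<le> t + (G + 2 * real j) \<Longrightarrow> attracting p \<or> repelling p \<Longrightarrow> \<eta> \<le> \<bar>z x - p x\<bar>"
      by blast
    obtain l where l: "t + real j < l" "l < t + real j + G" "almost_period (1 / (real j + 1)) l" using G(2) by blast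
    obtain n :: int where n: "0 \<le> z l + of_int n" "z l + of_int n < 0 + 1" using shift_to_unit by blast
    have "\<eta> \<le> \<bar>z (x + l) + of_int n - p (x + l)\<bar>" if "\<bar>x\<bar> \<le> real j" "attracting p \<or> repelling p" for x p
    proof -
      have "attracting (\<lambda>t. p t + of_int (- n)) \<or> repelling (\<lambda>t. p t + of_int (- n))"
        using that(2) attracting_shift repelling_shift by blast
      from far[OF _ _ this, of "x + l"] that(1) l show ?thesis by (simp add: algebra_simps abs_le_iff)
    qed
    with l(3) n solution_shift_int[OF z, of n] show ?thesis
      by (intro exI[of _ l] exI[of _ "\<lambda>t. z t + of_int n"]) simp
  qed
  then obtain l u where l: "\<And>j. almost_period (1 / (real j + 1)) (l j)" and u: "\<And>j. lifted_solution f (u j)"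
    and u0: "\<And>j. 0 \<le> u j (l j)" "\<And>j. u j (l j) < 1" and
    far: "\<And>j x p. \<bar>x\<bar> \<le> real j \<Longrightarrow> attracting p \<or> repelling p \<Longrightarrow> \<eta> \<le> \<bar>u j (x + l j) - p (x + l j)\<bar>"
    by metis
  have "bounded (range (\<lambda>k. u k (l k)))"
    unfolding bounded_iff using u0 by (intro exI[of _ 1]) (auto simp: abs_le_iff less_imp_le intro: order_trans[of _ 0])
  then obtain r y where r: "strict_mono (r :: nat \<Rightarrow> nat)" and y: "lifted_solution f y"
    and lim: "\<And>t. (\<lambda>k. u (r k) (t + l (r k))) \<longlonglongrightarrow> y t"
    using translates_cluster[where u = u and l = l, OF u l inverse_Suc_tendsto] by blast
  have lim_r: "(\<lambda>k. 1 / (real (r k) + 1)) \<longlonglongrightarrow> 0"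
    using LIMSEQ_subseq_LIMSEQ[OF inverse_Suc_tendsto r] by (simp add: o_def)
  \<comment> \<open>Half of \<open>\<eta>\<close> is lost: a quarter to the convergence and a
    quarter to the shadow of \<open>p\<close>.\<close>
  have y_far: "\<eta> / 2 \<le> \<bar>y t - p t\<bar>" if p: "attracting p \<or> repelling p" for p t
  proof -
    have "\<forall>\<^sub>F k in sequentially. dist (u (r k) (t + l (r k))) (y t) < \<eta> / 4"
      using tendstoD[OF lim] \<eta> by (metis divide_pos_pos zero_less_numeral)
    moreover have "\<forall>\<^sub>F k in sequentially. 1 / (real (r k) + 1) < \<epsilon>"
      by (rule order_tendstoD(2)[OF lim_r \<epsilon>])
    moreover have "\<forall>\<^sub>F k in sequentially. \<bar>t\<bar> \<le> real (r k)"
    proof (rule eventually_sequentiallyI)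
      fix k assume "nat \<lceil>\<bar>t\<bar>\<rceil> \<le> k"
      then show "\<bar>t\<bar> \<le> real (r k)" using seq_suble[OF r, of k] by linarith
    qed
    ultimately have "\<forall>\<^sub>F k in sequentially. dist (u (r k) (t + l (r k))) (y t) < \<eta> / 4 \<and>
      1 / (real (r k) + 1) < \<epsilon> \<and> \<bar>t\<bar> \<le> real (r k)" by (intro eventually_conj)
    then obtain k where k: "dist (u (r k) (t + l (r k))) (y t) < \<eta> / 4" "1 / (real (r k) + 1) < \<epsilon>"
      "\<bar>t\<bar> \<le> real (r k)" using eventually_happens'[OF sequentially_bot] by blast
    have "almost_period \<epsilon> (- l (r k))" using almost_period_mono[OF l] k(2) by (intro almost_period_minus) auto
    then obtain p' where p': "attracting p' \<or> repelling p'" "\<And>t. \<bar>p' t - p (t + - l (r k))\<bar> \<le> \<eta> / 4"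
      using shadow[OF p] by blast
    have "\<bar>p' (t + l (r k)) - p t\<bar> \<le> \<eta> / 4" using p'(2)[of "t + l (r k)"] by simp
    with far[OF k(3) p'(1)] k(1) show ?thesis unfolding dist_real_def by linarith
  qed
  have "\<not> repelling y" using y_far[of y 0] \<eta> by auto
  then obtain C m where m: "0 < m" "contracting {0..} C m (\<lambda>t. fx t (y t))"
    using not_repelling_contracting[OF y] by blast
  \<comment> \<open>Now \<open>y\<close> itself is translated into its future, where it contracts.
    The limit is attracting, and a shadow of it comes too close to \<open>y\<close>.\<close>
  have "\<exists>l n. real k \<le> l \<and> almost_period (1 / (real k + 1)) l \<and> 0 \<le> y l + of_int n \<and> y l + of_int n < 1" for k :: nat
  proof -
    obtain l where "real k \<le> l" "almost_period (1 / (real k + 1)) l"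
      using almost_period_beyond[of "1 / (real k + 1)" "real k"] by auto
    moreover obtain n :: int where "0 \<le> y l + of_int n" "y l + of_int n < 0 + 1" using shift_to_unit by blast
    ultimately show ?thesis by auto
  qed
  then obtain l n where l: "\<And>k. real k \<le> l k" "\<And>k. almost_period (1 / (real k + 1)) (l k)"
    and n: "\<And>k. 0 \<le> y (l k) + of_int (n k)" "\<And>k. y (l k) + of_int (n k) < 1" by metis
  define v where "v k t = y t + of_int (n k)" for k t
  have v: "lifted_solution f (v k)" for k unfolding v_def by (intro solution_shift_int y)
  have "bounded (range (\<lambda>k. v k (l k)))"
    unfolding bounded_iff using n by (intro exI[of _ 1]) (auto simp: v_def abs_le_iff less_imp_le intro: order_trans[of _ 0])
  then obtain r s where r: "strict_mono (r :: nat \<Rightarrow> nat)" and s: "lifted_solution f s"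
    and lim: "(\<lambda>k. v (r k) (l (r k))) \<longlonglongrightarrow> s 0"
    using translates_cluster[where u = v and l = l, OF v l(2) inverse_Suc_tendsto] by blast
  have lim_r: "(\<lambda>k. 1 / (real (r k) + 1)) \<longlonglongrightarrow> 0"
    using LIMSEQ_subseq_LIMSEQ[OF inverse_Suc_tendsto r] by (simp add: o_def)
  have "contracting UNIV C m (\<lambda>t. fx t (s t))"
  proof (rule contracting_limit[OF v l(2) lim_r s lim])
    fix x t :: real assume "x \<le> t"
    show "\<forall>\<^sub>F k in sequentially. integral {x + l (r k)..t + l (r k)} (\<lambda>t. fx t (v (r k) t)) \<le> C - m * (t - x)"
    proof (rule eventually_sequentiallyI)
      fix k assume "nat \<lceil>- x\<rceil> \<le> k"
      then have "- x \<le> l (r k)" using seq_suble[OF r, of k] l(1)[of "r k"] by linarith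
      then show "integral {x + l (r k)..t + l (r k)} (\<lambda>t. fx t (v (r k) t)) \<le> C - m * (t - x)"
        using m(2)[unfolded contracting_def, rule_format, of "x + l (r k)" "t + l (r k)"] \<open>x \<le> t\<close>
        by (simp add: v_def fx_periodic_int)
    qed
  qed
  then have "attracting s" using m(1) s unfolding attracting_iff by blast
  have "\<forall>\<^sub>F k in sequentially. dist (v (r k) (l (r k))) (s 0) < \<eta> / 4"
    using tendstoD[OF lim] \<eta> by (metis divide_pos_pos zero_less_numeral)
  moreover have "\<forall>\<^sub>F k in sequentially. 1 / (real (r k) + 1) < \<epsilon>"
    by (rule order_tendstoD(2)[OF lim_r \<epsilon>])
  ultimately have "\<forall>\<^sub>F k in sequentially. dist (v (r k) (l (r k))) (s 0) < \<eta> / 4 \<and> 1 / (real (r k) + 1) < \<epsilon>"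
    by (intro eventually_conj)
  then obtain k where k: "dist (v (r k) (l (r k))) (s 0) < \<eta> / 4" "1 / (real (r k) + 1) < \<epsilon>"
    using eventually_happens'[OF sequentially_bot] by blast
  have "almost_period \<epsilon> (- l (r k))" using almost_period_mono[OF l(2)] k(2) by (intro almost_period_minus) auto
  then obtain p' where p': "attracting p' \<or> repelling p'" "\<And>t. \<bar>p' t - s (t + - l (r k))\<bar> \<le> \<eta> / 4"
    using shadow \<open>attracting s\<close> by blast
  have "attracting (\<lambda>t. p' t + of_int (- n (r k))) \<or> repelling (\<lambda>t. p' t + of_int (- n (r k)))"
    using p'(1) attracting_shift repelling_shift by blast
  from y_far[OF this, of "l (r k)"]
  have "\<eta> / 2 \<le> \<bar>y (l (r k)) - p' (l (r k)) + of_int (n (r k))\<bar>" by (simp add: algebra_simps)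
  moreover have "\<bar>y (l (r k)) + of_int (n (r k)) - s 0\<bar> < \<eta> / 4" using k(1) by (simp add: dist_real_def v_def)
  moreover have "\<bar>p' (l (r k)) - s 0\<bar> \<le> \<eta> / 4" using p'(2)[of "l (r k)"] by simp
  ultimately show False by linarith
qed

end

section \<open>The strip between an attracting and a repelling solution\<close>

context periodic_field
begin

lemma solution_gap_lower:
  assumes "lifted_solution f u" "lifted_solution f v"
  shows "\<bar>u s - v s\<bar> * exp (- (2 * L + 1) * \<bar>t - s\<bar>) \<le> \<bar>u t - v t\<bar>"
proof -
  define K where "K = (2 * L + 1) * \<bar>t - s\<bar>"
  have "\<bar>u s - v s\<bar> \<le> \<bar>u t - v t\<bar> * exp K"
    using solution_gap[OF assms, of s t] by (simp add: K_def abs_minus_commute)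
  then have "\<bar>u s - v s\<bar> * exp (- K) \<le> \<bar>u t - v t\<bar> * exp K * exp (- K)"
    by (rule mult_right_mono) simp
  also have "\<dots> = \<bar>u t - v t\<bar>" by (simp add: mult.assoc flip: exp_add)
  finally show ?thesis by (simp only: K_def mult_minus_left)
qed

text \<open>A solution close to \<open>w\<close> at arbitrarily late times equals \<open>w\<close>,
  and one close to \<open>s\<close> at arbitrarily early times equals \<open>s\<close>. So
  \<open>z\<close> comes close to each of the two at some time, after which stability in the
  respective direction of time takes over.\<close>

lemma strip_asymptotic:
  assumes s: "lifted_solution f s" "0 < m" "contracting UNIV C m (\<lambda>t. fx t (s t))"
    and w: "lifted_solution f w" "0 < m'" "expanding UNIV C' m' (\<lambda>t. fx t (w t))"
    and z: "lifted_solution f z" "z \<noteq> s" "z \<noteq> w"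
    and passage: "\<And>\<eta> t. 0 < \<eta> \<Longrightarrow> \<exists>x\<ge>t. \<bar>z x - s x\<bar> < \<eta> \<or> \<bar>z x - w x\<bar> < \<eta>"
      "\<And>\<eta> t. 0 < \<eta> \<Longrightarrow> \<exists>x\<le>t. \<bar>z x - s x\<bar> < \<eta> \<or> \<bar>z x - w x\<bar> < \<eta>"
  shows "((\<lambda>t. z t - s t) \<longlongrightarrow> 0) at_top" "((\<lambda>t. z t - w t) \<longlongrightarrow> 0) at_bot"
proof -
  obtain ds where ds: "0 < ds" and iso_s: "\<forall>u y. lifted_solution f u \<longrightarrow> contracting UNIV C m (\<lambda>t. fx t (u t)) \<longrightarrow>
    lifted_solution f y \<longrightarrow> (\<forall>T. \<exists>t\<le>T. \<bar>y t - u t\<bar> \<le> ds) \<longrightarrow> y = u"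
    using stable_isolated[OF s(2), of C] by blast
  obtain dw where dw: "0 < dw" and iso_w: "\<forall>w y. lifted_solution f w \<longrightarrow> expanding UNIV C' m' (\<lambda>t. fx t (w t)) \<longrightarrow>
    lifted_solution f y \<longrightarrow> (\<forall>T. \<exists>t\<ge>T. \<bar>y t - w t\<bar> \<le> dw) \<longrightarrow> y = w"
    using unstable_isolated[OF w(2), of C'] by blast
  have near_s: "\<exists>x. \<bar>z x - s x\<bar> < \<eta>" if "0 < \<eta>" for \<eta>
  proof (rule ccontr)
    assume neg: "\<nexists>x. \<bar>z x - s x\<bar> < \<eta>"
    have "\<exists>x\<ge>t. \<bar>z x - w x\<bar> \<le> dw" for t
      using passage(1)[of "min \<eta> dw" t] neg that dw by (auto intro: less_imp_le)
    then have "z = w" by (intro iso_w[rule_format, OF w(1,3) z(1)]) blast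
    with z show False by simp
  qed
  have near_w: "\<exists>x. \<bar>z x - w x\<bar> < \<eta>" if "0 < \<eta>" for \<eta>
  proof (rule ccontr)
    assume neg: "\<nexists>x. \<bar>z x - w x\<bar> < \<eta>"
    have "\<exists>x\<le>t. \<bar>z x - s x\<bar> \<le> ds" for t
      using passage(2)[of "min \<eta> ds" t] neg that ds by (auto intro: less_imp_le)
    then have "z = s" by (intro iso_s[rule_format, OF s(1,3) z(1)]) blast
    with z show False by simp
  qed
  obtain d where d: "0 < d" and attr: "\<forall>J u y s. lifted_solution f u \<longrightarrow>
      contracting J C m (\<lambda>t. fx t (u t)) \<longrightarrow> s \<in> J \<longrightarrow> (\<forall>s\<in>J. {s..} \<subseteq> J) \<longrightarrow> lifted_solution f y \<longrightarrow>
      \<bar>y s - u s\<bar> \<le> d \<longrightarrow> ((\<lambda>t. y t - u t) \<longlongrightarrow> 0) at_top"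
    using stable_attracts[OF s(2), of C] by blast
  obtain x where x: "\<bar>z x - s x\<bar> < d" using near_s[OF d] by blast
  show "((\<lambda>t. z t - s t) \<longlongrightarrow> 0) at_top"
    by (rule attr[rule_format, OF s(1,3) UNIV_I _ z(1), of x]) (use x in auto)
  show "((\<lambda>t. z t - w t) \<longlongrightarrow> 0) at_bot"
  proof (rule tendstoI)
    fix e :: real assume "0 < e"
    then have e: "0 < e / 2" by simp
    obtain d where d: "0 < d" and near: "\<forall>J w y s t. lifted_solution f w \<longrightarrow>
      expanding J C' m' (\<lambda>t. fx t (w t)) \<longrightarrow> s \<in> J \<longrightarrow> (\<forall>s\<in>J. {..s} \<subseteq> J) \<longrightarrow> lifted_solution f y \<longrightarrow>
      \<bar>y s - w s\<bar> \<le> d \<longrightarrow> t \<le> s \<longrightarrow> \<bar>y t - w t\<bar> \<le> e / 2"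
      using unstable_nearby[OF w(2) e, of C'] by blast
    obtain x where x: "\<bar>z x - w x\<bar> < d" using near_w[OF d] by blast
    have "\<bar>z t - w t\<bar> \<le> e / 2" if "t \<le> x" for t
      by (rule near[rule_format, OF w(1,3) UNIV_I _ z(1), of x]) (use x that in auto)
    then show "\<forall>\<^sub>F t in at_bot. dist (z t - w t) 0 < e"
      using e by (intro eventually_at_bot_linorderI[of x]) (force simp: dist_real_def)
  qed
qed

end

text \<open>\<open>\<theta> = kink t\<close> solves \<open>\<theta>' = - sin (\<pi> \<theta>) / \<pi>\<close> and runs from \<open>1\<close> to \<open>0\<close>.\<close>

definition kink :: "real \<Rightarrow> real" where
  "kink e = 2 / pi * arctan (exp (- e))"

definition kink_inv :: "real \<Rightarrow> real" where
  "kink_inv \<theta> = - ln (tan (pi * \<theta> / 2))"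

lemma kink_bounds: "0 < kink e" "kink e < 1"
  using arctan_ubound[of "exp (- e)"] by (auto simp: kink_def field_simps)

lemma kink_inv_kink [simp]: "kink_inv (kink e) = e"
  by (simp add: kink_inv_def kink_def tan_arctan)

lemma kink_kink_inv:
  assumes "0 < \<theta>" "\<theta> < 1"
  shows "kink (kink_inv \<theta>) = \<theta>"
proof -
  have "0 < pi * \<theta> / 2" "pi * \<theta> / 2 < pi / 2" using assms by auto
  then have "0 < tan (pi * \<theta> / 2)" "arctan (tan (pi * \<theta> / 2)) = pi * \<theta> / 2"
    by (intro tan_gt_zero arctan_tan; linarith)+
  then show ?thesis by (simp add: kink_inv_def kink_def field_simps)
qed

lemma kink_less_iff: "kink a < kink b \<longleftrightarrow> b < a"
  by (simp add: kink_def arctan_less_iff divide_less_cancel)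

lemma kink_inv_less:
  assumes "0 < a" "a < b" "b < 1"
  shows "kink_inv b < kink_inv a"
  using kink_less_iff[of "kink_inv a" "kink_inv b"] kink_kink_inv assms by auto

lemma isCont_kink_inv:
  assumes "0 < \<theta>" "\<theta> < 1"
  shows "isCont kink_inv \<theta>"
proof -
  have "0 < pi * \<theta> / 2" "pi * \<theta> / 2 < pi / 2" using assms by auto
  then have "0 < tan (pi * \<theta> / 2)" "cos (pi * \<theta> / 2) \<noteq> 0"
    using cos_gt_zero[of "pi * \<theta> / 2"] by (auto intro: tan_gt_zero)
  then show ?thesis unfolding kink_inv_def
    by (intro continuous_intros isCont_o2[of _ _ tan] isCont_tan) auto
qed

context periodic_field
begin

text \<open>All solutions in the strip cross the curve \<open>s + \<rho> / Q\<close>, where \<open>Q\<close> is the adapted weight, downwards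
  and exactly once. A solution is labelled by its crossing time, and a point of the strip by
  the time elapsed since the crossing.\<close>

lemma strip_labels:
  assumes s: "lifted_solution f s" "0 < m" "contracting UNIV C m (\<lambda>t. fx t (s t))"
    and w: "lifted_solution f w" "0 < m'" "expanding UNIV C' m' (\<lambda>t. fx t (w t))"
    and sw: "\<And>t. s t < w t"
    and passage: "\<And>\<eta>. 0 < \<eta> \<Longrightarrow> \<exists>T>0. \<forall>z t. lifted_solution f z \<longrightarrow> (\<forall>t. s t < z t \<and> z t < w t) \<longrightarrow>
      (\<exists>x\<ge>t. x \<le> t + T \<and> (z x - s x < \<eta> \<or> w x - z x < \<eta>))"
  obtains X where
    "\<And>z. lifted_solution f z \<Longrightarrow> (\<And>t. s t < z t \<and> z t < w t) \<Longrightarrow> \<exists>T. \<forall>t. z t = X (t - T) t"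
    "\<And>e e'. e < e' \<Longrightarrow> \<exists>\<delta>>0. \<forall>t. X e' t + \<delta> \<le> X e t"
    "\<And>e \<eta>. 0 < \<eta> \<Longrightarrow> \<exists>\<delta>>0. \<forall>e' t. \<bar>e' - e\<bar> < \<delta> \<longrightarrow> \<bar>X e' t - X e t\<bar> \<le> \<eta>"
    "\<And>\<eta>. 0 < \<eta> \<Longrightarrow> \<exists>E. \<forall>e\<ge>E. \<forall>t. X e t - s t \<le> \<eta>"
    "\<And>\<eta>. 0 < \<eta> \<Longrightarrow> \<exists>E. \<forall>e\<le>E. \<forall>t. w t - X e t \<le> \<eta>"
    "\<And>e. \<exists>\<delta>>0. \<forall>t. s t + \<delta> \<le> X e t \<and> X e t + \<delta> \<le> w t"
proof -
  define K where "K = 2 * L + 1"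
  have K: "0 < K" using L_pos by (simp add: K_def)
  obtain q1 q2 r where q: "0 < q1" "0 < q2" "0 < r" and
    Qex: "\<And>J u. lifted_solution f u \<Longrightarrow> contracting J C m (\<lambda>t. fx t (u t)) \<Longrightarrow> J \<noteq> {} \<Longrightarrow>
       \<forall>s\<in>J. {s..} \<subseteq> J \<Longrightarrow> \<exists>Q. adapted_weight J u q1 q2 r Q"
    using stable_weight[OF s(2), of C] by blast
  obtain Q where Q: "adapted_weight UNIV s q1 q2 r Q" using Qex[OF s(1,3)] by auto
  then have QJ: "q1 \<le> Q t" "Q t \<le> q2" for t unfolding adapted_weight_def by auto
  have Q_pos: "0 < Q t" for t using QJ(1)[of t] q(1) by linarith
  obtain \<sigma> where \<sigma>: "0 < \<sigma>" "\<And>t. \<sigma> < w t - s t"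
  proof -
    obtain d where d: "0 < d" "\<forall>s w t. lifted_solution f s \<longrightarrow> contracting UNIV C m (\<lambda>t. fx t (s t)) \<longrightarrow>
      lifted_solution f w \<longrightarrow> expanding UNIV C' m' (\<lambda>t. fx t (w t)) \<longrightarrow> d < \<bar>s t - w t\<bar>"
      using stable_unstable_separated[OF s(2) w(2), of C C'] by blast
    show thesis
    proof (rule that[OF d(1)])
      show "d < w t - s t" for t using d(2)[rule_format, OF s(1,3) w(1,3), of t] sw[of t] by simp
    qed
  qed
  obtain ds where ds: "0 < ds" and iso_s: "\<forall>u y. lifted_solution f u \<longrightarrow> contracting UNIV C m (\<lambda>t. fx t (u t)) \<longrightarrow>
    lifted_solution f y \<longrightarrow> (\<forall>T. \<exists>t\<le>T. \<bar>y t - u t\<bar> \<le> ds) \<longrightarrow> y = u"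
    using stable_isolated[OF s(2), of C] by blast
  \<comment> \<open>\<open>r\<close> makes the weight effective, \<open>ds\<close> keeps the other
    solutions outside the tube in the far past, and \<open>\<sigma> / 2\<close> leaves room between
    the tube and \<open>w\<close>.\<close>
  define \<rho>' where "\<rho>' = min (min r ds) (\<sigma> / 2)"
  have \<rho>': "0 < \<rho>'" "\<rho>' \<le> r" "\<rho>' \<le> ds" "\<rho>' \<le> \<sigma> / 2" using q ds \<sigma> by (auto simp: \<rho>'_def)
  define \<rho> where "\<rho> = q1 * \<rho>'"
  have \<rho>: "0 < \<rho>" "\<rho> \<le> q1 * r" using \<rho>' q by (auto simp: \<rho>_def)
  define k where "k = 1 / (2 * q2)"
  have k: "0 < k" using q by (simp add: k_def)
  define v where "v z t = Q t * (z t - s t)" for z t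
  have v_abs: "Q t * \<bar>z t - s t\<bar> = \<bar>v z t\<bar>" for z t using Q_pos[of t] by (simp add: v_def abs_mult)
  have near: "\<bar>z t - s t\<bar> \<le> \<bar>v z t\<bar> / q1" for z t
    using mult_right_mono[OF QJ(1)[of t], of "\<bar>z t - s t\<bar>"] q by (simp add: v_abs field_simps)
  have far: "\<bar>v z t\<bar> / q2 \<le> \<bar>z t - s t\<bar>" for z t
    using mult_right_mono[OF QJ(2)[of t], of "\<bar>z t - s t\<bar>"] q by (simp add: v_abs field_simps)
  have stay: "\<bar>v z t\<bar> \<le> \<rho>" if z: "lifted_solution f z" "\<bar>v z T\<bar> \<le> \<rho>" "T \<le> t" for z t T
    using weight_invariant[OF Q q(1,2) UNIV_I _ approx_solution_of_solution[OF z(1) order_refl] \<rho>(2), of T t]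
      z \<rho> by (simp add: v_abs)
  have close: "\<bar>z t - s t\<bar> \<le> \<rho>'" if "\<bar>v z t\<bar> \<le> \<rho>" for z t
  proof -
    have "\<bar>v z t\<bar> / q1 \<le> \<rho>'" using that q by (simp add: \<rho>_def field_simps)
    with near[of z t] show ?thesis by linarith
  qed
  have decay: "\<bar>v z t\<bar> \<le> \<bar>v z T\<bar> * exp (- k * (t - T))"
    if z: "lifted_solution f z" "\<bar>v z T\<bar> \<le> \<rho>" "T \<le> t" for z t T
  proof -
    have "\<bar>z x - s x\<bar> \<le> r" if "T \<le> x" for x
      using close[OF stay[OF z(1,2) that]] \<rho>'(2) by linarith
    with weight_decay[OF Q q(1,2) UNIV_I _ z(1) _ z(3)] show ?thesis by (simp add: v_abs k_def)
  qed
  \<comment> \<open>A speed limit for \<open>v\<close>, complementary to the decay; it makes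
    \<open>X\<close> Lipschitz in the elapsed time.\<close>
  have slow: "\<bar>v z t - v z T\<bar> \<le> 2 * r * (t - T)"
    if z: "lifted_solution f z" "\<bar>v z T\<bar> \<le> \<rho>" "T \<le> t" for z t T
  proof -
    have "\<exists>D. (v z has_real_derivative D) (at x) \<and> (\<bar>z x - s x\<bar> \<le> r \<longrightarrow> \<bar>D\<bar> \<le> 2 * r)" for x
    proof -
      have "(z has_real_derivative f x (z x) + 0) (at x)" using z(1) by (simp add: lifted_solution_def)
      then obtain D where D: "((\<lambda>t. Q t * (z t - s t)) has_real_derivative D) (at x)"
        "\<bar>z x - s x\<bar> \<le> r \<longrightarrow> \<bar>D + (z x - s x)\<bar> \<le> \<bar>z x - s x\<bar> / 2 + q2 * \<bar>0\<bar>"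
        using Q unfolding adapted_weight_def by blast
      have "\<bar>D\<bar> \<le> 2 * r" if "\<bar>z x - s x\<bar> \<le> r"
      proof -
        have "2 * \<bar>D + (z x - s x)\<bar> \<le> \<bar>z x - s x\<bar>" using D(2) that by simp
        moreover have "\<bar>D\<bar> \<le> \<bar>D + (z x - s x)\<bar> + \<bar>z x - s x\<bar>"
          using abs_triangle_ineq4[of "D + (z x - s x)" "z x - s x"] by simp
        moreover have "a \<le> 2 * r" if "a \<le> b + c" "c \<le> r" "2 * b \<le> c" for a b c :: real
          using that q(3) by linarith
        ultimately show ?thesis using that by blast
      qed
      with D(1) show ?thesis unfolding v_def by blast
    qed
    then have "\<forall>x. \<exists>D. (v z has_real_derivative D) (at x) \<and> (\<bar>z x - s x\<bar> \<le> r \<longrightarrow> \<bar>D\<bar> \<le> 2 * r)" by (rule allI)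
    from choice[OF this] obtain D where "\<forall>x. (v z has_real_derivative D x) (at x) \<and> (\<bar>z x - s x\<bar> \<le> r \<longrightarrow> \<bar>D x\<bar> \<le> 2 * r)" ..
    then have D: "\<And>x. (v z has_real_derivative D x) (at x)"
      "\<And>x. \<bar>z x - s x\<bar> \<le> r \<Longrightarrow> \<bar>D x\<bar> \<le> 2 * r" by simp_all
    have "\<bar>v z t - v z T\<bar> \<le> 2 * r * t - 2 * r * T"
    proof (rule abs_diff_le_of_deriv_le[OF z(3) D(1)])
      show "((\<lambda>x. 2 * r * x) has_real_derivative 2 * r) (at x)" for x
        by (auto intro!: derivative_eq_intros)
      show "\<bar>D x\<bar> \<le> 2 * r" if "T \<le> x" for x
        using close[OF stay[OF z(1,2) that]] \<rho>'(2) by (intro D(2)) linarith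
    qed
    then show ?thesis by (simp add: algebra_simps)
  qed
  define \<gamma> where "\<gamma> t = s t + \<rho> / Q t" for t
  have \<gamma>_iff: "z t = \<gamma> t \<longleftrightarrow> v z t = \<rho>" for z t
    using Q_pos[of t] by (auto simp: \<gamma>_def v_def field_simps)
  have "\<exists>Y. \<forall>T. lifted_solution f (Y T) \<and> Y T T = \<gamma> T" by (intro choice allI solution_exists)
  then obtain Y where Y: "\<And>T. lifted_solution f (Y T)" "\<And>T. Y T T = \<gamma> T" by blast
  have vY: "v (Y T) T = \<rho>" for T using Y(2) \<gamma>_iff by blast
  have Y_lower: "\<rho> / q2 \<le> Y T T - s T" for T
    using far[of "Y T" T] vY[of T] \<rho>(1) Q_pos[of T] by (simp add: Y(2) \<gamma>_def)
  have Y_upper: "\<sigma> / 2 \<le> w T - Y T T" for T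
    using close[of "Y T" T] vY[of T] \<rho> \<rho>'(4) \<sigma>(2)[of T] by linarith
  have Y_between: "s t < Y T t" "Y T t < w t" for t T
  proof -
    have "0 < \<rho> / q2" using \<rho> q by simp
    then show "s t < Y T t" using Y_lower[of T] solution_less[OF s(1) Y(1)[of T], of T t] by linarith
    show "Y T t < w t" using Y_upper[of T] \<sigma>(1) solution_less[OF Y(1)[of T] w(1), of T t] by linarith
  qed
  have vpos: "0 < v z t" if "s t < z t" for z t using that Q_pos[of t] by (simp add: v_def)
  \<comment> \<open>\<open>X e t\<close> is the position at time \<open>t\<close> of the solution
    that crossed the curve at time \<open>t - e\<close>; a negative \<open>e\<close> stands for a
    crossing still to come.\<close>
  define X where "X e t = Y (t - e) t" for e t
  show thesis
  proof (rule that[of X])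
    fix z assume z: "lifted_solution f z" and between: "\<And>t. s t < z t \<and> z t < w t"
    have pass: "\<exists>T. \<forall>t. \<exists>x\<ge>t. x \<le> t + T \<and> (\<bar>z x - s x\<bar> < \<eta> \<or> \<bar>z x - w x\<bar> < \<eta>)" if \<eta>: "0 < \<eta>" for \<eta>
    proof -
      obtain T where T: "\<forall>z t. lifted_solution f z \<longrightarrow> (\<forall>t. s t < z t \<and> z t < w t) \<longrightarrow>
        (\<exists>x\<ge>t. x \<le> t + T \<and> (z x - s x < \<eta> \<or> w x - z x < \<eta>))" using passage[OF \<eta>] by blast
      have "\<exists>x\<ge>t. x \<le> t + T \<and> (\<bar>z x - s x\<bar> < \<eta> \<or> \<bar>z x - w x\<bar> < \<eta>)" for t
      proof -
        obtain x where x: "x \<ge> t" "x \<le> t + T" "z x - s x < \<eta> \<or> w x - z x < \<eta>"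
          using T[rule_format, OF z between, of t] by blast
        have "\<bar>z x - s x\<bar> = z x - s x" "\<bar>z x - w x\<bar> = w x - z x" using between[of x] by auto
        with x show ?thesis by (intro exI[of _ x]) simp
      qed
      then show ?thesis by blast
    qed
    \<comment> \<open>In the future \<open>z\<close> enters the tube, in the far past isolation
      keeps it outside, so \<open>v z\<close> takes the value \<open>\<rho>\<close> in
      between.\<close>
    have "((\<lambda>t. z t - s t) \<longlongrightarrow> 0) at_top"
    proof (rule strip_asymptotic(1)[OF s w z])
      show "z \<noteq> s" "z \<noteq> w" using between[of 0] by auto
      show "\<exists>x\<ge>t. \<bar>z x - s x\<bar> < \<eta> \<or> \<bar>z x - w x\<bar> < \<eta>" if \<eta>: "0 < \<eta>" for \<eta> t
        using pass[OF \<eta>] by blast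
      show "\<exists>x\<le>t. \<bar>z x - s x\<bar> < \<eta> \<or> \<bar>z x - w x\<bar> < \<eta>" if \<eta>: "0 < \<eta>" for \<eta> t
      proof -
        obtain T where T: "\<forall>t. \<exists>x\<ge>t. x \<le> t + T \<and> (\<bar>z x - s x\<bar> < \<eta> \<or> \<bar>z x - w x\<bar> < \<eta>)"
          using pass[OF \<eta>] by blast
        obtain x where "x \<le> t - T + T" "\<bar>z x - s x\<bar> < \<eta> \<or> \<bar>z x - w x\<bar> < \<eta>"
          using T[rule_format, of "t - T"] by blast
        then show ?thesis by (intro exI[of _ x]) simp
      qed
    qed
    then have "\<forall>\<^sub>F t in at_top. dist (z t - s t) 0 < \<rho> / q2" using \<rho> q by (intro tendstoD) auto
    then obtain b where "dist (z b - s b) 0 < \<rho> / q2"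
      using eventually_happens'[OF trivial_limit_at_top_linorder] by blast
    then have "Q b * \<bar>z b - s b\<bar> \<le> q2 * (\<rho> / q2)"
      using QJ(2)[of b] Q_pos[of b] q by (intro mult_mono) (auto simp: dist_real_def)
    then have b: "v z b \<le> \<rho>" using v_abs[of b z] q by simp
    have "\<not> (\<forall>T. \<exists>t\<le>T. \<bar>z t - s t\<bar> \<le> ds)"
    proof
      assume "\<forall>T. \<exists>t\<le>T. \<bar>z t - s t\<bar> \<le> ds"
      then have "z = s" by (intro iso_s[rule_format, OF s(1,3) z]) blast
      with between[of 0] show False by simp
    qed
    then obtain T0 where T0: "\<And>t. t \<le> T0 \<Longrightarrow> \<not> \<bar>z t - s t\<bar> \<le> ds" by blast
    define a where "a = min T0 b"
    have "\<rho> < v z a"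
    proof (rule ccontr)
      assume "\<not> \<rho> < v z a"
      then have "\<bar>v z a\<bar> \<le> \<rho>" using vpos[of a z] between[of a] by simp
      from close[OF this] \<rho>'(3) T0[of a] show False by (simp add: a_def)
    qed
    moreover have "continuous_on A (v z)" for A
    proof (intro continuous_at_imp_continuous_on ballI)
      fix x
      have "(z has_real_derivative f x (z x) + 0) (at x)" using z by (simp add: lifted_solution_def)
      then have "\<exists>D. (v z has_real_derivative D) (at x)" using Q unfolding adapted_weight_def v_def by blast
      then show "isCont (v z) x" using DERIV_isCont by blast
    qed
    ultimately have "\<exists>T\<ge>a. T \<le> b \<and> v z T = \<rho>"
      using b by (intro IVT2') (auto simp: a_def)
    then obtain T where "v z T = \<rho>" by blast
    then have "z = Y T" using \<gamma>_iff[of z T] solution_unique[OF z Y(1)[of T]] Y(2) by metis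
    then show "\<exists>T. \<forall>t. z t = X (t - T) t" by (intro exI[of _ T]) (simp add: X_def)
  next
    fix e e' :: real assume e: "e < e'"
    \<comment> \<open>When the later solution crosses, the earlier one has decayed from
      \<open>\<rho>\<close> to at most \<open>\<rho> * exp (- k * (e' - e))\<close>. The gap is
      carried from time \<open>t - e\<close> to \<open>t\<close> at the cost of the factor
      \<open>exp (- K * \<bar>e\<bar>)\<close>.\<close>
    define \<beta> where "\<beta> = \<rho> * (1 - exp (- k * (e' - e)))"
    have \<beta>: "0 < \<beta>" using \<rho> k e by (simp add: \<beta>_def)
    have "X e' t + \<beta> / q2 * exp (- K * \<bar>e\<bar>) \<le> X e t" for t
    proof -
      let ?T = "t - e" and ?T' = "t - e'"
      have "\<bar>v (Y ?T') ?T\<bar> \<le> \<bar>v (Y ?T') ?T'\<bar> * exp (- k * (?T - ?T'))"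
        using vY[of ?T'] \<rho> e by (intro decay Y) auto
      then have "v (Y ?T') ?T \<le> \<rho> * exp (- k * (e' - e))"
        using vY[of ?T'] \<rho> by simp
      then have "\<beta> \<le> v (Y ?T) ?T - v (Y ?T') ?T" using vY[of ?T] by (simp add: \<beta>_def algebra_simps)
      also have "\<dots> = Q ?T * (Y ?T ?T - Y ?T' ?T)" by (simp add: v_def algebra_simps)
      finally have \<beta>_le: "\<beta> \<le> Q ?T * (Y ?T ?T - Y ?T' ?T)" .
      then have "0 < Q ?T * (Y ?T ?T - Y ?T' ?T)" using \<beta> by linarith
      then have pos: "Y ?T' ?T < Y ?T ?T" using Q_pos[of ?T] by (simp add: zero_less_mult_iff)
      have "\<beta> \<le> q2 * (Y ?T ?T - Y ?T' ?T)"
        using \<beta>_le mult_right_mono[OF QJ(2)[of ?T], of "Y ?T ?T - Y ?T' ?T"] pos by linarith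
      then have "\<beta> / q2 \<le> \<bar>Y ?T ?T - Y ?T' ?T\<bar>" using q pos by (simp add: field_simps)
      then have "\<beta> / q2 * exp (- K * \<bar>e\<bar>) \<le> \<bar>Y ?T ?T - Y ?T' ?T\<bar> * exp (- K * \<bar>e\<bar>)"
        by (rule mult_right_mono) simp
      also have "\<dots> \<le> \<bar>Y ?T t - Y ?T' t\<bar>"
        using solution_gap_lower[OF Y(1)[of ?T] Y(1)[of ?T'], of ?T t] by (simp add: K_def)
      also have "\<dots> = X e t - X e' t" using solution_less[OF Y(1) Y(1) pos, of t] by (simp add: X_def)
      finally show ?thesis by simp
    qed
    moreover have "0 < \<beta> / q2 * exp (- K * \<bar>e\<bar>)" using \<beta> q by simp
    ultimately show "\<exists>\<delta>>0. \<forall>t. X e' t + \<delta> \<le> X e t" by blast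
  next
    have lip: "\<bar>X e' t - X e t\<bar> \<le> 2 * r / q1 * (e' - e) * exp (K * \<bar>e\<bar>)" if e: "e \<le> e'" for e e' t
    proof -
      let ?T = "t - e" and ?T' = "t - e'"
      have "\<bar>v (Y ?T') ?T - v (Y ?T') ?T'\<bar> \<le> 2 * r * (?T - ?T')"
        using vY[of ?T'] \<rho> e by (intro slow Y) auto
      then have "\<bar>v (Y ?T') ?T - v (Y ?T) ?T\<bar> \<le> 2 * r * (e' - e)" using vY by simp
      also have "v (Y ?T') ?T - v (Y ?T) ?T = Q ?T * (Y ?T' ?T - Y ?T ?T)" by (simp add: v_def algebra_simps)
      finally have "Q ?T * \<bar>Y ?T' ?T - Y ?T ?T\<bar> \<le> 2 * r * (e' - e)" using Q_pos[of ?T] by (simp add: abs_mult)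
      then have "q1 * \<bar>Y ?T' ?T - Y ?T ?T\<bar> \<le> 2 * r * (e' - e)"
        using mult_right_mono[OF QJ(1)[of ?T], of "\<bar>Y ?T' ?T - Y ?T ?T\<bar>"] by linarith
      then have "\<bar>Y ?T' ?T - Y ?T ?T\<bar> \<le> 2 * r / q1 * (e' - e)" using q by (simp add: field_simps)
      then have "\<bar>Y ?T' ?T - Y ?T ?T\<bar> * exp (K * \<bar>e\<bar>) \<le> 2 * r / q1 * (e' - e) * exp (K * \<bar>e\<bar>)"
        by (rule mult_right_mono) simp
      with solution_gap[OF Y(1)[of ?T'] Y(1)[of ?T], of t ?T] show ?thesis by (simp add: X_def K_def)
    qed
    fix e \<eta> :: real assume \<eta>: "0 < \<eta>"
    \<comment> \<open>For \<open>\<bar>e' - e\<bar> < 1\<close> the number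
      \<open>\<bar>e\<bar> + 1\<close> bounds both \<open>\<bar>e\<bar>\<close> and
      \<open>\<bar>e'\<bar>\<close>, so one constant covers both orders of \<open>e\<close> and
      \<open>e'\<close>.\<close>
    define M where "M = 2 * r / q1 * exp (K * (\<bar>e\<bar> + 1))"
    have M: "0 < M" using q by (simp add: M_def)
    have "\<bar>X e' t - X e t\<bar> \<le> \<eta>" if e': "\<bar>e' - e\<bar> < min 1 (\<eta> / M)" for e' t
    proof -
      have "\<bar>X e' t - X e t\<bar> \<le> 2 * r / q1 * \<bar>e' - e\<bar> * exp (K * (\<bar>e\<bar> + 1))"
      proof (cases "e \<le> e'")
        case True
        have "\<bar>X e' t - X e t\<bar> \<le> 2 * r / q1 * (e' - e) * exp (K * \<bar>e\<bar>)" by (rule lip[OF True])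
        also have "\<dots> \<le> 2 * r / q1 * \<bar>e' - e\<bar> * exp (K * (\<bar>e\<bar> + 1))"
          using True q K by (intro mult_mono) auto
        finally show ?thesis .
      next
        case False
        then have "e' \<le> e" by simp
        from lip[OF this, of t] have "\<bar>X e' t - X e t\<bar> \<le> 2 * r / q1 * (e - e') * exp (K * \<bar>e'\<bar>)"
          by (simp add: abs_minus_commute)
        also have "\<dots> \<le> 2 * r / q1 * \<bar>e' - e\<bar> * exp (K * (\<bar>e\<bar> + 1))"
          using False q K e' by (intro mult_mono) auto
        finally show ?thesis .
      qed
      also have "\<dots> = M * \<bar>e' - e\<bar>" by (simp add: M_def)
      also have "\<dots> \<le> M * (\<eta> / M)" using e' M by (intro mult_left_mono) auto
      finally show ?thesis using M by simp
    qed
    then show "\<exists>\<delta>>0. \<forall>e' t. \<bar>e' - e\<bar> < \<delta> \<longrightarrow> \<bar>X e' t - X e t\<bar> \<le> \<eta>"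
      using \<eta> M by (intro exI[of _ "min 1 (\<eta> / M)"]) auto
  next
    fix \<eta> :: real assume \<eta>: "0 < \<eta>"
    \<comment> \<open>The logarithm is the time in which \<open>\<rho>'\<close> decays to
      \<open>\<eta>\<close> at rate \<open>k\<close>; the maximum with 0 keeps the crossing in the
      past.\<close>
    define E where "E = max 0 (ln (\<rho>' / \<eta>) / k)"
    have "X e t - s t \<le> \<eta>" if e: "E \<le> e" for e t
    proof -
      let ?T = "t - e"
      have "0 \<le> e" using e by (simp add: E_def)
      then have "\<bar>v (Y ?T) t\<bar> \<le> \<bar>v (Y ?T) ?T\<bar> * exp (- k * (t - ?T))"
        using vY[of ?T] \<rho> by (intro decay Y) auto
      then have le: "\<bar>v (Y ?T) t\<bar> \<le> \<rho> * exp (- k * e)" using vY[of ?T] \<rho> by simp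
      have "X e t - s t \<le> \<bar>v (Y ?T) t\<bar> / q1" using near[of "Y ?T" t] by (simp add: X_def)
      also have "\<dots> \<le> \<rho> * exp (- k * e) / q1" using le q by (simp add: divide_right_mono)
      also have "\<dots> = \<rho>' * exp (- k * e)" using q by (simp add: \<rho>_def)
      also have "\<dots> \<le> \<rho>' * exp (- ln (\<rho>' / \<eta>))"
      proof -
        have "ln (\<rho>' / \<eta>) / k \<le> e" using e by (simp add: E_def)
        then have "ln (\<rho>' / \<eta>) \<le> k * e" using k by (simp add: field_simps)
        then show ?thesis using \<rho>' by simp
      qed
      also have "\<dots> = \<eta>" using \<rho>'(1) \<eta> by (simp add: exp_minus)
      finally show ?thesis .
    qed
    then show "\<exists>E. \<forall>e\<ge>E. \<forall>t. X e t - s t \<le> \<eta>" by blast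
  next
    fix \<eta> :: real assume \<eta>: "0 < \<eta>"
    obtain d where d: "0 < d" and nearby: "\<forall>J w y s t. lifted_solution f w \<longrightarrow>
      expanding J C' m' (\<lambda>t. fx t (w t)) \<longrightarrow> s \<in> J \<longrightarrow> (\<forall>s\<in>J. {..s} \<subseteq> J) \<longrightarrow> lifted_solution f y \<longrightarrow>
      \<bar>y s - w s\<bar> \<le> d \<longrightarrow> t \<le> s \<longrightarrow> \<bar>y t - w t\<bar> \<le> \<eta>"
      using unstable_nearby[OF w(2) \<eta>, of C'] by blast
    have "0 < min d (\<rho> / q2)" using d \<rho> q by simp
    from passage[OF this] obtain T where T: "0 < T" "\<forall>z t. lifted_solution f z \<longrightarrow>
      (\<forall>t. s t < z t \<and> z t < w t) \<longrightarrow> (\<exists>x\<ge>t. x \<le> t + T \<and> (z x - s x < min d (\<rho> / q2) \<or> w x - z x < min d (\<rho> / q2)))"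
      by blast
    \<comment> \<open>Before its crossing a solution is at least \<open>\<rho> / q2\<close> away
      from \<open>s\<close>. If the crossing lies \<open>T\<close> or more ahead, the encounter
      within time \<open>T\<close> must be with \<open>w\<close>, and closeness to \<open>w\<close>
      persists backwards to \<open>t\<close>.\<close>
    have "w t - X e t \<le> \<eta>" if e: "e \<le> - T" for e t
    proof -
      let ?Y = "Y (t - e)"
      obtain x where x: "x \<ge> t" "x \<le> t + T" "?Y x - s x < min d (\<rho> / q2) \<or> w x - ?Y x < min d (\<rho> / q2)"
        using T(2)[rule_format, OF Y(1)[of "t - e"], of t] Y_between by blast
      have "\<not> ?Y x - s x < \<rho> / q2"
      proof
        assume "?Y x - s x < \<rho> / q2"
        then have "\<bar>v ?Y x\<bar> / q2 < \<rho> / q2" using far[of ?Y x] Y_between(1)[of x "t - e"] by linarith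
        then have lt: "\<bar>v ?Y x\<bar> < \<rho>" using q by (simp add: divide_less_cancel)
        have "x \<le> t - e" using x(2) e by linarith
        have "\<bar>v ?Y (t - e)\<bar> \<le> \<bar>v ?Y x\<bar> * exp (- k * (t - e - x))"
          using lt \<open>x \<le> t - e\<close> by (intro decay Y) auto
        also have "\<dots> \<le> \<bar>v ?Y x\<bar> * 1" using k \<open>x \<le> t - e\<close> by (intro mult_left_mono) auto
        finally show False using lt vY[of "t - e"] \<rho> by simp
      qed
      then have "w x - ?Y x < d" using x(3) by auto
      then have "\<bar>?Y x - w x\<bar> \<le> d" using Y_between(2)[of "t - e" x] by simp
      from nearby[rule_format, OF w(1,3) UNIV_I _ Y(1) this x(1)]
      show ?thesis using Y_between(2)[of "t - e" t] by (simp add: X_def)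
    qed
    then show "\<exists>E. \<forall>e\<le>E. \<forall>t. w t - X e t \<le> \<eta>" by blast
  next
    fix e :: real
    define c where "c = min (\<rho> / q2) (\<sigma> / 2)"
    have c: "0 < c" "c \<le> \<rho> / q2" "c \<le> \<sigma> / 2"
      using \<rho> q \<sigma> unfolding c_def by (simp, intro min.cobounded1, intro min.cobounded2)
    have "s t + c * exp (- K * \<bar>e\<bar>) \<le> X e t \<and> X e t + c * exp (- K * \<bar>e\<bar>) \<le> w t" for t
    proof
      let ?T = "t - e"
      have "c * exp (- K * \<bar>e\<bar>) \<le> \<bar>Y ?T ?T - s ?T\<bar> * exp (- K * \<bar>e\<bar>)"
        using Y_lower[of ?T] c(2) by (intro mult_right_mono) auto
      also have "\<dots> \<le> \<bar>Y ?T t - s t\<bar>"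
        using solution_gap_lower[OF Y(1)[of ?T] s(1), of ?T t] by (simp add: K_def)
      finally show "s t + c * exp (- K * \<bar>e\<bar>) \<le> X e t" using Y_between(1)[of t ?T] by (simp add: X_def)
      have "c * exp (- K * \<bar>e\<bar>) \<le> \<bar>Y ?T ?T - w ?T\<bar> * exp (- K * \<bar>e\<bar>)"
        using Y_upper[of ?T] c(3) by (intro mult_right_mono) auto
      also have "\<dots> \<le> \<bar>Y ?T t - w t\<bar>"
        using solution_gap_lower[OF Y(1)[of ?T] w(1), of ?T t] by (simp add: K_def)
      finally show "X e t + c * exp (- K * \<bar>e\<bar>) \<le> w t" using Y_between(2)[of ?T t] by (simp add: X_def)
    qed
    moreover have "0 < c * exp (- K * \<bar>e\<bar>)" using c by simp
    ultimately show "\<exists>\<delta>>0. \<forall>t. s t + \<delta> \<le> X e t \<and> X e t + \<delta> \<le> w t" by blast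
  qed
qed


text \<open>The elapsed time is compressed by \<open>kink\<close>, so that the strip with both
  boundary curves is indexed by the compact interval \<open>[0, 1]\<close>. There equicontinuity at
  each index improves to uniform equicontinuity.\<close>

lemma strip_family:
  assumes s: "lifted_solution f s" "0 < m" "contracting UNIV C m (\<lambda>t. fx t (s t))"
    and w: "lifted_solution f w" "0 < m'" "expanding UNIV C' m' (\<lambda>t. fx t (w t))"
    and sw: "\<And>t. s t < w t"
    and passage: "\<And>\<eta>. 0 < \<eta> \<Longrightarrow> \<exists>T>0. \<forall>z t. lifted_solution f z \<longrightarrow> (\<forall>t. s t < z t \<and> z t < w t) \<longrightarrow>
      (\<exists>x\<ge>t. x \<le> t + T \<and> (\<bar>z x - s x\<bar> < \<eta> \<or> \<bar>z x - w x\<bar> < \<eta>))"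
  obtains Z where "\<And>t. Z 0 t = s t" "\<And>t. Z 1 t = w t"
    "\<And>a b :: real. 0 \<le> a \<Longrightarrow> a < b \<Longrightarrow> b \<le> 1 \<Longrightarrow> \<exists>\<delta>>0. \<forall>t. Z a t + \<delta> \<le> Z b t"
    "\<And>\<eta>. 0 < \<eta> \<Longrightarrow> \<exists>\<delta>>0. \<forall>a\<in>{0..1}. \<forall>b\<in>{0..1}. \<bar>a - b\<bar> < \<delta> \<longrightarrow> (\<forall>t. \<bar>Z a t - Z b t\<bar> \<le> \<eta>)"
    "\<And>z. lifted_solution f z \<Longrightarrow> (\<And>t. s t < z t \<and> z t < w t) \<Longrightarrow> \<exists>T. \<forall>t. z t = Z (kink (t - T)) t"
proof -
  have "\<exists>T>0. \<forall>z t. lifted_solution f z \<longrightarrow> (\<forall>t. s t < z t \<and> z t < w t) \<longrightarrow>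
      (\<exists>x\<ge>t. x \<le> t + T \<and> (z x - s x < \<eta> \<or> w x - z x < \<eta>))" if \<eta>: "0 < \<eta>" for \<eta>
  proof -
    obtain T where T: "0 < T" "\<forall>z t. lifted_solution f z \<longrightarrow> (\<forall>t. s t < z t \<and> z t < w t) \<longrightarrow>
      (\<exists>x\<ge>t. x \<le> t + T \<and> (\<bar>z x - s x\<bar> < \<eta> \<or> \<bar>z x - w x\<bar> < \<eta>))" using passage[OF \<eta>] by blast
    have "\<exists>x\<ge>t. x \<le> t + T \<and> (z x - s x < \<eta> \<or> w x - z x < \<eta>)"
      if z: "lifted_solution f z" "\<forall>t. s t < z t \<and> z t < w t" for z t
    proof -
      obtain x where "x \<ge> t" "x \<le> t + T" "\<bar>z x - s x\<bar> < \<eta> \<or> \<bar>z x - w x\<bar> < \<eta>" using T(2) z by blast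
      then show ?thesis by (intro exI[of _ x]) auto
    qed
    with T(1) show ?thesis by blast
  qed
  from strip_labels[OF s w sw this] obtain X where
    orbit: "\<And>z. lifted_solution f z \<Longrightarrow> (\<And>t. s t < z t \<and> z t < w t) \<Longrightarrow> \<exists>T. \<forall>t. z t = X (t - T) t" and
    X_less: "\<And>e e'. e < e' \<Longrightarrow> \<exists>\<delta>>0. \<forall>t. X e' t + \<delta> \<le> X e t" and
    X_cont: "\<And>e \<eta>. 0 < \<eta> \<Longrightarrow> \<exists>\<delta>>0. \<forall>e' t. \<bar>e' - e\<bar> < \<delta> \<longrightarrow> \<bar>X e' t - X e t\<bar> \<le> \<eta>" and
    X_s: "\<And>\<eta>. 0 < \<eta> \<Longrightarrow> \<exists>E. \<forall>e\<ge>E. \<forall>t. X e t - s t \<le> \<eta>" and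
    X_w: "\<And>\<eta>. 0 < \<eta> \<Longrightarrow> \<exists>E. \<forall>e\<le>E. \<forall>t. w t - X e t \<le> \<eta>" and
    X_sep: "\<And>e. \<exists>\<delta>>0. \<forall>t. s t + \<delta> \<le> X e t \<and> X e t + \<delta> \<le> w t" by blast
  define Z where "Z \<theta> t = (if \<theta> \<le> 0 then s t else if 1 \<le> \<theta> then w t else X (kink_inv \<theta>) t)" for \<theta> t
  have X_between: "s t \<le> X e t" "X e t \<le> w t" for e t
    using X_sep[of e] by (smt (verit))+
  show thesis
  proof (rule that[of Z])
    show "Z 0 t = s t" "Z 1 t = w t" for t by (auto simp: Z_def)
    show "\<exists>T. \<forall>t. z t = Z (kink (t - T)) t"
      if z: "lifted_solution f z" "\<And>t. s t < z t \<and> z t < w t" for z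
    proof -
      obtain T where "\<And>t. z t = X (t - T) t" using orbit[OF z] by blast
      then have "z t = Z (kink (t - T)) t" for t
        using kink_bounds[of "t - T"] by (simp add: Z_def)
      then show ?thesis by blast
    qed
    show "\<exists>\<delta>>0. \<forall>t. Z a t + \<delta> \<le> Z b t" if ab: "0 \<le> a" "a < b" "b \<le> 1" for a b :: real
    proof -
      consider "a = 0" "b = 1" | "a = 0" "b < 1" | "0 < a" "b = 1" | "0 < a" "b < 1" using ab by linarith
      then show ?thesis
      proof cases
        case 1
        obtain \<delta> where \<delta>: "\<delta> > 0" "\<And>t. s t + \<delta> \<le> X 0 t \<and> X 0 t + \<delta> \<le> w t" using X_sep[of 0] by blast
        have "s t + \<delta> \<le> w t" for t using \<delta>(1) \<delta>(2)[of t] by linarith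
        then show ?thesis using 1 \<delta>(1) by (intro exI[of _ \<delta>]) (simp add: Z_def)
      next
        case 2
        obtain \<delta> where "\<delta> > 0" "\<And>t. s t + \<delta> \<le> X (kink_inv b) t \<and> X (kink_inv b) t + \<delta> \<le> w t"
          using X_sep[of "kink_inv b"] by blast
        then show ?thesis using 2 ab by (intro exI[of _ \<delta>]) (simp add: Z_def)
      next
        case 3
        obtain \<delta> where "\<delta> > 0" "\<And>t. s t + \<delta> \<le> X (kink_inv a) t \<and> X (kink_inv a) t + \<delta> \<le> w t"
          using X_sep[of "kink_inv a"] by blast
        then show ?thesis using 3 ab by (intro exI[of _ \<delta>]) (simp add: Z_def)
      next
        case 4
        obtain \<delta> where "\<delta> > 0" "\<And>t. X (kink_inv a) t + \<delta> \<le> X (kink_inv b) t"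
          using X_less[OF kink_inv_less] 4 ab by blast
        then show ?thesis using 4 ab by (intro exI[of _ \<delta>]) (simp add: Z_def)
      qed
    qed
    fix \<eta> :: real assume \<eta>: "0 < \<eta>"
    \<comment> \<open>The functions of the index, one for each \<open>t\<close>, are equicontinuous
      at each \<open>a\<close>; at 0 and 1 this is the uniform approach of \<open>X\<close> to
      \<open>s\<close> and \<open>w\<close>.\<close>
    have equi: "\<exists>\<delta>>0. \<forall>F\<in>range (\<lambda>t \<theta>. Z \<theta> t). \<forall>b\<in>{0..1}. dist b a < \<delta> \<longrightarrow> dist (F b) (F a) < e"
      if a: "a \<in> {0..1}" and e: "0 < e" for a e :: real
    proof -
      have e2: "0 < e / 2" using e by simp
      have "\<exists>\<delta>>0. \<forall>b\<in>{0..1}. \<bar>b - a\<bar> < \<delta> \<longrightarrow> (\<forall>t. \<bar>Z b t - Z a t\<bar> \<le> e / 2)"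
      proof -
        consider "a = 0" | "a = 1" | "0 < a" "a < 1" using a by fastforce
        then show ?thesis
        proof cases
          case 1
          obtain E where E: "\<And>e' t. E \<le> e' \<Longrightarrow> X e' t - s t \<le> e / 2" using X_s[OF e2] by blast
          have "\<bar>Z b t - Z a t\<bar> \<le> e / 2" if b: "b \<in> {0..1}" "\<bar>b - a\<bar> < kink E" for b t
          proof (cases "b = 0")
            case False
            then have b': "0 < b" "b < kink E" "b < 1" using b 1 kink_bounds[of E] by auto
            then have "kink (kink_inv b) < kink E" by (simp add: kink_kink_inv)
            then have "E \<le> kink_inv b" by (simp add: kink_less_iff)
            from E[OF this, of t] X_between(1)[of t "kink_inv b"] show ?thesis using b' 1 by (simp add: Z_def)
          qed (use 1 e in \<open>simp add: Z_def\<close>)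
          then show ?thesis using kink_bounds[of E] by blast
        next
          case 2
          obtain E where E: "\<And>e' t. e' \<le> E \<Longrightarrow> w t - X e' t \<le> e / 2" using X_w[OF e2] by blast
          have "\<bar>Z b t - Z a t\<bar> \<le> e / 2" if b: "b \<in> {0..1}" "\<bar>b - a\<bar> < 1 - kink E" for b t
          proof (cases "b = 1")
            case False
            then have b': "kink E < b" "0 < b" "b < 1" using b 2 kink_bounds[of E] by auto
            then have "kink E < kink (kink_inv b)" by (simp add: kink_kink_inv)
            then have "kink_inv b \<le> E" by (simp add: kink_less_iff)
            from E[OF this, of t] X_between(2)[of "kink_inv b" t] show ?thesis using b' 2 by (simp add: Z_def)
          qed (use 2 e in \<open>simp add: Z_def\<close>)
          then show ?thesis using kink_bounds[of E] by (intro exI[of _ "1 - kink E"]) auto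
        next
          case 3
          obtain \<delta>1 where 1: "\<delta>1 > 0" "\<And>e' t. \<bar>e' - kink_inv a\<bar> < \<delta>1 \<Longrightarrow> \<bar>X e' t - X (kink_inv a) t\<bar> \<le> e / 2"
            using X_cont[OF e2, of "kink_inv a"] by blast
          obtain \<delta>2 where 2: "\<delta>2 > 0" "\<And>b. \<bar>b - a\<bar> < \<delta>2 \<Longrightarrow> \<bar>kink_inv b - kink_inv a\<bar> < \<delta>1"
            using isCont_kink_inv[OF 3] 1(1) unfolding continuous_at_eps_delta dist_real_def by blast
          have "\<bar>Z b t - Z a t\<bar> \<le> e / 2" if b: "\<bar>b - a\<bar> < min \<delta>2 (min a (1 - a))" for b t
          proof -
            have "0 < b" "b < 1" "\<bar>b - a\<bar> < \<delta>2" using b by auto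
            then show ?thesis using 1(2)[OF 2(2), of b t] 3 by (simp add: Z_def)
          qed
          then show ?thesis using 2(1) 3 by (intro exI[of _ "min \<delta>2 (min a (1 - a))"]) auto
        qed
      qed
      then obtain \<delta> where \<delta>: "\<delta> > 0" "\<And>b t. b \<in> {0..1} \<Longrightarrow> \<bar>b - a\<bar> < \<delta> \<Longrightarrow> \<bar>Z b t - Z a t\<bar> \<le> e / 2" by blast
      have "dist (F b) (F a) < e" if F: "F \<in> range (\<lambda>t \<theta>. Z \<theta> t)" and b: "b \<in> {0..1}" "dist b a < \<delta>" for F b
      proof -
        obtain t where "F = (\<lambda>\<theta>. Z \<theta> t)" using F by blast
        then show ?thesis using \<delta>(2)[of b t] b e by (simp add: dist_real_def)
      qed
      with \<delta>(1) show ?thesis by blast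
    qed
    obtain \<delta> where "0 < \<delta>" and \<delta>: "\<And>F a b. F \<in> range (\<lambda>t \<theta>. Z \<theta> t) \<Longrightarrow> a \<in> {0..1} \<Longrightarrow> b \<in> {0..1} \<Longrightarrow>
      dist b a < \<delta> \<Longrightarrow> dist (F b) (F a) < \<eta>"
      by (rule compact_uniformly_equicontinuous[OF compact_Icc equi \<eta>]) (assumption, assumption, rule that, assumption, blast)
    have "\<bar>Z a t - Z b t\<bar> \<le> \<eta>" if "a \<in> {0..1}" "b \<in> {0..1}" "\<bar>a - b\<bar> < \<delta>" for a b t
      using \<delta>[of "\<lambda>\<theta>. Z \<theta> t" b a] that by (simp add: dist_real_def less_imp_le)
    with \<open>0 < \<delta>\<close> show "\<exists>\<delta>>0. \<forall>a\<in>{0..1}. \<forall>b\<in>{0..1}. \<bar>a - b\<bar> < \<delta> \<longrightarrow> (\<forall>t. \<bar>Z a t - Z b t\<bar> \<le> \<eta>)" by blast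
  qed
qed

text \<open>Reflection puts the attracting boundary below. Reversing the index afterwards restores
  the increasing order, hence \<open>1 - kink (t - T)\<close>.\<close>

lemma strip_family_mirrored:
  assumes s: "lifted_solution f s" "0 < m" "contracting UNIV C m (\<lambda>t. fx t (s t))"
    and w: "lifted_solution f w" "0 < m'" "expanding UNIV C' m' (\<lambda>t. fx t (w t))"
    and sw: "\<And>t. w t < s t"
    and passage: "\<And>\<eta>. 0 < \<eta> \<Longrightarrow> \<exists>T>0. \<forall>z t. lifted_solution f z \<longrightarrow> (\<forall>t. w t < z t \<and> z t < s t) \<longrightarrow>
      (\<exists>x\<ge>t. x \<le> t + T \<and> (\<bar>z x - s x\<bar> < \<eta> \<or> \<bar>z x - w x\<bar> < \<eta>))"
  obtains Z where "\<And>t. Z 0 t = w t" "\<And>t. Z 1 t = s t"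
    "\<And>a b :: real. 0 \<le> a \<Longrightarrow> a < b \<Longrightarrow> b \<le> 1 \<Longrightarrow> \<exists>\<delta>>0. \<forall>t. Z a t + \<delta> \<le> Z b t"
    "\<And>\<eta>. 0 < \<eta> \<Longrightarrow> \<exists>\<delta>>0. \<forall>a\<in>{0..1}. \<forall>b\<in>{0..1}. \<bar>a - b\<bar> < \<delta> \<longrightarrow> (\<forall>t. \<bar>Z a t - Z b t\<bar> \<le> \<eta>)"
    "\<And>z. lifted_solution f z \<Longrightarrow> (\<And>t. w t < z t \<and> z t < s t) \<Longrightarrow> \<exists>T. \<forall>t. z t = Z (1 - kink (t - T)) t"
proof -
  interpret mir: periodic_field "\<lambda>t x. - f t (- x)" "\<lambda>t x. fx t (- x)" L by (rule mirrored)
  have sm: "lifted_solution (\<lambda>t x. - f t (- x)) (\<lambda>t. - s t)" "contracting UNIV C m (\<lambda>t. fx t (- (- s t)))"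
    using s by (simp_all add: mirrored_solution_iff)
  have wm: "lifted_solution (\<lambda>t x. - f t (- x)) (\<lambda>t. - w t)" "expanding UNIV C' m' (\<lambda>t. fx t (- (- w t)))"
    using w by (simp_all add: mirrored_solution_iff)
  have swm: "- s t < - w t" for t using sw by simp
  have sol_m: "lifted_solution f (\<lambda>t. - z t)" if "lifted_solution (\<lambda>t x. - f t (- x)) z" for z
    using mirrored_solution_iff[of f "\<lambda>t. - z t"] that by simp
  have pm: "\<exists>T>0. \<forall>z t. lifted_solution (\<lambda>t x. - f t (- x)) z \<longrightarrow> (\<forall>t. - s t < z t \<and> z t < - w t) \<longrightarrow>
      (\<exists>x\<ge>t. x \<le> t + T \<and> (\<bar>z x - - s x\<bar> < \<eta> \<or> \<bar>z x - - w x\<bar> < \<eta>))" if \<eta>: "0 < \<eta>" for \<eta>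
  proof -
    obtain T where T: "0 < T" "\<forall>z t. lifted_solution f z \<longrightarrow> (\<forall>t. w t < z t \<and> z t < s t) \<longrightarrow>
      (\<exists>x\<ge>t. x \<le> t + T \<and> (\<bar>z x - s x\<bar> < \<eta> \<or> \<bar>z x - w x\<bar> < \<eta>))" using passage[OF \<eta>] by blast
    have "\<exists>x\<ge>t. x \<le> t + T \<and> (\<bar>z x - - s x\<bar> < \<eta> \<or> \<bar>z x - - w x\<bar> < \<eta>)"
      if z: "lifted_solution (\<lambda>t x. - f t (- x)) z" "\<forall>t. - s t < z t \<and> z t < - w t" for z t
    proof -
      have "\<forall>t. w t < - z t \<and> - z t < s t" using z(2) by (metis minus_less_iff less_minus_iff)
      then obtain x where "x \<ge> t" "x \<le> t + T" "\<bar>- z x - s x\<bar> < \<eta> \<or> \<bar>- z x - w x\<bar> < \<eta>"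
        using T(2)[rule_format, OF sol_m[OF z(1)], of t] by blast
      then show ?thesis by (intro exI[of _ x]) (auto simp: abs_minus_commute algebra_simps)
    qed
    with T(1) show ?thesis by blast
  qed
  from mir.strip_family[OF sm(1) s(2) sm(2) wm(1) w(2) wm(2) swm pm]
  obtain Z where Z: "\<And>t. Z 0 t = - s t" "\<And>t. Z 1 t = - w t"
    "\<And>a b :: real. 0 \<le> a \<Longrightarrow> a < b \<Longrightarrow> b \<le> 1 \<Longrightarrow> \<exists>\<delta>>0. \<forall>t. Z a t + \<delta> \<le> Z b t"
    "\<And>\<eta>. 0 < \<eta> \<Longrightarrow> \<exists>\<delta>>0. \<forall>a\<in>{0..1}. \<forall>b\<in>{0..1}. \<bar>a - b\<bar> < \<delta> \<longrightarrow> (\<forall>t. \<bar>Z a t - Z b t\<bar> \<le> \<eta>)"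
    "\<And>z. lifted_solution (\<lambda>t x. - f t (- x)) z \<Longrightarrow> (\<And>t. - s t < z t \<and> z t < - w t) \<Longrightarrow>
      \<exists>T. \<forall>t. z t = Z (kink (t - T)) t" by blast
  show thesis
  proof (rule that[of "\<lambda>\<theta> t. - Z (1 - \<theta>) t"])
    show "- Z (1 - 0) t = w t" "- Z (1 - 1) t = s t" for t using Z(1,2) by simp_all
    show "\<exists>\<delta>>0. \<forall>t. - Z (1 - a) t + \<delta> \<le> - Z (1 - b) t" if "0 \<le> a" "a < b" "b \<le> 1" for a b :: real
    proof -
      obtain \<delta> where "\<delta> > 0" "\<And>t. Z (1 - b) t + \<delta> \<le> Z (1 - a) t" using Z(3)[of "1 - b" "1 - a"] \<open>0 \<le> a\<close> \<open>a < b\<close> \<open>b \<le> 1\<close> by auto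
      then show ?thesis by (intro exI[of _ \<delta>]) (force simp: algebra_simps)
    qed
    show "\<exists>\<delta>>0. \<forall>a\<in>{0..1}. \<forall>b\<in>{0..1}. \<bar>a - b\<bar> < \<delta> \<longrightarrow> (\<forall>t. \<bar>- Z (1 - a) t - - Z (1 - b) t\<bar> \<le> \<eta>)"
      if "0 < \<eta>" for \<eta>
    proof -
      obtain \<delta> where \<delta>: "\<delta> > 0" "\<And>a b t. a \<in> {0..1} \<Longrightarrow> b \<in> {0..1} \<Longrightarrow> \<bar>a - b\<bar> < \<delta> \<Longrightarrow> \<bar>Z a t - Z b t\<bar> \<le> \<eta>"
        using Z(4)[OF \<open>0 < \<eta>\<close>] by blast
      have "\<bar>- Z (1 - a) t - - Z (1 - b) t\<bar> \<le> \<eta>" if "a \<in> {0..1}" "b \<in> {0..1}" "\<bar>a - b\<bar> < \<delta>" for a b t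
        using \<delta>(2)[of "1 - a" "1 - b" t] that by (simp add: abs_minus_commute)
      with \<delta>(1) show ?thesis by blast
    qed
    show "\<exists>T. \<forall>t. z t = - Z (1 - (1 - kink (t - T))) t"
      if z: "lifted_solution f z" "\<And>t. w t < z t \<and> z t < s t" for z
    proof -
      have "\<exists>T. \<forall>t. - z t = Z (kink (t - T)) t"
        by (rule Z(5)) (use z in \<open>simp_all add: mirrored_solution_iff\<close>)
      then obtain T where T: "\<And>t. - z t = Z (kink (t - T)) t" by blast
      have "z t = - Z (1 - (1 - kink (t - T))) t" for t using T[of t] by simp
      then show ?thesis by blast
    qed
  qed
qed

end


section \<open>Gluing the strips\<close>

lemma finite_uniform_pos:
  fixes N :: nat
  assumes "\<And>j. j < N \<Longrightarrow> \<exists>\<delta>>0. P j \<delta>" and mono: "\<And>j \<delta> \<delta>'. P j \<delta> \<Longrightarrow> \<delta>' \<le> \<delta> \<Longrightarrow> P j \<delta>'"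
  shows "\<exists>\<delta>>0. \<forall>j<N. P j (\<delta> :: real)"
proof -
  obtain d where d: "\<And>j. j < N \<Longrightarrow> 0 < d j \<and> P j (d j)" using assms(1) by metis
  define \<delta> where "\<delta> = Min (insert 1 (d ` {..<N}))"
  have "0 < \<delta>" using d by (auto simp: \<delta>_def)
  moreover have "\<delta> \<le> d j" if "j < N" for j using that by (auto simp: \<delta>_def)
  ultimately show ?thesis using d mono by blast
qed

text \<open>One passage through the \<open>N\<close> cells raises the curves by 1, so the cells can
  be continued periodically to all integers. They agree along common boundaries, which makes the
  family monotone and continuous across them.\<close>

lemma glue_cells:
  fixes Z :: "nat \<Rightarrow> real \<Rightarrow> real \<Rightarrow> real"
  assumes N: "0 < N"
    and next_cell: "\<And>j t. Suc j < N \<Longrightarrow> Z j 1 t = Z (Suc j) 0 t"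
    and last_cell: "\<And>t. Z (N - 1) 1 t = Z 0 0 t + 1"
    and less: "\<And>j a b. j < N \<Longrightarrow> 0 \<le> a \<Longrightarrow> a < b \<Longrightarrow> b \<le> 1 \<Longrightarrow> \<exists>\<delta>>0. \<forall>t. Z j a t + \<delta> \<le> Z j b t"
    and cont: "\<And>j \<eta>. j < N \<Longrightarrow> 0 < \<eta> \<Longrightarrow>
      \<exists>\<delta>>0. \<forall>a\<in>{0..1}. \<forall>b\<in>{0..1}. \<bar>a - b\<bar> < \<delta> \<longrightarrow> (\<forall>t. \<bar>Z j a t - Z j b t\<bar> \<le> \<eta>)"
  obtains H where "\<And>y t. H (y + real N) t = H y t + 1"
    "\<And>y y'. y < y' \<Longrightarrow> \<exists>\<delta>>0. \<forall>t. H y t + \<delta> \<le> H y' t"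
    "\<And>\<eta>. 0 < \<eta> \<Longrightarrow> \<exists>\<delta>>0. \<forall>y y' t. \<bar>y - y'\<bar> < \<delta> \<longrightarrow> \<bar>H y t - H y' t\<bar> \<le> \<eta>"
    "\<And>j \<theta> t. j < N \<Longrightarrow> 0 \<le> \<theta> \<Longrightarrow> \<theta> \<le> 1 \<Longrightarrow> H (real j + \<theta>) t = Z j \<theta> t"
proof -
  \<comment> \<open>Cell \<open>j\<close> for an arbitrary integer \<open>j\<close>: the remainder
    selects the given cell, the quotient counts the turns.\<close>
  define B where "B j \<theta> t = Z (nat (j mod int N)) \<theta> t + of_int (j div int N)" for j :: int and \<theta> t
  have modN: "nat (j mod int N) < N" for j using N by (simp add: nat_less_iff)
  have B_next: "B j 1 t = B (j + 1) 0 t" for j t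
  proof (cases "j mod int N = int N - 1")
    case True
    moreover have "int N * (j div int N) + j mod int N = j" by (rule mult_div_mod_eq)
    ultimately have "j + 1 = int N * (j div int N) + int N" by linarith
    then have "j + 1 = int N * (j div int N + 1)" by (simp only: distrib_left mult_1_right)
    then have "(j + 1) mod int N = 0" "(j + 1) div int N = j div int N + 1"
      using N by simp_all
    moreover have "nat (j mod int N) = N - 1" using True N by (simp add: nat_diff_distrib)
    ultimately show ?thesis using last_cell[of t] by (simp add: B_def)
  next
    case False
    define k where "k = j mod int N"
    have k: "0 \<le> k" "k < int N" "k \<noteq> int N - 1" using False N by (auto simp: k_def)
    define q where "q = j div int N"
    have eq: "j + 1 = (k + 1) + int N * q" by (simp add: k_def q_def)
    have "(j + 1) mod int N = (k + 1) mod int N" by (simp only: eq mod_mult_self2)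
    moreover have "(j + 1) div int N = q + (k + 1) div int N"
      unfolding eq using N by (intro div_mult_self2) simp
    ultimately have "(j + 1) mod int N = k + 1" "(j + 1) div int N = j div int N"
      using k by (simp_all add: q_def)
    moreover have "nat (k + 1) = Suc (nat k)" "Suc (nat k) < N" using k by auto
    ultimately show ?thesis using next_cell[of "nat k" t] by (simp add: B_def k_def)
  qed
  have B_less: "\<exists>\<delta>>0. \<forall>t. B j a t + \<delta> \<le> B j b t" if "0 \<le> a" "a < b" "b \<le> 1" for j a b
    using less[OF modN that, of j] by (simp add: B_def add.commute add.left_commute)
  have B_mono: "B j a t \<le> B j b t" if "0 \<le> a" "a \<le> b" "b \<le> 1" for j a b t
  proof (cases "a = b")
    case False
    then have "a < b" using that by simp
    from B_less[OF that(1) this that(3), of j]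
    obtain \<delta> where "\<delta> > 0" "\<forall>t. B j a t + \<delta> \<le> B j b t" by blast
    then have "\<delta> > 0" "B j a t + \<delta> \<le> B j b t" by simp_all
    then show ?thesis by linarith
  qed simp
  define H where "H y t = B \<lfloor>y\<rfloor> (frac y) t" for y t
  \<comment> \<open>The formula includes the right end of the cell, where the floor already belongs
    to the next one.\<close>
  have H_cell: "H y t = B j (y - of_int j) t" if "of_int j \<le> y" "y \<le> of_int j + 1" for y j t
  proof (cases "y = of_int j + 1")
    case True
    then show ?thesis using B_next[of j t] by (simp add: H_def)
  next
    case False
    then have "\<lfloor>y\<rfloor> = j" using that by linarith
    then show ?thesis by (simp add: H_def frac_def)
  qed
  have node_mono: "B i 0 t \<le> B j 0 t" if "i \<le> j" for i j t
    using that
  proof (induction j rule: int_ge_induct)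
    case (step j)
    then show ?case using B_mono[of 0 1 j t] B_next[of j t] by simp
  qed simp
  have H_mono: "H y t \<le> H y' t" if "y \<le> y'" for y y' t
  proof (cases "\<lfloor>y\<rfloor> = \<lfloor>y'\<rfloor>")
    case True
    then have "frac y \<le> frac y'" using that by (simp add: frac_def)
    then show ?thesis unfolding H_def True using frac_lt_1[of y'] by (intro B_mono) auto
  next
    case False
    then have "\<lfloor>y\<rfloor> + 1 \<le> \<lfloor>y'\<rfloor>" using that floor_mono[OF that] by linarith
    have "H y t \<le> B \<lfloor>y\<rfloor> 1 t" unfolding H_def using frac_lt_1[of y] by (intro B_mono) auto
    also have "\<dots> \<le> B \<lfloor>y'\<rfloor> 0 t" unfolding B_next by (rule node_mono) fact
    also have "\<dots> \<le> H y' t" unfolding H_def using frac_lt_1[of y'] by (intro B_mono) auto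
    finally show ?thesis .
  qed
  show thesis
  proof (rule that[of H])
    show "H (y + real N) t = H y t + 1" for y t
    proof -
      have "\<lfloor>y + real N\<rfloor> = \<lfloor>y\<rfloor> + int N" by linarith
      then show ?thesis using N by (simp add: H_def B_def frac_def)
    qed
    show "H (real j + \<theta>) t = Z j \<theta> t" if "j < N" "0 \<le> \<theta>" "\<theta> \<le> 1" for j \<theta> t
      using H_cell[of "int j" "real j + \<theta>" t] that by (simp add: B_def)
    show "\<exists>\<delta>>0. \<forall>t. H y t + \<delta> \<le> H y' t" if "y < y'" for y y'
    proof -
      \<comment> \<open>The interval \<open>(j, j + 1]\<close> contains \<open>y'\<close>: the
        strict increase is taken from this cell alone, and monotonicity covers the rest.\<close>
      define j where "j = \<lceil>y'\<rceil> - 1"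
      define p where "p = max y (of_int j)"
      have j: "of_int j < y'" "y' \<le> of_int j + 1" unfolding j_def by linarith+
      then have p: "y \<le> p" "p < y'" "of_int j \<le> p" using that by (auto simp: p_def)
      obtain \<delta> where \<delta>: "\<delta> > 0" "\<And>t. B j (p - of_int j) t + \<delta> \<le> B j (y' - of_int j) t"
        using B_less[of "p - of_int j" "y' - of_int j" j] p j by auto
      have "H y t + \<delta> \<le> H y' t" for t
        using \<delta>(2)[of t] H_mono[OF p(1), of t] H_cell[of j p t] H_cell[of j y' t] p j by linarith
      with \<delta>(1) show ?thesis by blast
    qed
    fix \<eta> :: real assume "0 < \<eta>"
    then have "\<exists>\<delta>>0. \<forall>j<N. \<forall>a\<in>{0..1}. \<forall>b\<in>{0..1}. \<bar>a - b\<bar> < \<delta> \<longrightarrow> (\<forall>t. \<bar>Z j a t - Z j b t\<bar> \<le> \<eta> / 2)"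
      by (intro finite_uniform_pos cont) (assumption, simp, meson less_le_trans)
    then obtain \<delta> where \<delta>: "\<delta> > 0" "\<And>j a b t. j < N \<Longrightarrow> a \<in> {0..1} \<Longrightarrow> b \<in> {0..1} \<Longrightarrow> \<bar>a - b\<bar> < \<delta> \<Longrightarrow>
      \<bar>Z j a t - Z j b t\<bar> \<le> \<eta> / 2" by blast
    have B_cont: "\<bar>B j a t - B j b t\<bar> \<le> \<eta> / 2" if "0 \<le> a" "a \<le> 1" "0 \<le> b" "b \<le> 1" "\<bar>a - b\<bar> < \<delta>" for j a b t
      using \<delta>(2)[OF modN, of a b j t] that by (simp add: B_def)
    \<comment> \<open>Indices less than 1 apart are separated by at most one cell boundary, so two
      estimates with \<open>\<eta> / 2\<close> suffice.\<close>
    have H_le: "\<bar>H y t - H y' t\<bar> \<le> \<eta>" if y: "y \<le> y'" "y' - y < min 1 \<delta>" for y y' t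
    proof (cases "y' \<le> of_int \<lfloor>y\<rfloor> + 1")
      case True
      have "\<bar>H y t - H y' t\<bar> = \<bar>B \<lfloor>y\<rfloor> (y - of_int \<lfloor>y\<rfloor>) t - B \<lfloor>y\<rfloor> (y' - of_int \<lfloor>y\<rfloor>) t\<bar>"
        using H_cell[of "\<lfloor>y\<rfloor>" y t] H_cell[of "\<lfloor>y\<rfloor>" y' t] True y by simp linarith
      also have "\<dots> \<le> \<eta> / 2" using True y by (intro B_cont) linarith+
      finally show ?thesis using \<open>0 < \<eta>\<close> by linarith
    next
      case False
      define j where "j = \<lfloor>y\<rfloor> + 1"
      have j: "y \<le> of_int j" "of_int (j - 1) \<le> y" "of_int j < y'" "y' \<le> of_int j + 1"
        using False y unfolding j_def by (simp_all, linarith+)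
      have "\<bar>H y t - H (of_int j) t\<bar> \<le> \<eta> / 2"
      proof -
        have 1: "H y t = B (j - 1) (y - of_int (j - 1)) t" by (rule H_cell) (use j in auto)
        have 2: "H (of_int j) t = B (j - 1) (of_int j - of_int (j - 1)) t" by (rule H_cell) auto
        show ?thesis unfolding 1 2 by (rule B_cont) (use j y in auto)
      qed
      moreover have "\<bar>H (of_int j) t - H y' t\<bar> \<le> \<eta> / 2"
      proof -
        have 1: "H y' t = B j (y' - of_int j) t" by (rule H_cell) (use j in auto)
        have 2: "H (of_int j) t = B j (of_int j - of_int j) t" by (rule H_cell) auto
        show ?thesis unfolding 1 2 by (rule B_cont) (use j y in auto)
      qed
      ultimately show ?thesis by linarith
    qed
    have "\<bar>H y t - H y' t\<bar> \<le> \<eta>" if "\<bar>y - y'\<bar> < min 1 \<delta>" for y y' t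
      using H_le[of y y' t] H_le[of y' y t] that by (cases "y \<le> y'") (auto simp: abs_minus_commute)
    with \<delta>(1) show "\<exists>\<delta>>0. \<forall>y y' t. \<bar>y - y'\<bar> < \<delta> \<longrightarrow> \<bar>H y t - H y' t\<bar> \<le> \<eta>"
      by (intro exI[of _ "min 1 \<delta>"]) auto
  qed
qed

section \<open>Maps of the cylinder\<close>

lemma dist_to_circle_le: "dist (to_circle x) (to_circle y) \<le> \<bar>x - y\<bar>"
proof -
  define a where "a = frac x - frac y"
  define n where "n = \<lfloor>x\<rfloor> - \<lfloor>y\<rfloor>"
  have xy: "x - y = a + of_int n" by (simp add: a_def n_def frac_def)
  have a: "\<bar>a\<bar> < 1" unfolding a_def using frac_lt_1[of x] frac_lt_1[of y] frac_ge_0[of x] frac_ge_0[of y] by linarith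
  have "min \<bar>a\<bar> (1 - \<bar>a\<bar>) \<le> \<bar>x - y\<bar>"
  proof (cases "n = 0")
    case True
    then show ?thesis using xy by simp
  next
    case False
    then have "1 \<le> \<bar>real_of_int n\<bar>" by linarith
    then have "1 - \<bar>a\<bar> \<le> \<bar>x - y\<bar>" unfolding xy by linarith
    then show ?thesis by linarith
  qed
  then show ?thesis by (simp add: dist_circle_def circle_rep_to_circle a_def)
qed

lemma to_circle_add_int [simp]: "to_circle (x + of_int n) = to_circle x"
  by (simp add: to_circle_eq_iff)

lemma dist_circle_lift: "\<exists>x y. p = to_circle x \<and> q = to_circle y \<and> \<bar>x - y\<bar> = dist p q"
proof -
  let ?x = "circle_rep p" and ?y = "circle_rep q"
  note b = circle_rep_bounds[of p] circle_rep_bounds[of q]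
  show ?thesis
  proof (cases "\<bar>?x - ?y\<bar> \<le> 1 - \<bar>?x - ?y\<bar>")
    case True
    then show ?thesis by (intro exI[of _ ?x] exI[of _ ?y]) (simp add: dist_circle_def)
  next
    case False
    \<comment> \<open>The shorter arc passes through the base point, so the representative of
      \<open>p\<close> is moved by one turn.\<close>
    have eq: "to_circle (?x + 1) = p" using to_circle_add_int[of ?x 1] by simp
    have eq': "to_circle (?x + - 1) = p" using to_circle_add_int[of ?x "- 1"] by simp
    have d: "dist p q = 1 - \<bar>?x - ?y\<bar>" using False by (simp add: dist_circle_def)
    show ?thesis
    proof (cases "?x \<le> ?y")
      case True
      then show ?thesis using eq d b by (intro exI[of _ "?x + 1"] exI[of _ ?y]) auto
    next
      case False
      then show ?thesis using eq' d b by (intro exI[of _ "?x + - 1"] exI[of _ ?y]) auto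
    qed
  qed
qed

lemma continuous_on_to_circle: "continuous_on UNIV to_circle"
  unfolding continuous_on_iff
proof safe
  fix x e :: real assume "0 < e"
  then show "\<exists>d>0. \<forall>y\<in>UNIV. dist y x < d \<longrightarrow> dist (to_circle y) (to_circle x) < e"
    using dist_to_circle_le by (intro exI[of _ e]) (auto simp: dist_real_def intro: le_less_trans)
qed

text \<open>Meant for lifts that commute with the unit translation, for which any other
  representative gives the same value.\<close>

definition cylinder_map :: "(real \<Rightarrow> real \<Rightarrow> real) \<Rightarrow> real \<times> circle \<Rightarrow> real \<times> circle" where
  "cylinder_map F z = (fst z, to_circle (F (circle_rep (snd z)) (fst z)))"

lemma periodic_shift_map:
  fixes F :: "real \<Rightarrow> real \<Rightarrow> real"
  assumes "\<And>x t. F (x + 1) t = F x t + 1"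
  shows "F (x + of_int n) t = F x t + of_int n"
  using periodic_shift_int[of "\<lambda>x. F x t - x" x n] assms by (simp add: algebra_simps)

lemma cylinder_map_to_circle:
  assumes "\<And>x t. F (x + 1) t = F x t + 1"
  shows "cylinder_map F (t, to_circle x) = (t, to_circle (F x t))"
proof -
  have "F x t = F (frac x) t + of_int \<lfloor>x\<rfloor>"
    using periodic_shift_map[where F = F, OF assms, of "frac x" "\<lfloor>x\<rfloor>" t] by (simp add: frac_def)
  then show ?thesis by (simp add: cylinder_map_def circle_rep_to_circle)
qed

text \<open>Close points of the circle have equally close lifts, and the projection does not
  increase distances; so the modulus on the line passes to the cylinder.\<close>

lemma cylinder_map_uniformly_continuous:
  assumes per: "\<And>x t. F (x + 1) t = F x t + 1"
    and cont: "\<And>e. 0 < e \<Longrightarrow> \<exists>d>0. \<forall>x y s t. \<bar>x - y\<bar> < d \<longrightarrow> \<bar>s - t\<bar> < d \<longrightarrow> \<bar>F x s - F y t\<bar> \<le> e"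
  shows "uniformly_continuous_on UNIV (cylinder_map F)"
  unfolding uniformly_continuous_on_def
proof (intro allI impI)
  fix e :: real assume "0 < e"
  then obtain d where d: "d > 0" "\<And>x y s t. \<bar>x - y\<bar> < d \<Longrightarrow> \<bar>s - t\<bar> < d \<Longrightarrow> \<bar>F x s - F y t\<bar> \<le> e / 3"
    using cont[of "e / 3"] by auto
  have "dist (cylinder_map F z') (cylinder_map F z) < e" if "dist z' z < min d (e / 3)" for z z'
  proof -
    obtain s p t q where z: "z' = (s, p)" "z = (t, q)" by (cases z', cases z)
    have "\<bar>s - t\<bar> \<le> dist z' z" "dist p q \<le> dist z' z"
      using dist_fst_le[of z' z] dist_snd_le[of z' z] by (simp_all add: z dist_real_def)
    then have st: "\<bar>s - t\<bar> < d" "\<bar>s - t\<bar> < e / 3" "dist p q < d" using that by linarith+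
    obtain x y where xy: "p = to_circle x" "q = to_circle y" "\<bar>x - y\<bar> = dist p q" using dist_circle_lift by blast
    have "dist (to_circle (F x s)) (to_circle (F y t)) \<le> e / 3"
      using dist_to_circle_le[of "F x s" "F y t"] d(2)[of x y s t] st xy by linarith
    moreover have "dist (cylinder_map F z') (cylinder_map F z) \<le> \<bar>s - t\<bar> + dist (to_circle (F x s)) (to_circle (F y t))"
      unfolding z xy(1,2) cylinder_map_to_circle[where F = F, OF per] dist_Pair_Pair
      using sqrt_sum_squares_le_sum[of "dist s t" "dist (to_circle (F x s)) (to_circle (F y t))"]
      by (simp add: dist_real_def)
    ultimately show ?thesis using st(2) \<open>0 < e\<close> by linarith
  qed
  then show "\<exists>d>0. \<forall>z\<in>UNIV. \<forall>z'\<in>UNIV. dist z' z < d \<longrightarrow> dist (cylinder_map F z') (cylinder_map F z) < e"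
    using d(1) \<open>0 < e\<close> by (intro exI[of _ "min d (e / 3)"]) auto
qed

text \<open>The family \<open>H\<close> gives the inverse of the equivalence on the universal cover: \<open>H y t\<close> is the point of
  the fibre over \<open>t\<close> that corresponds to the point \<open>y\<close> of the autonomous equation. Regularity in
  \<open>t\<close> comes for free, since moving along integral curves costs a bounded multiple of the elapsed time.\<close>

lemma (in periodic_field) uniformly_equivalent_of_family:
  assumes per: "\<And>y t. H (y + 1) t = H y t + (1::real)"
    and less: "\<And>y y'. y < y' \<Longrightarrow> \<exists>\<delta>>0. \<forall>t. H y t + \<delta> \<le> H y' t"
    and cont: "\<And>\<eta>. 0 < \<eta> \<Longrightarrow> \<exists>\<delta>>0. \<forall>y y' t. \<bar>y - y'\<bar> < \<delta> \<longrightarrow> \<bar>H y t - H y' t\<bar> \<le> \<eta>"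
    and orbit: "\<And>u. lifted_solution f u \<Longrightarrow> \<exists>v. lifted_solution (\<lambda>_. g) v \<and> (\<forall>t. u t = H (v t) t)"
    and g: "\<And>x. \<bar>g x\<bar> \<le> M"
  shows "uniformly_equivalent f (\<lambda>_. g)"
proof -
  have per_int: "H (y + of_int n) t = H y t + of_int n" for y n t
    by (rule periodic_shift_map) (rule per)
  have H_less: "H y t < H y' t" if y: "y < y'" for y y' t
  proof -
    obtain \<delta> where "\<delta> > 0" "\<forall>t. H y t + \<delta> \<le> H y' t" using less[OF y] by blast
    then have "\<delta> > 0" "H y t + \<delta> \<le> H y' t" by simp_all
    then show ?thesis by linarith
  qed
  have H_mono: "H y t \<le> H y' t" if "y \<le> y'" for y y' t
    using H_less[of y y' t] that by (cases "y = y'") auto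
  have H_inj: "y = y'" if "H y t = H y' t" for y y' t
    using H_less[of y y' t] H_less[of y' y t] that by (cases y y' rule: linorder_cases) auto
  have H_cont: "continuous_on A (\<lambda>y. H y t)" for A t
    unfolding continuous_on_iff dist_real_def
  proof safe
    fix x e :: real assume "0 < e"
    then obtain \<delta> where "\<delta> > 0" "\<And>y y' t. \<bar>y - y'\<bar> < \<delta> \<Longrightarrow> \<bar>H y t - H y' t\<bar> \<le> e / 2"
      using cont[of "e / 2"] by auto
    then show "\<exists>d>0. \<forall>x'\<in>A. \<bar>x' - x\<bar> < d \<longrightarrow> \<bar>H x' t - H x t\<bar> < e"
      using \<open>0 < e\<close> by (intro exI[of _ \<delta>]) (auto intro: le_less_trans[of _ "e / 2"])
  qed
  have "\<exists>y. H y t = x" for x t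
  proof -
    define n where "n = \<lfloor>x - H 0 t\<rfloor>"
    have n: "H (0 + of_int n) t \<le> x" "x \<le> H (0 + of_int (n + 1)) t"
      unfolding per_int n_def by linarith+
    have "\<exists>y\<ge>0 + of_int n. y \<le> 0 + of_int (n + 1) \<and> H y t = x"
      by (rule IVT'[OF n _ H_cont]) simp
    then show ?thesis by blast
  qed
  note surj = this
  define V where "V x t = (SOME y. H y t = x)" for x t
  have V: "H (V x t) t = x" for x t unfolding V_def using surj by (rule someI_ex)
  have V_H: "V (H y t) t = y" for y t using H_inj V by blast
  have V_per: "V (x + 1) t = V x t + 1" for x t using H_inj[of "V (x + 1) t" t "V x t + 1"] by (simp add: V per)
  \<comment> \<open>As \<open>2 / e < N\<close>, every interval of length \<open>e\<close> contains
    a full cell of the grid of mesh \<open>1 / N\<close>, and modulo 1 there are only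
    \<open>N\<close> cells. The resulting gap is independent of the position, which makes
    \<open>V\<close> uniformly continuous.\<close>
  have less_uniform: "\<exists>\<delta>>0. \<forall>y y' t. y + e \<le> y' \<longrightarrow> H y t + \<delta> \<le> H y' t" if e: "0 < e" for e
  proof -
    obtain N :: nat where N: "0 < N" "2 / e < real N" using reals_Archimedean2[of "2 / e"] e
      by (metis divide_pos_pos gr0I less_irrefl less_trans of_nat_0 zero_less_numeral)
    have "\<exists>\<delta>>0. \<forall>j<N. \<forall>t. H (real j / real N) t + \<delta> \<le> H ((real j + 1) / real N) t"
    proof (rule finite_uniform_pos)
      fix j assume "j < N"
      have "real j / real N < (real j + 1) / real N" using N(1) by (simp add: divide_strict_right_mono)
      then show "\<exists>\<delta>>0. \<forall>t. H (real j / real N) t + \<delta> \<le> H ((real j + 1) / real N) t" by (rule less)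
    next
      fix j and \<delta> \<delta>' :: real assume "\<forall>t. H (real j / real N) t + \<delta> \<le> H ((real j + 1) / real N) t" "\<delta>' \<le> \<delta>"
      then show "\<forall>t. H (real j / real N) t + \<delta>' \<le> H ((real j + 1) / real N) t"
        by (meson add_left_mono order_trans)
    qed
    then obtain \<delta> where \<delta>: "\<delta> > 0" "\<And>j t. j < N \<Longrightarrow> H (real j / real N) t + \<delta> \<le> H ((real j + 1) / real N) t"
      by blast
    have "H y t + \<delta> \<le> H y' t" if yy: "y + e \<le> y'" for y y' t
    proof -
      define k where "k = \<lceil>y * real N\<rceil>"
      define j where "j = nat (k mod int N)"
      define q where "q = k div int N"
      have j: "j < N" "k = int j + int N * q" using N(1) by (auto simp: j_def q_def nat_less_iff)
      have k: "y * real N \<le> of_int k" "of_int k < y * real N + 1" unfolding k_def by linarith+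
      have "real_of_int k = real j + real N * of_int q" unfolding j(2) by simp
      then have kN: "of_int k / real N = real j / real N + of_int q"
        "(of_int k + 1) / real N = (real j + 1) / real N + of_int q" using N(1) by (simp_all add: field_simps)
      have "y \<le> of_int k / real N" using k(1) N(1) by (simp add: field_simps)
      then have "H y t \<le> H (real j / real N) t + of_int q" using H_mono kN(1) per_int by metis
      moreover have "(of_int k + 1) / real N \<le> y'"
      proof -
        have "2 < e * real N" using N(2) e by (simp add: field_simps)
        moreover have "(y + e) * real N \<le> y' * real N" using yy N(1) by (simp add: mult_right_mono)
        ultimately have "of_int k + 1 \<le> y' * real N" using k(2) by (simp add: distrib_right)
        then show ?thesis using N(1) by (simp add: field_simps)
      qed
      then have "H ((real j + 1) / real N) t + of_int q \<le> H y' t" using H_mono kN(2) per_int by metis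
      ultimately show ?thesis using \<delta>(2)[OF j(1), of t] by linarith
    qed
    with \<delta>(1) show ?thesis by blast
  qed
  have V_cont: "\<exists>\<delta>>0. \<forall>x x' t. \<bar>x - x'\<bar> < \<delta> \<longrightarrow> \<bar>V x t - V x' t\<bar> < e" if e: "0 < e" for e
  proof -
    obtain \<delta> where \<delta>: "\<delta> > 0" "\<And>y y' t. y + e \<le> y' \<Longrightarrow> H y t + \<delta> \<le> H y' t" using less_uniform[OF e] by blast
    have "\<bar>V x t - V x' t\<bar> < e" if "\<bar>x - x'\<bar> < \<delta>" for x x' t
      using \<delta>(2)[of "V x t" "V x' t" t] \<delta>(2)[of "V x' t" "V x t" t] that by (simp add: V) linarith
    with \<delta>(1) show ?thesis by blast
  qed
  have M: "0 \<le> M" using g[of 0] by linarith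
  have v_lip: "\<bar>v t - v s\<bar> \<le> M * \<bar>t - s\<bar>" if "lifted_solution (\<lambda>_. g) v" for v t s
    by (rule abs_diff_le_of_deriv_bound[of v "\<lambda>t. g (v t)"]) (use that g in \<open>auto simp: lifted_solution_def\<close>)
  \<comment> \<open>From time \<open>s\<close> to \<open>t\<close> one travels along the solution
    through \<open>H x s\<close>: its index moves by at most \<open>M * \<bar>s - t\<bar>\<close>,
    its position by at most \<open>L * \<bar>s - t\<bar>\<close>.\<close>
  have H_joint: "\<exists>d>0. \<forall>x y s t. \<bar>x - y\<bar> < d \<longrightarrow> \<bar>s - t\<bar> < d \<longrightarrow> \<bar>H x s - H y t\<bar> \<le> e" if e: "0 < e" for e
  proof -
    obtain \<delta> where \<delta>: "\<delta> > 0" "\<And>y y' t. \<bar>y - y'\<bar> < \<delta> \<Longrightarrow> \<bar>H y t - H y' t\<bar> \<le> e / 2"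
      using cont[of "e / 2"] e by auto
    define d where "d = min (\<delta> / (M + 1)) (e / (2 * L))"
    have d: "0 < d" "d \<le> \<delta> / (M + 1)" "d \<le> e / (2 * L)"
      unfolding d_def using \<delta>(1) e L_pos M by (simp, intro min.cobounded1, intro min.cobounded2)
    have "\<bar>H x s - H y t\<bar> \<le> e" if xy: "\<bar>x - y\<bar> < d" "\<bar>s - t\<bar> < d" for x y s t
    proof -
      obtain u where u: "lifted_solution f u" "u s = H x s" using solution_exists by blast
      obtain v where v: "lifted_solution (\<lambda>_. g) v" "\<And>t. u t = H (v t) t" using orbit[OF u(1)] by blast
      have "v s = x" using H_inj[of "v s" s x] v(2)[of s] u(2) by simp
      have "\<bar>v t - x\<bar> \<le> M * \<bar>s - t\<bar>" using v_lip[OF v(1), of t s] \<open>v s = x\<close> by (simp add: abs_minus_commute)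
      also have "\<dots> \<le> M * d" using xy M by (intro mult_left_mono) auto
      finally have "\<bar>v t - y\<bar> < M * d + d" using xy(1) by linarith
      also have "\<dots> \<le> \<delta>" using d(2) M by (simp add: field_simps)
      finally have "\<bar>H (v t) t - H y t\<bar> \<le> e / 2" by (rule \<delta>(2))
      moreover have "\<bar>H x s - H (v t) t\<bar> \<le> L * \<bar>s - t\<bar>"
        using solution_lipschitz[OF u(1), of s t] u(2) v(2)[of t] by simp
      moreover have "L * \<bar>s - t\<bar> \<le> L * (e / (2 * L))" using xy(2) d(3) L_pos by (intro mult_left_mono) auto
      moreover have "L * (e / (2 * L)) = e / 2" using L_pos by simp
      ultimately show ?thesis by linarith
    qed
    with d(1) show ?thesis by blast
  qed
  have V_joint: "\<exists>d>0. \<forall>x y s t. \<bar>x - y\<bar> < d \<longrightarrow> \<bar>s - t\<bar> < d \<longrightarrow> \<bar>V x s - V y t\<bar> \<le> e" if e: "0 < e" for e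
  proof -
    have "0 < e / 2" using e by simp
    from V_cont[OF this] obtain \<delta> where \<delta>: "\<delta> > 0" "\<And>x x' t. \<bar>x - x'\<bar> < \<delta> \<Longrightarrow> \<bar>V x t - V x' t\<bar> < e / 2" by blast
    \<comment> \<open>\<open>M + 1\<close> replaces \<open>M\<close> in the denominator because
      \<open>M\<close> may vanish.\<close>
    define d where "d = min (\<delta> / (L + 1)) (e / (2 * (M + 1)))"
    have d: "0 < d" "d \<le> \<delta> / (L + 1)" "d \<le> e / (2 * (M + 1))"
      unfolding d_def using \<delta>(1) e L_pos M by (simp, intro min.cobounded1, intro min.cobounded2)
    have "\<bar>V x s - V y t\<bar> \<le> e" if xy: "\<bar>x - y\<bar> < d" "\<bar>s - t\<bar> < d" for x y s t
    proof -
      obtain u where u: "lifted_solution f u" "u s = x" using solution_exists by blast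
      obtain v where v: "lifted_solution (\<lambda>_. g) v" "\<And>t. u t = H (v t) t" using orbit[OF u(1)] by blast
      have v_V: "v t = V (u t) t" for t using V_H[of "v t" t] v(2)[of t] by simp
      have "\<bar>u t - x\<bar> \<le> L * \<bar>s - t\<bar>" using solution_lipschitz[OF u(1), of t s] u(2) by (simp add: abs_minus_commute)
      also have "\<dots> \<le> L * d" using xy L_pos by (intro mult_left_mono) auto
      finally have "\<bar>u t - y\<bar> < L * d + d" using xy(1) by linarith
      also have "\<dots> \<le> \<delta>" using d(2) L_pos by (simp add: field_simps)
      finally have "\<bar>V (u t) t - V y t\<bar> < e / 2" by (rule \<delta>(2))
      moreover have "\<bar>V x s - V (u t) t\<bar> \<le> M * \<bar>s - t\<bar>"
        using v_lip[OF v(1), of s t] v_V[of s] v_V[of t] u(2) by simp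
      moreover have "M * \<bar>s - t\<bar> \<le> (M + 1) * (e / (2 * (M + 1)))" using xy(2) d(3) M by (intro mult_mono) auto
      moreover have "M + 1 \<noteq> 0" using M by linarith
      then have "(M + 1) * (e / (2 * (M + 1))) = e / 2" by (simp add: field_simps)
      ultimately show ?thesis by linarith
    qed
    with d(1) show ?thesis by blast
  qed
  note map_V = cylinder_map_to_circle[where F = V, OF V_per] and map_H = cylinder_map_to_circle[where F = H, OF per]
  note uc = cylinder_map_uniformly_continuous[where F = V, OF V_per V_joint]
    cylinder_map_uniformly_continuous[where F = H, OF per H_joint]
  have inv: "cylinder_map H (cylinder_map V z) = z" "cylinder_map V (cylinder_map H z) = z" for z
  proof -
    obtain t p where z: "z = (t, p)" by (cases z)
    have "z = (t, to_circle (circle_rep p))" by (simp add: z)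
    then show "cylinder_map H (cylinder_map V z) = z" "cylinder_map V (cylinder_map H z) = z"
      by (simp_all only: map_V map_H V V_H)
  qed
  have "surj (cylinder_map V)" "surj (cylinder_map H)" using inv by (metis surjI)+
  then have "homeomorphism UNIV UNIV (cylinder_map V) (cylinder_map H)"
    unfolding homeomorphism_def
    using inv uc[THEN uniformly_continuous_imp_continuous] by simp
  then have "equimorphism (cylinder_map V)"
    unfolding equimorphism_def using uc by blast
  moreover have "(\<exists>y. solution (\<lambda>_. g) y \<and> cylinder_map V ` integral_curve x = integral_curve y) \<and>
      strict_mono (\<lambda>t. fst (cylinder_map V (t, x t)))" if x: "solution f x" for x
  proof
    show "strict_mono (\<lambda>t. fst (cylinder_map V (t, x t)))" by (simp add: strict_mono_def cylinder_map_def)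
    obtain u where u: "lifted_solution f u" "x = to_circle \<circ> u" using x unfolding solution_def by blast
    obtain v where v: "lifted_solution (\<lambda>_. g) v" "\<And>t. u t = H (v t) t" using orbit[OF u(1)] by blast
    have "cylinder_map V (t, x t) = (t, to_circle (v t))" for t
      using V_H[of "v t" t] v(2)[of t] by (simp add: u(2) map_V)
    then have "cylinder_map V ` integral_curve x = integral_curve (to_circle \<circ> v)"
      unfolding integral_curve_def by (simp add: image_image)
    then show "\<exists>y. solution (\<lambda>_. g) y \<and> cylinder_map V ` integral_curve x = integral_curve y"
      using v(1) unfolding solution_def by blast
  qed
  ultimately show ?thesis unfolding uniformly_equivalent_def by blast
qed

section \<open>The autonomous model\<close>

text \<open>The zeros are the multiples of \<open>1 / (2 * real n)\<close>, with slopes -1 and 1 in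
  turn; the solutions between them are copies of \<open>kink\<close> scaled by this factor.\<close>

definition model :: "nat \<Rightarrow> real \<Rightarrow> real" where
  "model n x = - sin (2 * pi * real n * x) / (2 * pi * real n)"

lemma kink_deriv: "(kink has_real_derivative - sin (pi * kink e) / pi) (at e)"
proof -
  define E where "E = exp (- e)"
  have nz: "1 + E\<^sup>2 \<noteq> 0" by (smt (verit) zero_le_power2)
  have "sin (2 * arctan E) = 2 * (E / sqrt (1 + E\<^sup>2)) * (1 / sqrt (1 + E\<^sup>2))"
    by (simp only: sin_double sin_arctan cos_arctan)
  also have "\<dots> = 2 * E / (1 + E\<^sup>2)" using real_sqrt_pow2[of "1 + E\<^sup>2"] by (simp add: power2_eq_square)
  finally have *: "sin (pi * kink e) = 2 * E / (1 + E\<^sup>2)" by (simp add: kink_def E_def)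
  have "(kink has_real_derivative 2 / pi * (inverse (1 + E\<^sup>2) * (- E))) (at e)"
    unfolding kink_def E_def by (auto intro!: derivative_eq_intros)
  moreover have "2 / pi * (inverse (1 + E\<^sup>2) * (- E)) = - sin (pi * kink e) / pi"
    unfolding * using nz by (simp add: field_simps)
  ultimately show ?thesis by simp
qed

lemma model_solution_const:
  assumes "0 < n"
  shows "lifted_solution (\<lambda>_. model n) (\<lambda>t. of_int k / (2 * real n))"
proof -
  have "2 * pi * real n * (of_int k / (2 * real n)) = of_int k * pi" using assms by simp
  then have "model n (of_int k / (2 * real n)) = 0"
    unfolding model_def by (simp only: sin_int_times_real) (simp add: sin_zero_iff_int2)
  then show ?thesis by (simp add: lifted_solution_def)
qed

lemma sin_add_int_2pi: "sin (y + of_int k * (2 * pi)) = sin y"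
  using sin_int_2pin[of k] cos_int_2pin[of k] by (simp add: sin_add mult.commute mult.left_commute)

text \<open>Both families tend to the stable zero \<open>k / n\<close> as t tends to infinity, the
  first from above and the second, its reflection, from below.\<close>

lemma model_solution_kink:
  assumes "0 < n"
  shows "lifted_solution (\<lambda>_. model n) (\<lambda>t. (2 * of_int k + kink (t - T)) / (2 * real n))"
    and "lifted_solution (\<lambda>_. model n) (\<lambda>t. (2 * of_int k - kink (t - T)) / (2 * real n))"
proof -
  have sh: "((\<lambda>t. kink (t - T)) has_real_derivative - sin (pi * kink (t - T)) / pi) (at t)" for t
    using DERIV_shift[of kink _ t "- T"] kink_deriv[of "t - T"] by simp
  have a: "2 * pi * real n * ((2 * of_int k + x) / (2 * real n)) = pi * x + of_int k * (2 * pi)" for x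
    using assms by (simp add: field_simps)
  have b: "2 * pi * real n * ((2 * of_int k - x) / (2 * real n)) = - (pi * x) + of_int k * (2 * pi)" for x
    using assms by (simp add: field_simps)
  show "lifted_solution (\<lambda>_. model n) (\<lambda>t. (2 * of_int k + kink (t - T)) / (2 * real n))"
    unfolding lifted_solution_def model_def a sin_add_int_2pi
    by (intro allI) (rule derivative_eq_intros sh refl | use assms in \<open>simp add: field_simps\<close>)+
  show "lifted_solution (\<lambda>_. model n) (\<lambda>t. (2 * of_int k - kink (t - T)) / (2 * real n))"
    unfolding lifted_solution_def model_def b sin_add_int_2pi
    by (intro allI) (rule derivative_eq_intros sh refl | use assms in \<open>simp add: field_simps\<close>)+
qed

lemma trig_iterated_deriv:
  "\<exists>a' b'. (deriv ^^ k) (\<lambda>x. a * sin (c * x) + b * cos (c * x)) = (\<lambda>x. a' * sin (c * x) + b' * cos (c * x :: real))"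
proof (induction k)
  case (Suc k)
  then obtain a' b' where *: "(deriv ^^ k) (\<lambda>x. a * sin (c * x) + b * cos (c * x)) =
    (\<lambda>x. a' * sin (c * x) + b' * cos (c * x))" by blast
  have "deriv (\<lambda>x. a' * sin (c * x) + b' * cos (c * x)) x = (- b' * c) * sin (c * x) + (a' * c) * cos (c * x)" for x
    by (rule DERIV_imp_deriv) (auto intro!: derivative_eq_intros simp: algebra_simps)
  then have "(deriv ^^ Suc k) (\<lambda>x. a * sin (c * x) + b * cos (c * x)) =
    (\<lambda>x. (- b' * c) * sin (c * x) + (a' * c) * cos (c * x))" by (simp add: * fun_eq_iff)
  then show ?case by blast
qed auto

lemma model_smooth:
  assumes "0 < n"
  shows "model n \<in> Cr_periodic r"
proof -
  define c where "c = 2 * pi * real n"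
  have eq: "model n = (\<lambda>x. (- 1 / c) * sin (c * x) + 0 * cos (c * x))" by (auto simp: model_def c_def)
  have "\<exists>a b. (deriv ^^ k) (model n) = (\<lambda>x. a * sin (c * x) + b * cos (c * x))" for k
    unfolding eq by (rule trig_iterated_deriv)
  then obtain a b where ab: "\<And>k. (deriv ^^ k) (model n) = (\<lambda>x. a k * sin (c * x) + b k * cos (c * x))" by metis
  have "model n (x + 1) = model n x" for x
  proof -
    have "sin (2 * pi * real n * (x + 1)) = sin (2 * pi * real n * x + of_int (int n) * (2 * pi))"
      by (simp add: algebra_simps)
    also have "\<dots> = sin (2 * pi * real n * x)" by (rule sin_add_int_2pi)
    finally show ?thesis by (simp add: model_def)
  qed
  moreover have "(\<lambda>x. a k * sin (c * x) + b k * cos (c * x)) differentiable (at x)" for k x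
    by (auto intro!: derivative_intros simp: real_differentiable_def) 
       (auto intro!: exI derivative_eq_intros)
  moreover have "continuous_on UNIV (\<lambda>x. a k * sin (c * x) + b k * cos (c * x))" for k
    by (intro continuous_intros)
  ultimately show ?thesis by (simp add: Cr_periodic_def ab)
qed

lemma model_zero_iff:
  assumes "0 < n"
  shows "model n x = 0 \<longleftrightarrow> (\<exists>k::int. x = of_int k / (2 * real n))"
proof -
  have "model n x = 0 \<longleftrightarrow> sin (2 * pi * real n * x) = 0" using assms by (simp add: model_def)
  also have "\<dots> \<longleftrightarrow> (\<exists>k::int. 2 * pi * real n * x = of_int k * pi)" by (rule sin_zero_iff_int2)
  also have "\<dots> \<longleftrightarrow> (\<exists>k::int. x = of_int k / (2 * real n))"
    using assms by (intro ex_cong1) (auto simp: field_simps)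
  finally show ?thesis .
qed

lemma model_deriv:
  assumes "0 < n"
  shows "deriv (model n) x = - cos (2 * pi * real n * x)"
  unfolding model_def using assms by (intro DERIV_imp_deriv) (auto intro!: derivative_eq_intros)

lemma model_zero_simple:
  assumes "0 < n" "model n x = 0"
  shows "deriv (model n) x \<noteq> 0"
proof
  assume "deriv (model n) x = 0"
  then have "cos (2 * pi * real n * x) = 0" using model_deriv[OF assms(1)] by simp
  moreover have "sin (2 * pi * real n * x) = 0" using assms by (simp add: model_def)
  ultimately show False using sin_cos_squared_add[of "2 * pi * real n * x"] by simp
qed

lemma model_zero_card:
  assumes "0 < n"
  shows "card {p. model n (circle_rep p) = 0} = 2 * n"
proof -
  let ?g = "\<lambda>j::nat. to_circle (real j / (2 * real n))"
  have rep: "circle_rep (?g j) = real j / (2 * real n)" if "j < 2 * n" for j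
  proof -
    have "real j < 2 * real n" using that by linarith
    then show ?thesis using assms by (simp add: circle_rep_to_circle frac_eq)
  qed
  have "{p. model n (circle_rep p) = 0} = ?g ` {..<2 * n}"
  proof safe
    fix p assume "model n (circle_rep p) = 0"
    then obtain k :: int where k: "circle_rep p = of_int k / (2 * real n)" using model_zero_iff[OF assms] by blast
    have "0 \<le> real_of_int k" "real_of_int k < 2 * real n"
      using circle_rep_bounds[of p] assms unfolding k by (simp_all add: field_simps zero_le_divide_iff)
    then have k_bounds: "0 \<le> k" "nat k < 2 * n" by linarith+
    have "p = to_circle (of_int k / (2 * real n))" unfolding k[symmetric] by simp
    then have "p = ?g (nat k)" using k_bounds(1) by simp
    then show "p \<in> ?g ` {..<2 * n}" using k_bounds(2) by blast
  next
    fix j assume "j < 2 * n"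
    then have "circle_rep (?g j) = of_int (int j) / (2 * real n)" using rep by simp
    then show "model n (circle_rep (?g j)) = 0" using model_zero_iff[OF assms] by blast
  qed
  moreover have "inj_on ?g {..<2 * n}"
  proof (rule inj_onI)
    fix i j assume "i \<in> {..<2 * n}" "j \<in> {..<2 * n}" "?g i = ?g j"
    then have "real i / (2 * real n) = real j / (2 * real n)" using rep[of i] rep[of j] by (metis lessThan_iff)
    then show "i = j" using assms by simp
  qed
  ultimately show ?thesis by (simp add: card_image)
qed


section \<open>The cyclic arrangement of attracting and repelling solutions\<close>

context gradient_field
begin

text \<open>Lifts over one turn, closed up by the translate \<open>s n\<close> of
  \<open>s 0\<close>. The absence of further attracting or repelling solutions is stated at time 0,
  since solutions keep their order.\<close>

definition alternating :: "nat \<Rightarrow> (nat \<Rightarrow> real \<Rightarrow> real) \<Rightarrow> (nat \<Rightarrow> real \<Rightarrow> real) \<Rightarrow> bool" where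
  "alternating n s w \<longleftrightarrow> 1 \<le> n \<and> (\<forall>i\<le>n. attracting (s i)) \<and> (\<forall>i<n. repelling (w i)) \<and>
     (\<forall>i<n. \<forall>t. s i t < w i t) \<and> (\<forall>i<n. \<forall>t. w i t < s (Suc i) t) \<and> (\<forall>t. s n t = s 0 t + 1) \<and>
     (\<forall>i<n. \<forall>p. attracting p \<or> repelling p \<longrightarrow> \<not> (s i 0 < p 0 \<and> p 0 < w i 0)) \<and>
     (\<forall>i<n. \<forall>p. attracting p \<or> repelling p \<longrightarrow> \<not> (w i 0 < p 0 \<and> p 0 < s (Suc i) 0))"

lemma alternatingD:
  assumes "alternating n s w"
  shows "1 \<le> n" "i \<le> n \<Longrightarrow> attracting (s i)" "i < n \<Longrightarrow> repelling (w i)"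
    "i < n \<Longrightarrow> s i t < w i t" "i < n \<Longrightarrow> w i t < s (Suc i) t" "s n t = s 0 t + 1"
    "i < n \<Longrightarrow> \<forall>p. attracting p \<or> repelling p \<longrightarrow> \<not> (s i 0 < p 0 \<and> p 0 < w i 0)"
    "i < n \<Longrightarrow> \<forall>p. attracting p \<or> repelling p \<longrightarrow> \<not> (w i 0 < p 0 \<and> p 0 < s (Suc i) 0)"
  using assms unfolding alternating_def by simp_all

text \<open>The finitely many repelling solutions in the period above one attracting solution are
  sorted, and an attracting one is chosen between successive members. A further attracting solution
  would share a gap with a chosen one, and \<open>repelling_between\<close> would put an unlisted
  repelling solution between them.\<close>

lemma alternating_exists:
  obtains n s w where "alternating n s w"
proof -
  obtain v where v: "repelling v" using repelling_exists by blast
  obtain s0 where s0: "attracting s0" using attracting_between[OF v repelling_shift[OF v, of 1]] by auto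
  define W where "W = {w. repelling w \<and> s0 0 < w 0 \<and> w 0 < s0 0 + 1}"
  have "finite W" unfolding W_def by (rule finite_subset[OF _ repelling_finite[of "s0 0" "s0 0 + 1"]]) auto
  have W_inj: "inj_on (\<lambda>w. w 0) W"
    by (auto intro!: inj_onI solution_unique[of _ _ 0] simp: W_def repelling_solution)
  define P where "P = (\<lambda>w. w 0) ` W"
  have "finite P" using \<open>finite W\<close> by (simp add: P_def)
  define xs where "xs = sorted_list_of_set P"
  define n where "n = length xs"
  have xs: "set xs = P" "sorted_wrt (<) xs" using \<open>finite P\<close> by (simp_all add: xs_def strict_sorted_list_of_set)
  have xs_less: "xs ! i < xs ! j" if "i < j" "j < n" for i j
    using sorted_wrt_nth_less[OF xs(2)] that by (simp add: n_def)
  have "\<exists>w. repelling w \<and> s0 0 < w 0 \<and> w 0 < s0 0 + 1 \<and> w 0 = xs ! i" if "i < n" for i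
  proof -
    have "xs ! i \<in> P" using that xs(1) by (auto simp: n_def)
    then show ?thesis by (auto simp: P_def W_def)
  qed
  then obtain w where w: "\<And>i. i < n \<Longrightarrow> repelling (w i)" "\<And>i. i < n \<Longrightarrow> s0 0 < w i 0"
    "\<And>i. i < n \<Longrightarrow> w i 0 < s0 0 + 1" "\<And>i. i < n \<Longrightarrow> w i 0 = xs ! i" by metis
  have w_all: "\<exists>i<n. p 0 = w i 0" if p: "repelling p" "s0 0 < p 0" "p 0 < s0 0 + 1" for p
  proof -
    have "p 0 \<in> set xs" using p xs(1) by (auto simp: P_def W_def)
    then show ?thesis using w(4) by (auto simp: in_set_conv_nth n_def)
  qed
  have w_less: "w i 0 < w j 0" if "i < j" "j < n" for i j using xs_less[OF that] w(4) that by simp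
  have s1: "attracting (\<lambda>t. s0 t + 1)" using attracting_shift[OF s0, of 1] by simp
  obtain p where "repelling p" "s0 0 < p 0" "p 0 < s0 0 + 1" using repelling_between[OF s0 s1] by auto
  with w_all have "1 \<le> n" by force
  have "\<exists>s. attracting s \<and> w i 0 < s 0 \<and> s 0 < w (Suc i) 0" if i: "Suc i < n" for i
    using attracting_between[OF w(1) w(1), of i "Suc i"] w_less[of i "Suc i"] i by (metis Suc_lessD lessI)
  then obtain s' where s': "\<And>i. Suc i < n \<Longrightarrow> attracting (s' i)" "\<And>i. Suc i < n \<Longrightarrow> w i 0 < s' i 0"
    "\<And>i. Suc i < n \<Longrightarrow> s' i 0 < w (Suc i) 0" by metis
  \<comment> \<open>The solution chosen between \<open>w i\<close> and \<open>w (Suc i)\<close>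
    receives the index \<open>Suc i\<close>; the ends are \<open>s0\<close> and its
    translate.\<close>
  define s where "s i = (if i = 0 then s0 else if i = n then (\<lambda>t. s0 t + 1) else s' (i - 1))" for i
  have s: "attracting (s i)" if "i \<le> n" for i
    using that s0 s1 s'(1)[of "i - 1"] by (auto simp: s_def)
  have s_ge: "s0 0 \<le> s i 0" if i: "i \<le> n" for i
  proof (cases "i = 0 \<or> i = n")
    case False
    then have i': "Suc (i - 1) < n" "i - 1 < n" using i by auto
    then show ?thesis using s'(2)[OF i'(1)] w(2)[OF i'(2)] False by (simp add: s_def)
  qed (auto simp: s_def)
  have s_le: "s i 0 \<le> s0 0 + 1" if i: "i \<le> n" for i
  proof (cases "i = 0 \<or> i = n")
    case False
    then have i': "Suc (i - 1) < n" "Suc (i - 1) = i" "i < n" using i by auto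
    then show ?thesis using s'(3)[OF i'(1)] w(3)[OF i'(3)] False by (simp add: s_def)
  qed (auto simp: s_def)
  have sw0: "s i 0 < w i 0" if i: "i < n" for i
    using s'(3)[of "i - 1"] w(2)[of i] i by (cases i) (auto simp: s_def)
  have ws0: "w i 0 < s (Suc i) 0" if i: "i < n" for i
    using s'(2)[of i] w(3)[of i] i by (auto simp: s_def)
  have sw_rep: "\<not> (s i 0 < p 0 \<and> p 0 < w i 0)" if i: "i < n" and p: "repelling p" for i p
  proof
    assume between: "s i 0 < p 0 \<and> p 0 < w i 0"
    then have "s0 0 < p 0" "p 0 < s0 0 + 1" using s_ge[of i] w(3)[OF i] i by auto
    from w_all[OF p this] obtain j where j: "j < n" "p 0 = w j 0" by blast
    then have "j < i" using between w_less[of i j] by (cases i j rule: linorder_cases) auto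
    then have i0: "i \<noteq> 0" "Suc (i - 1) < n" "j \<le> i - 1" using i by auto
    then have "w j 0 \<le> w (i - 1) 0" using w_less[of j "i - 1"] i0 by (auto simp: le_less)
    also have "\<dots> < s i 0" using ws0[of "i - 1"] i0 i by simp
    finally show False using between j by simp
  qed
  have ws_rep: "\<not> (w i 0 < p 0 \<and> p 0 < s (Suc i) 0)" if i: "i < n" and p: "repelling p" for i p
  proof
    assume between: "w i 0 < p 0 \<and> p 0 < s (Suc i) 0"
    then have "s0 0 < p 0" "p 0 < s0 0 + 1" using s_le[of "Suc i"] w(2)[OF i] i by auto
    from w_all[OF p this] obtain j where j: "j < n" "p 0 = w j 0" by blast
    then have "i < j" using between w_less[of j i] i by (cases i j rule: linorder_cases) auto
    then have "Suc i < n" using j by simp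
    have "s (Suc i) 0 < w (Suc i) 0" by (rule sw0) fact
    also have "\<dots> \<le> w j 0" using w_less[of "Suc i" j] \<open>i < j\<close> j by (cases "j = Suc i") auto
    finally show False using between j by simp
  qed
  have "alternating n s w"
    unfolding alternating_def
  proof (intro conjI allI impI)
    show "s i t < w i t" if "i < n" for i t
      using solution_less[of "s i" "w i" 0 t] attracting_solution[OF s[of i]] repelling_solution[OF w(1)] sw0 that
      by simp
    show "w i t < s (Suc i) t" if "i < n" for i t
      using solution_less[of "w i" "s (Suc i)" 0 t] attracting_solution[OF s[of "Suc i"]]
        repelling_solution[OF w(1)] ws0 that
      by simp
    show "s n t = s 0 t + 1" for t using \<open>1 \<le> n\<close> by (simp add: s_def)
    show "\<not> (s i 0 < p 0 \<and> p 0 < w i 0)" if i: "i < n" and p: "attracting p \<or> repelling p" for i p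
    proof
      assume between: "s i 0 < p 0 \<and> p 0 < w i 0"
      with sw_rep[OF i] p have "attracting p" by blast
      from repelling_between[OF s[of i] this] obtain q where "repelling q" "s i 0 < q 0" "q 0 < p 0"
        using i between by auto
      with sw_rep[OF i, of q] between show False by simp
    qed
    show "\<not> (w i 0 < p 0 \<and> p 0 < s (Suc i) 0)" if i: "i < n" and p: "attracting p \<or> repelling p" for i p
    proof
      assume between: "w i 0 < p 0 \<and> p 0 < s (Suc i) 0"
      with ws_rep[OF i] p have "attracting p" by blast
      from repelling_between[OF this s[of "Suc i"]] obtain q where "repelling q" "p 0 < q 0" "q 0 < s (Suc i) 0"
        using i between by auto
      with ws_rep[OF i, of q] between show False by simp
    qed
  qed (use \<open>1 \<le> n\<close> s w in simp_all)
  then show thesis by (rule that)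
qed

text \<open>The solution \<open>p\<close> that is encountered is never strictly inside the strip, so
  the boundary curve on its side is at least as close to \<open>z\<close>.\<close>

lemma strip_passage:
  assumes ab: "lifted_solution f a" "lifted_solution f b"
    and none: "\<forall>p. attracting p \<or> repelling p \<longrightarrow> \<not> (a 0 < p 0 \<and> p 0 < b 0)" and "0 < \<eta>"
  shows "\<exists>T>0. \<forall>z t. lifted_solution f z \<longrightarrow> (\<forall>t. a t < z t \<and> z t < b t) \<longrightarrow>
      (\<exists>x\<ge>t. x \<le> t + T \<and> (\<bar>z x - a x\<bar> < \<eta> \<or> \<bar>z x - b x\<bar> < \<eta>))"
proof -
  obtain T where T: "0 < T" "\<forall>z t. lifted_solution f z \<longrightarrow>
    (\<exists>x p. t \<le> x \<and> x \<le> t + T \<and> (attracting p \<or> repelling p) \<and> \<bar>z x - p x\<bar> < \<eta>)"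
    using passage_time[OF \<open>0 < \<eta>\<close>] by blast
  have "\<exists>x\<ge>t. x \<le> t + T \<and> (\<bar>z x - a x\<bar> < \<eta> \<or> \<bar>z x - b x\<bar> < \<eta>)"
    if z: "lifted_solution f z" "\<forall>t. a t < z t \<and> z t < b t" for z t
  proof -
    obtain x p where x: "t \<le> x" "x \<le> t + T" and p: "attracting p \<or> repelling p" "\<bar>z x - p x\<bar> < \<eta>"
      using T(2) z(1) by blast
    have "lifted_solution f p" using p attracting_solution repelling_solution by blast
    then have "\<not> (a x < p x \<and> p x < b x)" using none p(1) solution_less ab by meson
    moreover have "a x < z x" "z x < b x" using z(2) by auto
    ultimately have "\<bar>z x - a x\<bar> < \<eta> \<or> \<bar>z x - b x\<bar> < \<eta>" using p(2) by linarith
    with x show ?thesis by blast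
  qed
  with T(1) show ?thesis by blast
qed

section \<open>Asymptotics inside a strip and almost periodicity\<close>

lemma strip_asymptotic_special:
  assumes s: "attracting s" and w: "repelling w" and z: "lifted_solution f z" "z \<noteq> s" "z \<noteq> w"
    and passage: "\<And>\<eta>. 0 < \<eta> \<Longrightarrow> \<exists>T. \<forall>t. \<exists>x\<ge>t. x \<le> t + T \<and> (\<bar>z x - s x\<bar> < \<eta> \<or> \<bar>z x - w x\<bar> < \<eta>)"
  shows "((\<lambda>t. z t - s t) \<longlongrightarrow> 0) at_top" "((\<lambda>t. z t - w t) \<longlongrightarrow> 0) at_bot"
proof -
  obtain C m where s': "0 < m" "contracting UNIV C m (\<lambda>t. fx t (s t))" using s unfolding attracting_iff by blast
  obtain C' m' where w': "0 < m'" "expanding UNIV C' m' (\<lambda>t. fx t (w t))" using w unfolding repelling_iff by blast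
  have fw: "\<exists>x\<ge>t. \<bar>z x - s x\<bar> < \<eta> \<or> \<bar>z x - w x\<bar> < \<eta>" if \<eta>: "0 < \<eta>" for \<eta> t
    using passage[OF \<eta>] by blast
  have bw: "\<exists>x\<le>t. \<bar>z x - s x\<bar> < \<eta> \<or> \<bar>z x - w x\<bar> < \<eta>" if \<eta>: "0 < \<eta>" for \<eta> t
  proof -
    obtain T where T: "\<forall>t. \<exists>x\<ge>t. x \<le> t + T \<and> (\<bar>z x - s x\<bar> < \<eta> \<or> \<bar>z x - w x\<bar> < \<eta>)"
      using passage[OF \<eta>] by blast
    obtain x where "x \<le> t - T + T" "\<bar>z x - s x\<bar> < \<eta> \<or> \<bar>z x - w x\<bar> < \<eta>" using T[rule_format, of "t - T"] by blast
    then show ?thesis by (intro exI[of _ x]) simp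
  qed
  show "((\<lambda>t. z t - s t) \<longlongrightarrow> 0) at_top" "((\<lambda>t. z t - w t) \<longlongrightarrow> 0) at_bot"
    by (rule strip_asymptotic[OF attracting_solution[OF s] s' repelling_solution[OF w] w' z fw bw]; assumption)+
qed

text \<open>Pigeonhole over the finite set \<open>F\<close>: an almost period of the equation
  translates \<open>u\<close>, modulo integers, close to some member of \<open>F\<close>. Two such
  translations close to the same member differ by an almost period of the projected
  solution.\<close>

lemma almost_periodic_special:
  assumes u: "lifted_solution f u"
    and fin: "finite {p. Q p \<and> 0 \<le> p 0 \<and> p 0 \<le> 1}"
    and shift: "\<And>p (n::int). Q p \<Longrightarrow> Q (\<lambda>t. p t + of_int n)"
    and shadow: "\<And>\<eta>. 0 < \<eta> \<Longrightarrow> \<exists>\<epsilon>>0. \<forall>l. almost_period \<epsilon> l \<longrightarrow> (\<exists>p. Q p \<and> (\<forall>t. \<bar>p t - u (t + l)\<bar> \<le> \<eta>))"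
  shows "almost_periodic euclidean_metric (to_circle \<circ> u)"
  unfolding almost_periodic_def
proof (intro conjI allI impI)
  have "continuous_on UNIV (to_circle \<circ> u)"
    by (rule continuous_on_compose[OF solution_continuous[OF u] continuous_on_subset[OF continuous_on_to_circle]]) simp
  then show "continuous_map euclideanreal (mtopology_of euclidean_metric) (to_circle \<circ> u)" by simp
  fix e :: real assume "0 < e"
  then have "0 < e / 2" by simp
  from shadow[OF this] obtain \<epsilon> where \<epsilon>: "0 < \<epsilon>" and
    sh: "\<And>l. almost_period \<epsilon> l \<Longrightarrow> \<exists>p. Q p \<and> (\<forall>t. \<bar>p t - u (t + l)\<bar> \<le> e / 2)" by blast
  define F where "F = {p. Q p \<and> 0 \<le> p 0 \<and> p 0 \<le> 1}"
  define R where "R l p \<longleftrightarrow> (\<exists>n::int. \<forall>t. \<bar>p t + of_int n - u (t + l)\<bar> \<le> e / 2)" for l p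
  have ex: "\<exists>p\<in>F. R l p" if l: "almost_period \<epsilon> l" for l
  proof -
    obtain p where p: "Q p" "\<And>t. \<bar>p t - u (t + l)\<bar> \<le> e / 2" using sh[OF l] by blast
    obtain n :: int where n: "0 \<le> p 0 + of_int n" "p 0 + of_int n < 0 + 1" using shift_to_unit by blast
    have "R l (\<lambda>t. p t + of_int n)" unfolding R_def using p(2) by (intro exI[of _ "- n"]) simp
    then show ?thesis using shift[OF p(1), of n] n by (intro bexI[of _ "\<lambda>t. p t + of_int n"]) (auto simp: F_def)
  qed
  \<comment> \<open>A fixed translation of \<open>u\<close> close to \<open>p\<close>. Subtracting
    \<open>\<tau> p\<close> moves \<open>l\<close> by at most \<open>M\<close>, so relative density
    survives with \<open>T + 2 * M\<close>.\<close>
  define \<tau> where "\<tau> p = (SOME l. R l p)" for p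
  define M where "M = Max (insert 0 ((\<lambda>p. \<bar>\<tau> p\<bar>) ` F))"
  have M: "\<bar>\<tau> p\<bar> \<le> M" if "p \<in> F" for p unfolding M_def using that fin by (intro Max_ge) (auto simp: F_def)
  have "0 \<le> M" unfolding M_def using fin by (intro Max_ge) (auto simp: F_def)
  obtain T where T: "0 < T" "\<And>a. \<exists>l. a < l \<and> l < a + T \<and> almost_period \<epsilon> l" using recurrent[OF \<epsilon>] by blast
  let ?L = "{l. \<forall>t. dist (to_circle (u (t + l))) (to_circle (u t)) \<le> e}"
  have "relatively_dense ?L" unfolding relatively_dense_def
  proof (intro exI[of _ "T + 2 * M"] conjI allI)
    fix a
    obtain l where l: "a + M < l" "l < a + M + T" "almost_period \<epsilon> l" using T(2) by blast
    obtain p where p: "p \<in> F" "R l p" using ex[OF l(3)] by blast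
    have "R (\<tau> p) p" unfolding \<tau>_def using p(2) by (rule someI)
    then obtain n n' :: int where n: "\<And>t. \<bar>p t + of_int n - u (t + l)\<bar> \<le> e / 2"
      "\<And>t. \<bar>p t + of_int n' - u (t + \<tau> p)\<bar> \<le> e / 2" using p(2) unfolding R_def by blast
    have "dist (to_circle (u (t + (l - \<tau> p)))) (to_circle (u t)) \<le> e" for t
    proof -
      let ?t = "t - \<tau> p"
      have "dist (to_circle (u (?t + l))) (to_circle (u (?t + \<tau> p)))
          = dist (to_circle (u (?t + l) + of_int (- n))) (to_circle (u (?t + \<tau> p) + of_int (- n')))"
        by (simp only: to_circle_add_int)
      also have "\<dots> \<le> \<bar>(u (?t + l) + of_int (- n)) - (u (?t + \<tau> p) + of_int (- n'))\<bar>"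
        by (rule dist_to_circle_le)
      also have "\<dots> \<le> e / 2 + e / 2" using n(1)[of ?t] n(2)[of ?t] unfolding of_int_minus by linarith
      finally show ?thesis by (simp add: algebra_simps)
    qed
    moreover have "a < l - \<tau> p" "l - \<tau> p < a + (T + 2 * M)" using l M[OF p(1)] by linarith+
    ultimately have "l - \<tau> p \<in> ?L \<inter> {a<..<a + (T + 2 * M)}" by simp
    then show "?L \<inter> {a<..<a + (T + 2 * M)} \<noteq> {}" by blast
  qed (use T \<open>0 \<le> M\<close> in simp)
  then show "\<exists>L. relatively_dense L \<and> (\<forall>l\<in>L. \<forall>t. mdist euclidean_metric ((to_circle \<circ> u) (t + l)) ((to_circle \<circ> u) t) \<le> e)"
    by (intro exI[of _ ?L]) auto
qed

lemma repelling_almost_periodic: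
  assumes "repelling w"
  shows "almost_periodic euclidean_metric (to_circle \<circ> w)"
proof (rule almost_periodic_special[OF repelling_solution[OF assms] repelling_finite repelling_shift])
  fix \<eta> :: real assume "0 < \<eta>"
  from repelling_shadow[OF this] assms
  show "\<exists>\<epsilon>>0. \<forall>l. almost_period \<epsilon> l \<longrightarrow> (\<exists>p. repelling p \<and> (\<forall>t. \<bar>p t - w (t + l)\<bar> \<le> \<eta>))" by blast
qed

lemma attracting_almost_periodic:
  assumes "attracting s"
  shows "almost_periodic euclidean_metric (to_circle \<circ> s)"
proof (rule almost_periodic_special[OF attracting_solution[OF assms] attracting_finite attracting_shift])
  fix \<eta> :: real assume "0 < \<eta>"
  from attracting_shadow[OF this] assms
  show "\<exists>\<epsilon>>0. \<forall>l. almost_period \<epsilon> l \<longrightarrow> (\<exists>p. attracting p \<and> (\<forall>t. \<bar>p t - s (t + l)\<bar> \<le> \<eta>))" by blast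
qed

end

section \<open>Cells between neighbours and equivalence with the model\<close>

lemma step_exists:
  fixes a :: "nat \<Rightarrow> real"
  assumes "a 0 \<le> x" "x < a n"
  shows "\<exists>i<n. a i \<le> x \<and> x < a (Suc i)"
  using assms
proof (induction n)
  case (Suc n)
  then show ?case by (cases "x < a n") (auto simp: less_Suc_eq not_less)
qed simp

lemma step_less:
  fixes a :: "nat \<Rightarrow> real"
  assumes "\<And>i. Suc i \<le> n \<Longrightarrow> a i < a (Suc i)"
  shows "i < j \<Longrightarrow> j \<le> n \<Longrightarrow> a i < a j"
proof (induction j)
  case (Suc j)
  then show ?case using assms[of j] by (cases "i = j") (auto intro: less_trans)
qed simp

context gradient_field
begin

definition cell_family :: "(real \<Rightarrow> real \<Rightarrow> real) \<Rightarrow> bool" where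
  "cell_family Z \<longleftrightarrow> (\<forall>a b. 0 \<le> a \<longrightarrow> a < b \<longrightarrow> b \<le> 1 \<longrightarrow> (\<exists>\<delta>>0. \<forall>t. Z a t + \<delta> \<le> Z b t)) \<and>
     (\<forall>\<eta>>0. \<exists>\<delta>>0. \<forall>a\<in>{0..1}. \<forall>b\<in>{0..1}. \<bar>a - b\<bar> < \<delta> \<longrightarrow> (\<forall>t. \<bar>Z a t - Z b t\<bar> \<le> \<eta>))"

lemma descending_cell:
  assumes s: "attracting s" and w: "repelling w" and less: "\<And>t. s t < w t"
    and none: "\<forall>p. attracting p \<or> repelling p \<longrightarrow> \<not> (s 0 < p 0 \<and> p 0 < w 0)"
  shows "\<exists>Z. cell_family Z \<and> (\<forall>t. Z 0 t = s t \<and> Z 1 t = w t) \<and>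
    (\<forall>z. lifted_solution f z \<longrightarrow> (\<forall>t. s t < z t \<and> z t < w t) \<longrightarrow> (\<exists>T. \<forall>t. z t = Z (kink (t - T)) t))"
proof -
  obtain C m where s': "0 < m" "contracting UNIV C m (\<lambda>t. fx t (s t))" using s unfolding attracting_iff by blast
  obtain C' m' where w': "0 < m'" "expanding UNIV C' m' (\<lambda>t. fx t (w t))" using w unfolding repelling_iff by blast
  note sol = attracting_solution[OF s] repelling_solution[OF w]
  show ?thesis
  proof (rule strip_family[OF sol(1) s' sol(2) w' less strip_passage[where a = s and b = w, OF sol none]])
    fix Z :: "real \<Rightarrow> real \<Rightarrow> real"
    assume Z: "\<And>t. Z 0 t = s t" "\<And>t. Z 1 t = w t"
      "\<And>a b. 0 \<le> a \<Longrightarrow> a < b \<Longrightarrow> b \<le> 1 \<Longrightarrow> \<exists>\<delta>>0. \<forall>t. Z a t + \<delta> \<le> Z b t"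
      "\<And>\<eta>. 0 < \<eta> \<Longrightarrow> \<exists>\<delta>>0. \<forall>a\<in>{0..1}. \<forall>b\<in>{0..1}. \<bar>a - b\<bar> < \<delta> \<longrightarrow> (\<forall>t. \<bar>Z a t - Z b t\<bar> \<le> \<eta>)"
      "\<And>z. lifted_solution f z \<Longrightarrow> (\<And>t. s t < z t \<and> z t < w t) \<Longrightarrow> \<exists>T. \<forall>t. z t = Z (kink (t - T)) t"
    have "cell_family Z" unfolding cell_family_def using Z(3,4) by simp
    with Z(1,2,5) show ?thesis by (intro exI[of _ Z]) simp
  qed
qed

lemma ascending_cell:
  assumes s: "attracting s" and w: "repelling w" and less: "\<And>t. w t < s t"
    and none: "\<forall>p. attracting p \<or> repelling p \<longrightarrow> \<not> (w 0 < p 0 \<and> p 0 < s 0)"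
  shows "\<exists>Z. cell_family Z \<and> (\<forall>t. Z 0 t = w t \<and> Z 1 t = s t) \<and>
    (\<forall>z. lifted_solution f z \<longrightarrow> (\<forall>t. w t < z t \<and> z t < s t) \<longrightarrow> (\<exists>T. \<forall>t. z t = Z (1 - kink (t - T)) t))"
proof -
  obtain C m where s': "0 < m" "contracting UNIV C m (\<lambda>t. fx t (s t))" using s unfolding attracting_iff by blast
  obtain C' m' where w': "0 < m'" "expanding UNIV C' m' (\<lambda>t. fx t (w t))" using w unfolding repelling_iff by blast
  note sol = attracting_solution[OF s] repelling_solution[OF w]
  have passage: "\<exists>T>0. \<forall>z t. lifted_solution f z \<longrightarrow> (\<forall>t. w t < z t \<and> z t < s t) \<longrightarrow>
      (\<exists>x\<ge>t. x \<le> t + T \<and> (\<bar>z x - s x\<bar> < \<eta> \<or> \<bar>z x - w x\<bar> < \<eta>))" if "0 < \<eta>" for \<eta>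
    using strip_passage[where a = w and b = s, OF sol(2,1) none that] by (simp only: disj_commute)
  show ?thesis
  proof (rule strip_family_mirrored[OF sol(1) s' sol(2) w' less passage])
    fix Z :: "real \<Rightarrow> real \<Rightarrow> real"
    assume Z: "\<And>t. Z 0 t = w t" "\<And>t. Z 1 t = s t"
      "\<And>a b. 0 \<le> a \<Longrightarrow> a < b \<Longrightarrow> b \<le> 1 \<Longrightarrow> \<exists>\<delta>>0. \<forall>t. Z a t + \<delta> \<le> Z b t"
      "\<And>\<eta>. 0 < \<eta> \<Longrightarrow> \<exists>\<delta>>0. \<forall>a\<in>{0..1}. \<forall>b\<in>{0..1}. \<bar>a - b\<bar> < \<delta> \<longrightarrow> (\<forall>t. \<bar>Z a t - Z b t\<bar> \<le> \<eta>)"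
      "\<And>z. lifted_solution f z \<Longrightarrow> (\<And>t. w t < z t \<and> z t < s t) \<Longrightarrow> \<exists>T. \<forall>t. z t = Z (1 - kink (t - T)) t"
    have "cell_family Z" unfolding cell_family_def using Z(3,4) by simp
    with Z(1,2,5) show ?thesis by (intro exI[of _ Z]) simp
  qed
qed

text \<open>Descending and ascending strips alternate, which gives \<open>2 * n\<close> cells; the
  attracting solutions correspond to the even and the repelling ones to the odd multiples of
  \<open>1 / (2 * real n)\<close>.\<close>

lemma uniformly_equivalent_model:
  assumes "alternating n s w"
  shows "uniformly_equivalent f (\<lambda>_. model n)"
proof -
  note n = alternatingD(1)[OF assms] and s = alternatingD(2)[OF assms] and w = alternatingD(3)[OF assms]
    and sw = alternatingD(4)[OF assms] and ws = alternatingD(5)[OF assms] and sn = alternatingD(6)[OF assms]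
    and none_sw = alternatingD(7)[OF assms] and none_ws = alternatingD(8)[OF assms]
  define PS where "PS i Z \<longleftrightarrow> cell_family Z \<and> (\<forall>t. Z 0 t = s i t \<and> Z 1 t = w i t) \<and>
    (\<forall>z. lifted_solution f z \<longrightarrow> (\<forall>t. s i t < z t \<and> z t < w i t) \<longrightarrow> (\<exists>T. \<forall>t. z t = Z (kink (t - T)) t))" for i Z
  define PW where "PW i Z \<longleftrightarrow> cell_family Z \<and> (\<forall>t. Z 0 t = w i t \<and> Z 1 t = s (Suc i) t) \<and>
    (\<forall>z. lifted_solution f z \<longrightarrow> (\<forall>t. w i t < z t \<and> z t < s (Suc i) t) \<longrightarrow>
      (\<exists>T. \<forall>t. z t = Z (1 - kink (t - T)) t))" for i Z
  have "\<exists>Z. i < n \<longrightarrow> PS i Z" for i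
    using descending_cell[of "s i" "w i"] s w sw none_sw unfolding PS_def by (cases "i < n") auto
  then obtain ZS where ZS: "\<And>i. i < n \<Longrightarrow> PS i (ZS i)" by metis
  have "\<exists>Z. i < n \<longrightarrow> PW i Z" for i
    using ascending_cell[of "s (Suc i)" "w i"] s w ws none_ws unfolding PW_def by (cases "i < n") auto
  then obtain ZW where ZW: "\<And>i. i < n \<Longrightarrow> PW i (ZW i)" by metis
  define Z where "Z j = (if even j then ZS (j div 2) else ZW (j div 2))" for j :: nat
  have cell: "cell_family (Z j)" if "j < 2 * n" for j
    using ZS[of "j div 2"] ZW[of "j div 2"] that by (auto simp: Z_def PS_def PW_def)
  have Z_ends: "Z (2 * i) 0 t = s i t" "Z (2 * i) 1 t = w i t" "Z (2 * i + 1) 0 t = w i t"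
    "Z (2 * i + 1) 1 t = s (Suc i) t" if "i < n" for i t
    using ZS[OF that] ZW[OF that] by (auto simp: Z_def PS_def PW_def)
  have next_cell: "Z j 1 t = Z (Suc j) 0 t" if "Suc j < 2 * n" for j t
  proof (cases "even j")
    case True
    then obtain i where "j = 2 * i" by blast
    then show ?thesis using Z_ends(2,3)[of i t] that by simp
  next
    case False
    then obtain i where "j = 2 * i + 1" by (rule oddE)
    then show ?thesis using Z_ends(4)[of i t] Z_ends(1)[of "Suc i" t] that by simp
  qed
  have last_cell: "Z (2 * n - 1) 1 t = Z 0 0 t + 1" for t
  proof -
    have "2 * n - 1 = 2 * (n - 1) + 1" using n by simp
    then show ?thesis using Z_ends(4)[of "n - 1" t] Z_ends(1)[of 0 t] n sn[of t] by simp
  qed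
  have Z_less: "\<exists>\<delta>>0. \<forall>t. Z j a t + \<delta> \<le> Z j b t" if "j < 2 * n" "0 \<le> a" "a < b" "b \<le> 1" for j a b
    using cell[OF that(1)] that unfolding cell_family_def by blast
  have Z_cont: "\<exists>\<delta>>0. \<forall>a\<in>{0..1}. \<forall>b\<in>{0..1}. \<bar>a - b\<bar> < \<delta> \<longrightarrow> (\<forall>t. \<bar>Z j a t - Z j b t\<bar> \<le> \<eta>)"
    if "j < 2 * n" "0 < \<eta>" for j \<eta>
    using cell[OF that(1)] that unfolding cell_family_def by blast
  have "0 < 2 * n" using n by simp
  show ?thesis
  proof (rule glue_cells[of "2 * n" Z, OF \<open>0 < 2 * n\<close> next_cell last_cell Z_less Z_cont])
    fix H :: "real \<Rightarrow> real \<Rightarrow> real"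
    assume per: "\<And>y t. H (y + real (2 * n)) t = H y t + 1"
      and less: "\<And>y y'. y < y' \<Longrightarrow> \<exists>\<delta>>0. \<forall>t. H y t + \<delta> \<le> H y' t"
      and cont: "\<And>\<eta>. 0 < \<eta> \<Longrightarrow> \<exists>\<delta>>0. \<forall>y y' t. \<bar>y - y'\<bar> < \<delta> \<longrightarrow> \<bar>H y t - H y' t\<bar> \<le> \<eta>"
      and H_Z: "\<And>j \<theta> t. j < 2 * n \<Longrightarrow> 0 \<le> \<theta> \<Longrightarrow> \<theta> \<le> 1 \<Longrightarrow> H (real j + \<theta>) t = Z j \<theta> t"
    define N where "N = 2 * real n"
    have N: "0 < N" using n by (simp add: N_def)
    define K where "K y t = H (N * y) t" for y t
    have K_per: "K (y + 1) t = K y t + 1" for y t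
      using per[of "N * y" t] by (simp add: K_def N_def distrib_left)
    have K_per_int: "K (y + of_int k) t = K y t + of_int k" for y k t
      by (rule periodic_shift_map) (rule K_per)
    have K_div: "K (x / N) t = H x t" for x t using N by (simp add: K_def)
    show "uniformly_equivalent f (\<lambda>_. model n)"
    proof (rule uniformly_equivalent_of_family[of K "model n" "1 / (2 * pi * real n)"])
      show "K (y + 1) t = K y t + 1" for y t by (rule K_per)
      show "\<exists>\<delta>>0. \<forall>t. K y t + \<delta> \<le> K y' t" if "y < y'" for y y'
        unfolding K_def using that N by (intro less) simp
      show "\<exists>\<delta>>0. \<forall>y y' t. \<bar>y - y'\<bar> < \<delta> \<longrightarrow> \<bar>K y t - K y' t\<bar> \<le> \<eta>" if \<eta>: "0 < \<eta>" for \<eta>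
      proof -
        obtain \<delta> where \<delta>: "\<delta> > 0" "\<And>y y' t. \<bar>y - y'\<bar> < \<delta> \<Longrightarrow> \<bar>H y t - H y' t\<bar> \<le> \<eta>" using cont[OF \<eta>] by blast
        have "\<bar>K y t - K y' t\<bar> \<le> \<eta>" if "\<bar>y - y'\<bar> < \<delta> / N" for y y' t
        proof -
          have "\<bar>N * y - N * y'\<bar> = N * \<bar>y - y'\<bar>" using N by (simp add: abs_mult flip: right_diff_distrib)
          also have "\<dots> < \<delta>" using that N by (simp add: field_simps)
          finally show ?thesis unfolding K_def by (rule \<delta>(2))
        qed
        moreover have "0 < \<delta> / N" using \<delta>(1) N by simp
        ultimately show ?thesis by blast
      qed
      show "\<bar>model n x\<bar> \<le> 1 / (2 * pi * real n)" for x
        using abs_sin_le_one[of "2 * pi * real n * x"] n by (simp add: model_def abs_divide abs_mult divide_right_mono)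
      fix u assume u: "lifted_solution f u"
      \<comment> \<open>An integer translate of \<open>u\<close> starts between \<open>s 0\<close>
        and \<open>s n\<close>; the model solution is translated back at the end.\<close>
      obtain k :: int where k: "s 0 0 \<le> u 0 + of_int k" "u 0 + of_int k < s 0 0 + 1" using shift_to_unit by blast
      define z where "z t = u t + of_int k" for t
      have z: "lifted_solution f z" unfolding z_def by (rule solution_shift_int[OF u])
      have "s 0 0 \<le> z 0" "z 0 < s n 0" using k sn by (simp_all add: z_def)
      from step_exists[of "\<lambda>i. s i 0", OF this]
      obtain i where i: "i < n" "s i 0 \<le> z 0" "z 0 < s (Suc i) 0" by blast
      have si: "lifted_solution f (s i)" "lifted_solution f (s (Suc i))"
        using attracting_solution s i(1) by simp_all
      note wi = repelling_solution[OF w[OF i(1)]]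
      have "\<exists>v. lifted_solution (\<lambda>_. model n) v \<and> (\<forall>t. z t = K (v t) t)"
      proof -
        have n0: "0 < n" using n by simp
        consider "z 0 = s i 0" | "s i 0 < z 0" "z 0 < w i 0" | "z 0 = w i 0" | "w i 0 < z 0" using i by linarith
        then show ?thesis
        proof cases
          case 1
          then have "z = s i" using solution_unique[OF z si(1)] i by simp
          then have "z t = K (of_int (int (2 * i)) / (2 * real n)) t" for t
            using K_div[of "2 * real i" t] H_Z[of "2 * i" 0 t] Z_ends(1)[OF i(1)] i(1) by (simp add: N_def)
          then show ?thesis using model_solution_const[OF n0, of "int (2 * i)"] by blast
        next
          case 2
          have "s i t < z t \<and> z t < w i t" for t
            using solution_less[OF si(1) z 2(1), of t] solution_less[OF z wi 2(2), of t] by simp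
          then obtain T where T: "\<And>t. z t = ZS i (kink (t - T)) t"
            using ZS[OF i(1)] z unfolding PS_def by blast
          have "z t = K ((2 * of_int (int i) + kink (t - T)) / (2 * real n)) t" for t
            using K_div[of "2 * real i + kink (t - T)" t] H_Z[of "2 * i" "kink (t - T)" t] i(1)
              kink_bounds[of "t - T"] T[of t] by (simp add: N_def Z_def)
          then show ?thesis using model_solution_kink(1)[OF n0, of "int i" T] by blast
        next
          case 3
          then have "z = w i" using solution_unique[OF z wi] by simp
          then have "z t = K (of_int (int (2 * i + 1)) / (2 * real n)) t" for t
            using K_div[of "2 * real i + 1" t] H_Z[of "2 * i + 1" 0 t] Z_ends(3)[OF i(1)] i(1)
            by (simp add: N_def add.commute)
          then show ?thesis using model_solution_const[OF n0, of "int (2 * i + 1)"] by blast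
        next
          case 4
          have "w i t < z t \<and> z t < s (Suc i) t" for t
            using solution_less[OF wi z 4, of t] solution_less[OF z si(2) i(3), of t] by simp
          then obtain T where T: "\<And>t. z t = ZW i (1 - kink (t - T)) t"
            using ZW[OF i(1)] z unfolding PW_def by blast
          \<comment> \<open>In an ascending cell the index is measured downwards from the attracting
            solution \<open>s (Suc i)\<close>, that is from \<open>2 * (i + 1)\<close>.\<close>
          have "z t = K ((2 * of_int (int i + 1) - kink (t - T)) / (2 * real n)) t" for t
          proof -
            have "2 * of_int (int i + 1) - kink (t - T) = real (2 * i + 1) + (1 - kink (t - T))" by simp
            then show ?thesis
              using K_div[of "real (2 * i + 1) + (1 - kink (t - T))" t] H_Z[of "2 * i + 1" "1 - kink (t - T)" t] i(1)
                kink_bounds[of "t - T"] T[of t] by (simp only: N_def) (simp add: Z_def)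
          qed
          then show ?thesis using model_solution_kink(2)[OF n0, of "int i + 1" T] by blast
        qed
      qed
      then obtain v where v: "lifted_solution (\<lambda>_. model n) v" "\<And>t. z t = K (v t) t" by blast
      have "u t = K (v t + of_int (- k)) t" for t using v(2)[of t] K_per_int[of "v t" "- k" t] by (simp add: z_def)
      moreover have "lifted_solution (\<lambda>_. model n) (\<lambda>t. v t + of_int (- k))"
      proof -
        have "model n (x + 1) = model n x" for x using model_smooth[of n 0] n by (simp add: Cr_periodic_def)
        from periodic_shift_int[of "model n", OF this]
        have "model n (v t + of_int (- k)) = model n (v t)" for t .
        then show ?thesis using v(1) unfolding lifted_solution_def by (auto intro!: derivative_eq_intros)
      qed
      ultimately show "\<exists>v. lifted_solution (\<lambda>_. model n) v \<and> (\<forall>t. u t = K (v t) t)" by blast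
    qed
  qed
qed

end


section \<open>From the circle to the line\<close>

lemma Cr_periodic_diff:
  assumes "g \<in> Cr_periodic r" "h \<in> Cr_periodic r"
  shows "(\<lambda>x. g x - h x) \<in> Cr_periodic r"
proof -
  have "(deriv ^^ k) (\<lambda>x. g x - h x) differentiable at x" if "k < r" for k x
    using assms that by (subst Cr_periodic_deriv_diff[OF assms]) (auto simp: Cr_periodic_def)
  moreover have "continuous_on UNIV ((deriv ^^ r) (\<lambda>x. g x - h x))"
    using assms by (subst Cr_periodic_deriv_diff[OF assms]) (auto simp: Cr_periodic_def intro!: continuous_intros)
  ultimately show ?thesis using assms by (auto simp: Cr_periodic_def)
qed

lemma Cr_norm_ge:
  assumes "g \<in> Cr_periodic r" "k \<le> r"
  shows "\<bar>(deriv ^^ k) g x\<bar> \<le> Cr_norm r g"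
proof -
  have le: "\<bar>(deriv ^^ j) g x\<bar> \<le> (SUP x. \<bar>(deriv ^^ j) g x\<bar>)" if "j \<le> r" for j x
    by (rule cSUP_upper[OF _ Cr_periodic_bdd[OF assms(1) that]]) simp
  have "(SUP x. \<bar>(deriv ^^ k) g x\<bar>) \<le> Cr_norm r g"
    unfolding Cr_norm_def
  proof (rule member_le_sum)
    fix j assume "j \<in> {..r} - {k}"
    then show "0 \<le> (SUP x. \<bar>(deriv ^^ j) g x\<bar>)" using le[of j 0] by simp
  qed (use assms in auto)
  with le[OF assms(2), of x] show ?thesis by linarith
qed

lemma Cr_dist_ge:
  assumes "g \<in> Cr_periodic r" "h \<in> Cr_periodic r" "k \<le> r"
  shows "\<bar>(deriv ^^ k) g x - (deriv ^^ k) h x\<bar> \<le> Cr_dist r g h"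
  using Cr_norm_ge[OF Cr_periodic_diff[OF assms(1,2)] assms(3), of x] assms
  by (simp add: Cr_periodic_deriv_diff Cr_dist_def)

text \<open>The oriented interval integral of the dichotomy and the integral over
  \<open>{s..t}\<close> are differences of one and the same antiderivative.\<close>

lemma dichotomy_integral:
  fixes a :: "real \<Rightarrow> real"
  assumes a: "continuous_on UNIV a" "\<And>t. linearization f x t = a t"
  shows "s \<le> t \<Longrightarrow> (LBINT y=s..t. linearization f x y) = integral {s..t} a"
    and "t \<le> s \<Longrightarrow> (LBINT y=s..t. linearization f x y) = - integral {t..s} a"
proof -
  obtain A where A: "\<And>t. (A has_real_derivative a t) (at t)" using antiderivative_exists[OF a(1)] by blast
  have "(LBINT y=s..t. a y) = A t - A s"
    by (rule interval_integral_FTC_finite[OF continuous_on_subset[OF a(1) subset_UNIV]])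
      (use A in \<open>auto simp: has_real_derivative_iff_has_vector_derivative intro: has_vector_derivative_at_within\<close>)
  then have *: "(LBINT y=s..t. linearization f x y) = A t - A s" by (simp add: a(2))
  show "s \<le> t \<Longrightarrow> (LBINT y=s..t. linearization f x y) = integral {s..t} a"
    using integral_eq_antiderivative[of A a s t] A * by simp
  show "t \<le> s \<Longrightarrow> (LBINT y=s..t. linearization f x y) = - integral {t..s} a"
    using integral_eq_antiderivative[of A a t s] A * by simp
qed

lemma exp_le_iff_ln:
  assumes "0 < C"
  shows "exp x \<le> C * exp y \<longleftrightarrow> x \<le> ln C + (y :: real)"
proof -
  have "C * exp y = exp (ln C + y)" using assms by (simp add: exp_add)
  then show ?thesis by simp
qed

lemma stable_dichotomy_iff:
  assumes a: "continuous_on UNIV a" "\<And>t. linearization f x t = a t"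
  shows "stable_dichotomy f J x \<longleftrightarrow> (\<exists>C m. 0 < m \<and> contracting J C m a)"
proof -
  have *: "(\<forall>\<tau>\<in>J. \<forall>t\<in>J. \<tau> \<le> t \<longrightarrow> exp (LBINT s=\<tau>..t. linearization f x s) \<le> C * exp (- m * (t - \<tau>)))
      \<longleftrightarrow> contracting J (ln C) m a" if "0 < C" for C m
    unfolding contracting_def exp_le_iff_ln[OF that] by (simp add: dichotomy_integral(1)[OF a])
  show ?thesis
  proof
    assume "stable_dichotomy f J x"
    then show "\<exists>C m. 0 < m \<and> contracting J C m a" unfolding stable_dichotomy_def using * by blast
  next
    assume "\<exists>C m. 0 < m \<and> contracting J C m a"
    then obtain C m where "0 < m" "contracting J (ln (exp C)) m a" by auto
    then show "stable_dichotomy f J x" unfolding stable_dichotomy_def using *[of "exp C" m]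
      by (intro exI[of _ "exp C"] conjI exI[of _ m]) simp_all
  qed
qed

lemma unstable_dichotomy_iff:
  assumes a: "continuous_on UNIV a" "\<And>t. linearization f x t = a t"
  shows "unstable_dichotomy f J x \<longleftrightarrow> (\<exists>C m. 0 < m \<and> expanding J C m a)"
proof -
  have *: "(\<forall>\<tau>\<in>J. \<forall>t\<in>J. t \<le> \<tau> \<longrightarrow> exp (LBINT s=\<tau>..t. linearization f x s) \<le> C * exp (m * (t - \<tau>)))
      \<longleftrightarrow> expanding J (ln C) m a" if "0 < C" for C m
  proof -
    have "exp (LBINT s=\<tau>..t. linearization f x s) \<le> C * exp (m * (t - \<tau>)) \<longleftrightarrow>
        m * (\<tau> - t) - ln C \<le> integral {t..\<tau>} a" if "t \<le> \<tau>" for \<tau> t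
      unfolding exp_le_iff_ln[OF \<open>0 < C\<close>] dichotomy_integral(2)[OF a that] by (simp add: algebra_simps) linarith?
    then show ?thesis unfolding expanding_def by blast
  qed
  show ?thesis
  proof
    assume "unstable_dichotomy f J x"
    then show "\<exists>C m. 0 < m \<and> expanding J C m a" unfolding unstable_dichotomy_def using * by blast
  next
    assume "\<exists>C m. 0 < m \<and> expanding J C m a"
    then obtain C m where "0 < m" "expanding J (ln (exp C)) m a" by auto
    then show "unstable_dichotomy f J x" unfolding unstable_dichotomy_def using *[of "exp C" m]
      by (intro exI[of _ "exp C"] conjI exI[of _ m]) simp_all
  qed
qed

lemma linearization_to_circle:
  assumes "\<And>x. f t (x + 1) = f t x"
  shows "linearization f (to_circle \<circ> u) t = deriv (f t) (u t)"
proof -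
  have "deriv (f t) (x + 1) = deriv (f t) x" for x using deriv_iter_periodic[of "f t" 1 x] assms by simp
  from periodic_shift_int[of "deriv (f t)" "frac (u t)" "\<lfloor>u t\<rfloor>", OF this]
  show ?thesis by (simp add: linearization_def circle_rep_to_circle frac_def)
qed

section \<open>Regularity of an almost periodic field\<close>

locale almost_periodic_nvf =
  fixes r :: nat and f :: "real \<Rightarrow> real \<Rightarrow> real"
  assumes r: "1 \<le> r" and nvf: "nonautonomous_vf r f" and ap: "almost_periodic (Cr_metric r) f"
begin

lemma f_Cr: "f t \<in> Cr_periodic r"
  using nvf unfolding nonautonomous_vf_def uniformly_continuous_map_def by auto

lemma f_diff_le: "\<bar>f s x - f t x\<bar> \<le> Cr_dist r (f s) (f t)"
  and fx_diff_le: "\<bar>deriv (f s) x - deriv (f t) x\<bar> \<le> Cr_dist r (f s) (f t)"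
  using Cr_dist_ge[OF f_Cr f_Cr, of 0] Cr_dist_ge[OF f_Cr f_Cr, of 1] r by simp_all

lemma f_uniform:
  assumes "0 < e"
  shows "\<exists>d>0. \<forall>s t. \<bar>s - t\<bar> < d \<longrightarrow> Cr_dist r (f s) (f t) < e"
proof -
  have "uniformly_continuous_map euclidean_metric (Cr_metric r) f" using nvf by (simp add: nonautonomous_vf_def)
  then obtain d where "d > 0" "\<And>s t. dist s t < d \<Longrightarrow> Cr_dist r (f s) (f t) < e"
    using assms unfolding uniformly_continuous_map_def by fastforce
  then show ?thesis by (auto simp: dist_real_def)
qed

lemma f_periodic: "f t (x + 1) = f t x"
  using f_Cr[of t] by (simp add: Cr_periodic_def)

lemma f_deriv: "(f t has_real_derivative deriv (f t) x) (at x)"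
proof -
  have "\<forall>k<r. \<forall>x. (deriv ^^ k) (f t) differentiable (at x)" using f_Cr[of t] by (simp add: Cr_periodic_def)
  from this[rule_format, of 0 x] r show ?thesis by (simp add: DERIV_deriv_iff_real_differentiable)
qed

lemma fx_continuous: "continuous_on UNIV (deriv (f t))"
  using Cr_periodic_continuous[OF f_Cr, of 1] r by simp

lemma recurrent_translates:
  assumes "0 < e"
  shows "\<exists>T>0. \<forall>a. \<exists>l. a < l \<and> l < a + T \<and> (\<forall>t. Cr_dist r (f (t + l)) (f t) \<le> e)"
proof -
  obtain S where S: "relatively_dense S" "\<And>l t. l \<in> S \<Longrightarrow> Cr_dist r (f (t + l)) (f t) \<le> e"
    using ap assms unfolding almost_periodic_def by (metis mdist_Cr_metric)
  then obtain T where "T > 0" "\<And>a. S \<inter> {a<..<a + T} \<noteq> {}" unfolding relatively_dense_def by blast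
  with S(2) show ?thesis by (intro exI[of _ T]) fastforce
qed

text \<open>For \<open>r = 1\<close> a bound on the norm gives no modulus of continuity of the
  derivative in \<open>x\<close>. Almost periodicity supplies it: an almost period moves the time
  into \<open>[0, T]\<close>, an integer shift moves \<open>x\<close> into \<open>[0, 1)\<close>,
  and compactness does the rest.\<close>

lemma fx_uniform:
  assumes e: "0 < e"
  shows "\<exists>d>0. \<forall>s t x y. \<bar>s - t\<bar> < d \<longrightarrow> \<bar>x - y\<bar> < d \<longrightarrow> \<bar>deriv (f s) x - deriv (f t) y\<bar> < e"
proof -
  have e4: "0 < e / 4" using e by simp
  obtain T where T: "0 < T" "\<And>a. \<exists>l. a < l \<and> l < a + T \<and> (\<forall>t. Cr_dist r (f (t + l)) (f t) \<le> e / 4)"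
    using recurrent_translates[OF e4] by blast
  \<comment> \<open>The margin around \<open>[0, 1]\<close> accommodates the second point, which is
    less than 1 away from the first.\<close>
  have "continuous_on ({0..T} \<times> {-1..2}) (\<lambda>z. deriv (f (fst z)) (snd z))"
    unfolding continuous_on_iff
  proof safe
    fix s x b :: real assume b: "0 < b"
    then have b2: "0 < b / 2" by simp
    obtain d1 where d1: "d1 > 0" "\<And>s t. \<bar>s - t\<bar> < d1 \<Longrightarrow> Cr_dist r (f s) (f t) < b / 2" using f_uniform[OF b2] by blast
    obtain d2 where d2: "d2 > 0" "\<And>y. dist y x < d2 \<Longrightarrow> dist (deriv (f s) y) (deriv (f s) x) < b / 2"
      using fx_continuous[of s] b2 unfolding continuous_on_iff by blast
    have "dist (deriv (f (fst z)) (snd z)) (deriv (f (fst (s, x))) (snd (s, x))) < b"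
      if "dist z (s, x) < min d1 d2" for z
    proof -
      have "dist (fst z) s < d1" "dist (snd z) x < d2"
        using that dist_fst_le[of z "(s, x)"] dist_snd_le[of z "(s, x)"] by auto
      then have "Cr_dist r (f (fst z)) (f s) < b / 2" "dist (deriv (f s) (snd z)) (deriv (f s) x) < b / 2"
        using d1(2) d2(2) by (auto simp: dist_real_def)
      with fx_diff_le[of "fst z" "snd z" s] show ?thesis unfolding dist_real_def fst_conv snd_conv by linarith
    qed
    then show "\<exists>d>0. \<forall>z\<in>{0..T} \<times> {- 1..2}. dist z (s, x) < d \<longrightarrow>
        dist (deriv (f (fst z)) (snd z)) (deriv (f (fst (s, x))) (snd (s, x))) < b"
      using d1 d2 by (intro exI[of _ "min d1 d2"]) auto
  qed
  then have "uniformly_continuous_on ({0..T} \<times> {-1..2}) (\<lambda>z. deriv (f (fst z)) (snd z))"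
    by (intro compact_uniformly_continuous compact_Times) auto
  then obtain d where d: "d > 0" "\<And>z z'. z \<in> {0..T} \<times> {-1..2} \<Longrightarrow> z' \<in> {0..T} \<times> {-1..2} \<Longrightarrow>
      dist z' z < d \<Longrightarrow> dist (deriv (f (fst z')) (snd z')) (deriv (f (fst z)) (snd z)) < e / 4"
    by (rule uniformly_continuous_onE[OF _ e4]) blast
  obtain d' where d': "d' > 0" "\<And>s t. \<bar>s - t\<bar> < d' \<Longrightarrow> Cr_dist r (f s) (f t) < e / 4" using f_uniform[OF e4] by blast
  have per: "deriv (f t) (x + of_int n) = deriv (f t) x" for t x n
    using periodic_shift_int[of "deriv (f t)" x n] deriv_iter_periodic[of "f t" 1] f_periodic by simp
  have "\<bar>deriv (f s) x - deriv (f t) y\<bar> < e" if st: "\<bar>s - t\<bar> < min (min d d') 1" "\<bar>x - y\<bar> < min (min d d') 1" for s t x y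
  proof -
    obtain l where l: "s - T < l" "l < s" "\<And>t. Cr_dist r (f (t + l)) (f t) \<le> e / 4" using T(2)[of "s - T"] by auto
    define a where "a = x + of_int (- \<lfloor>x\<rfloor>)"
    define b where "b = y + of_int (- \<lfloor>x\<rfloor>)"
    have "a - b = x - y" by (simp add: a_def b_def)
    then have "\<bar>a - b\<bar> < d" "\<bar>a - b\<bar> < 1" using st by simp_all
    moreover have "0 \<le> a" "a < 1" unfolding a_def of_int_minus by linarith+
    ultimately have a: "0 \<le> a" "a < 1" "\<bar>a - b\<bar> < d" "\<bar>a - b\<bar> < 1" by blast+
    have "dist (s - l, a) (s - l, b) < d" using a by (simp add: dist_Pair_Pair dist_real_def)
    then have "dist (deriv (f (fst (s - l, a))) (snd (s - l, a))) (deriv (f (fst (s - l, b))) (snd (s - l, b))) < e / 4"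
      using l a by (intro d(2)) auto
    then have "\<bar>deriv (f (s - l)) a - deriv (f (s - l)) b\<bar> < e / 4" by (simp add: dist_real_def)
    moreover have "\<bar>deriv (f s) a - deriv (f (s - l)) a\<bar> \<le> e / 4" "\<bar>deriv (f s) b - deriv (f (s - l)) b\<bar> \<le> e / 4"
      using fx_diff_le[of s a "s - l"] fx_diff_le[of s b "s - l"] l(3)[of "s - l"] by simp_all
    moreover have "\<bar>deriv (f s) b - deriv (f t) b\<bar> < e / 4" using fx_diff_le[of s b t] d'(2)[of s t] st by linarith
    ultimately have "\<bar>deriv (f s) a - deriv (f t) b\<bar> < e" by linarith
    then show ?thesis unfolding a_def b_def per .
  qed
  then show ?thesis using d(1) d'(1) by (intro exI[of _ "min (min d d') 1"]) auto
qed

lemma f_continuous: "continuous_on UNIV (\<lambda>p. f (fst p) (snd p))"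
  unfolding continuous_on_iff
proof safe
  fix s x b :: real assume b: "0 < b"
  then have b2: "0 < b / 2" by simp
  obtain d1 where d1: "d1 > 0" "\<And>s t. \<bar>s - t\<bar> < d1 \<Longrightarrow> Cr_dist r (f s) (f t) < b / 2" using f_uniform[OF b2] by blast
  have "continuous_on UNIV (f s)" using Cr_periodic_continuous[OF f_Cr, of 0] by simp
  then obtain d2 where d2: "d2 > 0" "\<And>y. dist y x < d2 \<Longrightarrow> dist (f s y) (f s x) < b / 2"
    using b2 unfolding continuous_on_iff by blast
  have "dist (f (fst z) (snd z)) (f (fst (s, x)) (snd (s, x))) < b" if "dist z (s, x) < min d1 d2" for z
  proof -
    have "dist (fst z) s < d1" "dist (snd z) x < d2"
      using that dist_fst_le[of z "(s, x)"] dist_snd_le[of z "(s, x)"] by auto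
    then have "Cr_dist r (f (fst z)) (f s) < b / 2" "dist (f s (snd z)) (f s x) < b / 2"
      using d1(2) d2(2) by (auto simp: dist_real_def)
    with f_diff_le[of "fst z" "snd z" s] show ?thesis unfolding dist_real_def fst_conv snd_conv by linarith
  qed
  then show "\<exists>d>0. \<forall>z\<in>UNIV. dist z (s, x) < d \<longrightarrow> dist (f (fst z) (snd z)) (f (fst (s, x)) (snd (s, x))) < b"
    using d1 d2 by (intro exI[of _ "min d1 d2"]) auto
qed

lemma periodic_field: "\<exists>L. periodic_field f (\<lambda>t. deriv (f t)) L"
proof -
  obtain B where B: "\<And>t. Cr_norm r (f t) \<le> B" using nvf unfolding nonautonomous_vf_def by blast
  have f_B: "\<bar>f t x\<bar> \<le> B" and fx_B: "\<bar>deriv (f t) x\<bar> \<le> B" for t x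
    using Cr_norm_ge[OF f_Cr, of 0 t x] Cr_norm_ge[OF f_Cr, of 1 t x] B[of t] r by auto
  \<comment> \<open>The maximum with 1 makes the constant positive.\<close>
  have "periodic_field f (\<lambda>t. deriv (f t)) (max 1 B)"
    by unfold_locales (use f_B fx_B f_periodic f_deriv f_continuous fx_uniform in \<open>auto intro: le_max_iff_disj[THEN iffD2]\<close>)
  then show ?thesis ..
qed

end

section \<open>Lifting the gradient-like conditions\<close>

lemma asymptotic_of_lifts:
  assumes "((\<lambda>t. u t + of_int k - v t) \<longlongrightarrow> 0) F"
  shows "asymptotic F (to_circle \<circ> u) (to_circle \<circ> v)"
  unfolding asymptotic_def
proof (rule Lim_null_comparison)
  show "\<forall>\<^sub>F t in F. norm (dist ((to_circle \<circ> u) t) ((to_circle \<circ> v) t)) \<le> \<bar>u t + of_int k - v t\<bar>"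
  proof (rule always_eventually, rule allI)
    fix t
    show "norm (dist ((to_circle \<circ> u) t) ((to_circle \<circ> v) t)) \<le> \<bar>u t + of_int k - v t\<bar>"
      using dist_to_circle_le[of "u t + of_int k" "v t"] by simp
  qed
  show "((\<lambda>t. \<bar>u t + of_int k - v t\<bar>) \<longlongrightarrow> 0) F" using tendsto_rabs_zero[OF assms] .
qed

lemma to_circle_inj_near:
  assumes "to_circle a = to_circle b" "a < b" "b < a + 1"
  shows False
proof -
  obtain k :: int where "a - b = of_int k" using assms(1) by (auto simp: to_circle_eq_iff elim: Ints_cases)
  with assms(2,3) have "real_of_int (- 1) < real_of_int k" "real_of_int k < real_of_int 0" by simp_all
  then show False unfolding of_int_less_iff by linarith
qed

lemma mem_strip: "t \<in> J \<Longrightarrow> u t \<le> y \<Longrightarrow> y \<le> v t \<Longrightarrow> (t, to_circle y) \<in> strip J u v"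
  unfolding strip_def by blast

text \<open>The lift supplied by the neighborhood differs from \<open>u\<close> by an integer at
  each time, and this integer disappears under the projection.\<close>

lemma thin_neighborhood_tube:
  assumes "thin_neighborhood \<epsilon> (to_circle \<circ> u) lo hi"
  shows "\<exists>\<delta>>0. \<forall>t\<ge>0. \<forall>y. \<bar>y - u t\<bar> \<le> \<delta> \<longrightarrow> (t, to_circle y) \<in> strip {0..} lo hi"
proof -
  obtain u' \<delta> where u': "\<And>t. 0 \<le> t \<Longrightarrow> to_circle (u t) = to_circle (u' t)" "\<delta> > 0"
    "\<And>t. 0 \<le> t \<Longrightarrow> lo t \<le> u' t - \<delta> \<and> u' t + \<delta> \<le> hi t" using assms unfolding thin_neighborhood_def by auto
  have "(t, to_circle y) \<in> strip {0..} lo hi" if t: "0 \<le> t" and y: "\<bar>y - u t\<bar> \<le> \<delta>" for t y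
  proof -
    obtain k :: int where k: "u t - u' t = of_int k" using u'(1)[OF t] by (auto simp: to_circle_eq_iff elim: Ints_cases)
    have "\<bar>(y + of_int (- k)) - u' t\<bar> \<le> \<delta>" using y k by (simp add: algebra_simps)
    then have "lo t \<le> y + of_int (- k)" "y + of_int (- k) \<le> hi t" using u'(3)[OF t] by linarith+
    moreover have "to_circle y = to_circle (y + of_int (- k))" by (simp only: to_circle_add_int)
    ultimately show ?thesis unfolding strip_def using t by (intro CollectI exI conjI) auto
  qed
  with u'(2) show ?thesis by blast
qed

lemma (in periodic_field) gradient_field_of_gradient_like:
  assumes recurrent: "\<And>\<epsilon>. 0 < \<epsilon> \<Longrightarrow> \<exists>T>0. \<forall>a. \<exists>l. a < l \<and> l < a + T \<and> almost_period \<epsilon> l"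
    and grad: "gradient_like f" and fx: "\<And>t. fx t = deriv (f t)"
  shows "gradient_field f fx L"
proof -
  have lin: "linearization f (to_circle \<circ> u) t = fx t (u t)" for u t
    unfolding fx by (rule linearization_to_circle) (rule periodic)
  have stable: "stable_dichotomy f J (to_circle \<circ> u) \<longleftrightarrow> (\<exists>C m. 0 < m \<and> contracting J C m (\<lambda>t. fx t (u t)))"
    if "lifted_solution f u" for J u
    by (rule stable_dichotomy_iff[OF coefficient_continuous[OF that] lin])
  have unstable: "unstable_dichotomy f J (to_circle \<circ> u) \<longleftrightarrow> (\<exists>C m. 0 < m \<and> expanding J C m (\<lambda>t. fx t (u t)))"
    if "lifted_solution f u" for J u
    by (rule unstable_dichotomy_iff[OF coefficient_continuous[OF that] lin])
  have sol: "solution f (to_circle \<circ> u)" if "lifted_solution f u" for u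
    using that unfolding solution_def by blast
  have A1: "\<And>x. solution f x \<Longrightarrow> (stable_dichotomy f {0..} x \<or> unstable_dichotomy f {0..} x) \<and>
        (stable_dichotomy f {..0} x \<or> unstable_dichotomy f {..0} x)"
    and A3: "forward_unstable f \<inter> backward_stable f = {}" and A4: "bounded_passage f"
    using grad unfolding gradient_like_def by blast+
  have "\<exists>lo hi. (\<forall>x\<in>forward_unstable f. thin_neighborhood 1 x (lo x) (hi x)) \<and>
      (\<forall>x\<in>forward_unstable f. \<forall>y\<in>forward_unstable f. x \<noteq> y \<longrightarrow>
        strip {0..} (lo x) (hi x) \<inter> strip {0..} (lo y) (hi y) = {})"
  proof -
    obtain S where S: "\<forall>\<epsilon>>0. \<exists>lo hi. let U = forward_unstable f; N = (\<lambda>x. strip {0..} (lo x) (hi x)) in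
        (\<forall>x\<in>U \<union> S. thin_neighborhood \<epsilon> x (lo x) (hi x)) \<and>
        (\<forall>x\<in>U. leaves_strip f (lo x) (hi x)) \<and>
        (\<forall>x\<in>S. enters_strip f (lo x) (hi x)) \<and>
        (\<forall>x\<in>U \<union> S. \<forall>y\<in>U \<union> S. x \<noteq> y \<longrightarrow> N x \<inter> N y = {}) \<and>
        (\<exists>T. \<forall>x\<in>U. \<forall>z. solution f z \<longrightarrow>
           (\<forall>t0\<ge>0. z t0 \<in> {to_circle (lo x t0), to_circle (hi x t0)} \<longrightarrow>
              (\<exists>t1\<in>{t0..t0 + T}. (\<exists>y\<in>S. z t1 \<in> {to_circle (lo y t1), to_circle (hi y t1)}) \<and>
                 (\<forall>t\<in>{t0<..<t1}. \<forall>y\<in>U \<union> S. (t, z t) \<notin> N y))))"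
      using A4 unfolding bounded_passage_def by (elim exE conjE) 
    have aux: "\<exists>lo hi. A lo hi \<and> D lo hi" if "\<exists>lo hi. A lo hi \<and> B lo hi \<and> C lo hi \<and> D lo hi \<and> E lo hi"
      for A B C D E :: "((real \<Rightarrow> circle) \<Rightarrow> real \<Rightarrow> real) \<Rightarrow> ((real \<Rightarrow> circle) \<Rightarrow> real \<Rightarrow> real) \<Rightarrow> bool"
      using that by blast
    from aux[OF S[rule_format, OF zero_less_one, unfolded Let_def]] obtain lo hi where
      lh: "\<forall>x\<in>forward_unstable f \<union> S. thin_neighborhood 1 x (lo x) (hi x)"
      "\<forall>x\<in>forward_unstable f \<union> S. \<forall>y\<in>forward_unstable f \<union> S. x \<noteq> y \<longrightarrow>
        strip {0..} (lo x) (hi x) \<inter> strip {0..} (lo y) (hi y) = {}" by (elim exE conjE) (rule that)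
    show ?thesis
      by (rule exI[of _ lo], rule exI[of _ hi]) (use lh in \<open>simp only: ball_Un, simp\<close>)
  qed
  then obtain lo hi where thin: "\<forall>x\<in>forward_unstable f. thin_neighborhood 1 x (lo x) (hi x)"
    and disj: "\<forall>x\<in>forward_unstable f. \<forall>y\<in>forward_unstable f. x \<noteq> y \<longrightarrow>
        strip {0..} (lo x) (hi x) \<inter> strip {0..} (lo y) (hi y) = {}" by (elim exE conjE) (rule that)
  show ?thesis
  proof (intro_locales, unfold_locales)
    show "\<exists>T>0. \<forall>a. \<exists>l>a. l < a + T \<and> almost_period \<epsilon> l" if "0 < \<epsilon>" for \<epsilon>
      using recurrent[OF that] by blast
    show "(\<exists>C m. 0 < m \<and> contracting {0..} C m (\<lambda>t. fx t (u t))) \<or>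
      (\<exists>C m. 0 < m \<and> expanding {0..} C m (\<lambda>t. fx t (u t)))" if "lifted_solution f u" for u
      using A1[OF sol[OF that]] stable[OF that] unstable[OF that] by blast
    show "(\<exists>C m. 0 < m \<and> contracting {..0} C m (\<lambda>t. fx t (u t))) \<or>
      (\<exists>C m. 0 < m \<and> expanding {..0} C m (\<lambda>t. fx t (u t)))" if "lifted_solution f u" for u
      using A1[OF sol[OF that]] stable[OF that] unstable[OF that] by blast
    show False if "lifted_solution f u" "0 < m" "expanding {0..} C m (\<lambda>t. fx t (u t))"
      "0 < m'" "contracting {..0} C' m' (\<lambda>t. fx t (u t))" for u C m C' m'
    proof -
      have "to_circle \<circ> u \<in> forward_unstable f \<inter> backward_stable f"
        using sol[OF that(1)] stable[OF that(1)] unstable[OF that(1)] that by blast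
      then show False using A3 by blast
    qed
    fix w m C assume w: "lifted_solution f w" "0 < m" "expanding {0..} C m (\<lambda>t. fx t (w t))"
    then have wU: "to_circle \<circ> w \<in> forward_unstable f" using sol unstable by blast
    obtain \<delta> where \<delta>: "\<delta> > 0" "\<And>t y. 0 \<le> t \<Longrightarrow> \<bar>y - w t\<bar> \<le> \<delta> \<Longrightarrow>
        (t, to_circle y) \<in> strip {0..} (lo (to_circle \<circ> w)) (hi (to_circle \<circ> w))"
      using thin_neighborhood_tube[OF bspec[OF thin wU]] by blast
    \<comment> \<open>Either the projections agree and \<open>w'\<close> differs from
      \<open>w\<close> by a nonzero integer, or they differ and the disjointness of the
      neighborhoods keeps \<open>w'\<close> out of the \<open>\<delta>\<close>-tube of
      \<open>w\<close>.\<close>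
    have "min \<delta> (1 / 2) < \<bar>w' t - w t\<bar>" if w': "lifted_solution f w'" "w' \<noteq> w"
      "\<exists>C m. 0 < m \<and> expanding {0..} C m (\<lambda>t. fx t (w' t))" and t: "0 \<le> t" for w' t
    proof (cases "to_circle \<circ> w' = to_circle \<circ> w")
      case True
      then have "to_circle (w' t) = to_circle (w t)" by (metis comp_apply)
      then obtain k :: int where k: "w' t - w t = of_int k" by (auto simp: to_circle_eq_iff elim: Ints_cases)
      moreover have "w' t \<noteq> w t" using solution_unique w'(1,2) w(1) by blast
      ultimately have "k \<noteq> 0" by auto
      then have "1 \<le> \<bar>w' t - w t\<bar>" unfolding k by linarith
      then show ?thesis by linarith
    next
      case False
      have w'U: "to_circle \<circ> w' \<in> forward_unstable f" using w' sol unstable by blast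
      have "(t, to_circle (w' t)) \<in> strip {0..} (lo (to_circle \<circ> w')) (hi (to_circle \<circ> w'))"
      proof -
        obtain \<delta>' where \<delta>': "\<delta>' > 0" "\<And>t y. 0 \<le> t \<Longrightarrow> \<bar>y - w' t\<bar> \<le> \<delta>' \<Longrightarrow>
            (t, to_circle y) \<in> strip {0..} (lo (to_circle \<circ> w')) (hi (to_circle \<circ> w'))"
          using thin_neighborhood_tube[OF bspec[OF thin w'U]] by blast
        show ?thesis by (rule \<delta>'(2)[OF t]) (use \<delta>'(1) in simp)
      qed
      then have "\<not> \<bar>w' t - w t\<bar> \<le> \<delta>" using \<delta>(2)[OF t, of "w' t"] mp[OF bspec[OF bspec[OF disj w'U] wU] False] by blast
      then show ?thesis by linarith
    qed
    then show "\<exists>d>0. \<forall>w'. lifted_solution f w' \<longrightarrow> (\<exists>C m. 0 < m \<and> expanding {0..} C m (\<lambda>t. fx t (w' t))) \<longrightarrow>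
        w' \<noteq> w \<longrightarrow> (\<forall>t\<ge>0. d < \<bar>w' t - w t\<bar>)"
      using \<delta>(1) by (intro exI[of _ "min \<delta> (1 / 2)"]) simp
  qed
qed

lemma (in almost_periodic_nvf) gradient_field:
  assumes "gradient_like f"
  shows "\<exists>L. gradient_field f (\<lambda>t. deriv (f t)) L"
proof -
  obtain L where "periodic_field f (\<lambda>t. deriv (f t)) L" using periodic_field by blast
  then interpret periodic_field f "\<lambda>t. deriv (f t)" L .
  have "gradient_field f (\<lambda>t. deriv (f t)) L"
  proof (rule gradient_field_of_gradient_like[OF _ assms refl])
    fix \<epsilon> :: real assume "0 < \<epsilon>"
    from recurrent_translates[OF this] obtain T where T: "0 < T"
      "\<And>a. \<exists>l. a < l \<and> l < a + T \<and> (\<forall>t. Cr_dist r (f (t + l)) (f t) \<le> \<epsilon>)" by blast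
    have "almost_period \<epsilon> l" if "\<forall>t. Cr_dist r (f (t + l)) (f t) \<le> \<epsilon>" for l
      unfolding almost_period_def
      using f_diff_le[of "_ + l"] fx_diff_le[of "_ + l"] that order_trans by blast
    with T show "\<exists>T>0. \<forall>a. \<exists>l>a. l < a + T \<and> almost_period \<epsilon> l" by blast
  qed
  then show ?thesis ..
qed

text \<open>The strip selects the lift at time 0; preservation of order then keeps this lift between
  the boundary solutions at all times.\<close>

lemma (in gradient_field) solution_between:
  assumes sol: "lifted_solution f a" "lifted_solution f b"
    and x: "solution f x" "integral_curve x \<subseteq> strip UNIV a b" "x \<noteq> to_circle \<circ> a" "x \<noteq> to_circle \<circ> b"
  obtains u k where "lifted_solution f u" "x = to_circle \<circ> u" "\<And>t. a t < u t + of_int (k :: int)"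
    "\<And>t. u t + of_int k < b t"
proof -
  obtain u where u: "lifted_solution f u" "x = to_circle \<circ> u" using x(1) unfolding solution_def by blast
  have "(0, x 0) \<in> strip UNIV a b" using x(2) unfolding integral_curve_def by blast
  then obtain q where q: "to_circle (u 0) = to_circle q" "a 0 \<le> q" "q \<le> b 0" unfolding strip_def u(2) by auto
  then obtain j :: int where "u 0 - q = of_int j" by (auto simp: to_circle_eq_iff elim: Ints_cases)
  then have q_eq: "u 0 + of_int (- j) = q" by simp
  let ?z = "\<lambda>t. u t + of_int (- j)"
  have z: "lifted_solution f ?z" by (rule solution_shift_int[OF u(1)])
  have xz: "x = to_circle \<circ> ?z" unfolding u(2) by (auto simp: fun_eq_iff simp del: of_int_minus)
  have "?z \<noteq> a" "?z \<noteq> b" using x(3,4) xz by auto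
  then have "?z 0 \<noteq> a 0" "?z 0 \<noteq> b 0" using solution_unique[OF z sol(1), of 0] solution_unique[OF z sol(2), of 0] by blast+
  then have less: "a 0 < ?z 0" "?z 0 < b 0" using q q_eq by simp_all
  show thesis
    by (rule that[OF u, of "- j"]) (rule solution_less[OF sol(1) z less(1)], rule solution_less[OF z sol(2) less(2)])
qed

text \<open>The pairs are given by lifts with \<open>s 0 < w 0 < s 1 < ... < s n = s 0 + 1\<close>
  over one turn, so that each of the \<open>2 * n\<close> closed strips has one stable and one
  unstable boundary. The two bijections express that the lists are complete and free of repetitions
  on the circle.\<close>

theorem theorem5:
  fixes r :: nat and f :: "real \<Rightarrow> real \<Rightarrow> real"
  assumes "r \<ge> 1"
    and "nonautonomous_vf r f"
    and "gradient_like f"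
    and "almost_periodic (Cr_metric r) f"
  shows "(\<forall>x\<in>forward_unstable f.
            almost_periodic euclidean_metric x \<and> unstable_dichotomy f UNIV x) \<and>
         (\<forall>x\<in>backward_stable f.
            almost_periodic euclidean_metric x \<and> stable_dichotomy f UNIV x) \<and>
         (\<exists>n\<ge>1. \<exists>s w.
            (\<forall>i\<le>n. lifted_solution f (s i)) \<and> (\<forall>i<n. lifted_solution f (w i)) \<and>
            bij_betw (\<lambda>i. to_circle \<circ> s i) {..<n} (backward_stable f) \<and>
            bij_betw (\<lambda>i. to_circle \<circ> w i) {..<n} (forward_unstable f) \<and>
            (\<forall>i<n. \<forall>t. s i t < w i t \<and> w i t < s (Suc i) t) \<and>
            (\<forall>t. s n t = s 0 t + 1) \<and>
            (\<Union>i<n. strip UNIV (s i) (w i) \<union> strip UNIV (w i) (s (Suc i))) = UNIV \<and>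
            (\<forall>i<n. \<forall>x. solution f x \<and> integral_curve x \<subseteq> strip UNIV (s i) (w i) \<and>
               x \<noteq> to_circle \<circ> s i \<and> x \<noteq> to_circle \<circ> w i \<longrightarrow>
               asymptotic at_top x (to_circle \<circ> s i) \<and> asymptotic at_bot x (to_circle \<circ> w i)) \<and>
            (\<forall>i<n. \<forall>x. solution f x \<and> integral_curve x \<subseteq> strip UNIV (w i) (s (Suc i)) \<and>
               x \<noteq> to_circle \<circ> s (Suc i) \<and> x \<noteq> to_circle \<circ> w i \<longrightarrow>
               asymptotic at_top x (to_circle \<circ> s (Suc i)) \<and> asymptotic at_bot x (to_circle \<circ> w i)) \<and>
            (\<exists>g. (\<forall>k. g \<in> Cr_periodic k) \<and>
               card {p. g (circle_rep p) = 0} = 2 * n \<and>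
               (\<forall>p. g (circle_rep p) = 0 \<longrightarrow> deriv g (circle_rep p) \<noteq> 0) \<and>
               uniformly_equivalent f (\<lambda>_. g)))"
proof -
  interpret nvf: almost_periodic_nvf r f using assms by unfold_locales auto
  obtain L where "gradient_field f (\<lambda>t. deriv (f t)) L" using nvf.gradient_field[OF assms(3)] by blast
  then interpret gradient_field f "\<lambda>t. deriv (f t)" L .
  have lin: "linearization f (to_circle \<circ> u) t = deriv (f t) (u t)" for u t
    by (rule linearization_to_circle) (rule periodic)
  have stable: "stable_dichotomy f J (to_circle \<circ> u) \<longleftrightarrow> (\<exists>C m. 0 < m \<and> contracting J C m (\<lambda>t. deriv (f t) (u t)))"
    if "lifted_solution f u" for J u
    by (rule stable_dichotomy_iff[OF coefficient_continuous[OF that] lin])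
  have unstable: "unstable_dichotomy f J (to_circle \<circ> u) \<longleftrightarrow> (\<exists>C m. 0 < m \<and> expanding J C m (\<lambda>t. deriv (f t) (u t)))"
    if "lifted_solution f u" for J u
    by (rule unstable_dichotomy_iff[OF coefficient_continuous[OF that] lin])
  have sol: "solution f (to_circle \<circ> u)" if "lifted_solution f u" for u
    using that unfolding solution_def by blast
  have rep_in: "to_circle \<circ> w \<in> forward_unstable f" if "repelling w" for w
    using that sol unstable unfolding repelling_def by blast
  have rep_out: "\<exists>w. repelling w \<and> x = to_circle \<circ> w" if "x \<in> forward_unstable f" for x
    using that unstable unfolding repelling_def solution_def by blast
  have att_in: "to_circle \<circ> s \<in> backward_stable f" if "attracting s" for s
    using that sol stable unfolding attracting_def by blast
  have att_out: "\<exists>s. attracting s \<and> x = to_circle \<circ> s" if "x \<in> backward_stable f" for x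
    using that stable unfolding attracting_def solution_def by blast
  have part1: "\<forall>x\<in>forward_unstable f. almost_periodic euclidean_metric x \<and> unstable_dichotomy f UNIV x"
  proof
    fix x assume "x \<in> forward_unstable f"
    then obtain w where w: "repelling w" "x = to_circle \<circ> w" using rep_out by blast
    then show "almost_periodic euclidean_metric x \<and> unstable_dichotomy f UNIV x"
      using repelling_almost_periodic[OF w(1)] unstable[OF repelling_solution[OF w(1)]] unfolding repelling_iff by simp
  qed
  have part2: "\<forall>x\<in>backward_stable f. almost_periodic euclidean_metric x \<and> stable_dichotomy f UNIV x"
  proof
    fix x assume "x \<in> backward_stable f"
    then obtain s where s: "attracting s" "x = to_circle \<circ> s" using att_out by blast
    then show "almost_periodic euclidean_metric x \<and> stable_dichotomy f UNIV x"
      using attracting_almost_periodic[OF s(1)] stable[OF attracting_solution[OF s(1)]] unfolding attracting_iff by simp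
  qed
  obtain n s w where alt: "alternating n s w" by (rule alternating_exists)
  note n = alternatingD(1)[OF alt] and s = alternatingD(2)[OF alt] and w = alternatingD(3)[OF alt]
    and sw = alternatingD(4)[OF alt] and ws = alternatingD(5)[OF alt] and sn = alternatingD(6)[OF alt]
    and none_sw = alternatingD(7)[OF alt] and none_ws = alternatingD(8)[OF alt]
  have s_sol: "lifted_solution f (s i)" if "i \<le> n" for i using attracting_solution s that by blast
  have w_sol: "lifted_solution f (w i)" if "i < n" for i using repelling_solution w that by blast
  have s_step: "s i t < s (Suc i) t" if "Suc i \<le> n" for i t using sw[of i t] ws[of i t] that by simp
  have s_less: "s i t < s j t" if "i < j" "j \<le> n" for i j t
    using step_less[of n "\<lambda>i. s i t" i j] s_step that by blast
  have s_le: "s i t \<le> s j t" if "i \<le> j" "j \<le> n" for i j t using s_less[of i j t] that by (cases "i = j") auto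
  have locate: "\<exists>i<n. (s i t \<le> x \<and> x < w i t) \<or> (w i t \<le> x \<and> x < s (Suc i) t)" if "s 0 t \<le> x" "x < s 0 t + 1" for x t
    using step_exists[of "\<lambda>i. s i t" x n] that sn[of t] by (metis not_less)
  \<comment> \<open>No attracting or repelling solution starts strictly inside a strip, so it agrees
    at time 0, and then always, with the left boundary.\<close>
  have special: "\<exists>i<n. p = s i \<or> p = w i" if p: "attracting p \<or> repelling p" "s 0 0 \<le> p 0" "p 0 < s 0 0 + 1" for p
  proof -
    have "lifted_solution f p" using p attracting_solution repelling_solution by blast
    obtain i where i: "i < n" "(s i 0 \<le> p 0 \<and> p 0 < w i 0) \<or> (w i 0 \<le> p 0 \<and> p 0 < s (Suc i) 0)"
      using locate[OF p(2,3)] by blast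
    then have "p 0 = s i 0 \<or> p 0 = w i 0" using none_sw[OF i(1), rule_format, OF p(1)] none_ws[OF i(1), rule_format, OF p(1)] by linarith
    then show ?thesis
      using solution_unique[OF \<open>lifted_solution f p\<close> s_sol[of i]] solution_unique[OF \<open>lifted_solution f p\<close> w_sol[OF i(1)]] i(1)
      by auto
  qed
  have part_s: "bij_betw (\<lambda>i. to_circle \<circ> s i) {..<n} (backward_stable f)"
    unfolding bij_betw_def
  proof
    \<comment> \<open>The lifts lie less than one turn apart, so distinct ones have distinct
      projections.\<close>
    have neq: "to_circle \<circ> s i \<noteq> to_circle \<circ> s j" if "i < j" "j < n" for i j
    proof
      assume "to_circle \<circ> s i = to_circle \<circ> s j"
      then have "to_circle (s i 0) = to_circle (s j 0)" by (metis comp_apply)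
      moreover have "s j 0 < s n 0" "s 0 0 \<le> s i 0" using s_less[of j n 0] s_le[of 0 i 0] that by auto
      ultimately show False using to_circle_inj_near[of "s i 0" "s j 0"] s_less[of i j 0] that sn[of 0] by simp
    qed
    show "inj_on (\<lambda>i. to_circle \<circ> s i) {..<n}"
      by (rule inj_onI) (metis lessThan_iff linorder_neqE_nat neq)
    show "(\<lambda>i. to_circle \<circ> s i) ` {..<n} = backward_stable f"
    proof
      show "(\<lambda>i. to_circle \<circ> s i) ` {..<n} \<subseteq> backward_stable f" using att_in s by (intro image_subsetI) simp
      show "backward_stable f \<subseteq> (\<lambda>i. to_circle \<circ> s i) ` {..<n}"
      proof
        fix x assume "x \<in> backward_stable f"
        then obtain p where p: "attracting p" "x = to_circle \<circ> p" using att_out by blast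
        obtain k :: int where k: "s 0 0 \<le> p 0 + of_int k" "p 0 + of_int k < s 0 0 + 1" using shift_to_unit by blast
        let ?p = "\<lambda>t. p t + of_int k"
        have p': "attracting ?p" using attracting_shift p by blast
        then obtain i where i: "i < n" "?p = s i \<or> ?p = w i" using special[of ?p] k by blast
        then have "?p = s i" using attracting_not_repelling[OF p'] w by metis
        moreover have "x = to_circle \<circ> ?p" by (simp add: p(2) fun_eq_iff)
        ultimately have "x = to_circle \<circ> s i" by (simp only:)
        then show "x \<in> (\<lambda>i. to_circle \<circ> s i) ` {..<n}" by (rule image_eqI) (use i(1) in simp)
      qed
    qed
  qed
  have part_w: "bij_betw (\<lambda>i. to_circle \<circ> w i) {..<n} (forward_unstable f)"
    unfolding bij_betw_def
  proof
    have neq: "to_circle \<circ> w i \<noteq> to_circle \<circ> w j" if "i < j" "j < n" for i j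
    proof
      assume "to_circle \<circ> w i = to_circle \<circ> w j"
      then have "to_circle (w i 0) = to_circle (w j 0)" by (metis comp_apply)
      moreover have "w i 0 < s (Suc i) 0" "s (Suc i) 0 \<le> s j 0" "s j 0 < w j 0" "w j 0 < s (Suc j) 0"
        "s (Suc j) 0 \<le> s n 0" "s 0 0 \<le> s i 0" "s i 0 < w i 0"
        using ws[of i 0] s_le[of "Suc i" j 0] sw[of j 0] ws[of j 0] s_le[of "Suc j" n 0] s_le[of 0 i 0] sw[of i 0] that
        by auto
      ultimately show False using to_circle_inj_near[of "w i 0" "w j 0"] sn[of 0] by linarith
    qed
    show "inj_on (\<lambda>i. to_circle \<circ> w i) {..<n}"
      by (rule inj_onI) (metis lessThan_iff linorder_neqE_nat neq)
    show "(\<lambda>i. to_circle \<circ> w i) ` {..<n} = forward_unstable f"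
    proof
      show "(\<lambda>i. to_circle \<circ> w i) ` {..<n} \<subseteq> forward_unstable f" using rep_in w by (intro image_subsetI) simp
      show "forward_unstable f \<subseteq> (\<lambda>i. to_circle \<circ> w i) ` {..<n}"
      proof
        fix x assume "x \<in> forward_unstable f"
        then obtain p where p: "repelling p" "x = to_circle \<circ> p" using rep_out by blast
        obtain k :: int where k: "s 0 0 \<le> p 0 + of_int k" "p 0 + of_int k < s 0 0 + 1" using shift_to_unit by blast
        let ?p = "\<lambda>t. p t + of_int k"
        have p': "repelling ?p" using repelling_shift p by blast
        then obtain i where i: "i < n" "?p = s i \<or> ?p = w i" using special[of ?p] k by blast
        then have "?p = w i" using attracting_not_repelling s p' by (metis less_imp_le)
        moreover have "x = to_circle \<circ> ?p" by (simp add: p(2) fun_eq_iff)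
        ultimately have "x = to_circle \<circ> w i" by (simp only:)
        then show "x \<in> (\<lambda>i. to_circle \<circ> w i) ` {..<n}" by (rule image_eqI) (use i(1) in simp)
      qed
    qed
  qed
  have part_cover: "(\<Union>i<n. strip UNIV (s i) (w i) \<union> strip UNIV (w i) (s (Suc i))) = UNIV"
  proof -
    have "z \<in> (\<Union>i<n. strip UNIV (s i) (w i) \<union> strip UNIV (w i) (s (Suc i)))" for z
    proof -
      obtain t p where z: "z = (t, p)" by (cases z)
      obtain k :: int where k: "s 0 t \<le> circle_rep p + of_int k" "circle_rep p + of_int k < s 0 t + 1"
        using shift_to_unit by blast
      obtain i where i: "i < n" "(s i t \<le> circle_rep p + of_int k \<and> circle_rep p + of_int k < w i t) \<or>
        (w i t \<le> circle_rep p + of_int k \<and> circle_rep p + of_int k < s (Suc i) t)" using locate[OF k] by blast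
      have "z = (t, to_circle (circle_rep p + of_int k))" by (simp add: z)
      moreover have "(t, to_circle (circle_rep p + of_int k)) \<in> strip UNIV (s i) (w i) \<union> strip UNIV (w i) (s (Suc i))"
        unfolding Un_iff
        using i(2) mem_strip[of t UNIV "s i" "circle_rep p + of_int k" "w i"]
          mem_strip[of t UNIV "w i" "circle_rep p + of_int k" "s (Suc i)"] by (metis UNIV_I less_imp_le)
      ultimately have "z \<in> strip UNIV (s i) (w i) \<union> strip UNIV (w i) (s (Suc i))" by (simp only:)
      with i(1) show ?thesis by blast
    qed
    then show ?thesis by blast
  qed
  have part_sw: "asymptotic at_top x (to_circle \<circ> s i) \<and> asymptotic at_bot x (to_circle \<circ> w i)"
    if i: "i < n" and x: "solution f x" "integral_curve x \<subseteq> strip UNIV (s i) (w i)"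
      "x \<noteq> to_circle \<circ> s i" "x \<noteq> to_circle \<circ> w i" for i x
  proof -
    note si = s_sol[OF less_imp_le[OF i]]
    obtain u k where u: "lifted_solution f u" "x = to_circle \<circ> u" "\<And>t. s i t < u t + of_int (k :: int)"
      "\<And>t. u t + of_int k < w i t" using solution_between[OF si w_sol[OF i] x] by blast
    let ?z = "\<lambda>t. u t + of_int k"
    have z: "lifted_solution f ?z" by (rule solution_shift_int[OF u(1)])
    have neq: "?z \<noteq> s i" "?z \<noteq> w i" using u(3)[of 0] u(4)[of 0] by (metis less_irrefl)+
    have pass: "\<exists>T. \<forall>t. \<exists>x\<ge>t. x \<le> t + T \<and> (\<bar>?z x - s i x\<bar> < \<eta> \<or> \<bar>?z x - w i x\<bar> < \<eta>)" if "0 < \<eta>" for \<eta>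
      using strip_passage[OF si w_sol[OF i] none_sw[OF i] that] z u(3,4) by blast
    note lim = strip_asymptotic_special[OF s[OF less_imp_le[OF i]] w[OF i] z neq pass]
    show ?thesis unfolding u(2) using asymptotic_of_lifts[OF lim(1)] asymptotic_of_lifts[OF lim(2)] by blast
  qed
  have part_ws: "asymptotic at_top x (to_circle \<circ> s (Suc i)) \<and> asymptotic at_bot x (to_circle \<circ> w i)"
    if i: "i < n" and x: "solution f x" "integral_curve x \<subseteq> strip UNIV (w i) (s (Suc i))"
      "x \<noteq> to_circle \<circ> s (Suc i)" "x \<noteq> to_circle \<circ> w i" for i x
  proof -
    note si = s_sol[OF Suc_leI[OF i]]
    obtain u k where u: "lifted_solution f u" "x = to_circle \<circ> u" "\<And>t. w i t < u t + of_int (k :: int)"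
      "\<And>t. u t + of_int k < s (Suc i) t" using solution_between[OF w_sol[OF i] si x(1,2,4,3)] by blast
    let ?z = "\<lambda>t. u t + of_int k"
    have z: "lifted_solution f ?z" by (rule solution_shift_int[OF u(1)])
    have neq: "?z \<noteq> s (Suc i)" "?z \<noteq> w i" using u(3)[of 0] u(4)[of 0] by (metis less_irrefl)+
    have pass: "\<exists>T. \<forall>t. \<exists>x\<ge>t. x \<le> t + T \<and> (\<bar>?z x - s (Suc i) x\<bar> < \<eta> \<or> \<bar>?z x - w i x\<bar> < \<eta>)" if "0 < \<eta>" for \<eta>
      using strip_passage[OF w_sol[OF i] si none_ws[OF i] that] z u(3,4) by (simp only: disj_commute) blast
    note lim = strip_asymptotic_special[OF s[OF Suc_leI[OF i]] w[OF i] z neq pass]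
    show ?thesis unfolding u(2) using asymptotic_of_lifts[OF lim(1)] asymptotic_of_lifts[OF lim(2)] by blast
  qed
  have equiv: "uniformly_equivalent f (\<lambda>_. model n)"
    by (rule uniformly_equivalent_model[OF alt])
  have "0 < n" using n by simp
  then have part_g: "\<exists>g. (\<forall>k. g \<in> Cr_periodic k) \<and> card {p. g (circle_rep p) = 0} = 2 * n \<and>
      (\<forall>p. g (circle_rep p) = 0 \<longrightarrow> deriv g (circle_rep p) \<noteq> 0) \<and> uniformly_equivalent f (\<lambda>_. g)"
    using model_smooth model_zero_card model_zero_simple equiv by (intro exI[of _ "model n"]) blast
  show ?thesis
    by (rule conjI[OF part1 conjI[OF part2]], rule exI[of _ n], rule conjI[OF n], rule exI[of _ s],
        rule exI[of _ w], intro conjI part_s part_w part_cover part_g)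
      (use s_sol in blast, use w_sol in blast, use sw ws in blast, use sn in blast,
        use part_sw in blast, use part_ws in blast)
qed

end
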